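(* Let $k$ be a field of characteristic zero, $f\in k[x,y,z]$ homogeneous of degree $d\geqslant3$, and assume $R=k[x,y,z]/(f)$ is an isolated singularity hypersurface. The augmented minimal $R$-free resolution of $D^2_{R|k}\subseteq R^3\oplus R^6\oplus R$ has the form \[\cdots\xrightarrow{\begin{bmatrix}M_2(1)&\theta_3(2)\\ 0&M_2(2)\end{bmatrix}}R^4\oplus R^7\xrightarrow{\begin{bmatrix}M_1(1)&\theta_2(2)\\ 0&M_1(2)\end{bmatrix}}R^4\oplus R^7\xrightarrow{\begin{bmatrix}M_2(1)&\theta_3(2)\\ 0&M_2(2)\end{bmatrix}}R^4\oplus R^7\xrightarrow{\begin{bmatrix}M_1(1)&\theta_2(2)\\ 0&M_1(2)\\ 0&0\end{bmatrix}}R^4\oplus R^7\oplus R\xrightarrow{\ \epsilon\ }D^2_{R|k}\to0,\] where a minimal set of generators for $D^2_{R|k}$ is given by the columns of \[\epsilon=\begin{bmatrix}M_0(1)&\theta_1(2)&0\\ 0&M_0(2)&0\\ 0&0&1\end{bmatrix}.\]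
   Context: Isolated singularity means $R_{\mathfrak p}$ is regular local for every prime $\mathfrak p\neq(x,y,z)R$. $D^0_{R|k}=\mathrm{Hom}_R(R,R)\cong R$, and for $i>0$, $D^i_{R|k}=\{\delta\in\mathrm{Hom}_k(R,R):\delta\mu-\mu\delta\in D^{i-1}_{R|k}\ \forall\mu\in D^0_{R|k}\}$, an $R$-module via postmultiplication. With $Q=k[x,y,z]$, $D^2_{R|k}$ is identified with a submodule of the free module $R\otimes_QD^2_{Q|k}=R^3\oplus R^6\oplus R$ via $D^2_{R|k}\cong\{\delta\in D^2_{Q|k}:\delta(fQ)\subseteq fQ\}/fD^2_{Q|k}$; the ordered bases of $R^3,R^6,R$ are $(\partial_x,\partial_y,\partial_z)$, $(\partial_x^{(2)},\partial_x\partial_y,\partial_x\partial_z,\partial_y^{(2)},\partial_y\partial_z,\partial_z^{(2)})$ and $(1)$, where $\partial^{(2)}=\frac12\partial^2$. Subscripts on $f$ denote partial derivatives. $\Delta$ is the Hessian matrix of $f$, $\delta=\det\Delta$, $\Delta_{xx}=f_{yy}f_{zz}-f_{yz}^2$, $\Delta_{yy}=f_{xx}f_{zz}-f_{xz}^2$, $\Delta_{zz}=f_{xx}f_{yy}-f_{xy}^2$, $\Delta_{xy}=f_{xz}f_{yz}-f_{xy}f_{zz}$, $\Delta_{xz}=f_{xy}f_{yz}-f_{xz}f_{yy}$, $\Delta_{yz}=f_{xy}f_{xz}-f_{xx}f_{yz}$. Matrices over $R$: \[\partial_1=\begin{bmatrix}x&y&z\end{bmatrix},\ \partial_2=\begin{bmatrix}0&-z&y\\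 z&0&-x\\ -y&x&0\end{bmatrix},\ \partial_3=\partial_1^T,\quad D_1=\begin{bmatrix}f_x&f_y&f_z\end{bmatrix},\ D_2=\begin{bmatrix}0&-f_z&f_y\\ f_z&0&-f_x\\ -f_y&f_x&0\end{bmatrix},\ D_3=D_1^T,\] \[q=\partial_3\partial_1,\ \alpha_1=\tfrac1{d-1}\Delta,\ \alpha_2=\tfrac1{(d-1)^2}\begin{bmatrix}\Delta_{xx}&\Delta_{xy}&\Delta_{xz}\\ \Delta_{xy}&\Delta_{yy}&\Delta_{yz}\\ \Delta_{xz}&\Delta_{yz}&\Delta_{zz}\end{bmatrix},\ \alpha_3=\tfrac1{(d-1)^3}\delta,\] \[M_0(1)=\begin{bmatrix}\partial_3&D_2\end{bmatrix},\ M_1(1)=\begin{bmatrix}D_1&0\\ -\partial_2&D_3\end{bmatrix},\ M_2(1)=\begin{bmatrix}\partial_3&D_2\\ 0&\partial_1\end{bmatrix},\] \[M_1(2)=\begin{bmatrix}D_1&0&-2\alpha_3\\ -\partial_2&2\alpha_1&0\\ 0&-\partial_2&D_3\end{bmatrix},\ M_2(2)=\begin{bmatrix}\partial_3&D_2&2\alpha_2\\ 0&\frac12q&D_2\\ 0&0&\partial_1\end{bmatrix},\] \[\theta_1(2)=(d-1)\begin{bmatrix}0_{3\times4}&\alpha_2\end{bmatrix},\ \theta_2(2)=(d-1)\begin{bmatrix}0_{1\times3}&0_{1\times3}&-\alpha_3\\ 0_{3\times3}&\alpha_1&0_{3\times1}\end{bmatrix},\ \theta_3(2)=\tfrac{-(d-1)}2\begin{bmatrix}0_{3\times1}&0_{3\times3}&-2\alpha_2\\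 0&\partial_1&0_{1\times3}\end{bmatrix}.\] $M_0(2)$ is the $6\times7$ matrix whose first four columns are \[2\begin{bmatrix}x^2\\ xy\\ xz\\ y^2\\ yz\\ z^2\end{bmatrix},\ \begin{bmatrix}0\\ xf_z\\ -xf_y\\ 2yf_z\\ zf_z-yf_y\\ -2zf_y\end{bmatrix},\ \begin{bmatrix}-2xf_z\\ -yf_z\\ xf_x-zf_z\\ 0\\ yf_x\\ 2zf_x\end{bmatrix},\ \begin{bmatrix}2xf_y\\ yf_y-xf_x\\ zf_y\\ -2yf_x\\ -zf_x\\ 0\end{bmatrix}\] and whose last three columns are those of \[\frac2{(d-1)^2}\begin{bmatrix}x\Delta_{xx}&2x\Delta_{xy}-y\Delta_{xx}&2x\Delta_{xz}-z\Delta_{xx}\\ y\Delta_{xx}&x\Delta_{yy}&x\Delta_{yz}+y\Delta_{xz}-z\Delta_{xy}\\ z\Delta_{xx}&z\Delta_{xy}+x\Delta_{yz}-y\Delta_{xz}&x\Delta_{zz}\\ 2y\Delta_{xy}-x\Delta_{yy}&y\Delta_{yy}&2y\Delta_{yz}-z\Delta_{yy}\\ y\Delta_{xz}+z\Delta_{xy}-x\Delta_{yz}&z\Delta_{yy}&y\Delta_{zz}\\ 2z\Delta_{xz}-x\Delta_{zz}&2z\Delta_{yz}-y\Delta_{zz}&z\Delta_{zz}\end{bmatrix}.\] *)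

theory Defs
  imports
    "HOL-Algebra.Algebraic_Closure_Type"
    "HOL-Algebra.Ring_Divisibility"
    "HOL-Library.Extended_Nat"
    "HOL-Computational_Algebra.Polynomial"
    "Jordan_Normal_Form.Determinant"
begin

section \<open>Regular local rings and localization\<close>

definition krull_dim :: "('a, 'b) ring_scheme \<Rightarrow> enat" where
  "krull_dim R = Sup {enat n | n. \<exists>P :: nat \<Rightarrow> 'a set.
      (\<forall>i\<le>n. primeideal (P i) R) \<and> (\<forall>i<n. P i \<subset> P (Suc i))}"

definition regular_local_ring :: "('a, 'b) ring_scheme \<Rightarrow> bool" where
  "regular_local_ring R \<longleftrightarrow>
     cring R \<and> noetherian_ring R \<and>
     (\<exists>m. (\<forall>n. maximalideal n R \<longleftrightarrow> n = m) \<and>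
          (\<exists>S. S \<subseteq> carrier R \<and> finite S \<and> enat (card S) = krull_dim R \<and> Idl\<^bsub>R\<^esub> S = m))"

definition fraction_rel :: "('a, 'b) ring_scheme \<Rightarrow> 'a set \<Rightarrow> (('a \<times> 'a) \<times> ('a \<times> 'a)) set" where
  "fraction_rel R S = {((a, s), (b, t)). a \<in> carrier R \<and> s \<in> S \<and> b \<in> carrier R \<and> t \<in> S \<and>
      (\<exists>u\<in>S. u \<otimes>\<^bsub>R\<^esub> (a \<otimes>\<^bsub>R\<^esub> t) = u \<otimes>\<^bsub>R\<^esub> (b \<otimes>\<^bsub>R\<^esub> s))}"

definition localization :: "('a, 'b) ring_scheme \<Rightarrow> 'a set \<Rightarrow> ('a \<times> 'a) set ring" where
  "localization R S = (let frac = (\<lambda>a s. fraction_rel R S `` {(a, s)}) in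
     \<lparr>carrier = (carrier R \<times> S) // fraction_rel R S,
      monoid.mult = (\<lambda>A B. \<Union>(a, s)\<in>A. \<Union>(b, t)\<in>B. frac (a \<otimes>\<^bsub>R\<^esub> b) (s \<otimes>\<^bsub>R\<^esub> t)),
      one = frac \<one>\<^bsub>R\<^esub> \<one>\<^bsub>R\<^esub>,
      zero = frac \<zero>\<^bsub>R\<^esub> \<one>\<^bsub>R\<^esub>,
      add = (\<lambda>A B. \<Union>(a, s)\<in>A. \<Union>(b, t)\<in>B.
               frac ((a \<otimes>\<^bsub>R\<^esub> t) \<oplus>\<^bsub>R\<^esub> (b \<otimes>\<^bsub>R\<^esub> s)) (s \<otimes>\<^bsub>R\<^esub> t))\<rparr>)"


section \<open>Matrices over a ring and free resolutions\<close>

definition free_mod :: "('a, 'b) ring_scheme \<Rightarrow> nat \<Rightarrow> 'a vec set" where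
  "free_mod R n = {v. dim_vec v = n \<and> (\<forall>i<n. v $ i \<in> carrier R)}"

definition mat_app :: "('a, 'b) ring_scheme \<Rightarrow> 'a mat \<Rightarrow> 'a vec \<Rightarrow> 'a vec" where
  "mat_app R A v = vec (dim_row A)
     (\<lambda>i. \<Oplus>\<^bsub>R\<^esub>j\<in>{..<dim_col A}. A $$ (i, j) \<otimes>\<^bsub>R\<^esub> v $ j)"

text \<open>The maps are \<open>dif n : R^(rk (n + 1)) \<rightarrow> R^(rk n)\<close> and the augmentation
  \<open>aug : R^(rk 0) \<rightarrow> N \<subseteq> R^r\<close>; minimality refers to the ideal \<open>m\<close>.\<close>

definition aug_min_free_resolution ::
  "('a, 'b) ring_scheme \<Rightarrow> 'a set \<Rightarrow> nat \<Rightarrow> 'a vec set \<Rightarrow>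
   (nat \<Rightarrow> nat) \<Rightarrow> (nat \<Rightarrow> 'a mat) \<Rightarrow> 'a mat \<Rightarrow> bool" where
  "aug_min_free_resolution R m r N rk dif aug \<longleftrightarrow>
     aug \<in> carrier_mat r (rk 0) \<and> elements_mat aug \<subseteq> carrier R \<and>
     (\<forall>n. dif n \<in> carrier_mat (rk n) (rk (Suc n)) \<and> elements_mat (dif n) \<subseteq> carrier R) \<and>
     mat_app R aug ` free_mod R (rk 0) = N \<and>
     {v \<in> free_mod R (rk 0). mat_app R aug v = vec r (\<lambda>_. \<zero>\<^bsub>R\<^esub>)}
       = mat_app R (dif 0) ` free_mod R (rk 1) \<and>
     (\<forall>n. {v \<in> free_mod R (rk (Suc n)). mat_app R (dif n) v = vec (rk n) (\<lambda>_. \<zero>\<^bsub>R\<^esub>)}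
       = mat_app R (dif (Suc n)) ` free_mod R (rk (Suc (Suc n)))) \<and>
     (\<forall>n. elements_mat (dif n) \<subseteq> m)"

definition vec_span :: "('a, 'b) ring_scheme \<Rightarrow> nat \<Rightarrow> 'a vec set \<Rightarrow> 'a vec set" where
  "vec_span R r S = {vec r (\<lambda>i. \<Oplus>\<^bsub>R\<^esub>s\<in>S. c s \<otimes>\<^bsub>R\<^esub> s $ i) | c. c \<in> S \<rightarrow> carrier R}"

definition minimal_generating_set ::
  "('a, 'b) ring_scheme \<Rightarrow> nat \<Rightarrow> 'a vec set \<Rightarrow> 'a vec set \<Rightarrow> bool" where
  "minimal_generating_set R r N S \<longleftrightarrow>
     finite S \<and> S \<subseteq> free_mod R r \<and> vec_span R r S = N \<and>
     (\<forall>T. T \<subset> S \<longrightarrow> vec_span R r T \<noteq> N)"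


section \<open>Differential operators\<close>

text \<open>For \<open>K \<subseteq> carrier R\<close> these are the additive endomorphisms of \<open>R\<close> commuting with
  multiplication by elements of \<open>K\<close>: with \<open>K\<close> the image of \<open>k\<close> this is
  \<open>Hom_k(R, R)\<close>, with \<open>K = carrier R\<close> it is \<open>Hom_R(R, R)\<close>.\<close>

definition lin_endos :: "('a, 'b) ring_scheme \<Rightarrow> 'a set \<Rightarrow> ('a \<Rightarrow> 'a) set" where
  "lin_endos R K = {\<delta> \<in> carrier R \<rightarrow>\<^sub>E carrier R.
     (\<forall>a\<in>carrier R. \<forall>b\<in>carrier R. \<delta> (a \<oplus>\<^bsub>R\<^esub> b) = \<delta> a \<oplus>\<^bsub>R\<^esub> \<delta> b) \<and>
     (\<forall>c\<in>K. \<forall>a\<in>carrier R. \<delta> (c \<otimes>\<^bsub>R\<^esub> a) = c \<otimes>\<^bsub>R\<^esub> \<delta> a)}"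

fun diff_ops :: "('a, 'b) ring_scheme \<Rightarrow> 'a set \<Rightarrow> nat \<Rightarrow> ('a \<Rightarrow> 'a) set" where
  "diff_ops R K 0 = lin_endos R (carrier R)"
| "diff_ops R K (Suc i) = {\<delta> \<in> lin_endos R K. \<forall>\<mu>\<in>diff_ops R K 0.
     (\<lambda>r\<in>carrier R. \<delta> (\<mu> r) \<ominus>\<^bsub>R\<^esub> \<mu> (\<delta> r)) \<in> diff_ops R K i}"


section \<open>The polynomial ring \<open>Q = k[x,y,z]\<close> and \<open>R = Q/(f)\<close>\<close>

text \<open>\<open>Q\<close> is \<open>k[x][y][z]\<close>; the outermost polynomial variable is \<open>z\<close>.\<close>

type_synonym 'k poly3 = "'k poly poly poly"

definition cst :: "'k::comm_ring_1 \<Rightarrow> 'k poly3" where "cst c = [:[:[:c:]:]:]"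
definition xx :: "'k::comm_ring_1 poly3" where "xx = [:[:[:0, 1:]:]:]"
definition yy :: "'k::comm_ring_1 poly3" where "yy = [:[:0, 1:]:]"
definition zz :: "'k::comm_ring_1 poly3" where "zz = [:0, 1:]"

definition dx :: "'k::idom poly3 \<Rightarrow> 'k poly3" where "dx = map_poly (map_poly pderiv)"
definition dy :: "'k::idom poly3 \<Rightarrow> 'k poly3" where "dy = map_poly pderiv"
definition dz :: "'k::idom poly3 \<Rightarrow> 'k poly3" where "dz = pderiv"

definition homogeneous3 :: "nat \<Rightarrow> 'k::comm_ring_1 poly3 \<Rightarrow> bool" where
  "homogeneous3 d f \<longleftrightarrow>
     (\<forall>a b c. poly.coeff (poly.coeff (poly.coeff f c) b) a \<noteq> 0 \<longrightarrow> a + b + c = d)"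

definition hyp_ideal :: "'k::field_char_0 poly3 \<Rightarrow> 'k poly3 set" where
  "hyp_ideal f = PIdl\<^bsub>ring_of_type_algebra\<^esub> f"

definition hyp_ring :: "'k::field_char_0 poly3 \<Rightarrow> 'k poly3 set ring" where
  "hyp_ring f = ring_of_type_algebra Quot hyp_ideal f"

definition hyp_class :: "'k::field_char_0 poly3 \<Rightarrow> 'k poly3 \<Rightarrow> 'k poly3 set" where
  "hyp_class f g = hyp_ideal f +>\<^bsub>ring_of_type_algebra\<^esub> g"

definition irrelevant_ideal :: "'k::field_char_0 poly3 \<Rightarrow> 'k poly3 set set" where
  "irrelevant_ideal f = Idl\<^bsub>hyp_ring f\<^esub> {hyp_class f xx, hyp_class f yy, hyp_class f zz}"

definition isolated_singularity :: "'k::field_char_0 poly3 \<Rightarrow> bool" where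
  "isolated_singularity f \<longleftrightarrow>
     (\<forall>p. primeideal p (hyp_ring f) \<and> p \<noteq> irrelevant_ideal f \<longrightarrow>
        regular_local_ring (localization (hyp_ring f) (carrier (hyp_ring f) - p)))"

definition D2 :: "'k::field_char_0 poly3 \<Rightarrow> ('k poly3 set \<Rightarrow> 'k poly3 set) set" where
  "D2 f = diff_ops (hyp_ring f) (hyp_class f ` range cst) 2"

definition D2_basis :: "('k::field_char_0 poly3 \<Rightarrow> 'k poly3) list" where
  "D2_basis =
     [dx, dy, dz,
      \<lambda>g. cst (1/2) * dx (dx g), \<lambda>g. dx (dy g), \<lambda>g. dx (dz g),
      \<lambda>g. cst (1/2) * dy (dy g), \<lambda>g. dy (dz g),
      \<lambda>g. cst (1/2) * dz (dz g),
      \<lambda>g. g]"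

text \<open>The operator \<open>\<Sum>i. a\<^sub>i \<partial>\<^sub>i\<close> on \<open>Q\<close> induces \<open>\<delta>\<close> on \<open>R\<close>, and \<open>w\<close> is the class of
  \<open>a\<close> in \<open>R^10\<close>. Because the \<open>\<partial>\<^sub>i\<close> are a basis of \<open>D2\<close> of \<open>Q\<close>, to each \<open>\<delta>\<close> in
  \<open>D2 f\<close> there belongs exactly one \<open>w\<close>, which is \<open>D2_coords f \<delta>\<close>.\<close>

definition D2_represents ::
  "'k::field_char_0 poly3 \<Rightarrow> ('k poly3 set \<Rightarrow> 'k poly3 set) \<Rightarrow> 'k poly3 set vec \<Rightarrow> bool" where
  "D2_represents f \<delta> w \<longleftrightarrow>
     (\<exists>a. dim_vec a = 10 \<and> w = map_vec (hyp_class f) a \<and>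
        (\<forall>g. \<delta> (hyp_class f g) = hyp_class f (\<Sum>i<10. a $ i * (D2_basis ! i) g)))"

definition D2_coords ::
  "'k::field_char_0 poly3 \<Rightarrow> ('k poly3 set \<Rightarrow> 'k poly3 set) \<Rightarrow> 'k poly3 set vec" where
  "D2_coords f \<delta> = (THE w. D2_represents f \<delta> w)"

definition D2_submodule :: "'k::field_char_0 poly3 \<Rightarrow> 'k poly3 set vec set" where
  "D2_submodule f = D2_coords f ` D2 f"


section \<open>The matrices of the resolution\<close>

text \<open>All matrices are written with entries in \<open>Q\<close> and reduced modulo \<open>f\<close> at the end.\<close>

definition append_cols :: "'a::zero mat \<Rightarrow> 'a mat \<Rightarrow> 'a mat" (infixr "@\<^sub>c" 66) where
  "A @\<^sub>c B = four_block_mat A B (0\<^sub>m 0 (dim_col A)) (0\<^sub>m 0 (dim_col B))"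

definition par1 :: "'k::field_char_0 poly3 mat" where
  "par1 = mat_of_rows_list 3 [[xx, yy, zz]]"

definition par2 :: "'k::field_char_0 poly3 mat" where
  "par2 = mat_of_rows_list 3 [[0, - zz, yy], [zz, 0, - xx], [- yy, xx, 0]]"

definition par3 :: "'k::field_char_0 poly3 mat" where
  "par3 = transpose_mat par1"

definition Df1 :: "'k::field_char_0 poly3 \<Rightarrow> 'k poly3 mat" where
  "Df1 f = mat_of_rows_list 3 [[dx f, dy f, dz f]]"

definition Df2 :: "'k::field_char_0 poly3 \<Rightarrow> 'k poly3 mat" where
  "Df2 f = mat_of_rows_list 3
     [[0, - dz f, dy f],
      [dz f, 0, - dx f],
      [- dy f, dx f, 0]]"

definition Df3 :: "'k::field_char_0 poly3 \<Rightarrow> 'k poly3 mat" where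
  "Df3 f = transpose_mat (Df1 f)"

definition hess :: "'k::field_char_0 poly3 \<Rightarrow> 'k poly3 mat" where
  "hess f = mat_of_rows_list 3
     [[dx (dx f), dx (dy f), dx (dz f)],
      [dy (dx f), dy (dy f), dy (dz f)],
      [dz (dx f), dz (dy f), dz (dz f)]]"

definition Hxx :: "'k::field_char_0 poly3 \<Rightarrow> 'k poly3" where
  "Hxx f = dy (dy f) * dz (dz f) - (dy (dz f))^2"
definition Hyy :: "'k::field_char_0 poly3 \<Rightarrow> 'k poly3" where
  "Hyy f = dx (dx f) * dz (dz f) - (dx (dz f))^2"
definition Hzz :: "'k::field_char_0 poly3 \<Rightarrow> 'k poly3" where
  "Hzz f = dx (dx f) * dy (dy f) - (dx (dy f))^2"
definition Hxy :: "'k::field_char_0 poly3 \<Rightarrow> 'k poly3" where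
  "Hxy f = dx (dz f) * dy (dz f) - dx (dy f) * dz (dz f)"
definition Hxz :: "'k::field_char_0 poly3 \<Rightarrow> 'k poly3" where
  "Hxz f = dx (dy f) * dy (dz f) - dx (dz f) * dy (dy f)"
definition Hyz :: "'k::field_char_0 poly3 \<Rightarrow> 'k poly3" where
  "Hyz f = dx (dy f) * dx (dz f) - dx (dx f) * dy (dz f)"

definition qmat :: "'k::field_char_0 poly3 mat" where
  "qmat = par3 * par1"

definition alpha1 :: "nat \<Rightarrow> 'k::field_char_0 poly3 \<Rightarrow> 'k poly3 mat" where
  "alpha1 d f = cst (1 / (of_nat d - 1)) \<cdot>\<^sub>m hess f"

definition alpha2 :: "nat \<Rightarrow> 'k::field_char_0 poly3 \<Rightarrow> 'k poly3 mat" where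
  "alpha2 d f = cst (1 / (of_nat d - 1)^2) \<cdot>\<^sub>m mat_of_rows_list 3
     [[Hxx f, Hxy f, Hxz f],
      [Hxy f, Hyy f, Hyz f],
      [Hxz f, Hyz f, Hzz f]]"

definition alpha3 :: "nat \<Rightarrow> 'k::field_char_0 poly3 \<Rightarrow> 'k poly3" where
  "alpha3 d f = cst (1 / (of_nat d - 1)^3) * det (hess f)"

definition M0_1 :: "'k::field_char_0 poly3 \<Rightarrow> 'k poly3 mat" where
  "M0_1 f = par3 @\<^sub>c Df2 f"

definition M1_1 :: "'k::field_char_0 poly3 \<Rightarrow> 'k poly3 mat" where
  "M1_1 f =
     (Df1 f  @\<^sub>c 0\<^sub>m 1 1) @\<^sub>r
     (- par2 @\<^sub>c Df3 f)"

definition M2_1 :: "'k::field_char_0 poly3 \<Rightarrow> 'k poly3 mat" where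
  "M2_1 f =
     (par3   @\<^sub>c Df2 f) @\<^sub>r
     (0\<^sub>m 1 1 @\<^sub>c par1)"

definition M1_2 :: "nat \<Rightarrow> 'k::field_char_0 poly3 \<Rightarrow> 'k poly3 mat" where
  "M1_2 d f =
     (Df1 f   @\<^sub>c 0\<^sub>m 1 3                 @\<^sub>c mat 1 1 (\<lambda>_. - 2 * alpha3 d f)) @\<^sub>r
     (- par2  @\<^sub>c (2 \<cdot>\<^sub>m alpha1 d f)    @\<^sub>c 0\<^sub>m 3 1) @\<^sub>r
     (0\<^sub>m 3 3 @\<^sub>c - par2                 @\<^sub>c Df3 f)"

definition M2_2 :: "nat \<Rightarrow> 'k::field_char_0 poly3 \<Rightarrow> 'k poly3 mat" where
  "M2_2 d f =
     (par3    @\<^sub>c Df2 f                  @\<^sub>c (2 \<cdot>\<^sub>m alpha2 d f)) @\<^sub>r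
     (0\<^sub>m 3 1 @\<^sub>c (cst (1/2) \<cdot>\<^sub>m qmat) @\<^sub>c Df2 f) @\<^sub>r
     (0\<^sub>m 1 1 @\<^sub>c 0\<^sub>m 1 3                @\<^sub>c par1)"

definition theta1 :: "nat \<Rightarrow> 'k::field_char_0 poly3 \<Rightarrow> 'k poly3 mat" where
  "theta1 d f = cst (of_nat d - 1) \<cdot>\<^sub>m (0\<^sub>m 3 4 @\<^sub>c alpha2 d f)"

definition theta2 :: "nat \<Rightarrow> 'k::field_char_0 poly3 \<Rightarrow> 'k poly3 mat" where
  "theta2 d f = cst (of_nat d - 1) \<cdot>\<^sub>m (
     (0\<^sub>m 1 3 @\<^sub>c 0\<^sub>m 1 3    @\<^sub>c mat 1 1 (\<lambda>_. - alpha3 d f)) @\<^sub>r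
     (0\<^sub>m 3 3 @\<^sub>c alpha1 d f @\<^sub>c 0\<^sub>m 3 1))"

definition theta3 :: "nat \<Rightarrow> 'k::field_char_0 poly3 \<Rightarrow> 'k poly3 mat" where
  "theta3 d f = cst (- (of_nat d - 1) / 2) \<cdot>\<^sub>m (
     (0\<^sub>m 3 1 @\<^sub>c 0\<^sub>m 3 3 @\<^sub>c ((- 2) \<cdot>\<^sub>m alpha2 d f)) @\<^sub>r
     (0\<^sub>m 1 1 @\<^sub>c par1   @\<^sub>c 0\<^sub>m 1 3))"

definition M0_2_left :: "'k::field_char_0 poly3 \<Rightarrow> 'k poly3 mat" where
  "M0_2_left f = (let fx = dx f; fy = dy f; fz = dz f; x = xx; y = yy; z = zz in
     mat_of_cols_list 6
       [[2 * x^2, 2 * (x * y), 2 * (x * z), 2 * y^2, 2 * (y * z), 2 * z^2],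
        [0, x * fz, - x * fy, 2 * y * fz, z * fz - y * fy, - 2 * z * fy],
        [- 2 * x * fz, - y * fz, x * fx - z * fz, 0, y * fx, 2 * z * fx],
        [2 * x * fy, y * fy - x * fx, z * fy, - 2 * y * fx, - z * fx, 0]])"

definition M0_2_right :: "nat \<Rightarrow> 'k::field_char_0 poly3 \<Rightarrow> 'k poly3 mat" where
  "M0_2_right d f = (let x = xx; y = yy; z = zz; Hxx = Hxx f; Hyy = Hyy f; Hzz = Hzz f;
       Hxy = Hxy f; Hxz = Hxz f; Hyz = Hyz f in
     cst (2 / (of_nat d - 1)^2) \<cdot>\<^sub>m mat_of_rows_list 3
       [[x * Hxx, 2 * x * Hxy - y * Hxx, 2 * x * Hxz - z * Hxx],
        [y * Hxx, x * Hyy, x * Hyz + y * Hxz - z * Hxy],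
        [z * Hxx, z * Hxy + x * Hyz - y * Hxz, x * Hzz],
        [2 * y * Hxy - x * Hyy, y * Hyy, 2 * y * Hyz - z * Hyy],
        [y * Hxz + z * Hxy - x * Hyz, z * Hyy, y * Hzz],
        [2 * z * Hxz - x * Hzz, 2 * z * Hyz - y * Hzz, z * Hzz]])"

definition M0_2 :: "nat \<Rightarrow> 'k::field_char_0 poly3 \<Rightarrow> 'k poly3 mat" where
  "M0_2 d f = M0_2_left f @\<^sub>c M0_2_right d f"

definition eps_poly :: "nat \<Rightarrow> 'k::field_char_0 poly3 \<Rightarrow> 'k poly3 mat" where
  "eps_poly d f =
     (M0_1 f  @\<^sub>c theta1 d f @\<^sub>c 0\<^sub>m 3 1) @\<^sub>r
     (0\<^sub>m 6 4 @\<^sub>c M0_2 d f   @\<^sub>c 0\<^sub>m 6 1) @\<^sub>r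
     (0\<^sub>m 1 4 @\<^sub>c 0\<^sub>m 1 7    @\<^sub>c 1\<^sub>m 1)"

definition odd_dif_poly :: "nat \<Rightarrow> 'k::field_char_0 poly3 \<Rightarrow> 'k poly3 mat" where
  "odd_dif_poly d f =
     (M1_1 f  @\<^sub>c theta2 d f) @\<^sub>r
     (0\<^sub>m 7 4 @\<^sub>c M1_2 d f)"

definition even_dif_poly :: "nat \<Rightarrow> 'k::field_char_0 poly3 \<Rightarrow> 'k poly3 mat" where
  "even_dif_poly d f =
     (M2_1 f  @\<^sub>c theta3 d f) @\<^sub>r
     (0\<^sub>m 7 4 @\<^sub>c M2_2 d f)"

definition first_dif_poly :: "nat \<Rightarrow> 'k::field_char_0 poly3 \<Rightarrow> 'k poly3 mat" where
  "first_dif_poly d f =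
     (M1_1 f  @\<^sub>c theta2 d f) @\<^sub>r
     (0\<^sub>m 7 4 @\<^sub>c M1_2 d f) @\<^sub>r
     (0\<^sub>m 1 4 @\<^sub>c 0\<^sub>m 1 7)"

definition res_rank :: "nat \<Rightarrow> nat" where
  "res_rank n = (if n = 0 then 4 + 7 + 1 else 4 + 7)"

text \<open>\<open>res_dif d f n\<close> is the differential from homological degree \<open>n + 1\<close> to degree \<open>n\<close>.\<close>

definition res_dif :: "nat \<Rightarrow> 'k::field_char_0 poly3 \<Rightarrow> nat \<Rightarrow> 'k poly3 set mat" where
  "res_dif d f n = map_mat (hyp_class f)
     (if n = 0 then first_dif_poly d f
      else if odd n then even_dif_poly d f else odd_dif_poly d f)"

definition eps :: "nat \<Rightarrow> 'k::field_char_0 poly3 \<Rightarrow> 'k poly3 set mat" where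
  "eps d f = map_mat (hyp_class f) (eps_poly d f)"

end

theory Submission
  imports Defs
begin

text \<open>
  Let \<open>Q = k[x,y,z]\<close>, let \<open>g = (f\<^sub>x, f\<^sub>y, f\<^sub>z)\<close> be the gradient of \<open>f\<close>, \<open>\<Delta>\<close> its Hessian and \<open>A\<close> the
  adjugate of \<open>\<Delta>\<close>. Write \<open>[v]\<close> for the skew matrix of the cross product with a vector \<open>v\<close>. The
  argument has an arithmetic input and a linear algebra part.

  The arithmetic input is that \<open>f\<^sub>x, f\<^sub>y, f\<^sub>z\<close> vanish together only at the origin: some power of each
  variable lies in the Jacobian ideal (\<open>isolated_singularity_power_in_jacobian_ideal\<close>).
  Otherwise a prime \<open>P\<close> contains the Jacobian ideal, hence \<open>f\<close>, but not all variables. Then the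
  local ring of \<open>R\<close> at \<open>P\<close> is not regular (\<open>not_regular\<close>): its embedding dimension is at least the
  height of \<open>P\<close> in \<open>Q\<close>, because the Jacobian matrix of \<open>P\<close> has rank at least that height modulo
  \<open>P\<close> in characteristic zero, whereas its dimension is smaller than this height by one. Since powers of
  \<open>x, y, z\<close> have an exact Koszul complex and lie in the ideal of \<open>g\<close>, the Koszul complex of \<open>g\<close> is
  exact at the two places that matter (\<open>koszul1_transfer\<close>, \<open>koszul2_transfer\<close>).

  Everything else follows from the two Koszul complexes, of \<open>(x,y,z)\<close> and of \<open>g\<close>, and from Euler's
  formulas \<open>(x,y,z) \<cdot> g = d f\<close> and \<open>\<Delta> (x,y,z)\<^sup>T = (d - 1) g\<close>. An operator of order at most two
  has a symmetric matrix \<open>S\<close> as second order symbol, a vector field part \<open>v\<close> and a scalar part. It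
  preserves \<open>(f)\<close> exactly when \<open>S g \<equiv> 0\<close> and its value at \<open>f\<close> is \<open>\<equiv> 0\<close> modulo \<open>f\<close>
  (\<open>dop_preserves_iff\<close>). The columns of \<open>M\<^sub>0(2)\<close> parametrize such \<open>S\<close>
  (\<open>symbol_kernel_mod_f\<close>), the block \<open>\<theta>\<^sub>1(2)\<close> corrects the first order part so that the second
  condition holds (\<open>symbol_trace\<close>), and the remaining freedom in \<open>v\<close> is \<open>v \<cdot> g \<equiv> 0\<close>, which
  \<open>M\<^sub>0(1)\<close> parametrizes (\<open>gradient_kernel_mod_f\<close>). The relations among the generators are
  found in the same triangular manner (\<open>symbol_relations\<close>, \<open>gradient_kernel_relations\<close>). From there
  on the two square matrices of the resolution satisfy \<open>M M' = M' M = d f\<close> over \<open>Q\<close>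
  (\<open>odd_even\<close>, \<open>even_odd\<close>), and a matrix factorization is always exact modulo \<open>f\<close>
  (\<open>matrix_factorization_kernel\<close>). Minimality holds because all entries of the differentials vanish at
  the origin, which also forces the columns of \<open>\<epsilon>\<close> to be a minimal generating set
  (\<open>minimal_generators\<close>).
\<close>

section \<open>Polynomials in three variables\<close>

definition c3 :: "'k::comm_ring_1 poly3 \<Rightarrow> nat \<Rightarrow> nat \<Rightarrow> nat \<Rightarrow> 'k" where
  "c3 p a b c = poly.coeff (poly.coeff (poly.coeff p c) b) a"

lemma poly3_eqI: "(\<And>a b c. c3 p a b c = c3 q a b c) \<Longrightarrow> p = q"
  unfolding c3_def by (intro poly_eqI) auto

lemma c3_add [simp]: "c3 (p + q) a b c = c3 p a b c + c3 q a b c"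
  and c3_diff [simp]: "c3 (p - q) a b c = c3 p a b c - c3 q a b c"
  and c3_minus [simp]: "c3 (- p) a b c = - c3 p a b c"
  and c3_zero [simp]: "c3 0 a b c = 0"
  by (simp_all add: c3_def)

lemma c3_sum [simp]: "c3 (sum F A) a b c = (\<Sum>i\<in>A. c3 (F i) a b c)"
  by (induction A rule: infinite_finite_induct) auto

lemma c3_cst: "c3 (cst k) a b c = (if a = 0 \<and> b = 0 \<and> c = 0 then k else 0)"
  by (auto simp: c3_def cst_def coeff_pCons split: nat.splits)

lemma c3_cst_mult [simp]: "c3 (cst k * p) a b c = k * c3 p a b c"
  by (simp add: c3_def cst_def)

lemma cst_hom [simp]: "cst 0 = 0" "cst 1 = 1" "cst (k + l) = cst k + cst l"
  "cst (k - l) = cst k - cst l" "cst (- k) = - cst k"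
  by (simp_all add: cst_def one_pCons)

lemma cst_mult: "cst (k * l) = cst k * cst l"
  by (simp add: cst_def)

lemma cst_of_nat: "cst (of_nat n) = of_nat n"
  by (induction n) auto

lemma cst_numeral: "cst (numeral n) = numeral n"
  by (metis cst_of_nat of_nat_numeral)

lemma cst_power: "cst (k ^ n) = cst k ^ n"
  by (induction n) (auto simp: cst_mult)

lemma cst_eq_iff [simp]: "cst k = cst l \<longleftrightarrow> k = l"
  by (simp add: cst_def)

lemma c3_mult:
  "c3 (p * q) a b c = (\<Sum>k\<le>c. \<Sum>j\<le>b. \<Sum>i\<le>a. c3 p i j k * c3 q (a - i) (b - j) (c - k))"
  by (simp add: c3_def coeff_mult coeff_sum)

lemma c3_xx_mult: "c3 (xx * p) a b c = (if a = 0 then 0 else c3 p (a - 1) b c)"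
  by (cases a) (simp_all add: c3_def xx_def coeff_pCons)

lemma c3_yy_mult: "c3 (yy * p) a b c = (if b = 0 then 0 else c3 p a (b - 1) c)"
  by (cases b) (simp_all add: c3_def yy_def coeff_pCons)

lemma c3_zz_mult: "c3 (zz * p) a b c = (if c = 0 then 0 else c3 p a b (c - 1))"
  by (cases c) (simp_all add: c3_def zz_def coeff_pCons)

lemma c3_xx_power_mult: "c3 (xx ^ n * p) a b c = (if a < n then 0 else c3 p (a - n) b c)"
  by (induction n arbitrary: a) (auto simp: mult.assoc c3_xx_mult)

lemma c3_yy_power_mult: "c3 (yy ^ n * p) a b c = (if b < n then 0 else c3 p a (b - n) c)"
  by (induction n arbitrary: b) (auto simp: mult.assoc c3_yy_mult)

lemma c3_zz_power_mult: "c3 (zz ^ n * p) a b c = (if c < n then 0 else c3 p a b (c - n))"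
  by (induction n arbitrary: c) (auto simp: mult.assoc c3_zz_mult)

lemma c3_finite_support: "\<exists>n. \<forall>a b c. c3 p a b c \<noteq> 0 \<longrightarrow> a + b + c \<le> n"
proof -
  have one: "\<exists>n. \<forall>b a. poly.coeff (poly.coeff q b) a \<noteq> 0 \<longrightarrow> a + b \<le> n" for q :: "'a poly poly"
  proof -
    define n where "n = degree q + (\<Sum>b\<le>degree q. degree (poly.coeff q b))"
    have "a + b \<le> n" if "poly.coeff (poly.coeff q b) a \<noteq> 0" for a b
    proof -
      have "b \<le> degree q" using that by (metis coeff_0 le_degree)
      moreover have "a \<le> degree (poly.coeff q b)" using that by (rule le_degree)
      moreover have "degree (poly.coeff q b) \<le> (\<Sum>b\<le>degree q. degree (poly.coeff q b))"
        using \<open>b \<le> degree q\<close> by (intro member_le_sum) auto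
      ultimately show ?thesis unfolding n_def by linarith
    qed
    then show ?thesis by blast
  qed
  then obtain N where N: "\<And>q b a. poly.coeff (poly.coeff q b) a \<noteq> 0 \<Longrightarrow> a + b \<le> N (q :: 'a poly poly)"
    by metis
  define n where "n = degree p + (\<Sum>c\<le>degree p. N (poly.coeff p c))"
  have "a + b + c \<le> n" if "c3 p a b c \<noteq> 0" for a b c
  proof -
    have "c \<le> degree p" using that unfolding c3_def by (metis coeff_0 le_degree)
    moreover have "a + b \<le> N (poly.coeff p c)" using that N unfolding c3_def by blast
    moreover have "N (poly.coeff p c) \<le> (\<Sum>c\<le>degree p. N (poly.coeff p c))"
      using \<open>c \<le> degree p\<close> by (intro member_le_sum) auto
    ultimately show ?thesis unfolding n_def by linarith
  qed
  then show ?thesis by blast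
qed

text \<open>Every polynomial arises from constants by addition and multiplication by a variable, so a statement
  about derivations or linear maps need only be followed through these operations.\<close>

lemma poly3_induct [case_names cst add xx yy zz]:
  fixes p :: "'k::comm_ring_1 poly3"
  assumes cst: "\<And>k. P (cst k)" and add: "\<And>p q. P p \<Longrightarrow> P q \<Longrightarrow> P (p + q)"
    and xx: "\<And>p. P p \<Longrightarrow> P (xx * p)" and yy: "\<And>p. P p \<Longrightarrow> P (yy * p)"
    and zz: "\<And>p. P p \<Longrightarrow> P (zz * p)"
  shows "P p"
proof -
  have 1: "P [:[:q:]:]" for q :: "'k poly"
  proof (induction q)
    case 0 show ?case using cst[of 0] by simp
  next
    case (pCons a q)
    have "[:[:pCons a q:]:] = cst a + xx * [:[:q:]:]" by (simp add: cst_def xx_def)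
    then show ?case using cst[of a] add xx[OF pCons.IH] by metis
  qed
  have 2: "P [:q:]" for q :: "'k poly poly"
  proof (induction q)
    case 0 show ?case using cst[of 0] by simp
  next
    case (pCons a q)
    have "[:pCons a q:] = [:[:a:]:] + yy * [:q:]" by (simp add: yy_def)
    then show ?case using 1[of a] add yy[OF pCons.IH] by metis
  qed
  show ?thesis
  proof (induction p)
    case 0 show ?case using cst[of 0] by simp
  next
    case (pCons a q)
    have "pCons a q = [:a:] + zz * q" by (simp add: zz_def)
    then show ?case using 2[of a] add zz[OF pCons.IH] by metis
  qed
qed

subsection \<open>Partial derivatives\<close>

lemma c3_dx: "c3 (dx p) a b c = of_nat (Suc a) * c3 p (Suc a) b c"
  by (simp add: c3_def dx_def coeff_map_poly coeff_pderiv)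

lemma c3_dy: "c3 (dy p) a b c = of_nat (Suc b) * c3 p a (Suc b) c"
proof -
  have "poly.coeff (of_nat n * q) a = of_nat n * poly.coeff q a" for n and q :: "'a poly"
    by (simp add: of_nat_poly)
  then show ?thesis
    by (simp add: c3_def dy_def coeff_map_poly coeff_pderiv del: of_nat_Suc)
qed

lemma c3_dz: "c3 (dz p) a b c = of_nat (Suc c) * c3 p a b (Suc c)"
proof -
  have 1: "poly.coeff (of_nat n * q) a = of_nat n * poly.coeff q a" for n a and q :: "'a poly"
    by (simp add: of_nat_poly)
  have 2: "poly.coeff (of_nat n * q) a = of_nat n * poly.coeff q a" for n a and q :: "'a poly poly"
    by (simp add: of_nat_poly)
  show ?thesis
    by (simp only: c3_def dz_def coeff_pderiv 1 2)
qed

lemmas c3_partial = c3_dx c3_dy c3_dz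

lemma partial_add [simp]: "dx (p + q) = dx p + dx q" "dy (p + q) = dy p + dy q"
    "dz (p + q) = dz p + dz q"
  by (rule poly3_eqI, simp add: c3_partial distrib_left del: of_nat_Suc)+

lemma partial_0 [simp]: "dx 0 = 0" "dy 0 = 0" "dz 0 = 0"
  by (rule poly3_eqI, simp add: c3_partial del: of_nat_Suc)+

lemma partial_minus [simp]: "dx (- p) = - dx p" "dy (- p) = - dy p" "dz (- p) = - dz p"
  by (rule poly3_eqI, simp add: c3_partial del: of_nat_Suc)+

lemma partial_diff [simp]: "dx (p - q) = dx p - dx q" "dy (p - q) = dy p - dy q"
    "dz (p - q) = dz p - dz q"
  by (rule poly3_eqI, simp add: c3_partial right_diff_distrib del: of_nat_Suc)+

lemma partial_cst_mult [simp]: "dx (cst k * p) = cst k * dx p" "dy (cst k * p) = cst k * dy p"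
    "dz (cst k * p) = cst k * dz p"
  by (rule poly3_eqI, simp add: c3_partial del: of_nat_Suc)+

lemma partial_cst [simp]: "dx (cst k) = 0" "dy (cst k) = 0" "dz (cst k) = 0"
  by (rule poly3_eqI, simp add: c3_partial c3_cst del: of_nat_Suc)+

lemma partial_1 [simp]: "dx 1 = 0" "dy 1 = 0" "dz 1 = 0"
  using partial_cst[of 1] by simp_all

lemma partial_commute: "dy (dx p) = dx (dy p)" "dz (dx p) = dx (dz p)" "dz (dy p) = dy (dz p)"
  by (rule poly3_eqI, simp add: c3_partial del: of_nat_Suc)+

lemma partial_var_mult:
  "dx (xx * p) = p + xx * dx p" "dx (yy * p) = yy * dx p" "dx (zz * p) = zz * dx p"
  "dy (xx * p) = xx * dy p" "dy (yy * p) = p + yy * dy p" "dy (zz * p) = zz * dy p"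
  "dz (xx * p) = xx * dz p" "dz (yy * p) = yy * dz p" "dz (zz * p) = p + zz * dz p"
  by (rule poly3_eqI,
      auto simp: c3_partial c3_xx_mult c3_yy_mult c3_zz_mult algebra_simps gr0_conv_Suc)+

lemma partial_mult:
  "dx (p * q) = dx p * q + p * dx q" "dy (p * q) = dy p * q + p * dy q"
  "dz (p * q) = dz p * q + p * dz q"
proof -
  have "dx (p * q) = dx p * q + p * dx q \<and> dy (p * q) = dy p * q + p * dy q \<and>
    dz (p * q) = dz p * q + p * dz q"
    by (induction p rule: poly3_induct)
      (simp_all add: distrib_right mult.assoc partial_var_mult, simp_all add: algebra_simps)
  then show "dx (p * q) = dx p * q + p * dx q" "dy (p * q) = dy p * q + p * dy q"
    "dz (p * q) = dz p * q + p * dz q" by blast+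
qed

lemma partial_var [simp]:
  "dx xx = 1" "dx yy = 0" "dx zz = 0" "dy xx = 0" "dy yy = 1" "dy zz = 0"
  "dz xx = 0" "dz yy = 0" "dz zz = 1"
  using partial_var_mult[of 1] by simp_all

text \<open>Compared coefficient by coefficient: the left side multiplies the coefficient of \<open>x\<^sup>a
  y\<^sup>b z\<^sup>c\<close> by \<open>a + b + c = d\<close>.\<close>

lemma euler_relation:
  fixes f :: "'k::idom poly3"
  assumes "homogeneous3 d f"
  shows "xx * dx f + yy * dy f + zz * dz f = cst (of_nat d) * f"
proof (rule poly3_eqI)
  fix a b c
  have "c3 (xx * dx f + yy * dy f + zz * dz f) a b c = of_nat (a + b + c) * c3 f a b c"
    by (cases a; cases b; cases c)
      (simp_all add: c3_partial c3_xx_mult c3_yy_mult c3_zz_mult algebra_simps)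
  also have "\<dots> = of_nat d * c3 f a b c"
    using assms unfolding homogeneous3_def c3_def by (cases "c3 f a b c = 0") (auto simp: c3_def)
  finally show "c3 (xx * dx f + yy * dy f + zz * dz f) a b c = c3 (cst (of_nat d) * f) a b c"
    by simp
qed

lemma homogeneous3_partial:
  fixes f :: "'k::idom poly3"
  assumes "homogeneous3 d f"
  shows "homogeneous3 (d - 1) (dx f)" "homogeneous3 (d - 1) (dy f)" "homogeneous3 (d - 1) (dz f)"
proof -
  have *: "a + b + c = d" if "c3 f a b c \<noteq> 0" for a b c
    using assms that unfolding homogeneous3_def c3_def by blast
  show "homogeneous3 (d - 1) (dx f)" "homogeneous3 (d - 1) (dy f)" "homogeneous3 (d - 1) (dz f)"
    unfolding homogeneous3_def c3_def[symmetric] c3_partial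
    by (auto simp del: of_nat_Suc dest!: *)
qed

text \<open>The constant coefficient is evaluation at the origin.\<close>

definition const_coeff :: "'k::comm_ring_1 poly3 \<Rightarrow> 'k" where
  "const_coeff p = c3 p 0 0 0"

lemma const_coeff_simps [simp]:
  "const_coeff (p + q) = const_coeff p + const_coeff q"
  "const_coeff (p - q) = const_coeff p - const_coeff q"
  "const_coeff (- p) = - const_coeff p"
  "const_coeff (p * q) = const_coeff p * const_coeff q"
  "const_coeff (cst k) = k" "const_coeff 0 = 0"
  "const_coeff xx = 0" "const_coeff yy = 0" "const_coeff zz = 0"
  using c3_xx_mult[of 1 0 0 0] c3_yy_mult[of 1 0 0 0] c3_zz_mult[of 1 0 0 0]
  by (simp_all add: const_coeff_def c3_mult c3_cst)

lemma const_coeff_1 [simp]: "const_coeff 1 = 1"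
  using const_coeff_simps(5)[of 1] by simp

lemma const_coeff_power [simp]: "const_coeff (p ^ n) = const_coeff p ^ n"
  by (induction n) auto

lemma const_coeff_homogeneous: "homogeneous3 d p \<Longrightarrow> d \<noteq> 0 \<Longrightarrow> const_coeff p = 0"
  unfolding homogeneous3_def const_coeff_def c3_def by force

text \<open>This identifies polynomials vanishing at the origin with the ideal \<open>(x,y,z)\<close>.\<close>

lemma const_coeff_eq_0_decompose:
  assumes "const_coeff p = 0"
  obtains u v w where "p = xx * u + yy * v + zz * w"
proof -
  have "\<exists>k u v w. p = cst k + xx * u + yy * v + zz * w"
  proof (induction p rule: poly3_induct)
    case (cst k)
    show ?case by (intro exI[of _ k] exI[of _ 0]) auto
  next
    case (add p q)
    then obtain k u v w k' u' v' w' where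
      "p = cst k + xx * u + yy * v + zz * w" "q = cst k' + xx * u' + yy * v' + zz * w'" by blast
    then have "p + q = cst (k + k') + xx * (u + u') + yy * (v + v') + zz * (w + w')"
      by (simp add: algebra_simps)
    then show ?case by blast
  next
    case (xx p)
    show ?case by (rule exI[of _ 0], rule exI[of _ p], intro exI[of _ 0]) simp
  next
    case (yy p)
    show ?case by (rule exI[of _ 0], rule exI[of _ 0], rule exI[of _ p], rule exI[of _ 0]) simp
  next
    case (zz p)
    show ?case by (rule exI[of _ 0], rule exI[of _ 0], rule exI[of _ 0], rule exI[of _ p]) simp
  qed
  then obtain k u v w where p: "p = cst k + xx * u + yy * v + zz * w" by blast
  with assms have "k = 0" by simp
  with p that show thesis by auto
qed

section \<open>Koszul complexes and the Hessian\<close>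

text \<open>Exactness of the Koszul complex of three elements in its two middle degrees, written with
  cross products.\<close>

definition koszul1 :: "'a::comm_ring_1 \<Rightarrow> 'a \<Rightarrow> 'a \<Rightarrow> bool" where
  "koszul1 g1 g2 g3 \<longleftrightarrow> (\<forall>u1 u2 u3. u1 * g1 + u2 * g2 + u3 * g3 = 0 \<longrightarrow>
     (\<exists>b1 b2 b3. u1 = g2 * b3 - g3 * b2 \<and> u2 = g3 * b1 - g1 * b3 \<and> u3 = g1 * b2 - g2 * b1))"

definition koszul2 :: "'a::comm_ring_1 \<Rightarrow> 'a \<Rightarrow> 'a \<Rightarrow> bool" where
  "koszul2 g1 g2 g3 \<longleftrightarrow> (\<forall>u1 u2 u3. g2 * u3 = g3 * u2 \<and> g3 * u1 = g1 * u3 \<and> g1 * u2 = g2 * u1 \<longrightarrow>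
     (\<exists>t. u1 = t * g1 \<and> u2 = t * g2 \<and> u3 = t * g3))"

lemma koszul1D:
  assumes "koszul1 g1 g2 g3" "u1 * g1 + u2 * g2 + u3 * g3 = 0"
  obtains b1 b2 b3 where "u1 = g2 * b3 - g3 * b2" "u2 = g3 * b1 - g1 * b3" "u3 = g1 * b2 - g2 * b1"
  using assms unfolding koszul1_def by blast

lemma koszul2D:
  assumes "koszul2 g1 g2 g3" "g2 * u3 = g3 * u2" "g3 * u1 = g1 * u3" "g1 * u2 = g2 * u1"
  obtains t where "u1 = t * g1" "u2 = t * g2" "u3 = t * g3"
  using assms unfolding koszul2_def by blast

text \<open>These rules prove an identity modulo known equations from a certificate: once the coefficients of a
  linear combination are given, only an identity of polynomials is left.\<close>

lemma lin1: "a = b \<Longrightarrow> s - t = c * (a - b) \<Longrightarrow> s = (t::'a::comm_ring_1)"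
  by simp

lemma lin2: "a = b \<Longrightarrow> a' = b' \<Longrightarrow> s - t = c * (a - b) + c' * (a' - b') \<Longrightarrow> s = (t::'a::comm_ring_1)"
  by simp

lemma lin3: "a = b \<Longrightarrow> a' = b' \<Longrightarrow> a'' = b'' \<Longrightarrow>
    s - t = c * (a - b) + c' * (a' - b') + c'' * (a'' - b'') \<Longrightarrow> s = (t::'a::comm_ring_1)"
  by simp

lemma lin4: "a = b \<Longrightarrow> a' = b' \<Longrightarrow> a'' = b'' \<Longrightarrow> ab = ba \<Longrightarrow>
    s - t = c * (a - b) + c' * (a' - b') + c'' * (a'' - b'') + k * (ab - ba) \<Longrightarrow> s = (t::'a::comm_ring_1)"
  by simp

lemma lin5: "a1 = b1 \<Longrightarrow> a2 = b2 \<Longrightarrow> a3 = b3 \<Longrightarrow> a4 = b4 \<Longrightarrow> a5 = b5 \<Longrightarrow>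
    s - t = c * (a1 - b1) + c' * (a2 - b2) + c'' * (a3 - b3) + k * (a4 - b4) + k' * (a5 - b5) \<Longrightarrow> s = (t::'a::comm_ring_1)"
  by simp

text \<open>If \<open>f\<close> divides each \<open>g\<^sub>i c\<close>, the quotients form a vector parallel to
  \<open>g\<close>, hence by Koszul exactness a multiple \<open>t g\<close>, and then \<open>c = t
  f\<close>.\<close>

lemma koszul2_annihilator:
  fixes f :: "'a::idom"
  assumes "koszul2 g1 g2 g3" "f \<noteq> 0" "g1 \<noteq> 0 \<or> g2 \<noteq> 0 \<or> g3 \<noteq> 0"
    and "f dvd g1 * c" "f dvd g2 * c" "f dvd g3 * c"
  shows "f dvd c"
proof -
  obtain h1 h2 h3 where h: "g1 * c = f * h1" "g2 * c = f * h2" "g3 * c = f * h3"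
    using assms(4-6) by (auto elim!: dvdE)
  have "f * (g2 * h3) = f * (g3 * h2)" "f * (g3 * h1) = f * (g1 * h3)" "f * (g1 * h2) = f * (g2 * h1)"
    unfolding mult.left_commute[of f] h[symmetric] by (simp_all only: ac_simps)
  then have "g2 * h3 = g3 * h2" "g3 * h1 = g1 * h3" "g1 * h2 = g2 * h1"
    using \<open>f \<noteq> 0\<close> by simp_all
  with assms(1) obtain t where t: "h1 = t * g1" "h2 = t * g2" "h3 = t * g3"
    by (rule koszul2D)
  have "g1 * c = g1 * (f * t)" "g2 * c = g2 * (f * t)" "g3 * c = g3 * (f * t)"
    unfolding h t by (simp_all only: ac_simps)
  with assms(3) have "c = f * t" by auto
  then show ?thesis by simp
qed

text \<open>What the identities below use of a homogeneous polynomial \<open>f\<close>: the Euler relations for \<open>f\<close> and for its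
  first derivatives, and the exactness of the Koszul complexes of the variables and of the gradient. Here \<open>g\<close> is the gradient, \<open>h\<close> the Hessian, \<open>d\<close> the degree, \<open>n = d - 1\<close>, and
  \<open>di\<close>, \<open>e\<close>, \<open>hf\<close> are the inverses of \<open>d\<close>, \<open>n\<close> and \<open>2\<close>.\<close>

locale hessian_ring =
  fixes x y z f g1 g2 g3 hxx hxy hxz hyy hyz hzz d di n e hf :: "'a::idom"
  assumes di: "d * di = 1" and e: "n * e = 1" and hf: "2 * hf = 1"
    and f0: "f \<noteq> 0" and x0: "x \<noteq> 0"
    and euler: "x * g1 + y * g2 + z * g3 = d * f"
    and euler1: "hxx * x + hxy * y + hxz * z = n * g1"
    and euler2: "hxy * x + hyy * y + hyz * z = n * g2"
    and euler3: "hxz * x + hyz * y + hzz * z = n * g3"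
    and kx1: "koszul1 x y z" and kx2: "koszul2 x y z"
    and kg1: "koszul1 g1 g2 g3" and kg2: "koszul2 g1 g2 g3"
begin

definition "axx = hyy * hzz - hyz^2"
definition "ayy = hxx * hzz - hxz^2"
definition "azz = hxx * hyy - hxy^2"
definition "axy = hxz * hyz - hxy * hzz"
definition "axz = hxy * hyz - hxz * hyy"
definition "ayz = hxy * hxz - hxx * hyz"
definition "hdet = hxx * axx + hxy * axy + hxz * axz"

lemmas adjugate_defs = axx_def ayy_def azz_def axy_def axz_def ayz_def

text \<open>The numbered abbreviations are the coordinates of linear maps: \<open>hess\<close> and \<open>adj\<close> of the Hessian and its
  adjugate, \<open>odd\<close> and \<open>even\<close> of the two periodic differentials (in the order of their rows), each applied to
  the arguments on which it depends. The families \<open>xcong\<close> and \<open>gcong\<close> are the entries of the congruence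
  transforms \<open>[x] T [x]\<^sup>T\<close> and \<open>[g] T [g]\<^sup>T\<close> of a symmetric matrix \<open>T\<close>, and \<open>polar\<close> inserts the parameters
  that represent \<open>[g] T [g]\<^sup>T\<close> as a symbol.\<close>

abbreviation "hess1 a b c \<equiv> hxx * a + hxy * b + hxz * c"
abbreviation "hess2 a b c \<equiv> hxy * a + hyy * b + hyz * c"
abbreviation "hess3 a b c \<equiv> hxz * a + hyz * b + hzz * c"
abbreviation "adj1 a b c \<equiv> axx * a + axy * b + axz * c"
abbreviation "adj2 a b c \<equiv> axy * a + ayy * b + ayz * c"
abbreviation "adj3 a b c \<equiv> axz * a + ayz * b + azz * c"
abbreviation "xdot a b c \<equiv> x * a + y * b + z * c"
abbreviation "dotx a b c \<equiv> a * x + b * y + c * z"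
abbreviation "gdot a b c \<equiv> g1 * a + g2 * b + g3 * c"
abbreviation "dotg a b c \<equiv> a * g1 + b * g2 + c * g3"
abbreviation "adj_trace a b c p q r \<equiv> axx * a + axy * b + axz * c + axy * b + ayy * p + ayz * q + axz * c + ayz * q + azz * r"
abbreviation "odd1 u v w s \<equiv> (dotg u v w) - n * (e^3 * hdet) * s"
abbreviation "odd2 v w t a b c \<equiv> - (y * w - z * v) + t * g1 + n * e * (hess1 a b c)"
abbreviation "odd3 u w t a b c \<equiv> - (z * u - x * w) + t * g2 + n * e * (hess2 a b c)"
abbreviation "odd4 u v t a b c \<equiv> - (x * v - y * u) + t * g3 + n * e * (hess3 a b c)"
abbreviation "odd5 u v w s \<equiv> (dotg u v w) - 2 * e^3 * hdet * s"
abbreviation "odd6 v w a b c \<equiv> - (y * w - z * v) + 2 * e * (hess1 a b c)"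
abbreviation "odd7 u w a b c \<equiv> - (z * u - x * w) + 2 * e * (hess2 a b c)"
abbreviation "odd8 u v a b c \<equiv> - (x * v - y * u) + 2 * e * (hess3 a b c)"
abbreviation "odd9 v w s \<equiv> - (y * w - z * v) + s * g1"
abbreviation "odd10 u w s \<equiv> - (z * u - x * w) + s * g2"
abbreviation "odd11 u v s \<equiv> - (x * v - y * u) + s * g3"
abbreviation "even1 h q r a b c \<equiv> h * x + (g2 * r - g3 * q) + n * e^2 * (adj1 a b c)"
abbreviation "even2 h p r a b c \<equiv> h * y + (g3 * p - g1 * r) + n * e^2 * (adj2 a b c)"
abbreviation "even3 h p q a b c \<equiv> h * z + (g1 * q - g2 * p) + n * e^2 * (adj3 a b c)"
abbreviation "even4 a b c p q r \<equiv> (xdot a b c) - n * hf * (xdot p q r)"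
abbreviation "even5 h q r a b c \<equiv> h * x + (g2 * r - g3 * q) + 2 * e^2 * (adj1 a b c)"
abbreviation "even6 h p r a b c \<equiv> h * y + (g3 * p - g1 * r) + 2 * e^2 * (adj2 a b c)"
abbreviation "even7 h p q a b c \<equiv> h * z + (g1 * q - g2 * p) + 2 * e^2 * (adj3 a b c)"
abbreviation "even8 p q r b c \<equiv> hf * x * (xdot p q r) + (g2 * c - g3 * b)"
abbreviation "even9 p q r a c \<equiv> hf * y * (xdot p q r) + (g3 * a - g1 * c)"
abbreviation "even10 p q r a b \<equiv> hf * z * (xdot p q r) + (g1 * b - g2 * a)"
abbreviation "xcongxx p q r \<equiv> (- z) * (- z) * p + (- z) * (y) * q + (y) * (- z) * q + (y) * (y) * r"
abbreviation "xcongxy b c q r \<equiv> (- z) * (z) * b + (- z) * (- x) * q + (y) * (z) * c + (y) * (- x) * r"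
abbreviation "xcongxz b c p q \<equiv> (- z) * (- y) * b + (- z) * (x) * p + (y) * (- y) * c + (y) * (x) * q"
abbreviation "xcongyy a c r \<equiv> (z) * (z) * a + (z) * (- x) * c + (- x) * (z) * c + (- x) * (- x) * r"
abbreviation "xcongyz a b c q \<equiv> (z) * (- y) * a + (z) * (x) * b + (- x) * (- y) * c + (- x) * (x) * q"
abbreviation "xcongzz a b p \<equiv> (- y) * (- y) * a + (- y) * (x) * b + (x) * (- y) * b + (x) * (x) * p"
abbreviation "gcongxx p q r \<equiv> (- g3) * (- g3) * p + (- g3) * (g2) * q + (g2) * (- g3) * q + (g2) * (g2) * r"
abbreviation "gcongxy b c q r \<equiv> (- g3) * (g3) * b + (- g3) * (- g1) * q + (g2) * (g3) * c + (g2) * (- g1) * r"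
abbreviation "gcongxz b c p q \<equiv> (- g3) * (- g2) * b + (- g3) * (g1) * p + (g2) * (- g2) * c + (g2) * (g1) * q"
abbreviation "gcongyy a c r \<equiv> (g3) * (g3) * a + (g3) * (- g1) * c + (- g1) * (g3) * c + (- g1) * (- g1) * r"
abbreviation "gcongyz a b c q \<equiv> (g3) * (- g2) * a + (g3) * (g1) * b + (- g1) * (- g2) * c + (- g1) * (g1) * q"
abbreviation "gcongzz a b p \<equiv> (- g2) * (- g2) * a + (- g2) * (g1) * b + (g1) * (- g2) * b + (g1) * (g1) * p"
abbreviation "polar F t11 t12 t13 t22 t23 t33 \<equiv>
  F (- hf * e^2 * (adj_trace t11 t12 t13 t22 t23 t33)) 0 0 0 (hf * (dotx t11 t12 t13)) (hf * (dotx t12 t22 t23)) (hf * (dotx t13 t23 t33))"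

lemma gradient_eq: "g1 = e * (hess1 x y z)"
   "g2 = e * (hess2 x y z)" "g3 = e * (hess3 x y z)"
  unfolding euler1 euler2 euler3 unfolding mult.assoc[symmetric] mult.commute[of e n] e by simp_all

text \<open>In matrix form \<open>[x] A = (d - 1) \<Delta> [g]\<close>. This is the identity \<open>M\<^sup>T [M
  v] M = det M [v]\<close> for \<open>M = \<Delta>\<close> and \<open>v = x\<close>, multiplied by
  the adjugate.\<close>

lemma adjugate_cross:
  "y * axz - z * axy = n * (hxy * g3 - hxz * g2)" (is ?t1)
  "y * ayz - z * ayy = n * (hxz * g1 - hxx * g3)" (is ?t2)
  "y * azz - z * ayz = n * (hxx * g2 - hxy * g1)" (is ?t3)
  "z * axx - x * axz = n * (hyy * g3 - hyz * g2)" (is ?t4)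
  "z * axy - x * ayz = n * (hyz * g1 - hxy * g3)" (is ?t5)
  "z * axz - x * azz = n * (hxy * g2 - hyy * g1)" (is ?t6)
  "x * axy - y * axx = n * (hyz * g3 - hzz * g2)" (is ?t7)
  "x * ayy - y * axy = n * (hzz * g1 - hxz * g3)" (is ?t8)
  "x * ayz - y * axz = n * (hxz * g2 - hyz * g1)" (is ?t9)
proof -
  have n: "n * (a * g1 - b * g2) = a * (hess1 x y z) - b * (hess2 x y z)"
    "n * (a * g2 - b * g1) = a * (hess2 x y z) - b * (hess1 x y z)"
    "n * (a * g1 - b * g3) = a * (hess1 x y z) - b * (hess3 x y z)"
    "n * (a * g3 - b * g2) = a * (hess3 x y z) - b * (hess2 x y z)" for a b
    unfolding euler1 euler2 euler3 by Groebner_Basis.algebra+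
  show ?t1 ?t2 ?t3 ?t4 ?t5 ?t6 ?t7 ?t8 ?t9
    unfolding n adjugate_defs by Groebner_Basis.algebra+
qed

text \<open>Here \<open>A g = A \<Delta> x / (d - 1)\<close>, and \<open>A \<Delta>\<close> is the determinant
  times the identity.\<close>

lemma adjugate_gradient:
  "(adj1 g1 g2 g3) = e * hdet * x"
  "(adj2 g1 g2 g3) = e * hdet * y"
  "(adj3 g1 g2 g3) = e * hdet * z"
  unfolding gradient_eq hdet_def adjugate_defs by Groebner_Basis.algebra+

text \<open>This is the second Euler formula \<open>x\<^sup>T \<Delta> x = d (d - 1) f\<close>.\<close>

lemma hessian_quadratic_form: "d * n * f = xdot (hess1 x y z) (hess2 x y z) (hess3 x y z)"
  unfolding euler1 euler2 euler3
  by (rule lin1[OF euler[symmetric], where c = n]) Groebner_Basis.algebra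

lemma degree_nonzero: "d \<noteq> 0"
  using di by auto

lemma variables_annihilator: "f dvd x * c \<Longrightarrow> f dvd y * c \<Longrightarrow> f dvd z * c \<Longrightarrow> f dvd c"
  using koszul2_annihilator[OF kx2 f0] x0 by blast

lemma gradient_annihilator: "f dvd g1 * c \<Longrightarrow> f dvd g2 * c \<Longrightarrow> f dvd g3 * c \<Longrightarrow> f dvd c"
proof -
  have "g1 \<noteq> 0 \<or> g2 \<noteq> 0 \<or> g3 \<noteq> 0"
    using euler degree_nonzero f0 by auto
  then show "f dvd g1 * c \<Longrightarrow> f dvd g2 * c \<Longrightarrow> f dvd g3 * c \<Longrightarrow> f dvd c"
    using koszul2_annihilator[OF kg2 f0] by blast
qed

lemma half_dvd: "f dvd 2 * c \<Longrightarrow> f dvd c"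
  using hf by (metis dvd_mult mult.assoc mult.commute mult_1)

text \<open>After subtracting the multiple of the Euler vector that has the same product with \<open>g\<close>,
  the vector is orthogonal to \<open>g\<close> over \<open>Q\<close>, so Koszul exactness applies.\<close>

lemma gradient_kernel_mod_f:
  assumes "f dvd dotg v1 v2 v3"
  obtains h w1 w2 w3 where "v1 = h * x + (g2 * w3 - g3 * w2)" "v2 = h * y + (g3 * w1 - g1 * w3)"
    "v3 = h * z + (g1 * w2 - g2 * w1)"
proof -
  obtain c where c: "dotg v1 v2 v3 = f * c" using assms by (rule dvdE)
  have "dotg (v1 - di * c * x) (v2 - di * c * y) (v3 - di * c * z) = 0"
    by (rule lin3[OF c euler di, where c = 1 and c' = "- di * c" and c'' = "- f * c"]) Groebner_Basis.algebra
  with kg1 obtain w1 w2 w3 where w: "v1 - di * c * x = g2 * w3 - g3 * w2"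
    "v2 - di * c * y = g3 * w1 - g1 * w3" "v3 - di * c * z = g1 * w2 - g2 * w1"
    by (rule koszul1D)
  show thesis
    by (rule that[of "di * c" w3 w2 w1];
        rule lin1[OF w(1), where c = 1] lin1[OF w(2), where c = 1] lin1[OF w(3), where c = 1], Groebner_Basis.algebra)
qed

text \<open>Pairing the relation with \<open>g\<close> determines \<open>h\<close> as a combination of the
  quotients by \<open>f\<close>; what is left of \<open>w\<close> after subtracting the
  corresponding Koszul syzygy is parallel to \<open>g\<close>.\<close>

lemma gradient_kernel_relations:
  assumes "f dvd h * x + (g2 * w3 - g3 * w2)" "f dvd h * y + (g3 * w1 - g1 * w3)"
    "f dvd h * z + (g1 * w2 - g2 * w1)"
  obtains u1 u2 u3 t where "h = dotg u1 u2 u3"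
    "w1 = odd9 u2 u3 t" "w2 = odd10 u1 u3 t"
    "w3 = odd11 u1 u2 t"
proof -
  obtain k1 k2 k3 where k: "h * x + (g2 * w3 - g3 * w2) = f * k1"
    "h * y + (g3 * w1 - g1 * w3) = f * k2" "h * z + (g1 * w2 - g2 * w1) = f * k3"
    using assms by (auto elim!: dvdE)
  define u1 u2 u3 where u: "u1 = di * k1" "u2 = di * k2" "u3 = di * k3"
  have "f * (d * h) = f * (gdot k1 k2 k3)"
  proof -
    have "f * (gdot k1 k2 k3) = gdot (f * k1) (f * k2) (f * k3)"
      by Groebner_Basis.algebra
    also have "\<dots> = h * (xdot g1 g2 g3)" unfolding k[symmetric] by Groebner_Basis.algebra
    finally show ?thesis unfolding euler by Groebner_Basis.algebra
  qed
  then have dh: "d * h = gdot k1 k2 k3" using f0 by simp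
  have h: "h = dotg u1 u2 u3"
    unfolding u by (rule lin2[OF dh di, where c = di and c' = "- h"]) Groebner_Basis.algebra
  have fk: "f * k1 = d * f * u1" "f * k2 = d * f * u2" "f * k3 = d * f * u3"
    unfolding u by (rule lin1[OF di, where c = "- (f * k1)"], Groebner_Basis.algebra,
      rule lin1[OF di, where c = "- (f * k2)"], Groebner_Basis.algebra, rule lin1[OF di, where c = "- (f * k3)"], Groebner_Basis.algebra)
  \<comment> \<open>\<open>g \<times> (x \<times> u) = x (g \<cdot> u) - u (g \<cdot> x)\<close>\<close>
  have "g2 * (w3 + (x * u2 - y * u1)) = g3 * (w2 + (z * u1 - x * u3))"
    by (rule lin3[OF k(1)[unfolded fk] h euler, where c = 1 and c' = "- x" and c'' = "- u1"]) Groebner_Basis.algebra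
  moreover have "g3 * (w1 + (y * u3 - z * u2)) = g1 * (w3 + (x * u2 - y * u1))"
    by (rule lin3[OF k(2)[unfolded fk] h euler, where c = 1 and c' = "- y" and c'' = "- u2"]) Groebner_Basis.algebra
  moreover have "g1 * (w2 + (z * u1 - x * u3)) = g2 * (w1 + (y * u3 - z * u2))"
    by (rule lin3[OF k(3)[unfolded fk] h euler, where c = 1 and c' = "- z" and c'' = "- u3"]) Groebner_Basis.algebra
  ultimately obtain t where t: "w1 + (y * u3 - z * u2) = t * g1" "w2 + (z * u1 - x * u3) = t * g2"
    "w3 + (x * u2 - y * u1) = t * g3"
    by (rule koszul2D[OF kg2])
  show thesis
    by (rule that[OF h, of t];
        rule lin1[OF t(1), where c = 1] lin1[OF t(2), where c = 1] lin1[OF t(3), where c = 1], Groebner_Basis.algebra)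
qed

text \<open>The entries of the symmetric matrix
  \<open>2 r x x\<^sup>T + x (g \<times> p)\<^sup>T + (g \<times> p) x\<^sup>T + 2 e\<^sup>2 (x (A w)\<^sup>T + (A w) x\<^sup>T - (x \<cdot> w) A)\<close>, which is the second order symbol
  of the combination of generators with parameters \<open>r, p, w\<close>.\<close>

definition nxx :: "'a \<Rightarrow> 'a \<Rightarrow> 'a \<Rightarrow> 'a \<Rightarrow> 'a \<Rightarrow> 'a \<Rightarrow> 'a \<Rightarrow> 'a" where
  "nxx r p1 p2 p3 w1 w2 w3 =
     2 * r * x * x + (x * (g2 * p3 - g3 * p2) + x * (g2 * p3 - g3 * p2))
     + 2 * e^2 * (x * (axx * w1 + axy * w2 + axz * w3) + x * (axx * w1 + axy * w2 + axz * w3) - (x * w1 + y * w2 + z * w3) * axx)"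
definition nxy :: "'a \<Rightarrow> 'a \<Rightarrow> 'a \<Rightarrow> 'a \<Rightarrow> 'a \<Rightarrow> 'a \<Rightarrow> 'a \<Rightarrow> 'a" where
  "nxy r p1 p2 p3 w1 w2 w3 =
     2 * r * x * y + (x * (g3 * p1 - g1 * p3) + y * (g2 * p3 - g3 * p2))
     + 2 * e^2 * (x * (axy * w1 + ayy * w2 + ayz * w3) + y * (axx * w1 + axy * w2 + axz * w3) - (x * w1 + y * w2 + z * w3) * axy)"
definition nxz :: "'a \<Rightarrow> 'a \<Rightarrow> 'a \<Rightarrow> 'a \<Rightarrow> 'a \<Rightarrow> 'a \<Rightarrow> 'a \<Rightarrow> 'a" where
  "nxz r p1 p2 p3 w1 w2 w3 =
     2 * r * x * z + (x * (g1 * p2 - g2 * p1) + z * (g2 * p3 - g3 * p2))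
     + 2 * e^2 * (x * (axz * w1 + ayz * w2 + azz * w3) + z * (axx * w1 + axy * w2 + axz * w3) - (x * w1 + y * w2 + z * w3) * axz)"
definition nyy :: "'a \<Rightarrow> 'a \<Rightarrow> 'a \<Rightarrow> 'a \<Rightarrow> 'a \<Rightarrow> 'a \<Rightarrow> 'a \<Rightarrow> 'a" where
  "nyy r p1 p2 p3 w1 w2 w3 =
     2 * r * y * y + (y * (g3 * p1 - g1 * p3) + y * (g3 * p1 - g1 * p3))
     + 2 * e^2 * (y * (axy * w1 + ayy * w2 + ayz * w3) + y * (axy * w1 + ayy * w2 + ayz * w3) - (x * w1 + y * w2 + z * w3) * ayy)"
definition nyz :: "'a \<Rightarrow> 'a \<Rightarrow> 'a \<Rightarrow> 'a \<Rightarrow> 'a \<Rightarrow> 'a \<Rightarrow> 'a \<Rightarrow> 'a" where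
  "nyz r p1 p2 p3 w1 w2 w3 =
     2 * r * y * z + (y * (g1 * p2 - g2 * p1) + z * (g3 * p1 - g1 * p3))
     + 2 * e^2 * (y * (axz * w1 + ayz * w2 + azz * w3) + z * (axy * w1 + ayy * w2 + ayz * w3) - (x * w1 + y * w2 + z * w3) * ayz)"
definition nzz :: "'a \<Rightarrow> 'a \<Rightarrow> 'a \<Rightarrow> 'a \<Rightarrow> 'a \<Rightarrow> 'a \<Rightarrow> 'a \<Rightarrow> 'a" where
  "nzz r p1 p2 p3 w1 w2 w3 =
     2 * r * z * z + (z * (g1 * p2 - g2 * p1) + z * (g1 * p2 - g2 * p1))
     + 2 * e^2 * (z * (axz * w1 + ayz * w2 + azz * w3) + z * (axz * w1 + ayz * w2 + azz * w3) - (x * w1 + y * w2 + z * w3) * azz)"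

lemmas symbol_defs = nxx_def nxy_def nxz_def nyy_def nyz_def nzz_def

text \<open>The congruence transform of \<open>A\<close> by the skew matrix \<open>[x]\<close> is \<open>[x] A
  [x]\<^sup>T = d (d - 1) f \<Delta> - (d - 1)\<^sup>2 g g\<^sup>T\<close>.\<close>

lemma adjugate_congruence:
  "xcongxx ayy ayz azz
     = d * n * f * hxx - n^2 * g1 * g1" (is ?t1)
  "xcongxy axy axz ayz azz
     = d * n * f * hxy - n^2 * g1 * g2" (is ?t2)
  "xcongxz axy axz ayy ayz
     = d * n * f * hxz - n^2 * g1 * g3" (is ?t3)
  "xcongyy axx axz azz
     = d * n * f * hyy - n^2 * g2 * g2" (is ?t4)
  "xcongyz axx axy axz ayz
     = d * n * f * hyz - n^2 * g2 * g3" (is ?t5)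
  "xcongzz axx axy ayy
     = d * n * f * hzz - n^2 * g3 * g3" (is ?t6)
proof -
  have n: "n^2 * a * b = (n * a) * (n * b)" for a b by Groebner_Basis.algebra
  show ?t1 ?t2 ?t3 ?t4 ?t5 ?t6
    unfolding hessian_quadratic_form n euler1[symmetric] euler2[symmetric] euler3[symmetric] adjugate_defs by Groebner_Basis.algebra+
qed

text \<open>The congruence by \<open>[x]\<close> annihilates every part of a symbol that contains a factor
  \<open>x\<close>, so only the term with \<open>A\<close> survives, and \<open>adjugate_congruence\<close>
  evaluates it.\<close>

lemma symbol_congruence:
  "xcongxx (nyy r p1 p2 p3 w1 w2 w3) (nyz r p1 p2 p3 w1 w2 w3) (nzz r p1 p2 p3 w1 w2 w3)
     = 2 * (g1 * (g1 * (xdot w1 w2 w3))) - f * (2 * e * d * (xdot w1 w2 w3) * hxx)" (is ?t1)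
  "xcongxy (nxy r p1 p2 p3 w1 w2 w3) (nxz r p1 p2 p3 w1 w2 w3) (nyz r p1 p2 p3 w1 w2 w3) (nzz r p1 p2 p3 w1 w2 w3)
     = 2 * (g1 * (g2 * (xdot w1 w2 w3))) - f * (2 * e * d * (xdot w1 w2 w3) * hxy)" (is ?t2)
  "xcongxz (nxy r p1 p2 p3 w1 w2 w3) (nxz r p1 p2 p3 w1 w2 w3) (nyy r p1 p2 p3 w1 w2 w3) (nyz r p1 p2 p3 w1 w2 w3)
     = 2 * (g1 * (g3 * (xdot w1 w2 w3))) - f * (2 * e * d * (xdot w1 w2 w3) * hxz)" (is ?t3)
  "xcongyy (nxx r p1 p2 p3 w1 w2 w3) (nxz r p1 p2 p3 w1 w2 w3) (nzz r p1 p2 p3 w1 w2 w3)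
     = 2 * (g2 * (g2 * (xdot w1 w2 w3))) - f * (2 * e * d * (xdot w1 w2 w3) * hyy)" (is ?t4)
  "xcongyz (nxx r p1 p2 p3 w1 w2 w3) (nxy r p1 p2 p3 w1 w2 w3) (nxz r p1 p2 p3 w1 w2 w3) (nyz r p1 p2 p3 w1 w2 w3)
     = 2 * (g2 * (g3 * (xdot w1 w2 w3))) - f * (2 * e * d * (xdot w1 w2 w3) * hyz)" (is ?t5)
  "xcongzz (nxx r p1 p2 p3 w1 w2 w3) (nxy r p1 p2 p3 w1 w2 w3) (nyy r p1 p2 p3 w1 w2 w3)
     = 2 * (g3 * (g3 * (xdot w1 w2 w3))) - f * (2 * e * d * (xdot w1 w2 w3) * hzz)" (is ?t6)
proof -
  have en: "2 * (a * (a' * t)) - f * (2 * e * d * t * b) = - 2 * e^2 * t * (d * n * f * b - n^2 * a * a')" for t b a a'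
    by (rule lin2[OF e e, where c = "- 2 * (e * n + 1) * t * a * a'" and c' = "2 * e * t * d * f * b"]) Groebner_Basis.algebra
  show ?t1 ?t2 ?t3 ?t4 ?t5 ?t6
    unfolding symbol_defs en adjugate_congruence[symmetric] by Groebner_Basis.algebra+
qed

text \<open>Parameters \<open>w = s g - x \<times> v\<close> can be absorbed, up to a multiple of
  \<open>f\<close>, in \<open>r\<close> and \<open>p\<close>, because \<open>A [x] = (d - 1) [g]
  \<Delta>\<close> and \<open>A g\<close> is proportional to \<open>x\<close>.\<close>

lemma symbol_shift:
  assumes w: "w1 = odd9 v2 v3 s" "w2 = odd10 v1 v3 s" "w3 = odd11 v1 v2 s"
  shows
  "nxx r p1 p2 p3 w1 w2 w3 = nxx (r + 2 * e^3 * hdet * s) (p1 - 2 * e * (hess1 v1 v2 v3)) (p2 - 2 * e * (hess2 v1 v2 v3)) (p3 - 2 * e * (hess3 v1 v2 v3)) 0 0 0 - f * (2 * e^2 * s * d * axx)" (is ?t1)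
  "nxy r p1 p2 p3 w1 w2 w3 = nxy (r + 2 * e^3 * hdet * s) (p1 - 2 * e * (hess1 v1 v2 v3)) (p2 - 2 * e * (hess2 v1 v2 v3)) (p3 - 2 * e * (hess3 v1 v2 v3)) 0 0 0 - f * (2 * e^2 * s * d * axy)" (is ?t2)
  "nxz r p1 p2 p3 w1 w2 w3 = nxz (r + 2 * e^3 * hdet * s) (p1 - 2 * e * (hess1 v1 v2 v3)) (p2 - 2 * e * (hess2 v1 v2 v3)) (p3 - 2 * e * (hess3 v1 v2 v3)) 0 0 0 - f * (2 * e^2 * s * d * axz)" (is ?t3)
  "nyy r p1 p2 p3 w1 w2 w3 = nyy (r + 2 * e^3 * hdet * s) (p1 - 2 * e * (hess1 v1 v2 v3)) (p2 - 2 * e * (hess2 v1 v2 v3)) (p3 - 2 * e * (hess3 v1 v2 v3)) 0 0 0 - f * (2 * e^2 * s * d * ayy)" (is ?t4)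
  "nyz r p1 p2 p3 w1 w2 w3 = nyz (r + 2 * e^3 * hdet * s) (p1 - 2 * e * (hess1 v1 v2 v3)) (p2 - 2 * e * (hess2 v1 v2 v3)) (p3 - 2 * e * (hess3 v1 v2 v3)) 0 0 0 - f * (2 * e^2 * s * d * ayz)" (is ?t5)
  "nzz r p1 p2 p3 w1 w2 w3 = nzz (r + 2 * e^3 * hdet * s) (p1 - 2 * e * (hess1 v1 v2 v3)) (p2 - 2 * e * (hess2 v1 v2 v3)) (p3 - 2 * e * (hess3 v1 v2 v3)) 0 0 0 - f * (2 * e^2 * s * d * azz)" (is ?t6)
proof -
  have a1: "(adj1 w1 w2 w3) = - (n * (g2 * (hess3 v1 v2 v3) - g3 * (hess2 v1 v2 v3))) + e * hdet * s * x"
    unfolding w by (rule lin4[OF adjugate_gradient(1) adjugate_cross(1) adjugate_cross(4) adjugate_cross(7), where c = s and c' = v1 and c'' = v2 and k = v3]) Groebner_Basis.algebra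
  have a2: "(adj2 w1 w2 w3) = - (n * (g3 * (hess1 v1 v2 v3) - g1 * (hess3 v1 v2 v3))) + e * hdet * s * y"
    unfolding w by (rule lin4[OF adjugate_gradient(2) adjugate_cross(2) adjugate_cross(5) adjugate_cross(8), where c = s and c' = v1 and c'' = v2 and k = v3]) Groebner_Basis.algebra
  have a3: "(adj3 w1 w2 w3) = - (n * (g1 * (hess2 v1 v2 v3) - g2 * (hess1 v1 v2 v3))) + e * hdet * s * z"
    unfolding w by (rule lin4[OF adjugate_gradient(3) adjugate_cross(3) adjugate_cross(6) adjugate_cross(9), where c = s and c' = v1 and c'' = v2 and k = v3]) Groebner_Basis.algebra
  have t: "(xdot w1 w2 w3) = s * (d * f)"
    unfolding w by (rule lin1[OF euler, where c = s]) Groebner_Basis.algebra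
  have en: "2 * e^2 * (a * (- (n * b) + k) + a' * (- (n * b') + k') - m) =
      2 * e^2 * (a * k + a' * k' - m) - 2 * e * (a * b + a' * b')" for a b k a' b' k' m
    by (rule lin1[OF e, where c = "- 2 * e * (a * b + a' * b')"]) Groebner_Basis.algebra
  show ?t1 ?t2 ?t3 ?t4 ?t5 ?t6
    unfolding symbol_defs a1 a2 a3 t en by Groebner_Basis.algebra+
qed

text \<open>For \<open>p = c g - x \<times> u\<close> the identity \<open>g \<times> (x \<times> u) = x (g
  \<cdot> u) - u (g \<cdot> x)\<close> together with Euler turns the symbol into a multiple of
  \<open>x x\<^sup>T\<close> modulo \<open>f\<close>.\<close>

lemma symbol_at_cross:
  assumes p: "p1 = odd9 u2 u3 c" "p2 = odd10 u1 u3 c" "p3 = odd11 u1 u2 c"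
  shows
  "nxx r p1 p2 p3 0 0 0 = 2 * (x * (x * (r - (dotg u1 u2 u3)))) + f * (d * (x * u1 + x * u1))" (is ?t1)
  "nxy r p1 p2 p3 0 0 0 = 2 * (x * (y * (r - (dotg u1 u2 u3)))) + f * (d * (x * u2 + y * u1))" (is ?t2)
  "nxz r p1 p2 p3 0 0 0 = 2 * (x * (z * (r - (dotg u1 u2 u3)))) + f * (d * (x * u3 + z * u1))" (is ?t3)
  "nyy r p1 p2 p3 0 0 0 = 2 * (y * (y * (r - (dotg u1 u2 u3)))) + f * (d * (y * u2 + y * u2))" (is ?t4)
  "nyz r p1 p2 p3 0 0 0 = 2 * (y * (z * (r - (dotg u1 u2 u3)))) + f * (d * (y * u3 + z * u2))" (is ?t5)
  "nzz r p1 p2 p3 0 0 0 = 2 * (z * (z * (r - (dotg u1 u2 u3)))) + f * (d * (z * u3 + z * u3))" (is ?t6)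
proof -
  have g1: "(g2 * p3 - g3 * p2) = d * f * u1 - x * (dotg u1 u2 u3)"
    unfolding p by (rule lin1[OF euler, where c = u1]) Groebner_Basis.algebra
  have g2: "(g3 * p1 - g1 * p3) = d * f * u2 - y * (dotg u1 u2 u3)"
    unfolding p by (rule lin1[OF euler, where c = u2]) Groebner_Basis.algebra
  have g3: "(g1 * p2 - g2 * p1) = d * f * u3 - z * (dotg u1 u2 u3)"
    unfolding p by (rule lin1[OF euler, where c = u3]) Groebner_Basis.algebra
  show ?t1 ?t2 ?t3 ?t4 ?t5 ?t6
    unfolding symbol_defs g1 g2 g3 by Groebner_Basis.algebra+
qed

text \<open>A symbol that vanishes modulo \<open>f\<close> is peeled from right to left. Its congruence by
  \<open>[x]\<close> gives \<open>f\<close> dividing \<open>(x \<cdot> w) g g\<^sup>T\<close>, hence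
  \<open>x \<cdot> w\<close>, so \<open>w\<close> is a Koszul vector and can be shifted away;
  crossing the rest with \<open>x\<close> gives the same for \<open>p\<close>; finally
  \<open>r\<close> is determined.\<close>

lemma symbol_relations:
  assumes "f dvd nxx r p1 p2 p3 w1 w2 w3" "f dvd nxy r p1 p2 p3 w1 w2 w3" "f dvd nxz r p1 p2 p3 w1 w2 w3" "f dvd nyy r p1 p2 p3 w1 w2 w3" "f dvd nyz r p1 p2 p3 w1 w2 w3" "f dvd nzz r p1 p2 p3 w1 w2 w3"
  obtains u1 u2 u3 v1 v2 v3 s where "f dvd r - (u1 * g1 + u2 * g2 + u3 * g3 - 2 * e^3 * hdet * s)"
    "p1 = odd6 u2 u3 v1 v2 v3"
    "p2 = odd7 u1 u3 v1 v2 v3"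
    "p3 = odd8 u1 u2 v1 v2 v3"
    "w1 = odd9 v2 v3 s"
    "w2 = odd10 v1 v3 s"
    "w3 = odd11 v1 v2 s"
proof -
  have "f dvd xcongxx (nyy r p1 p2 p3 w1 w2 w3) (nyz r p1 p2 p3 w1 w2 w3) (nzz r p1 p2 p3 w1 w2 w3)"
    using assms by (intro dvd_add dvd_mult)
  then have "f dvd 2 * (g1 * (g1 * (xdot w1 w2 w3)))"
    unfolding symbol_congruence by (simp only: dvd_diff_left_iff dvd_triv_left)
  then have g1g1: "f dvd g1 * (g1 * (xdot w1 w2 w3))" by (rule half_dvd)
  have "f dvd xcongxy (nxy r p1 p2 p3 w1 w2 w3) (nxz r p1 p2 p3 w1 w2 w3) (nyz r p1 p2 p3 w1 w2 w3) (nzz r p1 p2 p3 w1 w2 w3)"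
    using assms by (intro dvd_add dvd_mult)
  then have "f dvd 2 * (g1 * (g2 * (xdot w1 w2 w3)))"
    unfolding symbol_congruence by (simp only: dvd_diff_left_iff dvd_triv_left)
  then have g1g2: "f dvd g1 * (g2 * (xdot w1 w2 w3))" by (rule half_dvd)
  have "f dvd xcongxz (nxy r p1 p2 p3 w1 w2 w3) (nxz r p1 p2 p3 w1 w2 w3) (nyy r p1 p2 p3 w1 w2 w3) (nyz r p1 p2 p3 w1 w2 w3)"
    using assms by (intro dvd_add dvd_mult)
  then have "f dvd 2 * (g1 * (g3 * (xdot w1 w2 w3)))"
    unfolding symbol_congruence by (simp only: dvd_diff_left_iff dvd_triv_left)
  then have g1g3: "f dvd g1 * (g3 * (xdot w1 w2 w3))" by (rule half_dvd)
  have "f dvd xcongyy (nxx r p1 p2 p3 w1 w2 w3) (nxz r p1 p2 p3 w1 w2 w3) (nzz r p1 p2 p3 w1 w2 w3)"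
    using assms by (intro dvd_add dvd_mult)
  then have "f dvd 2 * (g2 * (g2 * (xdot w1 w2 w3)))"
    unfolding symbol_congruence by (simp only: dvd_diff_left_iff dvd_triv_left)
  then have g2g2: "f dvd g2 * (g2 * (xdot w1 w2 w3))" by (rule half_dvd)
  have "f dvd xcongyz (nxx r p1 p2 p3 w1 w2 w3) (nxy r p1 p2 p3 w1 w2 w3) (nxz r p1 p2 p3 w1 w2 w3) (nyz r p1 p2 p3 w1 w2 w3)"
    using assms by (intro dvd_add dvd_mult)
  then have "f dvd 2 * (g2 * (g3 * (xdot w1 w2 w3)))"
    unfolding symbol_congruence by (simp only: dvd_diff_left_iff dvd_triv_left)
  then have g2g3: "f dvd g2 * (g3 * (xdot w1 w2 w3))" by (rule half_dvd)
  have "f dvd xcongzz (nxx r p1 p2 p3 w1 w2 w3) (nxy r p1 p2 p3 w1 w2 w3) (nyy r p1 p2 p3 w1 w2 w3)"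
    using assms by (intro dvd_add dvd_mult)
  then have "f dvd 2 * (g3 * (g3 * (xdot w1 w2 w3)))"
    unfolding symbol_congruence by (simp only: dvd_diff_left_iff dvd_triv_left)
  then have g3g3: "f dvd g3 * (g3 * (xdot w1 w2 w3))" by (rule half_dvd)
  have "f dvd (xdot w1 w2 w3)"
    by (rule gradient_annihilator; rule gradient_annihilator; fact g1g1 g1g2 g1g3 g1g2[unfolded mult.left_commute[of g1 g2]] g2g2 g2g3 g1g3[unfolded mult.left_commute[of g1 g3]] g2g3[unfolded mult.left_commute[of g2 g3]] g3g3)
  then obtain c where c: "(xdot w1 w2 w3) = f * c" by (rule dvdE)
  define s where "s = di * c"
  have "dotx (w1 - s * g1) (w2 - s * g2) (w3 - s * g3) = 0"
    unfolding s_def by (rule lin3[OF c euler di, where c = 1 and c' = "- di * c" and c'' = "- f * c"]) Groebner_Basis.algebra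
  with kx1 obtain b1 b2 b3 where b: "w1 - s * g1 = y * b3 - z * b2" "w2 - s * g2 = z * b1 - x * b3"
      "w3 - s * g3 = x * b2 - y * b1"
    by (rule koszul1D)
  have w: "w1 = - (y * - b3 - z * - b2) + s * g1" "w2 = - (z * - b1 - x * - b3) + s * g2" "w3 = - (x * - b2 - y * - b1) + s * g3"
    by (rule lin1[OF b(1), where c = 1], Groebner_Basis.algebra, rule lin1[OF b(2), where c = 1], Groebner_Basis.algebra,
        rule lin1[OF b(3), where c = 1], Groebner_Basis.algebra)
  define ro where "ro = (r + 2 * e^3 * hdet * s)"
  define q1 where "q1 = p1 - 2 * e * (hxx * - b1 + hxy * - b2 + hxz * - b3)"
  define q2 where "q2 = p2 - 2 * e * (hxy * - b1 + hyy * - b2 + hyz * - b3)"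
  define q3 where "q3 = p3 - 2 * e * (hxz * - b1 + hyz * - b2 + hzz * - b3)"
  have mxx: "f dvd nxx ro q1 q2 q3 0 0 0"
    using assms(1) unfolding symbol_shift(1)[OF w] ro_def q1_def q2_def q3_def by (simp only: dvd_diff_left_iff dvd_triv_left)
  have mxy: "f dvd nxy ro q1 q2 q3 0 0 0"
    using assms(2) unfolding symbol_shift(2)[OF w] ro_def q1_def q2_def q3_def by (simp only: dvd_diff_left_iff dvd_triv_left)
  have mxz: "f dvd nxz ro q1 q2 q3 0 0 0"
    using assms(3) unfolding symbol_shift(3)[OF w] ro_def q1_def q2_def q3_def by (simp only: dvd_diff_left_iff dvd_triv_left)
  have myy: "f dvd nyy ro q1 q2 q3 0 0 0"
    using assms(4) unfolding symbol_shift(4)[OF w] ro_def q1_def q2_def q3_def by (simp only: dvd_diff_left_iff dvd_triv_left)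
  have myz: "f dvd nyz ro q1 q2 q3 0 0 0"
    using assms(5) unfolding symbol_shift(5)[OF w] ro_def q1_def q2_def q3_def by (simp only: dvd_diff_left_iff dvd_triv_left)
  have mzz: "f dvd nzz ro q1 q2 q3 0 0 0"
    using assms(6) unfolding symbol_shift(6)[OF w] ro_def q1_def q2_def q3_def by (simp only: dvd_diff_left_iff dvd_triv_left)
  have e: "y * (nxz ro q1 q2 q3 0 0 0) - z * (nxy ro q1 q2 q3 0 0 0) = x * (y * (g1 * q2 - g2 * q1) - z * (g3 * q1 - g1 * q3))"
    unfolding symbol_defs by Groebner_Basis.algebra
  have c1: "f dvd x * (y * (g1 * q2 - g2 * q1) - z * (g3 * q1 - g1 * q3))"
    unfolding e[symmetric] using mxy mxz by (intro dvd_diff dvd_mult)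
  have e: "y * (nyz ro q1 q2 q3 0 0 0) - z * (nyy ro q1 q2 q3 0 0 0) = y * (y * (g1 * q2 - g2 * q1) - z * (g3 * q1 - g1 * q3))"
    unfolding symbol_defs by Groebner_Basis.algebra
  have c2: "f dvd y * (y * (g1 * q2 - g2 * q1) - z * (g3 * q1 - g1 * q3))"
    unfolding e[symmetric] using myy myz by (intro dvd_diff dvd_mult)
  have e: "y * (nzz ro q1 q2 q3 0 0 0) - z * (nyz ro q1 q2 q3 0 0 0) = z * (y * (g1 * q2 - g2 * q1) - z * (g3 * q1 - g1 * q3))"
    unfolding symbol_defs by Groebner_Basis.algebra
  have c3: "f dvd z * (y * (g1 * q2 - g2 * q1) - z * (g3 * q1 - g1 * q3))"
    unfolding e[symmetric] using myz mzz by (intro dvd_diff dvd_mult)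
  have e: "(y * (g1 * q2 - g2 * q1) - z * (g3 * q1 - g1 * q3)) = g1 * (xdot q1 q2 q3) - f * (d * q1)"
    by (rule lin1[OF euler, where c = "- q1"]) Groebner_Basis.algebra
  from variables_annihilator[OF c1 c2 c3] have xq1: "f dvd g1 * (xdot q1 q2 q3)" unfolding e by (simp only: dvd_diff_left_iff dvd_triv_left)
  have e: "z * (nxx ro q1 q2 q3 0 0 0) - x * (nxz ro q1 q2 q3 0 0 0) = x * (z * (g2 * q3 - g3 * q2) - x * (g1 * q2 - g2 * q1))"
    unfolding symbol_defs by Groebner_Basis.algebra
  have c1: "f dvd x * (z * (g2 * q3 - g3 * q2) - x * (g1 * q2 - g2 * q1))"
    unfolding e[symmetric] using mxz mxx by (intro dvd_diff dvd_mult)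
  have e: "z * (nxy ro q1 q2 q3 0 0 0) - x * (nyz ro q1 q2 q3 0 0 0) = y * (z * (g2 * q3 - g3 * q2) - x * (g1 * q2 - g2 * q1))"
    unfolding symbol_defs by Groebner_Basis.algebra
  have c2: "f dvd y * (z * (g2 * q3 - g3 * q2) - x * (g1 * q2 - g2 * q1))"
    unfolding e[symmetric] using myz mxy by (intro dvd_diff dvd_mult)
  have e: "z * (nxz ro q1 q2 q3 0 0 0) - x * (nzz ro q1 q2 q3 0 0 0) = z * (z * (g2 * q3 - g3 * q2) - x * (g1 * q2 - g2 * q1))"
    unfolding symbol_defs by Groebner_Basis.algebra
  have c3: "f dvd z * (z * (g2 * q3 - g3 * q2) - x * (g1 * q2 - g2 * q1))"
    unfolding e[symmetric] using mzz mxz by (intro dvd_diff dvd_mult)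
  have e: "(z * (g2 * q3 - g3 * q2) - x * (g1 * q2 - g2 * q1)) = g2 * (xdot q1 q2 q3) - f * (d * q2)"
    by (rule lin1[OF euler, where c = "- q2"]) Groebner_Basis.algebra
  from variables_annihilator[OF c1 c2 c3] have xq2: "f dvd g2 * (xdot q1 q2 q3)" unfolding e by (simp only: dvd_diff_left_iff dvd_triv_left)
  have e: "x * (nxy ro q1 q2 q3 0 0 0) - y * (nxx ro q1 q2 q3 0 0 0) = x * (x * (g3 * q1 - g1 * q3) - y * (g2 * q3 - g3 * q2))"
    unfolding symbol_defs by Groebner_Basis.algebra
  have c1: "f dvd x * (x * (g3 * q1 - g1 * q3) - y * (g2 * q3 - g3 * q2))"
    unfolding e[symmetric] using mxx mxy by (intro dvd_diff dvd_mult)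
  have e: "x * (nyy ro q1 q2 q3 0 0 0) - y * (nxy ro q1 q2 q3 0 0 0) = y * (x * (g3 * q1 - g1 * q3) - y * (g2 * q3 - g3 * q2))"
    unfolding symbol_defs by Groebner_Basis.algebra
  have c2: "f dvd y * (x * (g3 * q1 - g1 * q3) - y * (g2 * q3 - g3 * q2))"
    unfolding e[symmetric] using mxy myy by (intro dvd_diff dvd_mult)
  have e: "x * (nyz ro q1 q2 q3 0 0 0) - y * (nxz ro q1 q2 q3 0 0 0) = z * (x * (g3 * q1 - g1 * q3) - y * (g2 * q3 - g3 * q2))"
    unfolding symbol_defs by Groebner_Basis.algebra
  have c3: "f dvd z * (x * (g3 * q1 - g1 * q3) - y * (g2 * q3 - g3 * q2))"
    unfolding e[symmetric] using mxz myz by (intro dvd_diff dvd_mult)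
  have e: "(x * (g3 * q1 - g1 * q3) - y * (g2 * q3 - g3 * q2)) = g3 * (xdot q1 q2 q3) - f * (d * q3)"
    by (rule lin1[OF euler, where c = "- q3"]) Groebner_Basis.algebra
  from variables_annihilator[OF c1 c2 c3] have xq3: "f dvd g3 * (xdot q1 q2 q3)" unfolding e by (simp only: dvd_diff_left_iff dvd_triv_left)
  from xq1 xq2 xq3 have "f dvd (xdot q1 q2 q3)" by (rule gradient_annihilator)
  then obtain k where k: "(xdot q1 q2 q3) = f * k" by (rule dvdE)
  define t where "t = di * k"
  have "dotx (q1 - t * g1) (q2 - t * g2) (q3 - t * g3) = 0"
    unfolding t_def by (rule lin3[OF k euler di, where c = 1 and c' = "- di * k" and c'' = "- f * k"]) Groebner_Basis.algebra
  with kx1 obtain l1 l2 l3 where l: "q1 - t * g1 = y * l3 - z * l2" "q2 - t * g2 = z * l1 - x * l3"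
      "q3 - t * g3 = x * l2 - y * l1"
    by (rule koszul1D)
  have q: "q1 = - (y * - l3 - z * - l2) + t * g1" "q2 = - (z * - l1 - x * - l3) + t * g2" "q3 = - (x * - l2 - y * - l1) + t * g3"
    by (rule lin1[OF l(1), where c = 1], Groebner_Basis.algebra, rule lin1[OF l(2), where c = 1], Groebner_Basis.algebra,
        rule lin1[OF l(3), where c = 1], Groebner_Basis.algebra)
  have "f dvd 2 * (x * (x * (ro - (- l1 * g1 + - l2 * g2 + - l3 * g3))))"
    using mxx unfolding symbol_at_cross(1)[OF q] by (simp only: dvd_add_left_iff dvd_triv_left)
  then have xx: "f dvd x * (x * (ro - (- l1 * g1 + - l2 * g2 + - l3 * g3)))" by (rule half_dvd)
  have "f dvd 2 * (x * (y * (ro - (- l1 * g1 + - l2 * g2 + - l3 * g3))))"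
    using mxy unfolding symbol_at_cross(2)[OF q] by (simp only: dvd_add_left_iff dvd_triv_left)
  then have xy: "f dvd x * (y * (ro - (- l1 * g1 + - l2 * g2 + - l3 * g3)))" by (rule half_dvd)
  have "f dvd 2 * (x * (z * (ro - (- l1 * g1 + - l2 * g2 + - l3 * g3))))"
    using mxz unfolding symbol_at_cross(3)[OF q] by (simp only: dvd_add_left_iff dvd_triv_left)
  then have xz: "f dvd x * (z * (ro - (- l1 * g1 + - l2 * g2 + - l3 * g3)))" by (rule half_dvd)
  have "f dvd 2 * (y * (y * (ro - (- l1 * g1 + - l2 * g2 + - l3 * g3))))"
    using myy unfolding symbol_at_cross(4)[OF q] by (simp only: dvd_add_left_iff dvd_triv_left)
  then have yy: "f dvd y * (y * (ro - (- l1 * g1 + - l2 * g2 + - l3 * g3)))" by (rule half_dvd)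
  have "f dvd 2 * (y * (z * (ro - (- l1 * g1 + - l2 * g2 + - l3 * g3))))"
    using myz unfolding symbol_at_cross(5)[OF q] by (simp only: dvd_add_left_iff dvd_triv_left)
  then have yz: "f dvd y * (z * (ro - (- l1 * g1 + - l2 * g2 + - l3 * g3)))" by (rule half_dvd)
  have "f dvd 2 * (z * (z * (ro - (- l1 * g1 + - l2 * g2 + - l3 * g3))))"
    using mzz unfolding symbol_at_cross(6)[OF q] by (simp only: dvd_add_left_iff dvd_triv_left)
  then have zz: "f dvd z * (z * (ro - (- l1 * g1 + - l2 * g2 + - l3 * g3)))" by (rule half_dvd)
  have "f dvd (ro - (- l1 * g1 + - l2 * g2 + - l3 * g3))"
    by (rule variables_annihilator; rule variables_annihilator; fact xx xy xz xy[unfolded mult.left_commute[of x y]] yy yz xz[unfolded mult.left_commute[of x z]] yz[unfolded mult.left_commute[of y z]] zz)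
  moreover have "(ro - (- l1 * g1 + - l2 * g2 + - l3 * g3)) = r - ((- l1 * g1 + - l2 * g2 + - l3 * g3) - 2 * e^3 * hdet * s)"
    unfolding ro_def by Groebner_Basis.algebra
  ultimately have r: "f dvd r - (- l1 * g1 + - l2 * g2 + - l3 * g3 - 2 * e^3 * hdet * s)" by (simp only:)
  \<comment> \<open>The summand \<open>t g\<close> of \<open>q\<close> is \<open>2 e \<Delta> (t x / 2)\<close>, and adding a multiple of \<open>x\<close> to \<open>b\<close> keeps \<open>x \<times> b\<close>.\<close>
  show thesis
  proof (rule that[of "- l1" "- l2" "- l3" s "hf * t * x - b1" "hf * t * y - b2" "hf * t * z - b3"])
    show "f dvd r - (- l1 * g1 + - l2 * g2 + - l3 * g3 - 2 * e^3 * hdet * s)" by (rule r)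
    show "p1 = - (y * - l3 - z * - l2) + 2 * e * (hess1 (hf * t * x - b1) (hf * t * y - b2) (hf * t * z - b3))"
      by (rule lin3[OF q(1)[unfolded q1_def] gradient_eq(1) hf, where c = 1 and c' = t and c'' = "- e * t * (hess1 x y z)"]) Groebner_Basis.algebra
    show "p2 = - (z * - l1 - x * - l3) + 2 * e * (hess2 (hf * t * x - b1) (hf * t * y - b2) (hf * t * z - b3))"
      by (rule lin3[OF q(2)[unfolded q2_def] gradient_eq(2) hf, where c = 1 and c' = t and c'' = "- e * t * (hess2 x y z)"]) Groebner_Basis.algebra
    show "p3 = - (x * - l2 - y * - l1) + 2 * e * (hess3 (hf * t * x - b1) (hf * t * y - b2) (hf * t * z - b3))"
      by (rule lin3[OF q(3)[unfolded q3_def] gradient_eq(3) hf, where c = 1 and c' = t and c'' = "- e * t * (hess3 x y z)"]) Groebner_Basis.algebra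
    show "w1 = odd9 (hf * t * y - b2) (hf * t * z - b3) s"
      unfolding w(1) by Groebner_Basis.algebra
    show "w2 = odd10 (hf * t * x - b1) (hf * t * z - b3) s"
      unfolding w(2) by Groebner_Basis.algebra
    show "w3 = odd11 (hf * t * x - b1) (hf * t * y - b2) s"
      unfolding w(3) by Groebner_Basis.algebra
  qed
qed

text \<open>As \<open>g = \<Delta> x / (d - 1)\<close>, this is a polynomial identity in
  \<open>\<Delta>\<close>, \<open>T\<close> and \<open>x\<close>, quadratic in
  \<open>\<Delta>\<close>, with \<open>f\<close> expressed by the quadratic form of
  \<open>\<Delta>\<close>. Modulo \<open>f\<close> it writes \<open>[g] T [g]\<^sup>T\<close> as a
  symbol with \<open>r = - tr(A T) / (2 (d - 1)\<^sup>2)\<close>, \<open>p = 0\<close> and \<open>w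
  = T x / 2\<close>.\<close>

lemma polarised_adjugate:
  "(gcongxx t22 t23 t33) = polar nxx t11 t12 t13 t22 t23 t33 + f * (d * e * (hyy * t33 + hzz * t22 - hyz * t23 - hyz * t23))" (is ?t1)
  "(gcongxy t12 t13 t23 t33) = polar nxy t11 t12 t13 t22 t23 t33 + f * (d * e * (hyz * t13 + hxz * t23 - hxy * t33 - hzz * t12))" (is ?t2)
  "(gcongxz t12 t13 t22 t23) = polar nxz t11 t12 t13 t22 t23 t33 + f * (d * e * (hxy * t23 + hyz * t12 - hyy * t13 - hxz * t22))" (is ?t3)
  "(gcongyy t11 t13 t33) = polar nyy t11 t12 t13 t22 t23 t33 + f * (d * e * (hzz * t11 + hxx * t33 - hxz * t13 - hxz * t13))" (is ?t4)
  "(gcongyz t11 t12 t13 t23) = polar nyz t11 t12 t13 t22 t23 t33 + f * (d * e * (hxz * t12 + hxy * t13 - hyz * t11 - hxx * t23))" (is ?t5)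
  "(gcongzz t11 t12 t22) = polar nzz t11 t12 t13 t22 t23 t33 + f * (d * e * (hxx * t22 + hyy * t11 - hxy * t12 - hxy * t12))" (is ?t6)
proof -
  have fe: "f * (d * e * c) = e^2 * ((xdot (hess1 x y z) (hess2 x y z) (hess3 x y z)) * c)" for c
    unfolding hessian_quadratic_form[symmetric] by (rule lin1[OF e, where c = "- f * d * e * c"]) Groebner_Basis.algebra
  have tr: "b = a + q" if "a = p" "b = p + q" for a b p q
    using that by simp
  have e1: "polar nxx t11 t12 t13 t22 t23 t33 = e^2 * (x * (adj1 (dotx t11 t12 t13) (dotx t12 t22 t23) (dotx t13 t23 t33)) + x * (adj1 (dotx t11 t12 t13) (dotx t12 t22 t23) (dotx t13 t23 t33)) - (xdot (dotx t11 t12 t13) (dotx t12 t22 t23) (dotx t13 t23 t33)) * axx) - e^2 * ((adj_trace t11 t12 t13 t22 t23 t33) * x * x)" (is "_ = ?rhs")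
    unfolding symbol_defs by (rule lin1[OF hf, where c = "?rhs"]) Groebner_Basis.algebra
  have e2: "(gcongxx t22 t23 t33) = ?rhs + e^2 * ((xdot (hess1 x y z) (hess2 x y z) (hess3 x y z)) * (hyy * t33 + hzz * t22 - hyz * t23 - hyz * t23))"
    unfolding gradient_eq adjugate_defs by Groebner_Basis.algebra
  show ?t1
    unfolding fe by (rule tr[OF e1 e2])
  have e1: "polar nxy t11 t12 t13 t22 t23 t33 = e^2 * (x * (adj2 (dotx t11 t12 t13) (dotx t12 t22 t23) (dotx t13 t23 t33)) + y * (adj1 (dotx t11 t12 t13) (dotx t12 t22 t23) (dotx t13 t23 t33)) - (xdot (dotx t11 t12 t13) (dotx t12 t22 t23) (dotx t13 t23 t33)) * axy) - e^2 * ((adj_trace t11 t12 t13 t22 t23 t33) * x * y)" (is "_ = ?rhs")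
    unfolding symbol_defs by (rule lin1[OF hf, where c = "?rhs"]) Groebner_Basis.algebra
  have e2: "(gcongxy t12 t13 t23 t33) = ?rhs + e^2 * ((xdot (hess1 x y z) (hess2 x y z) (hess3 x y z)) * (hyz * t13 + hxz * t23 - hxy * t33 - hzz * t12))"
    unfolding gradient_eq adjugate_defs by Groebner_Basis.algebra
  show ?t2
    unfolding fe by (rule tr[OF e1 e2])
  have e1: "polar nxz t11 t12 t13 t22 t23 t33 = e^2 * (x * (adj3 (dotx t11 t12 t13) (dotx t12 t22 t23) (dotx t13 t23 t33)) + z * (adj1 (dotx t11 t12 t13) (dotx t12 t22 t23) (dotx t13 t23 t33)) - (xdot (dotx t11 t12 t13) (dotx t12 t22 t23) (dotx t13 t23 t33)) * axz) - e^2 * ((adj_trace t11 t12 t13 t22 t23 t33) * x * z)" (is "_ = ?rhs")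
    unfolding symbol_defs by (rule lin1[OF hf, where c = "?rhs"]) Groebner_Basis.algebra
  have e2: "(gcongxz t12 t13 t22 t23) = ?rhs + e^2 * ((xdot (hess1 x y z) (hess2 x y z) (hess3 x y z)) * (hxy * t23 + hyz * t12 - hyy * t13 - hxz * t22))"
    unfolding gradient_eq adjugate_defs by Groebner_Basis.algebra
  show ?t3
    unfolding fe by (rule tr[OF e1 e2])
  have e1: "polar nyy t11 t12 t13 t22 t23 t33 = e^2 * (y * (adj2 (dotx t11 t12 t13) (dotx t12 t22 t23) (dotx t13 t23 t33)) + y * (adj2 (dotx t11 t12 t13) (dotx t12 t22 t23) (dotx t13 t23 t33)) - (xdot (dotx t11 t12 t13) (dotx t12 t22 t23) (dotx t13 t23 t33)) * ayy) - e^2 * ((adj_trace t11 t12 t13 t22 t23 t33) * y * y)" (is "_ = ?rhs")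
    unfolding symbol_defs by (rule lin1[OF hf, where c = "?rhs"]) Groebner_Basis.algebra
  have e2: "(gcongyy t11 t13 t33) = ?rhs + e^2 * ((xdot (hess1 x y z) (hess2 x y z) (hess3 x y z)) * (hzz * t11 + hxx * t33 - hxz * t13 - hxz * t13))"
    unfolding gradient_eq adjugate_defs by Groebner_Basis.algebra
  show ?t4
    unfolding fe by (rule tr[OF e1 e2])
  have e1: "polar nyz t11 t12 t13 t22 t23 t33 = e^2 * (y * (adj3 (dotx t11 t12 t13) (dotx t12 t22 t23) (dotx t13 t23 t33)) + z * (adj2 (dotx t11 t12 t13) (dotx t12 t22 t23) (dotx t13 t23 t33)) - (xdot (dotx t11 t12 t13) (dotx t12 t22 t23) (dotx t13 t23 t33)) * ayz) - e^2 * ((adj_trace t11 t12 t13 t22 t23 t33) * y * z)" (is "_ = ?rhs")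
    unfolding symbol_defs by (rule lin1[OF hf, where c = "?rhs"]) Groebner_Basis.algebra
  have e2: "(gcongyz t11 t12 t13 t23) = ?rhs + e^2 * ((xdot (hess1 x y z) (hess2 x y z) (hess3 x y z)) * (hxz * t12 + hxy * t13 - hyz * t11 - hxx * t23))"
    unfolding gradient_eq adjugate_defs by Groebner_Basis.algebra
  show ?t5
    unfolding fe by (rule tr[OF e1 e2])
  have e1: "polar nzz t11 t12 t13 t22 t23 t33 = e^2 * (z * (adj3 (dotx t11 t12 t13) (dotx t12 t22 t23) (dotx t13 t23 t33)) + z * (adj3 (dotx t11 t12 t13) (dotx t12 t22 t23) (dotx t13 t23 t33)) - (xdot (dotx t11 t12 t13) (dotx t12 t22 t23) (dotx t13 t23 t33)) * azz) - e^2 * ((adj_trace t11 t12 t13 t22 t23 t33) * z * z)" (is "_ = ?rhs")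
    unfolding symbol_defs by (rule lin1[OF hf, where c = "?rhs"]) Groebner_Basis.algebra
  have e2: "(gcongzz t11 t12 t22) = ?rhs + e^2 * ((xdot (hess1 x y z) (hess2 x y z) (hess3 x y z)) * (hxx * t22 + hyy * t11 - hxy * t12 - hxy * t12))"
    unfolding gradient_eq adjugate_defs by Groebner_Basis.algebra
  show ?t6
    unfolding fe by (rule tr[OF e1 e2])
qed

text \<open>Over \<open>Q\<close> the symmetric matrices \<open>S\<close> with \<open>S g = 0\<close> are the
  matrices \<open>[g] T [g]\<^sup>T\<close> with \<open>T\<close> symmetric. Applying Koszul
  exactness to rows gives \<open>S = M [g]\<^sup>T\<close>; symmetry of \<open>S\<close> makes the
  columns of \<open>M\<close> orthogonal to \<open>g\<close> up to a scalar matrix, and a second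
  application yields a matrix \<open>T\<close>, which is then symmetrized.\<close>

lemma symmetric_kernel:
  assumes S1: "(dotg s11 s12 s13) = 0"
    and S2: "(dotg s12 s22 s23) = 0"
    and S3: "(dotg s13 s23 s33) = 0"
  obtains t11 t12 t13 t22 t23 t33 where "s11 = (gcongxx t22 t23 t33)"
    "s12 = (gcongxy t12 t13 t23 t33)"
    "s13 = (gcongxz t12 t13 t22 t23)"
    "s22 = (gcongyy t11 t13 t33)"
    "s23 = (gcongyz t11 t12 t13 t23)"
    "s33 = (gcongzz t11 t12 t22)"
proof -
  from kg1 S1 obtain m11 m12 m13 where m1: "s11 = g2 * m13 - g3 * m12" "s12 = g3 * m11 - g1 * m13" "s13 = g1 * m12 - g2 * m11"
    by (rule koszul1D)
  from kg1 S2 obtain m21 m22 m23 where m2: "s12 = g2 * m23 - g3 * m22" "s22 = g3 * m21 - g1 * m23" "s23 = g1 * m22 - g2 * m21"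
    by (rule koszul1D)
  from kg1 S3 obtain m31 m32 m33 where m3: "s13 = g2 * m33 - g3 * m32" "s23 = g3 * m31 - g1 * m33" "s33 = g1 * m32 - g2 * m31"
    by (rule koszul1D)
  have col1: "g1 * s11 = g1 * (g2 * m13 - g3 * m12)" "g2 * s12 = g2 * (g2 * m23 - g3 * m22)" "g3 * s13 = g3 * (g2 * m33 - g3 * m32)"
    by (simp_all only: m1(1)[symmetric] m2(1)[symmetric] m3(1)[symmetric])
  have col2: "g1 * s12 = g1 * (g3 * m11 - g1 * m13)" "g2 * s22 = g2 * (g3 * m21 - g1 * m23)" "g3 * s23 = g3 * (g3 * m31 - g1 * m33)"
    by (simp_all only: m1(2)[symmetric] m2(2)[symmetric] m3(2)[symmetric])
  have col3: "g1 * s13 = g1 * (g1 * m12 - g2 * m11)" "g2 * s23 = g2 * (g1 * m22 - g2 * m21)" "g3 * s33 = g3 * (g1 * m32 - g2 * m31)"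
    by (simp_all only: m1(3)[symmetric] m2(3)[symmetric] m3(3)[symmetric])
  have "(gdot s11 s12 s13) = 0" using S1 by (simp only: mult.commute)
  then have c1: "g2 * (gdot m13 m23 m33) = g3 * (gdot m12 m22 m32)"
    unfolding col1 by (rule lin1[where c = 1]) Groebner_Basis.algebra
  have "(gdot s12 s22 s23) = 0" using S2 by (simp only: mult.commute)
  then have c2: "g3 * (gdot m11 m21 m31) = g1 * (gdot m13 m23 m33)"
    unfolding col2 by (rule lin1[where c = 1]) Groebner_Basis.algebra
  have "(gdot s13 s23 s33) = 0" using S3 by (simp only: mult.commute)
  then have c3: "g1 * (gdot m12 m22 m32) = g2 * (gdot m11 m21 m31)"
    unfolding col3 by (rule lin1[where c = 1]) Groebner_Basis.algebra
  obtain t where t: "(gdot m11 m21 m31) = t * g1" "(gdot m12 m22 m32) = t * g2" "(gdot m13 m23 m33) = t * g3"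
    using kg2 c1 c2 c3 by (rule koszul2D)
  have "dotg (m11 - t) m21 m31 = 0"
    by (rule lin1[OF t(1), where c = 1]) Groebner_Basis.algebra
  with kg1 obtain q11 q12 q13 where q1: "m11 - t = g2 * q13 - g3 * q12" "m21 = g3 * q11 - g1 * q13" "m31 = g1 * q12 - g2 * q11"
    by (rule koszul1D)
  have m11: "m11 = t + (g2 * q13 - g3 * q12)" by (rule lin1[OF q1(1), where c = 1]) Groebner_Basis.algebra
  have "dotg m12 (m22 - t) m32 = 0"
    by (rule lin1[OF t(2), where c = 1]) Groebner_Basis.algebra
  with kg1 obtain q21 q22 q23 where q2: "m12 = g2 * q23 - g3 * q22" "m22 - t = g3 * q21 - g1 * q23" "m32 = g1 * q22 - g2 * q21"
    by (rule koszul1D)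
  have m22: "m22 = t + (g3 * q21 - g1 * q23)" by (rule lin1[OF q2(2), where c = 1]) Groebner_Basis.algebra
  have "dotg m13 m23 (m33 - t) = 0"
    by (rule lin1[OF t(3), where c = 1]) Groebner_Basis.algebra
  with kg1 obtain q31 q32 q33 where q3: "m13 = g2 * q33 - g3 * q32" "m23 = g3 * q31 - g1 * q33" "m33 - t = g1 * q32 - g2 * q31"
    by (rule koszul1D)
  have m33: "m33 = t + (g1 * q32 - g2 * q31)" by (rule lin1[OF q3(3), where c = 1]) Groebner_Basis.algebra
  show thesis
  proof (rule that[of "hf * (q22 + q22)" "hf * (q23 + q32)" "hf * (q33 + q33)" "hf * (q12 + q21)" "hf * (q13 + q31)" "hf * (q11 + q11)"])
    have e: "s11 = (g2 * (g2 * q33 - g3 * q32) - g3 * (g2 * q23 - g3 * q22))"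
      unfolding m1(1) m11 m22 m33 q1 q2 q3 by (rule refl)
    show "s11 = (gcongxx (hf * (q22 + q22)) (hf * (q23 + q32)) (hf * (q33 + q33)))"
      by (rule lin3[OF e e hf, where c = hf and c' = hf and c'' = "- s11"]) Groebner_Basis.algebra
    have "s12 = (g3 * (t + (g2 * q13 - g3 * q12)) - g1 * (g2 * q33 - g3 * q32))"
      unfolding m1(2) m11 m22 m33 q1 q2 q3 by (rule refl)
    moreover have "s12 = (g2 * (g3 * q31 - g1 * q33) - g3 * (t + (g3 * q21 - g1 * q23)))"
      unfolding m2(1) m11 m22 m33 q1 q2 q3 by (rule refl)
    ultimately show "s12 = (gcongxy (hf * (q12 + q21)) (hf * (q13 + q31)) (hf * (q23 + q32)) (hf * (q33 + q33)))"
      by (rule lin3[OF _ _ hf, where c = hf and c' = hf and c'' = "- s12"]) Groebner_Basis.algebra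
    have "s13 = (g1 * (g2 * q23 - g3 * q22) - g2 * (t + (g2 * q13 - g3 * q12)))"
      unfolding m1(3) m11 m22 m33 q1 q2 q3 by (rule refl)
    moreover have "s13 = (g2 * (t + (g1 * q32 - g2 * q31)) - g3 * (g1 * q22 - g2 * q21))"
      unfolding m3(1) m11 m22 m33 q1 q2 q3 by (rule refl)
    ultimately show "s13 = (gcongxz (hf * (q12 + q21)) (hf * (q13 + q31)) (hf * (q22 + q22)) (hf * (q23 + q32)))"
      by (rule lin3[OF _ _ hf, where c = hf and c' = hf and c'' = "- s13"]) Groebner_Basis.algebra
    have e: "s22 = (g3 * (g3 * q11 - g1 * q13) - g1 * (g3 * q31 - g1 * q33))"
      unfolding m2(2) m11 m22 m33 q1 q2 q3 by (rule refl)
    show "s22 = (gcongyy (hf * (q11 + q11)) (hf * (q13 + q31)) (hf * (q33 + q33)))"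
      by (rule lin3[OF e e hf, where c = hf and c' = hf and c'' = "- s22"]) Groebner_Basis.algebra
    have "s23 = (g1 * (t + (g3 * q21 - g1 * q23)) - g2 * (g3 * q11 - g1 * q13))"
      unfolding m2(3) m11 m22 m33 q1 q2 q3 by (rule refl)
    moreover have "s23 = (g3 * (g1 * q12 - g2 * q11) - g1 * (t + (g1 * q32 - g2 * q31)))"
      unfolding m3(2) m11 m22 m33 q1 q2 q3 by (rule refl)
    ultimately show "s23 = (gcongyz (hf * (q11 + q11)) (hf * (q12 + q21)) (hf * (q13 + q31)) (hf * (q23 + q32)))"
      by (rule lin3[OF _ _ hf, where c = hf and c' = hf and c'' = "- s23"]) Groebner_Basis.algebra
    have e: "s33 = (g1 * (g1 * q22 - g2 * q21) - g2 * (g1 * q12 - g2 * q11))"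
      unfolding m3(3) m11 m22 m33 q1 q2 q3 by (rule refl)
    show "s33 = (gcongzz (hf * (q11 + q11)) (hf * (q12 + q21)) (hf * (q22 + q22)))"
      by (rule lin3[OF e e hf, where c = hf and c' = hf and c'' = "- s33"]) Groebner_Basis.algebra
  qed
qed

text \<open>The product vanishes modulo \<open>f\<close> because \<open>x \<cdot> g = d f\<close> and \<open>A
  g\<close> is proportional to \<open>x\<close>.\<close>

lemma symbol_times_gradient:
  "(nxx r p1 p2 p3 w1 w2 w3 * g1 + nxy r p1 p2 p3 w1 w2 w3 * g2 + nxz r p1 p2 p3 w1 w2 w3 * g3) = d * f * (2 * r * x + (g2 * p3 - g3 * p2) + 2 * e^2 * (adj1 w1 w2 w3))" (is ?t1)
  "(nxy r p1 p2 p3 w1 w2 w3 * g1 + nyy r p1 p2 p3 w1 w2 w3 * g2 + nyz r p1 p2 p3 w1 w2 w3 * g3) = d * f * (2 * r * y + (g3 * p1 - g1 * p3) + 2 * e^2 * (adj2 w1 w2 w3))" (is ?t2)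
  "(nxz r p1 p2 p3 w1 w2 w3 * g1 + nyz r p1 p2 p3 w1 w2 w3 * g2 + nzz r p1 p2 p3 w1 w2 w3 * g3) = d * f * (2 * r * z + (g1 * p2 - g2 * p1) + 2 * e^2 * (adj3 w1 w2 w3))" (is ?t3)
proof -
  show ?t1
    unfolding symbol_defs by (rule lin4[OF euler adjugate_gradient, where c = "(2 * r * x + (g2 * p3 - g3 * p2) + 2 * e^2 * (adj1 w1 w2 w3))" and c' = "2 * e^2 * x * w1 - 2 * e^2 * (xdot w1 w2 w3)" and c'' = "2 * e^2 * x * w2" and k = "2 * e^2 * x * w3"]) Groebner_Basis.algebra
  show ?t2
    unfolding symbol_defs by (rule lin4[OF euler adjugate_gradient, where c = "(2 * r * y + (g3 * p1 - g1 * p3) + 2 * e^2 * (adj2 w1 w2 w3))" and c' = "2 * e^2 * y * w1" and c'' = "2 * e^2 * y * w2 - 2 * e^2 * (xdot w1 w2 w3)" and k = "2 * e^2 * y * w3"]) Groebner_Basis.algebra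
  show ?t3
    unfolding symbol_defs by (rule lin4[OF euler adjugate_gradient, where c = "(2 * r * z + (g1 * p2 - g2 * p1) + 2 * e^2 * (adj3 w1 w2 w3))" and c' = "2 * e^2 * z * w1" and c'' = "2 * e^2 * z * w2" and k = "2 * e^2 * z * w3 - 2 * e^2 * (xdot w1 w2 w3)"]) Groebner_Basis.algebra
qed

lemma symbol_add:
  "nxx (r + r') p1 p2 p3 (w1 + w1') (w2 + w2') (w3 + w3') = nxx r p1 p2 p3 w1 w2 w3 + nxx r' 0 0 0 w1' w2' w3'"
  "nxy (r + r') p1 p2 p3 (w1 + w1') (w2 + w2') (w3 + w3') = nxy r p1 p2 p3 w1 w2 w3 + nxy r' 0 0 0 w1' w2' w3'"
  "nxz (r + r') p1 p2 p3 (w1 + w1') (w2 + w2') (w3 + w3') = nxz r p1 p2 p3 w1 w2 w3 + nxz r' 0 0 0 w1' w2' w3'"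
  "nyy (r + r') p1 p2 p3 (w1 + w1') (w2 + w2') (w3 + w3') = nyy r p1 p2 p3 w1 w2 w3 + nyy r' 0 0 0 w1' w2' w3'"
  "nyz (r + r') p1 p2 p3 (w1 + w1') (w2 + w2') (w3 + w3') = nyz r p1 p2 p3 w1 w2 w3 + nyz r' 0 0 0 w1' w2' w3'"
  "nzz (r + r') p1 p2 p3 (w1 + w1') (w2 + w2') (w3 + w3') = nzz r p1 p2 p3 w1 w2 w3 + nzz r' 0 0 0 w1' w2' w3'"
  unfolding symbol_defs by Groebner_Basis.algebra+

text \<open>Write \<open>S g = f h\<close>. Solving row by row gives \<open>S = h x\<^sup>T / d + N\<close> with
  \<open>N\<close> in the image of \<open>[g]\<close>, and the symmetry of \<open>S\<close>
  restricts \<open>h\<close>: the vector \<open>h \<times> x\<close> is \<open>C g\<close> for a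
  matrix \<open>C\<close> whose columns can be normalized by Koszul exactness for \<open>x\<close>
  and \<open>g\<close>. This determines parameters \<open>r, p, w\<close> whose symbol has the same
  product with \<open>g\<close> modulo multiples \<open>f K g\<close> with \<open>K\<close>
  symmetric. The difference is killed by \<open>g\<close> over \<open>Q\<close>, so it is \<open>[g]
  T [g]\<^sup>T\<close>, which is again a symbol modulo \<open>f\<close>.\<close>

lemma symbol_kernel_mod_f:
  assumes "f dvd (dotg s11 s12 s13)" "f dvd (dotg s12 s22 s23)" "f dvd (dotg s13 s23 s33)"
  obtains r p1 p2 p3 w1 w2 w3 where "f dvd s11 - nxx r p1 p2 p3 w1 w2 w3"
    "f dvd s12 - nxy r p1 p2 p3 w1 w2 w3"
    "f dvd s13 - nxz r p1 p2 p3 w1 w2 w3"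
    "f dvd s22 - nyy r p1 p2 p3 w1 w2 w3"
    "f dvd s23 - nyz r p1 p2 p3 w1 w2 w3"
    "f dvd s33 - nzz r p1 p2 p3 w1 w2 w3"
proof -
  obtain h1 h2 h3 where h: "(dotg s11 s12 s13) = f * h1" "(dotg s12 s22 s23) = f * h2" "(dotg s13 s23 s33) = f * h3"
    using assms by (auto elim!: dvdE)
  have "dotg (s11 - di * h1 * x) (s12 - di * h1 * y) (s13 - di * h1 * z) = 0"
    by (rule lin3[OF h(1) euler di, where c = 1 and c' = "- di * h1" and c'' = "- f * h1"]) Groebner_Basis.algebra
  with kg1 obtain n11 n12 n13 where n1: "s11 - di * h1 * x = g2 * n13 - g3 * n12" "s12 - di * h1 * y = g3 * n11 - g1 * n13" "s13 - di * h1 * z = g1 * n12 - g2 * n11"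
    by (rule koszul1D)
  have "dotg (s12 - di * h2 * x) (s22 - di * h2 * y) (s23 - di * h2 * z) = 0"
    by (rule lin3[OF h(2) euler di, where c = 1 and c' = "- di * h2" and c'' = "- f * h2"]) Groebner_Basis.algebra
  with kg1 obtain n21 n22 n23 where n2: "s12 - di * h2 * x = g2 * n23 - g3 * n22" "s22 - di * h2 * y = g3 * n21 - g1 * n23" "s23 - di * h2 * z = g1 * n22 - g2 * n21"
    by (rule koszul1D)
  have "dotg (s13 - di * h3 * x) (s23 - di * h3 * y) (s33 - di * h3 * z) = 0"
    by (rule lin3[OF h(3) euler di, where c = 1 and c' = "- di * h3" and c'' = "- f * h3"]) Groebner_Basis.algebra
  with kg1 obtain n31 n32 n33 where n3: "s13 - di * h3 * x = g2 * n33 - g3 * n32" "s23 - di * h3 * y = g3 * n31 - g1 * n33" "s33 - di * h3 * z = g1 * n32 - g2 * n31"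
    by (rule koszul1D)
  \<comment> \<open>Symmetry of \<open>S\<close> makes \<open>h \<times> x\<close> a combination \<open>C g\<close>.\<close>
  define c11 where "c11 = - d * (n22 + n33)"
  define c12 where "c12 = d * n21"
  define c13 where "c13 = d * n31"
  define c21 where "c21 = d * n12"
  define c22 where "c22 = - d * (n11 + n33)"
  define c23 where "c23 = d * n32"
  define c31 where "c31 = d * n13"
  define c32 where "c32 = d * n23"
  define c33 where "c33 = - d * (n11 + n22)"
  have hx1: "h2 * z - h3 * y = (dotg c11 c12 c13)"
    unfolding c11_def c12_def c13_def by (rule lin3[OF n2(3) n3(2) di, where c = "- d" and c' = d and c'' = "- (h2 * z - h3 * y)"]) Groebner_Basis.algebra
  have hx2: "h3 * x - h1 * z = (dotg c21 c22 c23)"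
    unfolding c21_def c22_def c23_def by (rule lin3[OF n3(1) n1(3) di, where c = "- d" and c' = d and c'' = "- (h3 * x - h1 * z)"]) Groebner_Basis.algebra
  have hx3: "h1 * y - h2 * x = (dotg c31 c32 c33)"
    unfolding c31_def c32_def c33_def by (rule lin3[OF n1(2) n2(1) di, where c = "- d" and c' = d and c'' = "- (h1 * y - h2 * x)"]) Groebner_Basis.algebra
  have "dotg (xdot c11 c21 c31) (xdot c12 c22 c32) (xdot c13 c23 c33) = 0"
    by (rule lin3[OF hx1 hx2 hx3, where c = "- x" and c' = "- y" and c'' = "- z"]) Groebner_Basis.algebra
  with kg1 obtain b1 b2 b3 where b: "xdot c11 c21 c31 = g2 * b3 - g3 * b2" "xdot c12 c22 c32 = g3 * b1 - g1 * b3" "xdot c13 c23 c33 = g1 * b2 - g2 * b1"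
    by (rule koszul1D)
  have "dotx (c11 - e * (hxy * b3 - hxz * b2)) (c21 - e * (hyy * b3 - hyz * b2)) (c31 - e * (hyz * b3 - hzz * b2)) = 0"
    by (rule lin3[OF b(1) gradient_eq(2) gradient_eq(3), where c = 1 and c' = b3 and c'' = "- b2"]) Groebner_Basis.algebra
  with kx1 obtain k11 k12 k13 where k1: "c11 - e * (hxy * b3 - hxz * b2) = y * k13 - z * k12" "c21 - e * (hyy * b3 - hyz * b2) = z * k11 - x * k13" "c31 - e * (hyz * b3 - hzz * b2) = x * k12 - y * k11"
    by (rule koszul1D)
  have c11: "c11 = e * (hxy * b3 - hxz * b2) + (y * k13 - z * k12)"
    by (rule lin1[OF k1(1), where c = 1]) Groebner_Basis.algebra
  have c21: "c21 = e * (hyy * b3 - hyz * b2) + (z * k11 - x * k13)"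
    by (rule lin1[OF k1(2), where c = 1]) Groebner_Basis.algebra
  have c31: "c31 = e * (hyz * b3 - hzz * b2) + (x * k12 - y * k11)"
    by (rule lin1[OF k1(3), where c = 1]) Groebner_Basis.algebra
  have "dotx (c12 - e * (hxz * b1 - hxx * b3)) (c22 - e * (hyz * b1 - hxy * b3)) (c32 - e * (hzz * b1 - hxz * b3)) = 0"
    by (rule lin3[OF b(2) gradient_eq(3) gradient_eq(1), where c = 1 and c' = b1 and c'' = "- b3"]) Groebner_Basis.algebra
  with kx1 obtain k21 k22 k23 where k2: "c12 - e * (hxz * b1 - hxx * b3) = y * k23 - z * k22" "c22 - e * (hyz * b1 - hxy * b3) = z * k21 - x * k23" "c32 - e * (hzz * b1 - hxz * b3) = x * k22 - y * k21"
    by (rule koszul1D)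
  have c12: "c12 = e * (hxz * b1 - hxx * b3) + (y * k23 - z * k22)"
    by (rule lin1[OF k2(1), where c = 1]) Groebner_Basis.algebra
  have c22: "c22 = e * (hyz * b1 - hxy * b3) + (z * k21 - x * k23)"
    by (rule lin1[OF k2(2), where c = 1]) Groebner_Basis.algebra
  have c32: "c32 = e * (hzz * b1 - hxz * b3) + (x * k22 - y * k21)"
    by (rule lin1[OF k2(3), where c = 1]) Groebner_Basis.algebra
  have "dotx (c13 - e * (hxx * b2 - hxy * b1)) (c23 - e * (hxy * b2 - hyy * b1)) (c33 - e * (hxz * b2 - hyz * b1)) = 0"
    by (rule lin3[OF b(3) gradient_eq(1) gradient_eq(2), where c = 1 and c' = b2 and c'' = "- b1"]) Groebner_Basis.algebra
  with kx1 obtain k31 k32 k33 where k3: "c13 - e * (hxx * b2 - hxy * b1) = y * k33 - z * k32" "c23 - e * (hxy * b2 - hyy * b1) = z * k31 - x * k33" "c33 - e * (hxz * b2 - hyz * b1) = x * k32 - y * k31"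
    by (rule koszul1D)
  have c13: "c13 = e * (hxx * b2 - hxy * b1) + (y * k33 - z * k32)"
    by (rule lin1[OF k3(1), where c = 1]) Groebner_Basis.algebra
  have c23: "c23 = e * (hxy * b2 - hyy * b1) + (z * k31 - x * k33)"
    by (rule lin1[OF k3(2), where c = 1]) Groebner_Basis.algebra
  have c33: "c33 = e * (hxz * b2 - hyz * b1) + (x * k32 - y * k31)"
    by (rule lin1[OF k3(3), where c = 1]) Groebner_Basis.algebra
  have u1: "y * (h3 + (gdot k13 k23 k33) - e^2 * (adj3 b1 b2 b3)) = z * (h2 + (gdot k12 k22 k32) - e^2 * (adj2 b1 b2 b3))"
    by (rule lin5[OF hx1[unfolded c11 c12 c13] adjugate_cross(1) adjugate_cross(2) adjugate_cross(3) e, where c = "- 1" and c' = "- (e^2 * b1)" and c'' = "- (e^2 * b2)" and k = "- (e^2 * b3)" and k' = "- e * (hess1 (g2 * b3 - g3 * b2) (g3 * b1 - g1 * b3) (g1 * b2 - g2 * b1))"]) Groebner_Basis.algebra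
  have u2: "z * (h1 + (gdot k11 k21 k31) - e^2 * (adj1 b1 b2 b3)) = x * (h3 + (gdot k13 k23 k33) - e^2 * (adj3 b1 b2 b3))"
    by (rule lin5[OF hx2[unfolded c21 c22 c23] adjugate_cross(4) adjugate_cross(5) adjugate_cross(6) e, where c = "- 1" and c' = "- (e^2 * b1)" and c'' = "- (e^2 * b2)" and k = "- (e^2 * b3)" and k' = "- e * (hess2 (g2 * b3 - g3 * b2) (g3 * b1 - g1 * b3) (g1 * b2 - g2 * b1))"]) Groebner_Basis.algebra
  have u3: "x * (h2 + (gdot k12 k22 k32) - e^2 * (adj2 b1 b2 b3)) = y * (h1 + (gdot k11 k21 k31) - e^2 * (adj1 b1 b2 b3))"
    by (rule lin5[OF hx3[unfolded c31 c32 c33] adjugate_cross(7) adjugate_cross(8) adjugate_cross(9) e, where c = "- 1" and c' = "- (e^2 * b1)" and c'' = "- (e^2 * b2)" and k = "- (e^2 * b3)" and k' = "- e * (hess3 (g2 * b3 - g3 * b2) (g3 * b1 - g1 * b3) (g1 * b2 - g2 * b1))"]) Groebner_Basis.algebra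
  obtain t where t: "h1 + (gdot k11 k21 k31) - e^2 * (adj1 b1 b2 b3) = t * x" "h2 + (gdot k12 k22 k32) - e^2 * (adj2 b1 b2 b3) = t * y" "h3 + (gdot k13 k23 k33) - e^2 * (adj3 b1 b2 b3) = t * z"
    using kx2 u1 u2 u3 by (rule koszul2D)
  define p1 where "p1 = - di * (hf * (k32 - k23))"
  define p2 where "p2 = - di * (hf * (k13 - k31))"
  define p3 where "p3 = - di * (hf * (k21 - k12))"
  define w1 where "w1 = hf * di * b1"
  define w2 where "w2 = hf * di * b2"
  define w3 where "w3 = hf * di * b3"
  define r where "r = hf * di * t"
  have q1: "d * (2 * r * x + (g2 * p3 - g3 * p2) + 2 * e^2 * (adj1 w1 w2 w3)) = t * x - (g2 * (hf * (k21 - k12)) - g3 * (hf * (k13 - k31))) + e^2 * (adj1 b1 b2 b3)"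
    unfolding p1_def p2_def p3_def w1_def w2_def w3_def r_def
    by (rule lin2[OF di hf, where c = "2 * hf * (t * x + e^2 * (adj1 b1 b2 b3)) - (g2 * (hf * (k21 - k12)) - g3 * (hf * (k13 - k31)))" and c' = "(t * x + e^2 * (adj1 b1 b2 b3))"]) Groebner_Basis.algebra
  have mk1: "(dotg (hf * (k11 + k11)) (hf * (k21 + k12)) (hf * (k31 + k13))) + (g2 * (hf * (k21 - k12)) - g3 * (hf * (k13 - k31))) = (gdot k11 k21 k31)"
    by (rule lin1[OF hf, where c = "(gdot k11 k21 k31)"]) Groebner_Basis.algebra
  have q2: "d * (2 * r * y + (g3 * p1 - g1 * p3) + 2 * e^2 * (adj2 w1 w2 w3)) = t * y - (g3 * (hf * (k32 - k23)) - g1 * (hf * (k21 - k12))) + e^2 * (adj2 b1 b2 b3)"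
    unfolding p1_def p2_def p3_def w1_def w2_def w3_def r_def
    by (rule lin2[OF di hf, where c = "2 * hf * (t * y + e^2 * (adj2 b1 b2 b3)) - (g3 * (hf * (k32 - k23)) - g1 * (hf * (k21 - k12)))" and c' = "(t * y + e^2 * (adj2 b1 b2 b3))"]) Groebner_Basis.algebra
  have mk2: "(dotg (hf * (k21 + k12)) (hf * (k22 + k22)) (hf * (k32 + k23))) + (g3 * (hf * (k32 - k23)) - g1 * (hf * (k21 - k12))) = (gdot k12 k22 k32)"
    by (rule lin1[OF hf, where c = "(gdot k12 k22 k32)"]) Groebner_Basis.algebra
  have q3: "d * (2 * r * z + (g1 * p2 - g2 * p1) + 2 * e^2 * (adj3 w1 w2 w3)) = t * z - (g1 * (hf * (k13 - k31)) - g2 * (hf * (k32 - k23))) + e^2 * (adj3 b1 b2 b3)"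
    unfolding p1_def p2_def p3_def w1_def w2_def w3_def r_def
    by (rule lin2[OF di hf, where c = "2 * hf * (t * z + e^2 * (adj3 b1 b2 b3)) - (g1 * (hf * (k13 - k31)) - g2 * (hf * (k32 - k23)))" and c' = "(t * z + e^2 * (adj3 b1 b2 b3))"]) Groebner_Basis.algebra
  have mk3: "(dotg (hf * (k31 + k13)) (hf * (k32 + k23)) (hf * (k33 + k33))) + (g1 * (hf * (k13 - k31)) - g2 * (hf * (k32 - k23))) = (gdot k13 k23 k33)"
    by (rule lin1[OF hf, where c = "(gdot k13 k23 k33)"]) Groebner_Basis.algebra
  define s11' where "s11' = s11 - nxx r p1 p2 p3 w1 w2 w3 + f * (hf * (k11 + k11))"
  define s12' where "s12' = s12 - nxy r p1 p2 p3 w1 w2 w3 + f * (hf * (k21 + k12))"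
  define s13' where "s13' = s13 - nxz r p1 p2 p3 w1 w2 w3 + f * (hf * (k31 + k13))"
  define s22' where "s22' = s22 - nyy r p1 p2 p3 w1 w2 w3 + f * (hf * (k22 + k22))"
  define s23' where "s23' = s23 - nyz r p1 p2 p3 w1 w2 w3 + f * (hf * (k32 + k23))"
  define s33' where "s33' = s33 - nzz r p1 p2 p3 w1 w2 w3 + f * (hf * (k33 + k33))"
  have z1: "(dotg s11' s12' s13') = 0"
    unfolding s11'_def s12'_def s13'_def s22'_def s23'_def s33'_def by (rule lin5[OF h(1) symbol_times_gradient(1)[of r p1 p2 p3 w1 w2 w3] q1 t(1) mk1, where c = 1 and c' = "- 1" and c'' = "- f" and k = f and k' = f]) Groebner_Basis.algebra
  have z2: "(dotg s12' s22' s23') = 0"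
    unfolding s11'_def s12'_def s13'_def s22'_def s23'_def s33'_def by (rule lin5[OF h(2) symbol_times_gradient(2)[of r p1 p2 p3 w1 w2 w3] q2 t(2) mk2, where c = 1 and c' = "- 1" and c'' = "- f" and k = f and k' = f]) Groebner_Basis.algebra
  have z3: "(dotg s13' s23' s33') = 0"
    unfolding s11'_def s12'_def s13'_def s22'_def s23'_def s33'_def by (rule lin5[OF h(3) symbol_times_gradient(3)[of r p1 p2 p3 w1 w2 w3] q3 t(3) mk3, where c = 1 and c' = "- 1" and c'' = "- f" and k = f and k' = f]) Groebner_Basis.algebra
  obtain t11 t12 t13 t22 t23 t33 where T: "s11' = (gcongxx t22 t23 t33)"
      "s12' = (gcongxy t12 t13 t23 t33)"
      "s13' = (gcongxz t12 t13 t22 t23)"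
      "s22' = (gcongyy t11 t13 t33)"
      "s23' = (gcongyz t11 t12 t13 t23)"
      "s33' = (gcongzz t11 t12 t22)"
    by (rule symmetric_kernel[OF z1 z2 z3])
  show thesis
  proof (rule that)
    have e: "(gcongxx t22 t23 t33) = polar nxx t11 t12 t13 t22 t23 t33 + f * (d * e * (hyy * t33 + hzz * t22 - hyz * t23 - hyz * t23))"
      by (rule polarised_adjugate)
    have "s11 - nxx (r + - hf * e^2 * (adj_trace t11 t12 t13 t22 t23 t33)) p1 p2 p3 (w1 + hf * (dotx t11 t12 t13)) (w2 + hf * (dotx t12 t22 t23)) (w3 + hf * (dotx t13 t23 t33)) = f * (d * e * (hyy * t33 + hzz * t22 - hyz * t23 - hyz * t23) - (hf * (k11 + k11)))" (is "?lhs = _")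
      using T(1) unfolding s11'_def e symbol_add by (rule lin1[where c = 1]) Groebner_Basis.algebra
    then show "f dvd ?lhs" by (simp only: dvd_triv_left)
    have e: "(gcongxy t12 t13 t23 t33) = polar nxy t11 t12 t13 t22 t23 t33 + f * (d * e * (hyz * t13 + hxz * t23 - hxy * t33 - hzz * t12))"
      by (rule polarised_adjugate)
    have "s12 - nxy (r + - hf * e^2 * (adj_trace t11 t12 t13 t22 t23 t33)) p1 p2 p3 (w1 + hf * (dotx t11 t12 t13)) (w2 + hf * (dotx t12 t22 t23)) (w3 + hf * (dotx t13 t23 t33)) = f * (d * e * (hyz * t13 + hxz * t23 - hxy * t33 - hzz * t12) - (hf * (k21 + k12)))" (is "?lhs = _")
      using T(2) unfolding s12'_def e symbol_add by (rule lin1[where c = 1]) Groebner_Basis.algebra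
    then show "f dvd ?lhs" by (simp only: dvd_triv_left)
    have e: "(gcongxz t12 t13 t22 t23) = polar nxz t11 t12 t13 t22 t23 t33 + f * (d * e * (hxy * t23 + hyz * t12 - hyy * t13 - hxz * t22))"
      by (rule polarised_adjugate)
    have "s13 - nxz (r + - hf * e^2 * (adj_trace t11 t12 t13 t22 t23 t33)) p1 p2 p3 (w1 + hf * (dotx t11 t12 t13)) (w2 + hf * (dotx t12 t22 t23)) (w3 + hf * (dotx t13 t23 t33)) = f * (d * e * (hxy * t23 + hyz * t12 - hyy * t13 - hxz * t22) - (hf * (k31 + k13)))" (is "?lhs = _")
      using T(3) unfolding s13'_def e symbol_add by (rule lin1[where c = 1]) Groebner_Basis.algebra
    then show "f dvd ?lhs" by (simp only: dvd_triv_left)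
    have e: "(gcongyy t11 t13 t33) = polar nyy t11 t12 t13 t22 t23 t33 + f * (d * e * (hzz * t11 + hxx * t33 - hxz * t13 - hxz * t13))"
      by (rule polarised_adjugate)
    have "s22 - nyy (r + - hf * e^2 * (adj_trace t11 t12 t13 t22 t23 t33)) p1 p2 p3 (w1 + hf * (dotx t11 t12 t13)) (w2 + hf * (dotx t12 t22 t23)) (w3 + hf * (dotx t13 t23 t33)) = f * (d * e * (hzz * t11 + hxx * t33 - hxz * t13 - hxz * t13) - (hf * (k22 + k22)))" (is "?lhs = _")
      using T(4) unfolding s22'_def e symbol_add by (rule lin1[where c = 1]) Groebner_Basis.algebra
    then show "f dvd ?lhs" by (simp only: dvd_triv_left)
    have e: "(gcongyz t11 t12 t13 t23) = polar nyz t11 t12 t13 t22 t23 t33 + f * (d * e * (hxz * t12 + hxy * t13 - hyz * t11 - hxx * t23))"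
      by (rule polarised_adjugate)
    have "s23 - nyz (r + - hf * e^2 * (adj_trace t11 t12 t13 t22 t23 t33)) p1 p2 p3 (w1 + hf * (dotx t11 t12 t13)) (w2 + hf * (dotx t12 t22 t23)) (w3 + hf * (dotx t13 t23 t33)) = f * (d * e * (hxz * t12 + hxy * t13 - hyz * t11 - hxx * t23) - (hf * (k32 + k23)))" (is "?lhs = _")
      using T(5) unfolding s23'_def e symbol_add by (rule lin1[where c = 1]) Groebner_Basis.algebra
    then show "f dvd ?lhs" by (simp only: dvd_triv_left)
    have e: "(gcongzz t11 t12 t22) = polar nzz t11 t12 t13 t22 t23 t33 + f * (d * e * (hxx * t22 + hyy * t11 - hxy * t12 - hxy * t12))"
      by (rule polarised_adjugate)
    have "s33 - nzz (r + - hf * e^2 * (adj_trace t11 t12 t13 t22 t23 t33)) p1 p2 p3 (w1 + hf * (dotx t11 t12 t13)) (w2 + hf * (dotx t12 t22 t23)) (w3 + hf * (dotx t13 t23 t33)) = f * (d * e * (hxx * t22 + hyy * t11 - hxy * t12 - hxy * t12) - (hf * (k33 + k33)))" (is "?lhs = _")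
      using T(6) unfolding s33'_def e symbol_add by (rule lin1[where c = 1]) Groebner_Basis.algebra
    then show "f dvd ?lhs" by (simp only: dvd_triv_left)
  qed
qed


end

section \<open>The matrix factorization\<close>

lemma lin6: "a1 = b1 \<Longrightarrow> a2 = b2 \<Longrightarrow> a3 = b3 \<Longrightarrow> a4 = b4 \<Longrightarrow> a5 = b5 \<Longrightarrow> a6 = b6 \<Longrightarrow>
    s - t = c * (a1 - b1) + c' * (a2 - b2) + c'' * (a3 - b3) + k * (a4 - b4) + k' * (a5 - b5) + k'' * (a6 - b6)
    \<Longrightarrow> s = (t::'a::comm_ring_1)"
  by simp

lemma lin7: "a1 = b1 \<Longrightarrow> a2 = b2 \<Longrightarrow> a3 = b3 \<Longrightarrow> a4 = b4 \<Longrightarrow> a5 = b5 \<Longrightarrow> a6 = b6 \<Longrightarrow> a7 = b7 \<Longrightarrow>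
    s - t = c * (a1 - b1) + c' * (a2 - b2) + c'' * (a3 - b3) + k * (a4 - b4) + k' * (a5 - b5) + k'' * (a6 - b6) + k''' * (a7 - b7)
    \<Longrightarrow> s = (t::'a::comm_ring_1)"
  by simp

context hessian_ring
begin

text \<open>Each identity is a combination of the Euler relations and the adjugate identities; the coefficients
  of the combination are listed in the proof.\<close>

lemma odd_even:
  "(odd1 (even1 h p2 p3 w1 w2 w3) (even2 h p1 p3 w1 w2 w3) (even3 h p1 p2 w1 w2 w3) (xdot w1 w2 w3)) = d * f * h" (is ?t1)
  "(odd2 (even2 h p1 p3 w1 w2 w3) (even3 h p1 p2 w1 w2 w3) (even4 p1 p2 p3 q1 q2 q3) (even8 q1 q2 q3 w2 w3) (even9 q1 q2 q3 w1 w3) (even10 q1 q2 q3 w1 w2)) = d * f * p1" (is ?t2)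
  "(odd3 (even1 h p2 p3 w1 w2 w3) (even3 h p1 p2 w1 w2 w3) (even4 p1 p2 p3 q1 q2 q3) (even8 q1 q2 q3 w2 w3) (even9 q1 q2 q3 w1 w3) (even10 q1 q2 q3 w1 w2)) = d * f * p2" (is ?t3)
  "(odd4 (even1 h p2 p3 w1 w2 w3) (even2 h p1 p3 w1 w2 w3) (even4 p1 p2 p3 q1 q2 q3) (even8 q1 q2 q3 w2 w3) (even9 q1 q2 q3 w1 w3) (even10 q1 q2 q3 w1 w2)) = d * f * p3" (is ?t4)
  "(odd5 (even5 r q2 q3 w1 w2 w3) (even6 r q1 q3 w1 w2 w3) (even7 r q1 q2 w1 w2 w3) (xdot w1 w2 w3)) = d * f * r" (is ?t5)
  "(odd6 (even6 r q1 q3 w1 w2 w3) (even7 r q1 q2 w1 w2 w3) (even8 q1 q2 q3 w2 w3) (even9 q1 q2 q3 w1 w3) (even10 q1 q2 q3 w1 w2)) = d * f * q1" (is ?t6)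
  "(odd7 (even5 r q2 q3 w1 w2 w3) (even7 r q1 q2 w1 w2 w3) (even8 q1 q2 q3 w2 w3) (even9 q1 q2 q3 w1 w3) (even10 q1 q2 q3 w1 w2)) = d * f * q2" (is ?t7)
  "(odd8 (even5 r q2 q3 w1 w2 w3) (even6 r q1 q3 w1 w2 w3) (even8 q1 q2 q3 w2 w3) (even9 q1 q2 q3 w1 w3) (even10 q1 q2 q3 w1 w2)) = d * f * q3" (is ?t8)
  "(odd9 (even9 q1 q2 q3 w1 w3) (even10 q1 q2 q3 w1 w2) (xdot w1 w2 w3)) = d * f * w1" (is ?t9)
  "(odd10 (even8 q1 q2 q3 w2 w3) (even10 q1 q2 q3 w1 w2) (xdot w1 w2 w3)) = d * f * w2" (is ?t10)
  "(odd11 (even8 q1 q2 q3 w2 w3) (even9 q1 q2 q3 w1 w3) (xdot w1 w2 w3)) = d * f * w3" (is ?t11)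
proof -
  show ?t1
    by (rule lin4[OF euler adjugate_gradient(1) adjugate_gradient(2) adjugate_gradient(3), where c = "h" and c' = "n * e^2 * w1" and c'' = "n * e^2 * w2" and k = "n * e^2 * w3"]) Groebner_Basis.algebra
  show ?t2
    by (rule lin6[OF euler adjugate_cross(1) adjugate_cross(2) adjugate_cross(3) e euler1, where c = "p1" and c' = "- (n * e^2 * w1)" and c'' = "- (n * e^2 * w2)" and k = "- (n * e^2 * w3)" and k' = "- (n * e * (hess1 (g2 * w3 - g3 * w2) (g3 * w1 - g1 * w3) (g1 * w2 - g2 * w1))) + n * hf * g1 * (xdot q1 q2 q3)" and k'' = "n * e * hf * (xdot q1 q2 q3)"]) Groebner_Basis.algebra
  show ?t3
    by (rule lin6[OF euler adjugate_cross(4) adjugate_cross(5) adjugate_cross(6) e euler2, where c = "p2" and c' = "- (n * e^2 * w1)" and c'' = "- (n * e^2 * w2)" and k = "- (n * e^2 * w3)" and k' = "- (n * e * (hess2 (g2 * w3 - g3 * w2) (g3 * w1 - g1 * w3) (g1 * w2 - g2 * w1))) + n * hf * g2 * (xdot q1 q2 q3)" and k'' = "n * e * hf * (xdot q1 q2 q3)"]) Groebner_Basis.algebra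
  show ?t4
    by (rule lin6[OF euler adjugate_cross(7) adjugate_cross(8) adjugate_cross(9) e euler3, where c = "p3" and c' = "- (n * e^2 * w1)" and c'' = "- (n * e^2 * w2)" and k = "- (n * e^2 * w3)" and k' = "- (n * e * (hess3 (g2 * w3 - g3 * w2) (g3 * w1 - g1 * w3) (g1 * w2 - g2 * w1))) + n * hf * g3 * (xdot q1 q2 q3)" and k'' = "n * e * hf * (xdot q1 q2 q3)"]) Groebner_Basis.algebra
  show ?t5
    by (rule lin4[OF euler adjugate_gradient(1) adjugate_gradient(2) adjugate_gradient(3), where c = "r" and c' = "2 * e^2 * w1" and c'' = "2 * e^2 * w2" and k = "2 * e^2 * w3"]) Groebner_Basis.algebra
  show ?t6
    by (rule lin7[OF euler adjugate_cross(1) adjugate_cross(2) adjugate_cross(3) e euler1 hf, where c = "q1" and c' = "- (2 * e^2 * w1)" and c'' = "- (2 * e^2 * w2)" and k = "- (2 * e^2 * w3)" and k' = "- (2 * e * (hess1 (g2 * w3 - g3 * w2) (g3 * w1 - g1 * w3) (g1 * w2 - g2 * w1))) + 2 * hf * g1 * (xdot q1 q2 q3)" and k'' = "2 * e * hf * (xdot q1 q2 q3)" and k''' = "g1 * (xdot q1 q2 q3)"]) Groebner_Basis.algebra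
  show ?t7
    by (rule lin7[OF euler adjugate_cross(4) adjugate_cross(5) adjugate_cross(6) e euler2 hf, where c = "q2" and c' = "- (2 * e^2 * w1)" and c'' = "- (2 * e^2 * w2)" and k = "- (2 * e^2 * w3)" and k' = "- (2 * e * (hess2 (g2 * w3 - g3 * w2) (g3 * w1 - g1 * w3) (g1 * w2 - g2 * w1))) + 2 * hf * g2 * (xdot q1 q2 q3)" and k'' = "2 * e * hf * (xdot q1 q2 q3)" and k''' = "g2 * (xdot q1 q2 q3)"]) Groebner_Basis.algebra
  show ?t8
    by (rule lin7[OF euler adjugate_cross(7) adjugate_cross(8) adjugate_cross(9) e euler3 hf, where c = "q3" and c' = "- (2 * e^2 * w1)" and c'' = "- (2 * e^2 * w2)" and k = "- (2 * e^2 * w3)" and k' = "- (2 * e * (hess3 (g2 * w3 - g3 * w2) (g3 * w1 - g1 * w3) (g1 * w2 - g2 * w1))) + 2 * hf * g3 * (xdot q1 q2 q3)" and k'' = "2 * e * hf * (xdot q1 q2 q3)" and k''' = "g3 * (xdot q1 q2 q3)"]) Groebner_Basis.algebra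
  show ?t9
    by (rule lin1[OF euler, where c = "w1"]) Groebner_Basis.algebra
  show ?t10
    by (rule lin1[OF euler, where c = "w2"]) Groebner_Basis.algebra
  show ?t11
    by (rule lin1[OF euler, where c = "w3"]) Groebner_Basis.algebra
qed

text \<open>The same identities for the other order of composition.\<close>

lemma even_odd:
  "(even1 (odd1 u1 u2 u3 s) (odd3 u1 u3 t b1 b2 b3) (odd4 u1 u2 t b1 b2 b3) (odd9 b2 b3 s) (odd10 b1 b3 s) (odd11 b1 b2 s)) = d * f * u1" (is ?t1)
  "(even2 (odd1 u1 u2 u3 s) (odd2 u2 u3 t b1 b2 b3) (odd4 u1 u2 t b1 b2 b3) (odd9 b2 b3 s) (odd10 b1 b3 s) (odd11 b1 b2 s)) = d * f * u2" (is ?t2)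
  "(even3 (odd1 u1 u2 u3 s) (odd2 u2 u3 t b1 b2 b3) (odd3 u1 u3 t b1 b2 b3) (odd9 b2 b3 s) (odd10 b1 b3 s) (odd11 b1 b2 s)) = d * f * u3" (is ?t3)
  "(even4 (odd2 u2 u3 t b1 b2 b3) (odd3 u1 u3 t b1 b2 b3) (odd4 u1 u2 t b1 b2 b3) (odd6 a2 a3 b1 b2 b3) (odd7 a1 a3 b1 b2 b3) (odd8 a1 a2 b1 b2 b3)) = d * f * t" (is ?t4)
  "(even5 (odd5 a1 a2 a3 s) (odd7 a1 a3 b1 b2 b3) (odd8 a1 a2 b1 b2 b3) (odd9 b2 b3 s) (odd10 b1 b3 s) (odd11 b1 b2 s)) = d * f * a1" (is ?t5)
  "(even6 (odd5 a1 a2 a3 s) (odd6 a2 a3 b1 b2 b3) (odd8 a1 a2 b1 b2 b3) (odd9 b2 b3 s) (odd10 b1 b3 s) (odd11 b1 b2 s)) = d * f * a2" (is ?t6)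
  "(even7 (odd5 a1 a2 a3 s) (odd6 a2 a3 b1 b2 b3) (odd7 a1 a3 b1 b2 b3) (odd9 b2 b3 s) (odd10 b1 b3 s) (odd11 b1 b2 s)) = d * f * a3" (is ?t7)
  "(even8 (odd6 a2 a3 b1 b2 b3) (odd7 a1 a3 b1 b2 b3) (odd8 a1 a2 b1 b2 b3) (odd10 b1 b3 s) (odd11 b1 b2 s)) = d * f * b1" (is ?t8)
  "(even9 (odd6 a2 a3 b1 b2 b3) (odd7 a1 a3 b1 b2 b3) (odd8 a1 a2 b1 b2 b3) (odd9 b2 b3 s) (odd11 b1 b2 s)) = d * f * b2" (is ?t9)
  "(even10 (odd6 a2 a3 b1 b2 b3) (odd7 a1 a3 b1 b2 b3) (odd8 a1 a2 b1 b2 b3) (odd9 b2 b3 s) (odd10 b1 b3 s)) = d * f * b3" (is ?t10)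
  "(xdot (odd9 b2 b3 s) (odd10 b1 b3 s) (odd11 b1 b2 s)) = d * f * s" (is ?t11)
proof -
  show ?t1
    by (rule lin6[OF euler adjugate_cross(1) adjugate_cross(4) adjugate_cross(7) adjugate_gradient(1) e, where c = "u1" and c' = "n * e^2 * b1" and c'' = "n * e^2 * b2" and k = "n * e^2 * b3" and k' = "n * e^2 * s" and k'' = "- (n * e * (g2 * (hess3 b1 b2 b3) - g3 * (hess2 b1 b2 b3)))"]) Groebner_Basis.algebra
  show ?t2
    by (rule lin6[OF euler adjugate_cross(2) adjugate_cross(5) adjugate_cross(8) adjugate_gradient(2) e, where c = "u2" and c' = "n * e^2 * b1" and c'' = "n * e^2 * b2" and k = "n * e^2 * b3" and k' = "n * e^2 * s" and k'' = "- (n * e * (g3 * (hess1 b1 b2 b3) - g1 * (hess3 b1 b2 b3)))"]) Groebner_Basis.algebra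
  show ?t3
    by (rule lin6[OF euler adjugate_cross(3) adjugate_cross(6) adjugate_cross(9) adjugate_gradient(3) e, where c = "u3" and c' = "n * e^2 * b1" and c'' = "n * e^2 * b2" and k = "n * e^2 * b3" and k' = "n * e^2 * s" and k'' = "- (n * e * (g1 * (hess2 b1 b2 b3) - g2 * (hess1 b1 b2 b3)))"]) Groebner_Basis.algebra
  show ?t4
    by (rule lin2[OF euler hf, where c = "t" and c' = "- (n * e * (xdot (hess1 b1 b2 b3) (hess2 b1 b2 b3) (hess3 b1 b2 b3)))"]) Groebner_Basis.algebra
  show ?t5
    by (rule lin6[OF euler adjugate_cross(1) adjugate_cross(4) adjugate_cross(7) adjugate_gradient(1) e, where c = "a1" and c' = "2 * e^2 * b1" and c'' = "2 * e^2 * b2" and k = "2 * e^2 * b3" and k' = "2 * e^2 * s" and k'' = "- (2 * e * (g2 * (hess3 b1 b2 b3) - g3 * (hess2 b1 b2 b3)))"]) Groebner_Basis.algebra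
  show ?t6
    by (rule lin6[OF euler adjugate_cross(2) adjugate_cross(5) adjugate_cross(8) adjugate_gradient(2) e, where c = "a2" and c' = "2 * e^2 * b1" and c'' = "2 * e^2 * b2" and k = "2 * e^2 * b3" and k' = "2 * e^2 * s" and k'' = "- (2 * e * (g3 * (hess1 b1 b2 b3) - g1 * (hess3 b1 b2 b3)))"]) Groebner_Basis.algebra
  show ?t7
    by (rule lin6[OF euler adjugate_cross(3) adjugate_cross(6) adjugate_cross(9) adjugate_gradient(3) e, where c = "a3" and c' = "2 * e^2 * b1" and c'' = "2 * e^2 * b2" and k = "2 * e^2 * b3" and k' = "2 * e^2 * s" and k'' = "- (2 * e * (g1 * (hess2 b1 b2 b3) - g2 * (hess1 b1 b2 b3)))"]) Groebner_Basis.algebra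
  show ?t8
    by (rule lin6[OF euler hf euler1 euler2 euler3 e, where c = "b1" and c' = "e * x * (xdot (hess1 b1 b2 b3) (hess2 b1 b2 b3) (hess3 b1 b2 b3))" and c'' = "e * x * b1" and k = "e * x * b2" and k' = "e * x * b3" and k'' = "x * (gdot b1 b2 b3)"]) Groebner_Basis.algebra
  show ?t9
    by (rule lin6[OF euler hf euler1 euler2 euler3 e, where c = "b2" and c' = "e * y * (xdot (hess1 b1 b2 b3) (hess2 b1 b2 b3) (hess3 b1 b2 b3))" and c'' = "e * y * b1" and k = "e * y * b2" and k' = "e * y * b3" and k'' = "y * (gdot b1 b2 b3)"]) Groebner_Basis.algebra
  show ?t10
    by (rule lin6[OF euler hf euler1 euler2 euler3 e, where c = "b3" and c' = "e * z * (xdot (hess1 b1 b2 b3) (hess2 b1 b2 b3) (hess3 b1 b2 b3))" and c'' = "e * z * b1" and k = "e * z * b2" and k' = "e * z * b3" and k'' = "z * (gdot b1 b2 b3)"]) Groebner_Basis.algebra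
  show ?t11
    by (rule lin1[OF euler, where c = "s"]) Groebner_Basis.algebra
qed

text \<open>Parameters in the image of the odd matrix have \<open>w = s g - x \<times> b\<close> and \<open>p =
  2 e \<Delta> b - x \<times> a\<close>; shifting removes \<open>b\<close> and \<open>s\<close>, and
  \<open>symbol_at_cross\<close> shows that \<open>r\<close> and \<open>a\<close> cancel.\<close>

lemma symbol_of_odd:
  "f dvd nxx (odd5 a1 a2 a3 s) (odd6 a2 a3 b1 b2 b3) (odd7 a1 a3 b1 b2 b3) (odd8 a1 a2 b1 b2 b3) (odd9 b2 b3 s) (odd10 b1 b3 s) (odd11 b1 b2 s)" (is ?t1)
  "f dvd nxy (odd5 a1 a2 a3 s) (odd6 a2 a3 b1 b2 b3) (odd7 a1 a3 b1 b2 b3) (odd8 a1 a2 b1 b2 b3) (odd9 b2 b3 s) (odd10 b1 b3 s) (odd11 b1 b2 s)" (is ?t2)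
  "f dvd nxz (odd5 a1 a2 a3 s) (odd6 a2 a3 b1 b2 b3) (odd7 a1 a3 b1 b2 b3) (odd8 a1 a2 b1 b2 b3) (odd9 b2 b3 s) (odd10 b1 b3 s) (odd11 b1 b2 s)" (is ?t3)
  "f dvd nyy (odd5 a1 a2 a3 s) (odd6 a2 a3 b1 b2 b3) (odd7 a1 a3 b1 b2 b3) (odd8 a1 a2 b1 b2 b3) (odd9 b2 b3 s) (odd10 b1 b3 s) (odd11 b1 b2 s)" (is ?t4)
  "f dvd nyz (odd5 a1 a2 a3 s) (odd6 a2 a3 b1 b2 b3) (odd7 a1 a3 b1 b2 b3) (odd8 a1 a2 b1 b2 b3) (odd9 b2 b3 s) (odd10 b1 b3 s) (odd11 b1 b2 s)" (is ?t5)
  "f dvd nzz (odd5 a1 a2 a3 s) (odd6 a2 a3 b1 b2 b3) (odd7 a1 a3 b1 b2 b3) (odd8 a1 a2 b1 b2 b3) (odd9 b2 b3 s) (odd10 b1 b3 s) (odd11 b1 b2 s)" (is ?t6)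
proof -
  have r: "(odd5 a1 a2 a3 s) + 2 * e^3 * hdet * s = (dotg a1 a2 a3)" by Groebner_Basis.algebra
  have p1: "(odd6 a2 a3 b1 b2 b3) - 2 * e * (hess1 b1 b2 b3) = odd9 a2 a3 0" by Groebner_Basis.algebra
  have p2: "(odd7 a1 a3 b1 b2 b3) - 2 * e * (hess2 b1 b2 b3) = odd10 a1 a3 0" by Groebner_Basis.algebra
  have p3: "(odd8 a1 a2 b1 b2 b3) - 2 * e * (hess3 b1 b2 b3) = odd11 a1 a2 0" by Groebner_Basis.algebra
  show ?t1
    unfolding symbol_shift(1)[OF refl refl refl] r p1 p2 p3 symbol_at_cross(1)[OF refl refl refl]
    by (simp only: diff_self mult_zero_right add_0_left dvd_diff dvd_triv_left)
  show ?t2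
    unfolding symbol_shift(2)[OF refl refl refl] r p1 p2 p3 symbol_at_cross(2)[OF refl refl refl]
    by (simp only: diff_self mult_zero_right add_0_left dvd_diff dvd_triv_left)
  show ?t3
    unfolding symbol_shift(3)[OF refl refl refl] r p1 p2 p3 symbol_at_cross(3)[OF refl refl refl]
    by (simp only: diff_self mult_zero_right add_0_left dvd_diff dvd_triv_left)
  show ?t4
    unfolding symbol_shift(4)[OF refl refl refl] r p1 p2 p3 symbol_at_cross(4)[OF refl refl refl]
    by (simp only: diff_self mult_zero_right add_0_left dvd_diff dvd_triv_left)
  show ?t5
    unfolding symbol_shift(5)[OF refl refl refl] r p1 p2 p3 symbol_at_cross(5)[OF refl refl refl]
    by (simp only: diff_self mult_zero_right add_0_left dvd_diff dvd_triv_left)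
  show ?t6
    unfolding symbol_shift(6)[OF refl refl refl] r p1 p2 p3 symbol_at_cross(6)[OF refl refl refl]
    by (simp only: diff_self mult_zero_right add_0_left dvd_diff dvd_triv_left)
qed

text \<open>The value of the operator at \<open>f\<close> consists of the pairing of its vector field with
  \<open>g\<close> and half the trace of \<open>S \<Delta>\<close>. In the trace the
  \<open>A\<close>-part of the symbol gives \<open>-det \<Delta> (x \<cdot> w)\<close> up to
  scalars, which the correction \<open>A w\<close> of the vector field cancels.\<close>

lemma symbol_trace:
  "g1 * (n * e^2 * (adj1 w1 w2 w3)) + g2 * (n * e^2 * (adj2 w1 w2 w3)) + g3 * (n * e^2 * (adj3 w1 w2 w3))
    + (hf * hxx * nxx r p1 p2 p3 w1 w2 w3 + hxy * nxy r p1 p2 p3 w1 w2 w3 + hxz * nxz r p1 p2 p3 w1 w2 w3 + hf * hyy * nyy r p1 p2 p3 w1 w2 w3 + hyz * nyz r p1 p2 p3 w1 w2 w3 + hf * hzz * nzz r p1 p2 p3 w1 w2 w3) = f * (r * d * n)"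
proof -
  have d1: "hf * hxx * nxx r p1 p2 p3 w1 w2 w3 = hxx * (r * x * x + x * (g2 * p3 - g3 * p2) + e^2 * (2 * x * (adj1 w1 w2 w3) - (xdot w1 w2 w3) * axx))" (is "_ = ?rhs")
    unfolding symbol_defs by (rule lin1[OF hf, where c = "?rhs"]) Groebner_Basis.algebra
  have d2: "hf * hyy * nyy r p1 p2 p3 w1 w2 w3 = hyy * (r * y * y + y * (g3 * p1 - g1 * p3) + e^2 * (2 * y * (adj2 w1 w2 w3) - (xdot w1 w2 w3) * ayy))" (is "_ = ?rhs")
    unfolding symbol_defs by (rule lin1[OF hf, where c = "?rhs"]) Groebner_Basis.algebra
  have d3: "hf * hzz * nzz r p1 p2 p3 w1 w2 w3 = hzz * (r * z * z + z * (g1 * p2 - g2 * p1) + e^2 * (2 * z * (adj3 w1 w2 w3) - (xdot w1 w2 w3) * azz))" (is "_ = ?rhs")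
    unfolding symbol_defs by (rule lin1[OF hf, where c = "?rhs"]) Groebner_Basis.algebra
  have s: "(hxx * (r * x * x + x * (g2 * p3 - g3 * p2) + e^2 * (2 * x * (adj1 w1 w2 w3) - (xdot w1 w2 w3) * axx)) + hyy * (r * y * y + y * (g3 * p1 - g1 * p3) + e^2 * (2 * y * (adj2 w1 w2 w3) - (xdot w1 w2 w3) * ayy)) + hzz * (r * z * z + z * (g1 * p2 - g2 * p1) + e^2 * (2 * z * (adj3 w1 w2 w3) - (xdot w1 w2 w3) * azz))) + (hxy * nxy r p1 p2 p3 w1 w2 w3 + hxz * nxz r p1 p2 p3 w1 w2 w3 + hyz * nyz r p1 p2 p3 w1 w2 w3)
      = r * (xdot (hess1 x y z) (hess2 x y z) (hess3 x y z)) + ((hess1 x y z) * (g2 * p3 - g3 * p2) + (hess2 x y z) * (g3 * p1 - g1 * p3) + (hess3 x y z) * (g1 * p2 - g2 * p1)) - e^2 * hdet * (xdot w1 w2 w3)"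
    unfolding symbol_defs hdet_def adjugate_defs by Groebner_Basis.algebra
  have h: "((hess1 x y z) * (g2 * p3 - g3 * p2) + (hess2 x y z) * (g3 * p1 - g1 * p3) + (hess3 x y z) * (g1 * p2 - g2 * p1)) = 0"
    unfolding euler1 euler2 euler3 by Groebner_Basis.algebra
  have g: "gdot (n * e^2 * (adj1 w1 w2 w3)) (n * e^2 * (adj2 w1 w2 w3)) (n * e^2 * (adj3 w1 w2 w3)) = e^2 * hdet * (xdot w1 w2 w3)"
    by (rule lin4[OF adjugate_gradient e, where c = "n * e^2 * w1" and c' = "n * e^2 * w2" and c'' = "n * e^2 * w3" and k = "e^2 * hdet * (xdot w1 w2 w3)"]) Groebner_Basis.algebra
  show ?thesis
    unfolding g d1 d2 d3 by (rule lin3[OF s h hessian_quadratic_form, where c = 1 and c' = 1 and c'' = "- r"]) Groebner_Basis.algebra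
qed

end

section \<open>Koszul exactness for the gradient\<close>

text \<open>Cutting a polynomial at \<open>z\<^sup>n\<close> is division with remainder by
  \<open>z\<^sup>n\<close>; this is how the last variable power is eliminated from a syzygy.\<close>

lemma zz_division: "p = zz ^ n * poly_shift n p + poly_cutoff n p"
  by (rule poly3_eqI)
    (auto simp: c3_zz_power_mult, auto simp: c3_def coeff_poly_shift coeff_poly_cutoff)

lemma yy_power_dvdI:
  assumes "\<And>a b c. b < n \<Longrightarrow> c3 p a b c = 0"
  shows "yy ^ n dvd p"
proof
  show "p = yy ^ n * map_poly (poly_shift n) p"
    by (rule poly3_eqI) (use assms in \<open>auto simp: c3_yy_power_mult, auto simp: c3_def coeff_map_poly coeff_poly_shift\<close>)
qed

lemma yy_power_dvd_xx_power_mult: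
  assumes "yy ^ n dvd xx ^ n * p"
  shows "yy ^ n dvd p"
proof (rule yy_power_dvdI)
  fix a b c :: nat assume "b < n"
  obtain q where q: "xx ^ n * p = yy ^ n * q" using assms by (rule dvdE)
  have "c3 p a b c = c3 (xx ^ n * p) (a + n) b c" by (simp add: c3_xx_power_mult)
  also have "\<dots> = 0" unfolding q using \<open>b < n\<close> by (simp add: c3_yy_power_mult)
  finally show "c3 p a b c = 0" .
qed

lemma var_power_nonzero: "xx ^ n \<noteq> (0 :: 'k::idom poly3)" "yy ^ n \<noteq> (0 :: 'k poly3)" "zz ^ n \<noteq> (0 :: 'k poly3)"
  by (simp_all add: xx_def yy_def zz_def)

text \<open>Monomials are divisible by a power of a variable independently of the other variables. Reducing the
  first two coefficients modulo \<open>z\<^sup>n\<close> leaves a syzygy of \<open>x\<^sup>n,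
  y\<^sup>n\<close> alone, which is a multiple of \<open>(y\<^sup>n, - x\<^sup>n)\<close>.\<close>

lemma koszul1_variables: "koszul1 (xx ^ n) (yy ^ n) (zz ^ n :: 'k::idom poly3)"
  unfolding koszul1_def
proof (intro allI impI)
  fix u1 u2 u3 :: "'k poly3"
  let ?x = "xx ^ n :: 'k poly3" and ?y = "yy ^ n :: 'k poly3" and ?z = "zz ^ n :: 'k poly3"
  assume u: "u1 * ?x + u2 * ?y + u3 * ?z = 0"
  define q1 q2 r1 r2 where q: "q1 = poly_shift n u1" "q2 = poly_shift n u2"
    and r: "r1 = poly_cutoff n u1" "r2 = poly_cutoff n u2"
  have u12: "u1 = ?z * q1 + r1" "u2 = ?z * q2 + r2" unfolding q r by (rule zz_division)+
  have "?x * r1 + ?y * r2 = - (?z * (u3 + ?x * q1 + ?y * q2))"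
    by (rule lin3[OF u u12, where c = 1 and c' = "- ?x" and c'' = "- ?y"]) Groebner_Basis.algebra
  then have eq: "c3 (?x * r1 + ?y * r2) a b c = - c3 (?z * (u3 + ?x * q1 + ?y * q2)) a b c" for a b c
    by simp
  have "?x * r1 + ?y * r2 = 0"
  proof (rule poly3_eqI)
    fix a b c
    show "c3 (?x * r1 + ?y * r2) a b c = c3 0 a b c"
    proof (cases "c < n")
      case True
      then show ?thesis unfolding eq by (simp add: c3_zz_power_mult)
    next
      case False
      then have "c3 r1 a b c = 0" "c3 r2 a b c = 0" for a b
        unfolding r by (simp_all add: c3_def coeff_poly_cutoff)
      then show ?thesis by (simp add: c3_xx_power_mult c3_yy_power_mult)
    qed
  qed
  then have xy: "?x * r1 + ?y * r2 = 0" .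
  have "?x * r1 = ?y * (- r2)" by (rule lin1[OF xy, where c = 1]) Groebner_Basis.algebra
  then have "?y dvd ?x * r1" by simp
  then obtain s where s: "r1 = ?y * s" using yy_power_dvd_xx_power_mult by (blast elim: dvdE)
  have "?y * (r2 + ?x * s) = 0"
    by (rule lin2[OF xy s, where c = 1 and c' = "- ?x"]) Groebner_Basis.algebra
  then have r2: "r2 + ?x * s = 0" using var_power_nonzero(2) mult_eq_0_iff by blast
  have "?z * (u3 + ?x * q1 + ?y * q2) = 0"
    by (rule lin4[OF u u12 xy, where c = 1 and c' = "- ?x" and c'' = "- ?y" and k = "- 1"]) Groebner_Basis.algebra
  then have u3: "u3 + ?x * q1 + ?y * q2 = 0" using var_power_nonzero(3) mult_eq_0_iff by blast
  show "\<exists>b1 b2 b3. u1 = ?y * b3 - ?z * b2 \<and> u2 = ?z * b1 - ?x * b3 \<and> u3 = ?x * b2 - ?y * b1"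
  proof (intro exI conjI)
    show "u1 = ?y * s - ?z * - q1"
      by (rule lin2[OF u12(1) s, where c = 1 and c' = 1]) Groebner_Basis.algebra
    show "u2 = ?z * q2 - ?x * s"
      by (rule lin2[OF u12(2) r2, where c = 1 and c' = 1]) Groebner_Basis.algebra
    show "u3 = ?x * - q1 - ?y * q2"
      by (rule lin1[OF u3, where c = 1]) Groebner_Basis.algebra
  qed
qed

lemma koszul2_variables: "koszul2 (xx ^ n) (yy ^ n) (zz ^ n :: 'k::idom poly3)"
  unfolding koszul2_def
proof (intro allI impI, elim conjE)
  fix u1 u2 u3 :: "'k poly3"
  assume u: "yy ^ n * u3 = zz ^ n * u2" "xx ^ n * u2 = yy ^ n * u1"
  have "yy ^ n dvd xx ^ n * u2" unfolding u(2) by simp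
  then obtain t where t: "u2 = yy ^ n * t" using yy_power_dvd_xx_power_mult by (blast elim: dvdE)
  have "yy ^ n * u1 = yy ^ n * (t * xx ^ n)" using u(2) unfolding t by (simp only: ac_simps)
  then have "u1 = t * xx ^ n" using var_power_nonzero(2) mult_left_cancel by blast
  moreover have "yy ^ n * u3 = yy ^ n * (t * zz ^ n)" using u(1) unfolding t by (simp only: ac_simps)
  then have "u3 = t * zz ^ n" using var_power_nonzero(2) mult_left_cancel by blast
  moreover have "u2 = t * yy ^ n" unfolding t by (rule mult.commute)
  ultimately show "\<exists>t. u1 = t * xx ^ n \<and> u2 = t * yy ^ n \<and> u3 = t * zz ^ n" by blast
qed

text \<open>A vector parallel to \<open>g\<close> pairs with each combination of the \<open>g\<^sub>i\<close> to
  give proportional multiples; as \<open>x, y, z\<close> are such combinations, the multipliers are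
  parallel to \<open>(x,y,z)\<close> and the exactness for \<open>(x,y,z)\<close> supplies the
  factor.\<close>

lemma koszul2_transfer:
  fixes g1 g2 g3 :: "'a::idom"
  assumes k2: "koszul2 x y z" and x0: "x \<noteq> 0" and g0: "g1 \<noteq> 0 \<or> g2 \<noteq> 0 \<or> g3 \<noteq> 0"
    and x: "x = a1 * g1 + a2 * g2 + a3 * g3" and y: "y = b1 * g1 + b2 * g2 + b3 * g3"
    and z: "z = d1 * g1 + d2 * g2 + d3 * g3"
  shows "koszul2 g1 g2 g3"
  unfolding koszul2_def
proof (intro allI impI, elim conjE)
  fix u1 u2 u3
  assume u: "g2 * u3 = g3 * u2" "g3 * u1 = g1 * u3" "g1 * u2 = g2 * u1"
  have lin: "(k1 * g1 + k2 * g2 + k3 * g3) * u1 = (k1 * u1 + k2 * u2 + k3 * u3) * g1"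
    "(k1 * g1 + k2 * g2 + k3 * g3) * u2 = (k1 * u1 + k2 * u2 + k3 * u3) * g2"
    "(k1 * g1 + k2 * g2 + k3 * g3) * u3 = (k1 * u1 + k2 * u2 + k3 * u3) * g3" for k1 k2 k3
    by (rule lin2[OF u(3) u(2), where c = "- k2" and c' = k3], Groebner_Basis.algebra,
        rule lin2[OF u(3) u(1), where c = k1 and c' = "- k3"], Groebner_Basis.algebra,
        rule lin2[OF u(2) u(1), where c = "- k1" and c' = k2], Groebner_Basis.algebra)
  define r where "r = a1 * u1 + a2 * u2 + a3 * u3"
  define s where "s = b1 * u1 + b2 * u2 + b3 * u3"
  define t where "t = d1 * u1 + d2 * u2 + d3 * u3"
  have xu: "x * u1 = r * g1" "x * u2 = r * g2" "x * u3 = r * g3"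
    and yu: "y * u1 = s * g1" "y * u2 = s * g2" "y * u3 = s * g3"
    and zu: "z * u1 = t * g1" "z * u2 = t * g2" "z * u3 = t * g3"
    unfolding x y z r_def s_def t_def by (fact lin)+
  have cancel: "p = q" if "p * g1 = q * g1" "p * g2 = q * g2" "p * g3 = q * g3" for p q
    using that g0 by auto
  have "y * t = z * s"
    by (rule cancel; rule lin2[OF zu(1) yu(1), where c = "- y" and c' = z]
        lin2[OF zu(2) yu(2), where c = "- y" and c' = z]
        lin2[OF zu(3) yu(3), where c = "- y" and c' = z], Groebner_Basis.algebra)
  moreover have "z * r = x * t"
    by (rule cancel; rule lin2[OF xu(1) zu(1), where c = "- z" and c' = x]
        lin2[OF xu(2) zu(2), where c = "- z" and c' = x]
        lin2[OF xu(3) zu(3), where c = "- z" and c' = x], Groebner_Basis.algebra)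
  moreover have "x * s = y * r"
    by (rule cancel; rule lin2[OF yu(1) xu(1), where c = "- x" and c' = y]
        lin2[OF yu(2) xu(2), where c = "- x" and c' = y]
        lin2[OF yu(3) xu(3), where c = "- x" and c' = y], Groebner_Basis.algebra)
  ultimately obtain k where "r = k * x" using k2 by (blast elim: koszul2D)
  then have "x * u1 = x * (k * g1)" "x * u2 = x * (k * g2)" "x * u3 = x * (k * g3)"
    using xu by (simp_all add: ac_simps)
  then show "\<exists>t. u1 = t * g1 \<and> u2 = t * g2 \<and> u3 = t * g3" using x0 by auto
qed

text \<open>Each of \<open>x, y, z\<close> is a combination of the \<open>g\<^sub>i\<close> and therefore
  annihilates the Koszul homology of \<open>g\<close>: multiplication by it is homotopic to zero.
  The three primitives so obtained differ by multiples of \<open>g\<close>, and these multiples form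
  a cocycle for \<open>(x,y,z)\<close>. It is trivial, so the primitives can be corrected until they
  are \<open>x, y, z\<close> times one common vector.\<close>

lemma koszul1_transfer:
  fixes g1 g2 g3 :: "'a::idom"
  assumes k1: "koszul1 x y z" and k2: "koszul2 x y z"
    and x0: "x \<noteq> 0" and g0: "g1 \<noteq> 0 \<or> g2 \<noteq> 0 \<or> g3 \<noteq> 0"
    and x: "x = a1 * g1 + a2 * g2 + a3 * g3" and y: "y = b1 * g1 + b2 * g2 + b3 * g3"
    and z: "z = d1 * g1 + d2 * g2 + d3 * g3"
  shows "koszul1 g1 g2 g3"
  unfolding koszul1_def
proof (intro allI impI)
  fix u1 u2 u3
  assume u: "u1 * g1 + u2 * g2 + u3 * g3 = 0"
  have kg: "koszul2 g1 g2 g3" by (rule koszul2_transfer[OF k2 x0 g0 x y z])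
  have hom: "\<exists>m1 m2 m3. (k1 * g1 + k2 * g2 + k3 * g3) * u1 = g2 * m3 - g3 * m2 \<and>
     (k1 * g1 + k2 * g2 + k3 * g3) * u2 = g3 * m1 - g1 * m3 \<and>
     (k1 * g1 + k2 * g2 + k3 * g3) * u3 = g1 * m2 - g2 * m1" for k1 k2 k3
  proof (intro exI conjI)
    show "(k1 * g1 + k2 * g2 + k3 * g3) * u1 = g2 * (u1 * k2 - u2 * k1) - g3 * (u3 * k1 - u1 * k3)"
      by (rule lin1[OF u, where c = k1]) Groebner_Basis.algebra
    show "(k1 * g1 + k2 * g2 + k3 * g3) * u2 = g3 * (u2 * k3 - u3 * k2) - g1 * (u1 * k2 - u2 * k1)"
      by (rule lin1[OF u, where c = k2]) Groebner_Basis.algebra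
    show "(k1 * g1 + k2 * g2 + k3 * g3) * u3 = g1 * (u3 * k1 - u1 * k3) - g2 * (u2 * k3 - u3 * k2)"
      by (rule lin1[OF u, where c = k3]) Groebner_Basis.algebra
  qed
  obtain l1 l2 l3 where l: "x * u1 = g2 * l3 - g3 * l2" "x * u2 = g3 * l1 - g1 * l3" "x * u3 = g1 * l2 - g2 * l1"
    using hom[of a1 a2 a3] unfolding x by blast
  obtain m1 m2 m3 where m: "y * u1 = g2 * m3 - g3 * m2" "y * u2 = g3 * m1 - g1 * m3" "y * u3 = g1 * m2 - g2 * m1"
    using hom[of b1 b2 b3] unfolding y by blast
  obtain n1 n2 n3 where n: "z * u1 = g2 * n3 - g3 * n2" "z * u2 = g3 * n1 - g1 * n3" "z * u3 = g1 * n2 - g2 * n1"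
    using hom[of d1 d2 d3] unfolding z by blast
  have par: "\<exists>t. y * l1 - x * m1 = t * g1 \<and> y * l2 - x * m2 = t * g2 \<and> y * l3 - x * m3 = t * g3"
    if "x * u1 = g2 * l3 - g3 * l2" "x * u2 = g3 * l1 - g1 * l3" "x * u3 = g1 * l2 - g2 * l1"
      "y * u1 = g2 * m3 - g3 * m2" "y * u2 = g3 * m1 - g1 * m3" "y * u3 = g1 * m2 - g2 * m1"
    for x y l1 l2 l3 m1 m2 m3
  proof (rule koszul2D[OF kg])
    show "g2 * (y * l3 - x * m3) = g3 * (y * l2 - x * m2)"
      by (rule lin2[OF that(1) that(4), where c = "- y" and c' = x]) Groebner_Basis.algebra
    show "g3 * (y * l1 - x * m1) = g1 * (y * l3 - x * m3)"
      by (rule lin2[OF that(2) that(5), where c = "- y" and c' = x]) Groebner_Basis.algebra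
    show "g1 * (y * l2 - x * m2) = g2 * (y * l1 - x * m1)"
      by (rule lin2[OF that(3) that(6), where c = "- y" and c' = x]) Groebner_Basis.algebra
  qed blast
  obtain t3 where t3: "y * l1 - x * m1 = t3 * g1" "y * l2 - x * m2 = t3 * g2" "y * l3 - x * m3 = t3 * g3"
    using par[OF l m] by blast
  obtain t1 where t1: "z * m1 - y * n1 = t1 * g1" "z * m2 - y * n2 = t1 * g2" "z * m3 - y * n3 = t1 * g3"
    using par[OF m n] by blast
  obtain t2 where t2: "x * n1 - z * l1 = t2 * g1" "x * n2 - z * l2 = t2 * g2" "x * n3 - z * l3 = t2 * g3"
    using par[OF n l] by blast
  have tg: "(t1 * x + t2 * y + t3 * z) * g1 = 0" "(t1 * x + t2 * y + t3 * z) * g2 = 0" "(t1 * x + t2 * y + t3 * z) * g3 = 0"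
    by (rule lin3[OF t1(1) t2(1) t3(1), where c = "- x" and c' = "- y" and c'' = "- z"], Groebner_Basis.algebra,
        rule lin3[OF t1(2) t2(2) t3(2), where c = "- x" and c' = "- y" and c'' = "- z"], Groebner_Basis.algebra,
        rule lin3[OF t1(3) t2(3) t3(3), where c = "- x" and c' = "- y" and c'' = "- z"], Groebner_Basis.algebra)
  then have "t1 * x + t2 * y + t3 * z = 0" using g0 by auto
  then obtain s1 s2 s3 where s: "t1 = y * s3 - z * s2" "t2 = z * s1 - x * s3" "t3 = x * s2 - y * s1"
    using k1 by (blast elim: koszul1D)
  have div: "\<exists>v. p + s1 * g = v * x" if "y * p - x * q = t3 * g" "z * q - y * r = t1 * g" "x * r - z * p = t2 * g"
    for p q r g
  proof (rule koszul2D[OF k2])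
    show "y * (r + s3 * g) = z * (q + s2 * g)"
      by (rule lin1[OF that(2)[unfolded s], where c = "- 1"]) Groebner_Basis.algebra
    show "z * (p + s1 * g) = x * (r + s3 * g)"
      by (rule lin1[OF that(3)[unfolded s], where c = "- 1"]) Groebner_Basis.algebra
    show "x * (q + s2 * g) = y * (p + s1 * g)"
      by (rule lin1[OF that(1)[unfolded s], where c = "- 1"]) Groebner_Basis.algebra
  qed blast
  obtain v1 where v1: "l1 + s1 * g1 = v1 * x" using div[OF t3(1) t1(1) t2(1)] by blast
  obtain v2 where v2: "l2 + s1 * g2 = v2 * x" using div[OF t3(2) t1(2) t2(2)] by blast
  obtain v3 where v3: "l3 + s1 * g3 = v3 * x" using div[OF t3(3) t1(3) t2(3)] by blast
  have "x * u1 = x * (g2 * v3 - g3 * v2)"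
    by (rule lin3[OF l(1) v3 v2, where c = 1 and c' = g2 and c'' = "- g3"]) Groebner_Basis.algebra
  moreover have "x * u2 = x * (g3 * v1 - g1 * v3)"
    by (rule lin3[OF l(2) v1 v3, where c = 1 and c' = g3 and c'' = "- g1"]) Groebner_Basis.algebra
  moreover have "x * u3 = x * (g1 * v2 - g2 * v1)"
    by (rule lin3[OF l(3) v2 v1, where c = 1 and c' = g1 and c'' = "- g2"]) Groebner_Basis.algebra
  ultimately have "u1 = g2 * v3 - g3 * v2" "u2 = g3 * v1 - g1 * v3" "u3 = g1 * v2 - g2 * v1"
    using x0 by simp_all
  then show "\<exists>b1 b2 b3. u1 = g2 * b3 - g3 * b2 \<and> u2 = g3 * b1 - g1 * b3 \<and> u3 = g1 * b2 - g2 * b1"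
    by blast
qed

section \<open>Prime ideals of polynomial rings\<close>

definition ideal_set :: "'a::comm_ring_1 set \<Rightarrow> bool" where
  "ideal_set I \<longleftrightarrow> 0 \<in> I \<and> (\<forall>a\<in>I. \<forall>b\<in>I. a + b \<in> I) \<and> (\<forall>a. \<forall>b\<in>I. a * b \<in> I)"

definition prime_set :: "'a::comm_ring_1 set \<Rightarrow> bool" where
  "prime_set P \<longleftrightarrow> ideal_set P \<and> 1 \<notin> P \<and> (\<forall>a b. a * b \<in> P \<longrightarrow> a \<in> P \<or> b \<in> P)"

lemma ideal_setD:
  assumes "ideal_set I"
  shows ideal_set_0: "0 \<in> I" and ideal_set_add: "a \<in> I \<Longrightarrow> b \<in> I \<Longrightarrow> a + b \<in> I"
    and ideal_set_mult: "b \<in> I \<Longrightarrow> a * b \<in> I" and ideal_set_mult2: "b \<in> I \<Longrightarrow> b * a \<in> I"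
  using assms unfolding ideal_set_def by (auto simp: mult.commute)

lemma ideal_set_diff: "ideal_set I \<Longrightarrow> a \<in> I \<Longrightarrow> b \<in> I \<Longrightarrow> a - b \<in> I"
  using ideal_set_add[of I a "- 1 * b"] ideal_set_mult[of I b "- 1"] by simp

lemma ideal_set_sum: "ideal_set I \<Longrightarrow> (\<And>i. i \<in> A \<Longrightarrow> g i \<in> I) \<Longrightarrow> sum g A \<in> I"
  by (induction A rule: infinite_finite_induct) (auto simp: ideal_setD)

lemma ideal_set_diff_iff: "ideal_set I \<Longrightarrow> b \<in> I \<Longrightarrow> a - b \<in> I \<longleftrightarrow> a \<in> I"
  using ideal_set_add[of I "a - b" b] ideal_set_diff[of I a b] by auto

lemma ideal_set_add_iff: "ideal_set I \<Longrightarrow> b \<in> I \<Longrightarrow> a + b \<in> I \<longleftrightarrow> a \<in> I"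
  using ideal_set_add[of I a b] ideal_set_diff[of I "a + b" b] by auto

lemma prime_setD:
  assumes "prime_set P"
  shows prime_set_ideal: "ideal_set P" and prime_set_1: "1 \<notin> P"
    and prime_set_mult: "a * b \<in> P \<longleftrightarrow> a \<in> P \<or> b \<in> P"
  using assms unfolding prime_set_def by (auto simp: ideal_setD)

lemma prime_set_power: "prime_set P \<Longrightarrow> a ^ n \<in> P \<Longrightarrow> a \<in> P"
  by (induction n) (auto simp: prime_setD)

lemma prime_set_0: "prime_set {0 :: 'a::idom}"
  unfolding prime_set_def ideal_set_def by auto

text \<open>By Zorn an ideal that is maximal among those avoiding the powers of \<open>v\<close> exists; it is
  prime.\<close>

lemma exists_prime_avoiding_powers:
  assumes I: "ideal_set I" and v: "\<And>n. v ^ n \<notin> I"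
  obtains P where "prime_set P" "I \<subseteq> P" "v \<notin> P"
proof -
  define A where "A = {J. ideal_set J \<and> I \<subseteq> J \<and> (\<forall>n. v ^ n \<notin> J)}"
  have "\<Union>C \<in> A" if "C \<noteq> {}" "subset.chain A C" for C
  proof -
    have CA: "C \<subseteq> A" and lin: "\<And>J K. J \<in> C \<Longrightarrow> K \<in> C \<Longrightarrow> J \<subseteq> K \<or> K \<subseteq> J"
      using that(2) unfolding subset.chain_def by auto
    have "ideal_set (\<Union>C)"
      unfolding ideal_set_def
    proof (intro conjI ballI allI)
      show "0 \<in> \<Union>C" using that(1) CA unfolding A_def ideal_set_def by blast
      show "a + b \<in> \<Union>C" if ab: "a \<in> \<Union>C" "b \<in> \<Union>C" for a b
      proof -
        obtain J K where "a \<in> J" "J \<in> C" "b \<in> K" "K \<in> C" using ab by blast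
        then obtain L where "a \<in> L" "b \<in> L" "L \<in> C" using lin[of J K] by blast
        then show ?thesis using CA unfolding A_def ideal_set_def by blast
      qed
      show "a * b \<in> \<Union>C" if "b \<in> \<Union>C" for a b
        using that CA unfolding A_def ideal_set_def by blast
    qed
    then show ?thesis using that(1) CA unfolding A_def by blast
  qed
  moreover have "A \<noteq> {}" using I v unfolding A_def by blast
  ultimately obtain M where MA: "M \<in> A" and max: "\<And>K. K \<in> A \<Longrightarrow> M \<subseteq> K \<Longrightarrow> K = M"
    using subset_Zorn_nonempty[of A] by blast
  then have M: "ideal_set M" "I \<subseteq> M" "\<And>n. v ^ n \<notin> M" unfolding A_def by auto
  have grow: "\<exists>n m r. m \<in> M \<and> v ^ n = m + r * a" if "a \<notin> M" for a
  proof (rule ccontr)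
    assume no: "\<not> ?thesis"
    define K where "K = {m + r * a | m r. m \<in> M}"
    have "ideal_set K"
      unfolding ideal_set_def
    proof (intro conjI ballI allI)
      have "0 = 0 + 0 * a" by simp
      then show "0 \<in> K" unfolding K_def using ideal_set_0[OF M(1)] by blast
      show "b + c \<in> K" if bc: "b \<in> K" "c \<in> K" for b c
      proof -
        obtain m r m' r' where "b = m + r * a" "c = m' + r' * a" "m \<in> M" "m' \<in> M"
          using bc unfolding K_def by blast
        then have "b + c = (m + m') + (r + r') * a" "m + m' \<in> M"
          using ideal_set_add[OF M(1)] by (auto simp: ring_distribs ac_simps)
        then show ?thesis unfolding K_def by blast
      qed
      show "c * b \<in> K" if b: "b \<in> K" for b c
      proof -
        obtain m r where "b = m + r * a" "m \<in> M" using b unfolding K_def by blast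
        then have "c * b = c * m + (c * r) * a" "c * m \<in> M"
          using ideal_set_mult[OF M(1)] by (simp_all add: ring_distribs mult.assoc)
        then show ?thesis unfolding K_def by blast
      qed
    qed
    moreover have MK: "M \<subseteq> K"
    proof
      fix m assume "m \<in> M"
      moreover have "m = m + 0 * a" by simp
      ultimately show "m \<in> K" unfolding K_def by blast
    qed
    moreover have "v ^ n \<notin> K" for n using no unfolding K_def by blast
    ultimately have "K = M" using max M(2) unfolding A_def by blast
    moreover have "a = 0 + 1 * a" by simp
    then have "a \<in> K" unfolding K_def using ideal_set_0[OF M(1)] by blast
    ultimately show False using that by blast
  qed
  have "prime_set M"
    unfolding prime_set_def
  proof (intro conjI allI impI)
    show "1 \<notin> M" using M(3)[of 0] by simp
    show "a \<in> M \<or> b \<in> M" if ab: "a * b \<in> M" for a b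
    proof (rule ccontr)
      assume "\<not> ?thesis"
      then obtain n m r n' m' r' where *: "v ^ n = m + r * a" "m \<in> M" "v ^ n' = m' + r' * b" "m' \<in> M"
        using grow by blast
      have "v ^ (n + n') = v ^ n' * m + (r * a) * m' + (r * r') * (a * b)"
        unfolding power_add *(1) by (simp add: *(3) ring_distribs ac_simps)
      also have "\<dots> \<in> M"
        by (rule ideal_set_add[OF M(1) ideal_set_add[OF M(1)]]; rule ideal_set_mult[OF M(1)]; fact *(2,4) ab)
      finally show False using M(3) by blast
    qed
  qed (rule M)
  moreover have "v \<notin> M" using M(3)[of 1] by simp
  ultimately show thesis using that M(2) by blast
qed

text \<open>Gaussian elimination over the domain \<open>Q/P\<close>: with more unknowns than equations there is
  a solution that is nonzero modulo \<open>P\<close>.\<close>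

lemma homogeneous_system_solution:
  fixes A :: "'e \<Rightarrow> 'u \<Rightarrow> 'a::comm_ring_1"
  assumes "prime_set P" "finite E" "finite U" "card E < card U"
  obtains l where "\<exists>u\<in>U. l u \<notin> P" "\<And>e. e \<in> E \<Longrightarrow> (\<Sum>u\<in>U. A e u * l u) \<in> P"
proof -
  have "\<exists>l. (\<exists>u\<in>U. l u \<notin> P) \<and> (\<forall>e\<in>E. (\<Sum>u\<in>U. A e u * l u) \<in> P)"
    using assms(2-4)
  proof (induction E arbitrary: U A rule: finite_induct)
    case empty
    then show ?case using prime_set_1[OF assms(1)]
      by (intro exI[of _ "\<lambda>_. 1"]) (auto simp: card_gt_0_iff)
  next
    case (insert e E)
    note I = prime_set_ideal[OF assms(1)]
    show ?case
    proof (cases "\<forall>u\<in>U. A e u \<in> P")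
      case True
      have "card E < card U" using insert by simp
      with insert obtain l where "\<exists>u\<in>U. l u \<notin> P" "\<forall>e\<in>E. (\<Sum>u\<in>U. A e u * l u) \<in> P"
        by metis
      moreover have "(\<Sum>u\<in>U. A e u * l u) \<in> P"
        using True by (intro ideal_set_sum[OF I] ideal_set_mult2[OF I]) auto
      ultimately show ?thesis by blast
    next
      case False
      then obtain v where v: "v \<in> U" "A e v \<notin> P" by blast
      define V where "V = U - {v}"
      have V: "finite V" "v \<notin> V" "U = insert v V" "card E < card V"
        using v insert by (auto simp: V_def)
      obtain l where l: "\<exists>u\<in>V. l u \<notin> P"
          "\<forall>e'\<in>E. (\<Sum>u\<in>V. (A e v * A e' u - A e' v * A e u) * l u) \<in> P"
        using insert.IH[of V "\<lambda>e' u. A e v * A e' u - A e' v * A e u"] V by metis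
      define l' where "l' = (\<lambda>u. if u = v then - (\<Sum>u\<in>V. A e u * l u) else A e v * l u)"
      have l': "(\<Sum>u\<in>U. A e' u * l' u)
          = (\<Sum>u\<in>V. (A e v * A e' u - A e' v * A e u) * l u)" for e'
      proof -
        have "(\<Sum>u\<in>U. A e' u * l' u) = A e' v * l' v + (\<Sum>u\<in>V. A e' u * l' u)"
          using V by simp
        also have "(\<Sum>u\<in>V. A e' u * l' u) = (\<Sum>u\<in>V. A e v * A e' u * l u)"
          using V by (intro sum.cong) (auto simp: l'_def ac_simps)
        also have "A e' v * l' v = - (\<Sum>u\<in>V. A e' v * A e u * l u)"
          by (simp add: l'_def sum_distrib_left ac_simps)
        finally show ?thesis by (simp add: left_diff_distrib sum_subtractf)
      qed
      have "\<exists>u\<in>U. l' u \<notin> P"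
      proof -
        obtain u where "u \<in> V" "l u \<notin> P" using l(1) by blast
        then have "u \<in> U" "l' u \<notin> P"
          using V v prime_set_mult[OF assms(1)] by (auto simp: l'_def)
        then show ?thesis by blast
      qed
      moreover have "(\<Sum>u\<in>U. A e u * l' u) = 0"
        unfolding l' by (simp add: mult.commute)
      ultimately show ?thesis using l(2) l' ideal_set_0[OF I] by (intro exI[of _ l']) auto
    qed
  qed
  then show thesis using that by blast
qed

section \<open>Chains of primes in three variables\<close>

definition box :: "nat \<Rightarrow> nat \<Rightarrow> nat list set" where
  "box r N = {l. set l \<subseteq> {..N} \<and> length l = r}"

text \<open>For a family \<open>w l = a\<^sub>1^l\<^sub>1 \<dots> a\<^sub>r^l\<^sub>r\<close> of monomials in \<open>r\<close> elements, this says that these elements are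
  algebraically independent modulo \<open>P\<close>. Families indexed by exponent lists avoid polynomials in a varying
  number of variables.\<close>

definition indep_mod :: "'k::field poly3 set \<Rightarrow> nat \<Rightarrow> (nat list \<Rightarrow> 'k poly3) \<Rightarrow> bool" where
  "indep_mod P r w \<longleftrightarrow> (\<forall>N c. (\<Sum>l\<in>box r N. cst (c l) * w l) \<in> P \<longrightarrow> (\<forall>l\<in>box r N. c l = 0))"

definition tdeg_le :: "nat \<Rightarrow> 'k::comm_ring_1 poly3 \<Rightarrow> bool" where
  "tdeg_le n p \<longleftrightarrow> (\<forall>a b c. c3 p a b c \<noteq> 0 \<longrightarrow> a + b + c \<le> n)"

definition deg_bounded :: "nat \<Rightarrow> nat \<Rightarrow> (nat list \<Rightarrow> 'k::comm_ring_1 poly3) \<Rightarrow> bool" where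
  "deg_bounded D r w \<longleftrightarrow> (\<forall>N. \<forall>l\<in>box r N. tdeg_le (D * N) (w l))"

lemma finite_box: "finite (box r N)" and card_box: "card (box r N) = (N + 1) ^ r"
  using finite_lists_length_eq[of "{..N}" r] card_lists_length_eq[of "{..N}" r]
  by (simp_all add: box_def)

lemma sum_box_Suc: "(\<Sum>l\<in>box (Suc r) N. g l) = (\<Sum>e\<le>N. \<Sum>l\<in>box r N. g (e # l))"
proof -
  have "box (Suc r) N = (\<lambda>(e, l). e # l) ` ({..N} \<times> box r N)"
    unfolding box_def by (auto simp: length_Suc_conv image_iff)
  then have "(\<Sum>l\<in>box (Suc r) N. g l) = (\<Sum>(e, l)\<in>{..N} \<times> box r N. g (e # l))"
    by (simp add: sum.reindex inj_on_def case_prod_unfold)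
  then show ?thesis by (simp add: sum.cartesian_product)
qed

lemma tdeg_le_mult: "tdeg_le m p \<Longrightarrow> tdeg_le n q \<Longrightarrow> tdeg_le (m + n) (p * q)"
  unfolding tdeg_le_def
proof (intro allI impI)
  fix a b c
  assume p: "\<forall>a b c. c3 p a b c \<noteq> 0 \<longrightarrow> a + b + c \<le> m" and q: "\<forall>a b c. c3 q a b c \<noteq> 0 \<longrightarrow> a + b + c \<le> n"
    and "c3 (p * q) a b c \<noteq> 0"
  then obtain i j k where ijk: "i \<le> a" "j \<le> b" "k \<le> c" "c3 p i j k * c3 q (a - i) (b - j) (c - k) \<noteq> 0"
    unfolding c3_mult by (metis (no_types, lifting) atMost_iff sum.neutral)
  then have "c3 p i j k \<noteq> 0" "c3 q (a - i) (b - j) (c - k) \<noteq> 0" by auto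
  then have "i + j + k \<le> m" "(a - i) + (b - j) + (c - k) \<le> n" using p q by blast+
  then show "a + b + c \<le> m + n" using ijk by linarith
qed

lemma tdeg_le_1: "tdeg_le 0 (1 :: 'a::comm_ring_1 poly3)"
  using c3_cst[of "1 :: 'a"] by (simp add: tdeg_le_def)

lemma tdeg_le_power: "tdeg_le m p \<Longrightarrow> tdeg_le (m * e) (p ^ e)"
  by (induction e) (use tdeg_le_1 tdeg_le_mult in auto)

lemma tdeg_le_mono: "tdeg_le m p \<Longrightarrow> m \<le> n \<Longrightarrow> tdeg_le n p"
  unfolding tdeg_le_def by (meson le_trans)

lemma deg_bounded_extend:
  assumes "deg_bounded D r w" "tdeg_le E a"
  shows "deg_bounded (D + E) (Suc r) (\<lambda>l. w (tl l) * a ^ hd l)"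
  unfolding deg_bounded_def
proof (intro allI ballI)
  fix N l assume "l \<in> box (Suc r) N"
  then obtain e k where l: "l = e # k" "e \<le> N" "k \<in> box r N"
    unfolding box_def by (cases l) auto
  have "tdeg_le (D * N + E * e) (w k * a ^ e)"
    using assms l tdeg_le_mult tdeg_le_power unfolding deg_bounded_def by blast
  moreover have "D * N + E * e \<le> (D + E) * N" using l by (simp add: add_mult_distrib)
  ultimately show "tdeg_le ((D + E) * N) (w (tl l) * a ^ hd l)"
    unfolding l list.sel by (rule tdeg_le_mono)
qed

text \<open>An element of \<open>P'\<close> outside \<open>P\<close> adds one to the number of algebraically
  independent elements: in a relation modulo \<open>P\<close>, reduction modulo \<open>P'\<close>
  kills the coefficients of its lowest power, which can then be cancelled because \<open>P\<close>
  is prime.\<close>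

lemma indep_mod_extend:
  assumes P: "prime_set P" and P': "ideal_set P'" "P \<subseteq> P'" and a: "a \<in> P'" "a \<notin> P"
    and w: "indep_mod P' r w"
  shows "indep_mod P (Suc r) (\<lambda>l. w (tl l) * a ^ hd l)"
  unfolding indep_mod_def
proof (intro allI impI)
  fix N and c :: "nat list \<Rightarrow> 'a"
  define s where "s e = (\<Sum>l\<in>box r N. cst (c (e # l)) * w l)" for e
  assume "(\<Sum>l\<in>box (Suc r) N. cst (c l) * (w (tl l) * a ^ hd l)) \<in> P"
  then have S: "(\<Sum>e\<le>N. s e * a ^ e) \<in> P"
    by (simp add: sum_box_Suc s_def sum_distrib_right mult.assoc)
  have z: "e \<le> N \<Longrightarrow> s e = 0 \<and> (\<forall>l\<in>box r N. c (e # l) = 0)" for e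
  proof (induction e rule: less_induct)
    case (less e)
    have "(\<Sum>j\<le>N. s j * a ^ j) = (\<Sum>j=e..N. s j * a ^ j)"
      using less by (intro sum.mono_neutral_right) auto
    also have "\<dots> = (\<Sum>j=e..N. a ^ e * (s j * a ^ (j - e)))"
      by (intro sum.cong) (auto simp: power_add[symmetric] ac_simps)
    also have "\<dots> = a ^ e * (\<Sum>j=e..N. s j * a ^ (j - e))"
      by (simp add: sum_distrib_left)
    finally have "a ^ e * (\<Sum>j=e..N. s j * a ^ (j - e)) \<in> P" using S by simp
    then have "(\<Sum>j=e..N. s j * a ^ (j - e)) \<in> P"
      using prime_set_mult[OF P] prime_set_power[OF P] a(2) by blast
    then have "(\<Sum>j=e..N. s j * a ^ (j - e)) \<in> P'" using P' by blast
    also have "(\<Sum>j=e..N. s j * a ^ (j - e)) = s e + (\<Sum>j=Suc e..N. s j * a ^ (j - e))"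
      using less.prems by (simp add: sum.atLeast_Suc_atMost)
    finally have "s e \<in> P'"
    proof (subst (asm) ideal_set_add_iff[OF P'(1)])
      show "(\<Sum>j=Suc e..N. s j * a ^ (j - e)) \<in> P'"
      proof (intro ideal_set_sum[OF P'(1)] ideal_set_mult[OF P'(1)])
        fix j assume "j \<in> {Suc e..N}"
        then obtain k where "j - e = Suc k" using gr0_implies_Suc[of "j - e"] by auto
        then show "a ^ (j - e) \<in> P'" using a(1) ideal_set_mult2[OF P'(1)] by simp
      qed
    qed
    then have "\<forall>l\<in>box r N. c (e # l) = 0"
      using w[unfolded indep_mod_def, THEN spec[of _ N], THEN spec[of _ "\<lambda>l. c (e # l)"]] unfolding s_def by blast
    then show ?case unfolding s_def by simp
  qed
  show "\<forall>l\<in>box (Suc r) N. c l = 0"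
  proof
    fix l assume "l \<in> box (Suc r) N"
    then obtain e k where "l = e # k" "e \<le> N" "k \<in> box r N"
      unfolding box_def by (cases l) auto
    then show "c l = 0" using z by blast
  qed
qed

text \<open>There are \<open>(N + 1)\<^sup>r\<close> independent polynomials of degree at most \<open>D
  N\<close> in a space of dimension \<open>O(N\<^sup>3)\<close>; large \<open>N\<close> gives
  \<open>r \<le> 3\<close>.\<close>

lemma indep_mod_bound:
  assumes w: "indep_mod {0} r w" and D: "deg_bounded D r w"
  shows "r \<le> 3"
proof (rule ccontr)
  assume "\<not> r \<le> 3"
  then have r: "4 \<le> r" by simp
  define N where "N = (D + 2) ^ 3 - 1"
  have N: "N + 1 = (D + 2) ^ 3" unfolding N_def by simp
  define E where "E = {..D * N} \<times> {..D * N} \<times> {..D * N}"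
  have "card E = (D * N + 1) ^ 3" unfolding E_def by (simp add: card_cartesian_product power3_eq_cube)
  also have "\<dots> < ((D + 2) * (N + 1)) ^ 3" by (intro power_strict_mono) auto
  also have "\<dots> = (N + 1) ^ 4" unfolding power_mult_distrib N[symmetric] by (simp add: power_Suc[symmetric] del: power_Suc)
  also have "\<dots> \<le> (N + 1) ^ r" using r by (intro power_increasing) auto
  finally have "card E < card (box r N)" by (simp add: card_box)
  moreover define A where "A = (\<lambda>(a, b, c) u. c3 (w u) a b c)"
  moreover have "finite E" unfolding E_def by simp
  ultimately obtain l where l: "\<exists>u\<in>box r N. l u \<notin> {0}" "\<And>e. e \<in> E \<Longrightarrow> (\<Sum>u\<in>box r N. A e u * l u) \<in> {0}"
    using homogeneous_system_solution[OF prime_set_0 _ finite_box] by blast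
  have "(\<Sum>u\<in>box r N. cst (l u) * w u) = 0"
  proof (rule poly3_eqI)
    fix a b c
    show "c3 (\<Sum>u\<in>box r N. cst (l u) * w u) a b c = c3 0 a b c"
    proof (cases "(a, b, c) \<in> E")
      case True
      have "c3 (\<Sum>u\<in>box r N. cst (l u) * w u) a b c = (\<Sum>u\<in>box r N. A (a, b, c) u * l u)"
        unfolding c3_sum c3_cst_mult A_def by (simp add: mult.commute)
      then show ?thesis using l(2)[OF True] by simp
    next
      case False
      then have "\<not> a + b + c \<le> D * N" unfolding E_def by auto
      then have "c3 (w u) a b c = 0" if "u \<in> box r N" for u
        using D that unfolding deg_bounded_def tdeg_le_def by blast
      then show ?thesis by simp
    qed
  qed
  then show False using w l(1) unfolding indep_mod_def by blast
qed

section \<open>Coordinates independent modulo a prime\<close>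

definition pd :: "nat \<Rightarrow> 'k::idom poly3 \<Rightarrow> 'k poly3" where
  "pd i = (if i = 0 then dx else if i = 1 then dy else dz)"

definition var :: "nat \<Rightarrow> 'k::comm_ring_1 poly3" where
  "var i = (if i = 0 then xx else if i = 1 then yy else zz)"

text \<open>In characteristic zero the polynomials in the variables \<open>B\<close> are those killed by the
  other partial derivatives.\<close>

definition in_vars :: "nat set \<Rightarrow> 'k::idom poly3 set" where
  "in_vars B = {p. \<forall>i<3. i \<notin> B \<longrightarrow> pd i p = 0}"

lemma pd_simps [simp]: "pd i (p + q) = pd i p + pd i q" "pd i (p - q) = pd i p - pd i q"
  "pd i (cst k * p) = cst k * pd i p" "pd i 0 = 0" "pd i 1 = 0"
  by (auto simp: pd_def)

lemma pd_mult: "pd i (p * q) = pd i p * q + p * pd i q"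
  by (auto simp: pd_def partial_mult)

lemma pd_commute: "pd i (pd j p) = pd j (pd i p)"
  by (auto simp: pd_def partial_commute)

lemma pd_var: "i < 3 \<Longrightarrow> j < 3 \<Longrightarrow> pd i (var j) = (if i = j then 1 else 0)"
  by (auto simp: pd_def var_def less_Suc_eq numeral_3_eq_3)

lemma pd_sum: "pd i (sum g A) = (\<Sum>a\<in>A. pd i (g a))"
  by (induction A rule: infinite_finite_induct) auto

lemma pd_power_eq_0: "pd i p = 0 \<Longrightarrow> pd i (p ^ n) = 0"
  by (induction n) (auto simp: pd_mult)

lemma tdeg_le_pd: "tdeg_le n p \<Longrightarrow> tdeg_le (n - 1) (pd i p)"
  unfolding tdeg_le_def
proof (intro allI impI)
  fix a b c
  assume *: "\<forall>a b c. c3 p a b c \<noteq> 0 \<longrightarrow> a + b + c \<le> n" and "c3 (pd i p) a b c \<noteq> 0"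
  then have "c3 p (Suc a) b c \<noteq> 0 \<or> c3 p a (Suc b) c \<noteq> 0 \<or> c3 p a b (Suc c) \<noteq> 0"
    by (auto simp: pd_def c3_partial simp del: of_nat_Suc split: if_splits)
  then have "Suc a + b + c \<le> n"
    using *[rule_format, of "Suc a" b c] *[rule_format, of a "Suc b" c] *[rule_format, of a b "Suc c"] by auto
  then show "a + b + c \<le> n - 1" by simp
qed

text \<open>A polynomial without the variable \<open>j\<close> that is divisible by this variable vanishes.\<close>

lemma multiple_of_var_eq_0:
  fixes s :: "'k::field_char_0 poly3"
  assumes "j < 3" "pd j s = 0" "s = var j * q"
  shows "s = 0"
proof (rule poly3_eqI)
  fix a b c
  have d: "c3 (pd j s) a b c = 0" for a b c using assms by simp
  consider "j = 0" | "j = 1" | "j = 2" using assms(1) by linarith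
  then show "c3 s a b c = c3 0 a b c"
  proof cases
    case 1
    then show ?thesis using d[of "a - 1" b c] assms(3)
      by (cases a) (auto simp: pd_def var_def c3_partial c3_xx_mult simp del: of_nat_Suc)
  next
    case 2
    then show ?thesis using d[of a "b - 1" c] assms(3)
      by (cases b) (auto simp: pd_def var_def c3_partial c3_yy_mult simp del: of_nat_Suc)
  next
    case 3
    then show ?thesis using d[of a b "c - 1"] assms(3)
      by (cases c) (auto simp: pd_def var_def c3_partial c3_zz_mult simp del: of_nat_Suc)
  qed
qed

lemma ideal_set_multiples: "ideal_set (range ((*) (a :: 'a::comm_ring_1)))"
  unfolding ideal_set_def
proof (intro conjI ballI allI)
  show "0 \<in> range ((*) a)" by (metis mult_zero_right rangeI)
  show "b + c \<in> range ((*) a)" if "b \<in> range ((*) a)" "c \<in> range ((*) a)" for b c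
    using that by (auto simp: distrib_left[symmetric])
  show "c * b \<in> range ((*) a)" if "b \<in> range ((*) a)" for b c
    using that by (auto simp: mult.left_commute[of c])
qed

lemma monomial_family:
  assumes "finite B" "B \<subseteq> {..<3}"
  obtains w :: "nat list \<Rightarrow> 'k::field_char_0 poly3" and D
  where "\<And>l. w l \<in> in_vars B" "deg_bounded D (card B) w" "indep_mod {0} (card B) w"
proof -
  have "\<exists>(w :: nat list \<Rightarrow> 'k poly3) D. (\<forall>l. w l \<in> in_vars B) \<and> deg_bounded D (card B) w \<and> indep_mod {0} (card B) w"
    using assms
  proof (induction B rule: finite_induct)
    case empty
    have box0: "box 0 N = {[]}" for N unfolding box_def by auto
    show ?case
      by (rule exI[of _ "\<lambda>_. 1"], rule exI[of _ 0])
        (auto simp: in_vars_def deg_bounded_def tdeg_le_1 indep_mod_def box0 cst_eq_iff[of _ 0, unfolded cst_hom])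
  next
    case (insert j B)
    then obtain w :: "nat list \<Rightarrow> 'k poly3" and D where w: "\<forall>l. w l \<in> in_vars B"
      "deg_bounded D (card B) w" "indep_mod {0} (card B) w" by auto
    have j: "j < 3" using insert by auto
    have "indep_mod (range ((*) (var j))) (card B) w"
      unfolding indep_mod_def
    proof (intro allI impI)
      fix N and c :: "nat list \<Rightarrow> 'k"
      let ?s = "\<Sum>l\<in>box (card B) N. cst (c l) * w l"
      assume "?s \<in> range ((*) (var j))"
      moreover have "pd j ?s = 0"
        using w(1) insert.hyps j unfolding in_vars_def by (simp add: pd_sum)
      ultimately have "?s = 0" using multiple_of_var_eq_0[OF j] by blast
      then show "\<forall>l\<in>box (card B) N. c l = 0" using w(3) unfolding indep_mod_def by blast
    qed
    moreover have "var j \<in> range ((*) (var j :: 'k poly3))" by (metis mult_1_right rangeI)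
    moreover have "var j \<noteq> (0 :: 'k poly3)" by (simp add: var_def xx_def yy_def zz_def)
    moreover have "(0 :: 'k poly3) \<in> range ((*) (var j))" by (metis mult_zero_right rangeI)
    ultimately have "indep_mod {0} (Suc (card B)) (\<lambda>l. w (tl l) * var j ^ hd l)"
      by (intro indep_mod_extend[OF prime_set_0 ideal_set_multiples[of "var j"]]) auto
    moreover obtain E where "tdeg_le E (var j :: 'k poly3)"
      using c3_finite_support unfolding tdeg_le_def by blast
    then have "deg_bounded (D + E) (Suc (card B)) (\<lambda>l. w (tl l) * var j ^ hd l)"
      by (rule deg_bounded_extend[OF w(2)])
    moreover have "w (tl l) * var j ^ hd l \<in> in_vars (insert j B)" for l
      using w(1) j by (auto simp: in_vars_def pd_mult pd_power_eq_0 pd_var)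
    moreover have "card (insert j B) = Suc (card B)" using insert.hyps by simp
    ultimately show ?case by (intro exI[of _ "\<lambda>l. w (tl l) * var j ^ hd l"] exI[of _ "D + E"]) simp
  qed
  then show thesis using that by blast
qed

text \<open>Each strict inclusion of primes, and the nonzero \<open>f\<close> at the bottom, contributes one
  more algebraically independent element to the \<open>card B\<close> variables that are independent
  modulo the largest prime.\<close>

lemma prime_chain_bound:
  fixes f :: "'k::field_char_0 poly3"
  assumes B: "B \<subseteq> {..<3}" and ind: "in_vars B \<inter> C n \<subseteq> {0}"
    and C: "\<And>i. i \<le> n \<Longrightarrow> prime_set (C i)" "\<And>i. i < n \<Longrightarrow> C i \<subset> C (Suc i)"
    and f: "f \<in> C 0" "f \<noteq> 0"
  shows "card B + n + 1 \<le> 3"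
proof -
  have "finite B" using B finite_subset by blast
  then obtain w :: "nat list \<Rightarrow> 'k poly3" and D where w: "\<And>l. w l \<in> in_vars B"
      "deg_bounded D (card B) w" "indep_mod {0} (card B) w"
    using monomial_family[OF _ B] by blast
  have "indep_mod (C n) (card B) w"
    unfolding indep_mod_def
  proof (intro allI impI)
    fix N and c :: "nat list \<Rightarrow> 'k"
    let ?s = "\<Sum>l\<in>box (card B) N. cst (c l) * w l"
    assume "?s \<in> C n"
    moreover have "?s \<in> in_vars B" using w(1) by (auto simp: in_vars_def pd_sum)
    ultimately have "?s = 0" using ind by blast
    then show "\<forall>l\<in>box (card B) N. c l = 0" using w(3) unfolding indep_mod_def by blast
  qed
  then have "\<exists>w D. deg_bounded D (card B + i) w \<and> indep_mod (C (n - i)) (card B + i) w" if "i \<le> n" for i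
    using that
  proof (induction i)
    case 0
    then show ?case using w(2) by auto
  next
    case (Suc i)
    then obtain w D where w: "deg_bounded D (card B + i) w" "indep_mod (C (n - i)) (card B + i) w"
      by auto
    have ni: "n - i = Suc (n - Suc i)" "n - Suc i < n" using Suc.prems by auto
    then have sub: "C (n - Suc i) \<subset> C (n - i)" using C(2)[of "n - Suc i"] by simp
    then obtain a where a: "a \<in> C (n - i)" "a \<notin> C (n - Suc i)" by blast
    have "indep_mod (C (n - Suc i)) (Suc (card B + i)) (\<lambda>l. w (tl l) * a ^ hd l)"
      using C(1)[of "n - i"] C(1)[of "n - Suc i"] sub a w(2)
      by (intro indep_mod_extend) (auto simp: prime_setD)
    moreover obtain E where E: "tdeg_le E a" using c3_finite_support unfolding tdeg_le_def by blast
    ultimately show ?case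
      using deg_bounded_extend[OF w(1) E]
      by (intro exI[of _ "\<lambda>l. w (tl l) * a ^ hd l"] exI[of _ "D + E"]) simp
  qed
  from this[of n] obtain w D where w: "deg_bounded D (card B + n) w" "indep_mod (C 0) (card B + n) w"
    by auto
  have "indep_mod {0} (Suc (card B + n)) (\<lambda>l. w (tl l) * f ^ hd l)"
    using C(1)[of 0] f w(2) by (intro indep_mod_extend[OF prime_set_0]) (auto simp: prime_setD ideal_setD)
  moreover obtain E where E: "tdeg_le E f" using c3_finite_support unfolding tdeg_le_def by blast
  ultimately have "Suc (card B + n) \<le> 3"
    using indep_mod_bound deg_bounded_extend[OF w(1) E] by blast
  then show ?thesis by simp
qed

lemma maximal_independent_variables:
  assumes "prime_set (P :: 'k::field_char_0 poly3 set)"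
  obtains B where "B \<subseteq> {..<3}" "in_vars B \<inter> P \<subseteq> {0}"
    "\<And>j. j \<in> {..<3} - B \<Longrightarrow> \<not> in_vars (insert j B) \<inter> P \<subseteq> {0}"
proof -
  define A where "A = {B. B \<subseteq> {..<3} \<and> in_vars B \<inter> P \<subseteq> {0}}"
  have "finite A" unfolding A_def by (rule finite_subset[of _ "Pow {..<3}"]) auto
  moreover have "{} \<in> A"
  proof -
    have "p \<in> P \<longrightarrow> p = 0" if p: "p \<in> in_vars {}" for p
    proof
      assume "p \<in> P"
      have z: "dx p = 0" "dy p = 0" "dz p = 0"
        using p by (auto simp: in_vars_def pd_def dest: spec[of _ 0] spec[of _ 1] spec[of _ 2])
      have nz: "c3 p (Suc a) b c = 0" "c3 p a (Suc b) c = 0" "c3 p a b (Suc c) = 0" for a b c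
        using c3_dx[of p a b c] c3_dy[of p a b c] c3_dz[of p a b c] z by (simp_all del: of_nat_Suc)
      have "c3 p a b c = c3 (cst (c3 p 0 0 0)) a b c" for a b c
      proof (cases "a = 0 \<and> b = 0 \<and> c = 0")
        case False
        then consider a' where "a = Suc a'" | b' where "b = Suc b'" | c' where "c = Suc c'"
          by (meson not0_implies_Suc)
        then have "c3 p a b c = 0" by cases (simp_all add: nz)
        then show ?thesis unfolding c3_cst using False by auto
      qed (simp add: c3_cst)
      then have "p = cst (c3 p 0 0 0)" by (rule poly3_eqI)
      then obtain k where pc: "p = cst k" by blast
      show "p = 0"
      proof (rule ccontr)
        assume "p \<noteq> 0"
        then have "k \<noteq> 0" using pc by auto
        then have "cst (inverse k) * p = 1" unfolding pc cst_mult[symmetric] by simp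
        moreover have "cst (inverse k) * p \<in> P"
          by (rule ideal_set_mult[OF prime_set_ideal[OF assms] \<open>p \<in> P\<close>])
        ultimately show False using prime_set_1[OF assms] by simp
      qed
    qed
    then show ?thesis unfolding A_def by auto
  qed
  ultimately obtain B where B: "B \<in> A" "\<And>B'. B' \<in> A \<Longrightarrow> B \<subseteq> B' \<Longrightarrow> B = B'"
    using finite_has_maximal[of A] by blast
  show thesis
  proof (rule that)
    show "B \<subseteq> {..<3}" "in_vars B \<inter> P \<subseteq> {0}" using B(1) unfolding A_def by auto
    show "\<not> in_vars (insert j B) \<inter> P \<subseteq> {0}" if "j \<in> {..<3} - B" for j
      using B(2)[of "insert j B"] B(1) that unfolding A_def by auto
  qed
qed

text \<open>A nonzero polynomial of minimal degree in \<open>P\<close> that involves, besides the independent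
  variables, only the variable \<open>j\<close>. Its derivative in \<open>j\<close> has smaller
  degree, so it can lie in \<open>P\<close> only if it is zero, and in characteristic zero this
  would contradict the independence of the variables in \<open>B\<close>.\<close>

lemma jacobian_element:
  fixes P :: "'k::field_char_0 poly3 set"
  assumes P: "prime_set P" and j: "j \<in> {..<3} - B" and ind: "in_vars B \<inter> P \<subseteq> {0}"
    and dep: "\<not> in_vars (insert j B) \<inter> P \<subseteq> {0}"
  obtains p where "p \<in> P" "pd j p \<notin> P" "\<And>i. i \<in> {..<3} - B \<Longrightarrow> i \<noteq> j \<Longrightarrow> pd i p = 0"
proof -
  define good where "good n \<longleftrightarrow> (\<exists>p. p \<in> in_vars (insert j B) \<inter> P \<and> p \<noteq> 0 \<and> tdeg_le n p)" for n
  obtain p0 where "p0 \<in> in_vars (insert j B) \<inter> P" "p0 \<noteq> 0" using dep by blast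
  moreover obtain n where "tdeg_le n p0" using c3_finite_support unfolding tdeg_le_def by blast
  ultimately have "good n" unfolding good_def by blast
  then have gl: "good (LEAST n. good n)" by (rule LeastI)
  define m where "m = (LEAST n. good n)"
  obtain p where p: "p \<in> in_vars (insert j B)" "p \<in> P" "p \<noteq> 0" "tdeg_le m p"
    using gl unfolding m_def good_def by blast
  have "pd j p \<notin> P"
  proof
    assume dP: "pd j p \<in> P"
    have "pd j p \<in> in_vars (insert j B)"
      using p(1) by (auto simp: in_vars_def pd_commute[of _ j])
    have "pd j p = 0"
    proof (cases "m = 0")
      case True
      then have "tdeg_le 0 (pd j p)" using tdeg_le_pd[OF p(4), of j] by simp
      show ?thesis
        using p(4) True unfolding tdeg_le_def
        by (intro poly3_eqI) (auto simp: pd_def c3_partial simp del: of_nat_Suc)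
    next
      case False
      then have "\<not> good (m - 1)" using not_less_Least[of "m - 1" good] unfolding m_def by auto
      then show ?thesis
        using tdeg_le_pd[OF p(4), of j] dP \<open>pd j p \<in> in_vars (insert j B)\<close> unfolding good_def by blast
    qed
    then have "p \<in> in_vars B" using p(1) unfolding in_vars_def by auto
    then show False using p ind by blast
  qed
  moreover have "pd i p = 0" if "i \<in> {..<3} - B" "i \<noteq> j" for i
    using p(1) that unfolding in_vars_def by auto
  ultimately show thesis using that p(2) by blast
qed

text \<open>The elements of \<open>jacobian_element\<close> have a diagonal Jacobian matrix of size \<open>3 -
  card B\<close> that is invertible modulo \<open>P\<close>. If fewer gradients spanned all the
  others modulo \<open>P\<close>, its rows would be linearly dependent there.\<close>

lemma jacobian_generator_bound:
  fixes P :: "'k::field_char_0 poly3 set"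
  assumes P: "prime_set P" and "finite I" and B: "in_vars B \<inter> P \<subseteq> {0}"
    and dep: "\<And>j. j \<in> {..<3} - B \<Longrightarrow> \<not> in_vars (insert j B) \<inter> P \<subseteq> {0}"
    and gen: "\<And>p. p \<in> P \<Longrightarrow> \<exists>s c. s \<notin> P \<and> (\<forall>i<3. s * pd i p - (\<Sum>u\<in>I. c u * pd i (q u)) \<in> P)"
  shows "card ({..<3} - B) \<le> card I"
proof (rule ccontr)
  assume "\<not> ?thesis"
  then have less: "card I < card ({..<3} - B)" by simp
  define J where "J = {..<3} - B"
  define good where "good j p s c \<longleftrightarrow> pd j p \<notin> P \<and> (\<forall>i\<in>J. i \<noteq> j \<longrightarrow> pd i p = 0) \<and> s \<notin> P \<and>
      (\<forall>i<3. s * pd i p - (\<Sum>u\<in>I. c u * pd i (q u)) \<in> P)" for j p s c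
  have "\<exists>p s c. good j p s c" if "j \<in> J" for j
  proof -
    have j: "j \<in> {..<3} - B" using that unfolding J_def .
    obtain p where "p \<in> P" "pd j p \<notin> P" "\<And>i. i \<in> J \<Longrightarrow> i \<noteq> j \<Longrightarrow> pd i p = 0"
      using jacobian_element[OF P j B dep[OF j]] unfolding J_def by blast
    moreover from gen[OF \<open>p \<in> P\<close>] obtain s c
      where "s \<notin> P" "\<forall>i<3. s * pd i p - (\<Sum>u\<in>I. c u * pd i (q u)) \<in> P" by blast
    ultimately show ?thesis unfolding good_def by blast
  qed
  then obtain p s c where G: "\<And>j. j \<in> J \<Longrightarrow> good j (p j) (s j) (c j)" by metis
  have p: "pd j (p j) \<notin> P" "s j \<notin> P" "\<forall>i<3. s j * pd i (p j) - (\<Sum>u\<in>I. c j u * pd i (q u)) \<in> P"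
    if "j \<in> J" for j
    using G[OF that] unfolding good_def by simp_all
  have p0: "pd i (p j) = 0" if "j \<in> J" "i \<in> J" "i \<noteq> j" for i j
    using G[OF that(1)] that unfolding good_def by simp
  have fJ: "finite J" unfolding J_def by simp
  obtain l where l: "\<exists>j\<in>J. l j \<notin> P" "\<And>u. u \<in> I \<Longrightarrow> (\<Sum>j\<in>J. c j u * l j) \<in> P"
    by (rule homogeneous_system_solution[OF P \<open>finite I\<close> fJ less[folded J_def], where A = "\<lambda>u j. c j u"])
      (auto simp only:)
  then obtain k where k: "k \<in> J" "l k \<notin> P" by blast
  then have k3: "k < 3" unfolding J_def by auto
  note I = prime_set_ideal[OF P]
  define S1 S2 where "S1 = (\<Sum>j\<in>J. l j * (s j * pd k (p j)))"
    and "S2 = (\<Sum>u\<in>I. pd k (q u) * (\<Sum>j\<in>J. c j u * l j))"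
  have "S2 = (\<Sum>u\<in>I. \<Sum>j\<in>J. l j * (c j u * pd k (q u)))"
    unfolding S2_def sum_distrib_left by (intro sum.cong refl) (simp only: ac_simps)
  also have "\<dots> = (\<Sum>j\<in>J. l j * (\<Sum>u\<in>I. c j u * pd k (q u)))"
    unfolding sum_distrib_left by (rule sum.swap)
  finally have "S1 - S2 = (\<Sum>j\<in>J. l j * (s j * pd k (p j) - (\<Sum>u\<in>I. c j u * pd k (q u))))"
    unfolding S1_def by (simp only: right_diff_distrib sum_subtractf)
  also have "\<dots> \<in> P"
  proof (rule ideal_set_sum[OF I], rule ideal_set_mult[OF I])
    show "s j * pd k (p j) - (\<Sum>u\<in>I. c j u * pd k (q u)) \<in> P" if "j \<in> J" for j
      using p(3)[OF that] k3 by blast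
  qed
  finally have "S1 - S2 \<in> P" .
  moreover have "S2 \<in> P"
    unfolding S2_def by (rule ideal_set_sum[OF I], rule ideal_set_mult[OF I], rule l(2))
  ultimately have "S1 \<in> P" using ideal_set_diff_iff[OF I] by blast
  moreover have "S1 = l k * (s k * pd k (p k))"
  proof -
    have "l j * (s j * pd k (p j)) = 0" if "j \<in> J - {k}" for j
      using p0[of j k] that k(1) by auto
    then show ?thesis unfolding S1_def using fJ k(1) by (subst sum.remove[of _ k]) (auto intro!: sum.neutral simp del: mult_eq_0_iff)
  qed
  ultimately have "l k * (s k * pd k (p k)) \<in> P" by simp
  then show False using p(1,2)[OF k(1)] k(2) by (simp add: prime_set_mult[OF P])
qed

section \<open>The hypersurface ring\<close>

context
  fixes f :: "'k::field_char_0 poly3"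
begin

abbreviation "Q_ring \<equiv> (ring_of_type_algebra :: 'k poly3 ring)"

lemma Q_ring_simps: "carrier Q_ring = UNIV" "x \<otimes>\<^bsub>Q_ring\<^esub> y = x * y" "x \<oplus>\<^bsub>Q_ring\<^esub> y = x + y"
    "\<one>\<^bsub>Q_ring\<^esub> = 1" "\<zero>\<^bsub>Q_ring\<^esub> = 0"
  by (simp_all add: ring_of_type_algebra_def)

lemma Q_cring: "cring Q_ring"
  by (rule cring_from_type_algebra)

lemma hyp_ideal_eq: "hyp_ideal f = {h. f dvd h}"
  by (auto simp: hyp_ideal_def cgenideal_def Q_ring_simps dvd_def mult.commute)

lemma hyp_ideal: "ideal (hyp_ideal f) Q_ring"
  unfolding hyp_ideal_def by (rule cring.cgenideal_ideal[OF Q_cring]) (simp add: Q_ring_simps)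

lemma hyp_class_eq: "hyp_class f g = {h. f dvd h - g}"
proof -
  have "hyp_class f g = {h + g | h. f dvd h}"
    by (auto simp: hyp_class_def a_r_coset_def' Q_ring_simps hyp_ideal_eq)
  also have "\<dots> = {h. f dvd h - g}"
    by (auto intro: exI[of _ "_ - g"])
  finally show ?thesis .
qed

lemma hyp_class_eq_iff: "hyp_class f a = hyp_class f b \<longleftrightarrow> f dvd a - b"
proof
  show "f dvd a - b" if "hyp_class f a = hyp_class f b"
  proof -
    have "a \<in> hyp_class f a" by (simp add: hyp_class_eq)
    then show ?thesis unfolding that by (simp add: hyp_class_eq)
  qed
  show "hyp_class f a = hyp_class f b" if "f dvd a - b"
  proof -
    have "f dvd h - a \<longleftrightarrow> f dvd h - b" for h
      using that dvd_add[OF _ that, of "h - a"] dvd_diff[OF _ that, of "h - b"] by auto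
    then show ?thesis by (simp add: hyp_class_eq)
  qed
qed

lemma hyp_class_hom: "hyp_class f \<in> Ring.ring_hom Q_ring (hyp_ring f)"
  unfolding hyp_ring_def hyp_class_def[abs_def] by (rule ideal.rcos_ring_hom[OF hyp_ideal])

lemma hyp_ring_cring: "cring (hyp_ring f)"
  unfolding hyp_ring_def by (rule ideal.quotient_is_cring[OF hyp_ideal Q_cring])

lemma carrier_hyp_ring: "carrier (hyp_ring f) = range (hyp_class f)"
  by (auto simp: hyp_ring_def FactRing_def A_RCOSETS_def' hyp_class_def Q_ring_simps)

lemma hyp_class_carrier [simp]: "hyp_class f a \<in> carrier (hyp_ring f)"
  by (simp add: carrier_hyp_ring)

lemma hyp_class_mult [simp]: "hyp_class f a \<otimes>\<^bsub>hyp_ring f\<^esub> hyp_class f b = hyp_class f (a * b)"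
  and hyp_class_add [simp]: "hyp_class f a \<oplus>\<^bsub>hyp_ring f\<^esub> hyp_class f b = hyp_class f (a + b)"
  and hyp_class_one: "\<one>\<^bsub>hyp_ring f\<^esub> = hyp_class f 1"
  using Ring.ring_hom_mult[OF hyp_class_hom, of a b] Ring.ring_hom_add[OF hyp_class_hom, of a b]
    Ring.ring_hom_one[OF hyp_class_hom] by (simp_all add: Q_ring_simps)

lemma hyp_class_zero: "\<zero>\<^bsub>hyp_ring f\<^esub> = hyp_class f 0"
  using Ring.ring_hom_zero[OF hyp_class_hom] Q_cring hyp_ring_cring
  by (simp add: Q_ring_simps cring.axioms(1))

lemma hyp_class_a_inv [simp]: "\<ominus>\<^bsub>hyp_ring f\<^esub> hyp_class f a = hyp_class f (- a)"
proof -
  interpret cring "hyp_ring f" by (rule hyp_ring_cring)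
  have "hyp_class f (- a) \<oplus>\<^bsub>hyp_ring f\<^esub> hyp_class f a = \<zero>\<^bsub>hyp_ring f\<^esub>"
    by (simp add: hyp_class_zero)
  then show ?thesis by (metis hyp_class_carrier minus_equality)
qed

lemma hyp_class_minus [simp]: "hyp_class f a \<ominus>\<^bsub>hyp_ring f\<^esub> hyp_class f b = hyp_class f (a - b)"
  by (simp add: a_minus_def)

lemma hyp_class_finsum:
  "finite A \<Longrightarrow> (\<Oplus>\<^bsub>hyp_ring f\<^esub>i\<in>A. hyp_class f (g i)) = hyp_class f (\<Sum>i\<in>A. g i)"
proof (induction A rule: finite_induct)
  interpret cring "hyp_ring f" by (rule hyp_ring_cring)
  case empty
  show ?case by (simp add: hyp_class_zero)
next
  interpret cring "hyp_ring f" by (rule hyp_ring_cring)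
  case (insert i A)
  then show ?case by (subst finsum_insert) auto
qed

lemma ideal_hyp_ring:
  assumes "f \<in> I" and "\<And>a b. a \<in> I \<Longrightarrow> b \<in> I \<Longrightarrow> a + b \<in> I" and mult: "\<And>a b. b \<in> I \<Longrightarrow> a * b \<in> I"
  shows "ideal (hyp_class f ` I) (hyp_ring f)"
proof (rule idealI)
  interpret cring "hyp_ring f" by (rule hyp_ring_cring)
  show "ring (hyp_ring f)" by (rule ring_axioms)
  have "0 \<in> I" using mult[OF assms(1), of 0] by simp
  show "subgroup (hyp_class f ` I) (add_monoid (hyp_ring f))"
  proof (rule add.subgroupI)
    show "hyp_class f ` I \<subseteq> carrier (hyp_ring f)" by auto
    show "hyp_class f ` I \<noteq> {}" using \<open>0 \<in> I\<close> by blast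
    show "\<ominus>\<^bsub>hyp_ring f\<^esub> a \<in> hyp_class f ` I" if "a \<in> hyp_class f ` I" for a
      using that mult[of _ "- 1"] by auto
    show "a \<oplus>\<^bsub>hyp_ring f\<^esub> b \<in> hyp_class f ` I" if "a \<in> hyp_class f ` I" "b \<in> hyp_class f ` I" for a b
      using that assms(2) by auto
  qed
  show "x \<otimes>\<^bsub>hyp_ring f\<^esub> a \<in> hyp_class f ` I" "a \<otimes>\<^bsub>hyp_ring f\<^esub> x \<in> hyp_class f ` I"
    if "a \<in> hyp_class f ` I" "x \<in> carrier (hyp_ring f)" for a x
    using that mult by (auto simp: carrier_hyp_ring mult.commute[of _ "_ :: 'k poly3"])
qed

lemma hyp_class_mem_image:
  assumes "f \<in> I" and "\<And>a b. a \<in> I \<Longrightarrow> b \<in> I \<Longrightarrow> a + b \<in> I" and "\<And>a b. b \<in> I \<Longrightarrow> a * b \<in> I"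
  shows "hyp_class f a \<in> hyp_class f ` I \<longleftrightarrow> a \<in> I"
proof
  assume "hyp_class f a \<in> hyp_class f ` I"
  then obtain b where b: "b \<in> I" "f dvd a - b" by (auto simp: hyp_class_eq_iff)
  from b(2) obtain h where "a - b = f * h" by (rule dvdE)
  then have "a = b + h * f" by (simp add: diff_eq_eq ac_simps)
  then show "a \<in> I" using assms b by simp
qed auto

lemma irrelevant_ideal_eq:
  assumes "const_coeff f = 0"
  shows "irrelevant_ideal f = hyp_class f ` {p. const_coeff p = 0}"
proof
  interpret cring "hyp_ring f" by (rule hyp_ring_cring)
  show "irrelevant_ideal f \<subseteq> hyp_class f ` {p. const_coeff p = 0}"
    unfolding irrelevant_ideal_def
    by (rule genideal_minimal, rule ideal_hyp_ring) (use assms in auto)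
  have S: "{hyp_class f xx, hyp_class f yy, hyp_class f zz} \<subseteq> carrier (hyp_ring f)" by simp
  interpret I: ideal "irrelevant_ideal f" "hyp_ring f"
    unfolding irrelevant_ideal_def by (rule genideal_ideal[OF S])
  have mem: "hyp_class f xx \<in> irrelevant_ideal f" "hyp_class f yy \<in> irrelevant_ideal f"
    "hyp_class f zz \<in> irrelevant_ideal f"
    using genideal_self[OF S] unfolding irrelevant_ideal_def by auto
  show "hyp_class f ` {p. const_coeff p = 0} \<subseteq> irrelevant_ideal f"
  proof safe
    fix p :: "'k poly3" assume "const_coeff p = 0"
    then obtain u v w where p: "p = xx * u + yy * v + zz * w" by (rule const_coeff_eq_0_decompose)
    have "hyp_class f (xx * u) \<in> irrelevant_ideal f" "hyp_class f (yy * v) \<in> irrelevant_ideal f"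
      "hyp_class f (zz * w) \<in> irrelevant_ideal f"
      using mem I.I_r_closed[of "hyp_class f _" "hyp_class f _"] by auto
    then show "hyp_class f p \<in> irrelevant_ideal f"
      unfolding p hyp_class_add[symmetric] by (intro I.a_closed)
  qed
qed

end

section \<open>The local ring at a prime of the hypersurface\<close>

lemma UN2_const:
  assumes "a \<in> A" "b \<in> B" "\<And>z w. z \<in> A \<Longrightarrow> w \<in> B \<Longrightarrow> F z w = Y"
  shows "(\<Union>z\<in>A. \<Union>w\<in>B. F z w) = Y"
proof -
  have "(\<Union>z\<in>A. \<Union>w\<in>B. F z w) = (\<Union>z\<in>A. \<Union>w\<in>B. Y)"
    using assms(3) by (intro SUP_cong refl)
  then show ?thesis using assms(1,2) by auto
qed

locale hyp_prime =
  fixes f :: "'k::field_char_0 poly3" and P :: "'k poly3 set"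
  assumes P: "prime_set P" and fP: "f \<in> P"
begin

abbreviation "cls \<equiv> hyp_class f"
abbreviation "R \<equiv> hyp_ring f"

definition "S = carrier R - cls ` P"
definition "quo q s = fraction_rel R S `` {(cls q, cls s)}"
definition "L = localization R S"

lemmas I = prime_set_ideal[OF P]

lemma dvd_in_P: "f dvd a \<Longrightarrow> a \<in> P"
  using ideal_set_mult2[OF I fP] by (auto elim!: dvdE)

lemma cls_in_image: "cls a \<in> cls ` P \<longleftrightarrow> a \<in> P"
  by (rule hyp_class_mem_image[OF fP]) (auto intro: ideal_setD[OF I])

lemma cls_in_S: "cls s \<in> S \<longleftrightarrow> s \<notin> P"
  unfolding S_def using cls_in_image by auto

lemma S_cases: "c \<in> S \<Longrightarrow> (\<And>s. c = cls s \<Longrightarrow> s \<notin> P \<Longrightarrow> thesis) \<Longrightarrow> thesis"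
  unfolding S_def carrier_hyp_ring by auto

lemma primeideal_image: "primeideal (cls ` P) R"
proof (rule primeidealI)
  show "ideal (cls ` P) R"
    by (rule ideal_hyp_ring[OF fP]) (auto intro: ideal_setD[OF I])
  show "cring R" by (rule hyp_ring_cring)
  show "carrier R \<noteq> cls ` P"
    using cls_in_image[of 1] prime_set_1[OF P] hyp_class_carrier[of f 1] by metis
  show "a \<in> cls ` P \<or> b \<in> cls ` P" if h: "a \<in> carrier R" "b \<in> carrier R" "a \<otimes>\<^bsub>R\<^esub> b \<in> cls ` P" for a b
  proof -
    obtain p q where "a = cls p" "b = cls q" using h(1,2) unfolding carrier_hyp_ring by blast
    then show ?thesis using h(3) prime_set_mult[OF P, of p q] by (simp add: cls_in_image)
  qed
qed

lemma rel_iff: "((cls q, cls s), (cls q', cls s')) \<in> fraction_rel R S \<longleftrightarrow>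
    s \<notin> P \<and> s' \<notin> P \<and> (\<exists>u. u \<notin> P \<and> f dvd u * (q * s') - u * (q' * s))"
proof -
  have "(\<exists>c\<in>S. c \<otimes>\<^bsub>R\<^esub> (cls q \<otimes>\<^bsub>R\<^esub> cls s') = c \<otimes>\<^bsub>R\<^esub> (cls q' \<otimes>\<^bsub>R\<^esub> cls s)) \<longleftrightarrow>
      (\<exists>u. u \<notin> P \<and> f dvd u * (q * s') - u * (q' * s))"
  proof
    assume "\<exists>c\<in>S. c \<otimes>\<^bsub>R\<^esub> (cls q \<otimes>\<^bsub>R\<^esub> cls s') = c \<otimes>\<^bsub>R\<^esub> (cls q' \<otimes>\<^bsub>R\<^esub> cls s)"
    then show "\<exists>u. u \<notin> P \<and> f dvd u * (q * s') - u * (q' * s)"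
      by (auto elim!: S_cases simp: hyp_class_eq_iff)
  next
    assume "\<exists>u. u \<notin> P \<and> f dvd u * (q * s') - u * (q' * s)"
    then obtain u where u: "u \<notin> P" "f dvd u * (q * s') - u * (q' * s)" by blast
    then show "\<exists>c\<in>S. c \<otimes>\<^bsub>R\<^esub> (cls q \<otimes>\<^bsub>R\<^esub> cls s') = c \<otimes>\<^bsub>R\<^esub> (cls q' \<otimes>\<^bsub>R\<^esub> cls s)"
      by (intro bexI[of _ "cls u"]) (simp_all add: hyp_class_eq_iff cls_in_S)
  qed
  then show ?thesis unfolding fraction_rel_def by (simp add: cls_in_S)
qed

lemma equiv_rel: "equiv (carrier R \<times> S) (fraction_rel R S)"
proof (rule equivI)
  show "fraction_rel R S \<subseteq> (carrier R \<times> S) \<times> (carrier R \<times> S)"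
    unfolding fraction_rel_def by auto
  show "refl_on (carrier R \<times> S) (fraction_rel R S)"
    using prime_set_1[OF P] 
    by (auto simp: refl_on_def carrier_hyp_ring rel_iff cls_in_S elim!: S_cases)
  have rep: "\<exists>q s. z = (cls q, cls s)" if "z \<in> carrier R \<times> S" for z
    using that unfolding S_def carrier_hyp_ring by auto
  have field: "z \<in> carrier R \<times> S" "z' \<in> carrier R \<times> S" if "(z, z') \<in> fraction_rel R S" for z z'
    using that unfolding fraction_rel_def by auto
  show "sym (fraction_rel R S)"
  proof (rule symI)
    fix z z' assume z: "(z, z') \<in> fraction_rel R S"
    obtain q s q' s' where e: "z = (cls q, cls s)" "z' = (cls q', cls s')"
      using field[OF z] rep by metis
    obtain u where u: "u \<notin> P" "f dvd u * (q * s') - u * (q' * s)" "s \<notin> P" "s' \<notin> P"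
      using z unfolding e rel_iff by blast
    have "f dvd - (u * (q * s') - u * (q' * s))" using u(2) by (simp only: dvd_minus_iff)
    then have "f dvd u * (q' * s) - u * (q * s')" by (simp only: minus_diff_eq)
    then show "(z', z) \<in> fraction_rel R S"
      unfolding e rel_iff using u by blast
  qed
  show "trans (fraction_rel R S)"
  proof (rule transI)
    fix z z' z'' assume z: "(z, z') \<in> fraction_rel R S" "(z', z'') \<in> fraction_rel R S"
    obtain q s q' s' q'' s'' where e: "z = (cls q, cls s)" "z' = (cls q', cls s')" "z'' = (cls q'', cls s'')"
      using field[OF z(1)] field[OF z(2)] rep by metis
    obtain u v where uv: "u \<notin> P" "f dvd u * (q * s') - u * (q' * s)" "v \<notin> P"
      "f dvd v * (q' * s'') - v * (q'' * s')" "s \<notin> P" "s' \<notin> P" "s'' \<notin> P"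
      using z unfolding e rel_iff by blast
    have "f dvd v * s'' * (u * (q * s') - u * (q' * s)) + u * s * (v * (q' * s'') - v * (q'' * s'))"
      using uv by (intro dvd_add dvd_mult)
    moreover have "v * s'' * (u * (q * s') - u * (q' * s)) + u * s * (v * (q' * s'') - v * (q'' * s'))
      = (u * v * s') * (q * s'') - (u * v * s') * (q'' * s)"
      by Groebner_Basis.algebra
    ultimately have "f dvd (u * v * s') * (q * s'') - (u * v * s') * (q'' * s)" by (simp only:)
    moreover have "u * v * s' \<notin> P" using uv prime_set_mult[OF P] by simp
    ultimately show "(z, z'') \<in> fraction_rel R S" unfolding e rel_iff using uv by blast
  qed
qed

lemma quo_eq_iff:
  assumes "s \<notin> P" "s' \<notin> P"
  shows "quo q s = quo q' s' \<longleftrightarrow> (\<exists>u. u \<notin> P \<and> f dvd u * (q * s') - u * (q' * s))"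
  unfolding quo_def using assms
  by (subst eq_equiv_class_iff[OF equiv_rel]) (simp_all add: rel_iff cls_in_S)

lemma quo_mem: 
  assumes "z \<in> quo q s"
  obtains q' s' where "z = (cls q', cls s')" "s \<notin> P" "s' \<notin> P" "quo q' s' = quo q s"
proof -
  have z: "((cls q, cls s), z) \<in> fraction_rel R S" using assms unfolding quo_def by auto
  then obtain q' s' where e: "z = (cls q', cls s')"
    unfolding fraction_rel_def S_def carrier_hyp_ring by auto
  have "s \<notin> P" "s' \<notin> P" using z unfolding e rel_iff by auto
  moreover have "quo q' s' = quo q s"
    unfolding quo_def using equiv_class_eq[OF equiv_rel z] unfolding e by simp
  ultimately show thesis by (rule that[OF e])
qed

lemma quo_self: "s \<notin> P \<Longrightarrow> (cls q, cls s) \<in> quo q s"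
  unfolding quo_def using rel_iff[of q s q s] prime_set_1[OF P] by auto

lemma quo_mult_cong:
  assumes "s \<notin> P" "s' \<notin> P" "t \<notin> P" "t' \<notin> P" "quo q s = quo q' s'" "quo r t = quo r' t'"
  shows "quo (q * r) (s * t) = quo (q' * r') (s' * t')"
proof -
  obtain u v where u: "u \<notin> P" "f dvd u * (q * s') - u * (q' * s)" and v: "v \<notin> P" "f dvd v * (r * t') - v * (r' * t)"
    using assms quo_eq_iff by metis
  have "f dvd v * r * t' * (u * (q * s') - u * (q' * s)) + u * q' * s * (v * (r * t') - v * (r' * t))"
    using u v by (intro dvd_add dvd_mult)
  moreover have "v * r * t' * (u * (q * s') - u * (q' * s)) + u * q' * s * (v * (r * t') - v * (r' * t))
      = (u * v) * ((q * r) * (s' * t')) - (u * v) * ((q' * r') * (s * t))"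
    by Groebner_Basis.algebra
  ultimately have "f dvd (u * v) * ((q * r) * (s' * t')) - (u * v) * ((q' * r') * (s * t))" by (simp only:)
  then show ?thesis
    using assms(1-4) u v by (subst quo_eq_iff) (auto simp: prime_set_mult[OF P] intro!: exI[of _ "u * v"])
qed

lemma quo_add_cong:
  assumes "s \<notin> P" "s' \<notin> P" "t \<notin> P" "t' \<notin> P" "quo q s = quo q' s'" "quo r t = quo r' t'"
  shows "quo (q * t + r * s) (s * t) = quo (q' * t' + r' * s') (s' * t')"
proof -
  obtain u v where u: "u \<notin> P" "f dvd u * (q * s') - u * (q' * s)" and v: "v \<notin> P" "f dvd v * (r * t') - v * (r' * t)"
    using assms quo_eq_iff by metis
  have "f dvd v * t * t' * (u * (q * s') - u * (q' * s)) + u * s * s' * (v * (r * t') - v * (r' * t))"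
    using u v by (intro dvd_add dvd_mult)
  moreover have "v * t * t' * (u * (q * s') - u * (q' * s)) + u * s * s' * (v * (r * t') - v * (r' * t))
      = (u * v) * ((q * t + r * s) * (s' * t')) - (u * v) * ((q' * t' + r' * s') * (s * t))"
    by Groebner_Basis.algebra
  ultimately have "f dvd (u * v) * ((q * t + r * s) * (s' * t')) - (u * v) * ((q' * t' + r' * s') * (s * t))" by (simp only:)
  then show ?thesis
    using assms(1-4) u v by (subst quo_eq_iff) (auto simp: prime_set_mult[OF P] intro!: exI[of _ "u * v"])
qed

lemma L_carrier: "carrier L = {quo q s | q s. s \<notin> P}"
proof (intro Set.equalityI subsetI)
  have L: "carrier L = (carrier R \<times> S) // fraction_rel R S"
    unfolding L_def localization_def Let_def by simp
  show "x \<in> {quo q s | q s. s \<notin> P}" if x: "x \<in> carrier L" for x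
  proof -
    obtain a c where ac: "a \<in> carrier R" "c \<in> S" "x = fraction_rel R S `` {(a, c)}"
      using x unfolding L by (auto elim!: quotientE)
    obtain q where "a = cls q" using ac(1) unfolding carrier_hyp_ring by blast
    moreover obtain s where "c = cls s" "s \<notin> P" using ac(2) by (rule S_cases)
    ultimately show ?thesis using ac(3) unfolding quo_def by blast
  qed
  show "x \<in> carrier L" if "x \<in> {quo q s | q s. s \<notin> P}" for x
    using that unfolding L quo_def by (auto intro!: quotientI simp: cls_in_S)
qed

lemma quo_carrier [simp]: "s \<notin> P \<Longrightarrow> quo q s \<in> carrier L"
  unfolding L_carrier by blast

lemma L_mult [simp]:
  assumes "s \<notin> P" "t \<notin> P"
  shows "quo q s \<otimes>\<^bsub>L\<^esub> quo r t = quo (q * r) (s * t)"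
proof -
  have "quo q s \<otimes>\<^bsub>L\<^esub> quo r t = (\<Union>(a, s)\<in>quo q s. \<Union>(b, t)\<in>quo r t. fraction_rel R S `` {(a \<otimes>\<^bsub>R\<^esub> b, s \<otimes>\<^bsub>R\<^esub> t)})"
    unfolding L_def localization_def Let_def by simp
  also have "\<dots> = quo (q * r) (s * t)"
  proof -
    have "fraction_rel R S `` {(fst z \<otimes>\<^bsub>R\<^esub> fst w, snd z \<otimes>\<^bsub>R\<^esub> snd w)} = quo (q * r) (s * t)"
      if zw: "z \<in> quo q s" "w \<in> quo r t" for z w
    proof -
      obtain q' s' where z: "z = (cls q', cls s')" "s' \<notin> P" "quo q' s' = quo q s"
        using zw(1) by (rule quo_mem)
      obtain r' t' where w: "w = (cls r', cls t')" "t' \<notin> P" "quo r' t' = quo r t"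
        using zw(2) by (rule quo_mem)
      show ?thesis using quo_mult_cong[OF z(2) assms(1) w(2) assms(2) z(3) w(3)]
        unfolding z w by (simp add: quo_def)
    qed
    then show ?thesis
      unfolding case_prod_unfold by (rule UN2_const[OF quo_self[OF assms(1)] quo_self[OF assms(2)]])
  qed
  finally show ?thesis .
qed

lemma L_add [simp]:
  assumes "s \<notin> P" "t \<notin> P"
  shows "quo q s \<oplus>\<^bsub>L\<^esub> quo r t = quo (q * t + r * s) (s * t)"
proof -
  have "quo q s \<oplus>\<^bsub>L\<^esub> quo r t = (\<Union>(a, s)\<in>quo q s. \<Union>(b, t)\<in>quo r t.
      fraction_rel R S `` {((a \<otimes>\<^bsub>R\<^esub> t) \<oplus>\<^bsub>R\<^esub> (b \<otimes>\<^bsub>R\<^esub> s), s \<otimes>\<^bsub>R\<^esub> t)})"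
    unfolding L_def localization_def Let_def by simp
  also have "\<dots> = quo (q * t + r * s) (s * t)"
  proof -
    have "fraction_rel R S `` {((fst z \<otimes>\<^bsub>R\<^esub> snd w) \<oplus>\<^bsub>R\<^esub> (fst w \<otimes>\<^bsub>R\<^esub> snd z), snd z \<otimes>\<^bsub>R\<^esub> snd w)}
        = quo (q * t + r * s) (s * t)"
      if zw: "z \<in> quo q s" "w \<in> quo r t" for z w
    proof -
      obtain q' s' where z: "z = (cls q', cls s')" "s' \<notin> P" "quo q' s' = quo q s"
        using zw(1) by (rule quo_mem)
      obtain r' t' where w: "w = (cls r', cls t')" "t' \<notin> P" "quo r' t' = quo r t"
        using zw(2) by (rule quo_mem)
      show ?thesis using quo_add_cong[OF z(2) assms(1) w(2) assms(2) z(3) w(3)]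
        unfolding z w by (simp add: quo_def)
    qed
    then show ?thesis
      unfolding case_prod_unfold by (rule UN2_const[OF quo_self[OF assms(1)] quo_self[OF assms(2)]])
  qed
  finally show ?thesis .
qed

lemma L_one: "\<one>\<^bsub>L\<^esub> = quo 1 1" and L_zero: "\<zero>\<^bsub>L\<^esub> = quo 0 1"
  unfolding L_def localization_def Let_def quo_def by (simp_all add: hyp_class_one hyp_class_zero)

lemma quo_self_one: "s \<notin> P \<Longrightarrow> quo s s = \<one>\<^bsub>L\<^esub>"
  using prime_set_1[OF P] by (subst L_one, subst quo_eq_iff) auto

lemma quo_zero: "f dvd q \<Longrightarrow> s \<notin> P \<Longrightarrow> quo q s = \<zero>\<^bsub>L\<^esub>"
  using prime_set_1[OF P] by (subst L_zero, subst quo_eq_iff) (auto intro!: exI[of _ 1])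

end

section \<open>The Jacobian criterion\<close>

context hyp_prime
begin

lemma L_ideal:
  assumes "cring L" and E: "ideal_set E"
  shows "ideal {quo q s | q s. q \<in> E \<and> s \<notin> P} L"
proof (rule idealI)
  interpret L: cring L by fact
  let ?I = "{quo q s | q s. q \<in> E \<and> s \<notin> P}"
  have 1: "1 \<notin> P" by (rule prime_set_1[OF P])
  show "ring L" by (rule L.ring_axioms)
  have mult: "x \<otimes>\<^bsub>L\<^esub> a \<in> ?I" if h: "a \<in> ?I" "x \<in> carrier L" for a x
  proof -
    obtain q s r t where "a = quo q s" "q \<in> E" "s \<notin> P" "x = quo r t" "t \<notin> P"
      using h unfolding L_carrier by blast
    then have "x \<otimes>\<^bsub>L\<^esub> a = quo (r * q) (t * s)" "r * q \<in> E" "t * s \<notin> P"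
      using ideal_set_mult[OF E] prime_set_mult[OF P] by simp_all
    then show ?thesis by blast
  qed
  show "x \<otimes>\<^bsub>L\<^esub> a \<in> ?I" "a \<otimes>\<^bsub>L\<^esub> x \<in> ?I" if h: "a \<in> ?I" "x \<in> carrier L" for a x
  proof -
    show "x \<otimes>\<^bsub>L\<^esub> a \<in> ?I" by (rule mult[OF h])
    moreover have "a \<in> carrier L" using h(1) by auto
    ultimately show "a \<otimes>\<^bsub>L\<^esub> x \<in> ?I" using h(2) L.m_comm[of a x] by simp
  qed
  show "subgroup ?I (add_monoid L)"
  proof (rule L.add.subgroupI)
    show sub: "?I \<subseteq> carrier L" by auto
    show "?I \<noteq> {}" using ideal_set_0[OF E] 1 by blast
    show "\<ominus>\<^bsub>L\<^esub> a \<in> ?I" if h: "a \<in> ?I" for a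
    proof -
      have "\<ominus>\<^bsub>L\<^esub> a = (\<ominus>\<^bsub>L\<^esub> \<one>\<^bsub>L\<^esub>) \<otimes>\<^bsub>L\<^esub> a" using h sub by (simp add: L.l_minus subset_iff)
      then show ?thesis using mult[OF h] by simp
    qed
    show "a \<oplus>\<^bsub>L\<^esub> b \<in> ?I" if h: "a \<in> ?I" "b \<in> ?I" for a b
    proof -
      obtain q s r t where "a = quo q s" "q \<in> E" "s \<notin> P" "b = quo r t" "r \<in> E" "t \<notin> P"
        using h by blast
      then have "a \<oplus>\<^bsub>L\<^esub> b = quo (q * t + r * s) (s * t)" "q * t + r * s \<in> E" "s * t \<notin> P"
        using ideal_setD[OF E] prime_set_mult[OF P] by simp_all
      then show ?thesis by blast
    qed
  qed
qed

lemma quo_unit: "q \<notin> P \<Longrightarrow> s \<notin> P \<Longrightarrow> quo q s \<otimes>\<^bsub>L\<^esub> quo s q = \<one>\<^bsub>L\<^esub>"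
  by (simp add: quo_self_one prime_set_mult[OF P] mult.commute[of s q])

lemma L_ideal_unit:
  assumes "ideal J L" "quo q s \<in> J" "q \<notin> P" "s \<notin> P"
  shows "J = carrier L"
proof -
  interpret ideal J L by fact
  have "quo q s \<otimes>\<^bsub>L\<^esub> quo s q \<in> J" using assms by (intro I_r_closed) auto
  then show ?thesis using quo_unit[OF assms(3,4)] one_imp_carrier by simp
qed

lemma maximalideal_L:
  assumes "cring L"
  shows "maximalideal {quo q s | q s. q \<in> P \<and> s \<notin> P} L"
proof (rule maximalidealI)
  let ?M = "{quo q s | q s. q \<in> P \<and> s \<notin> P}"
  show "ideal ?M L" by (rule L_ideal[OF assms I])
  show "carrier L \<noteq> ?M"
  proof
    assume "carrier L = ?M"
    then have "quo 1 1 \<in> ?M" using prime_set_1[OF P] quo_carrier by blast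
    then obtain q s where qs: "q \<in> P" "s \<notin> P" "quo 1 1 = quo q s" by blast
    then obtain u where "u \<notin> P" "f dvd u * (1 * s) - u * (q * 1)"
      using quo_eq_iff[of 1 s 1 q] prime_set_1[OF P] by blast
    then have "u * s - u * q \<in> P" "u * q \<in> P" using dvd_in_P ideal_set_mult[OF I qs(1)] by auto
    then show False
      using ideal_set_diff_iff[OF I] \<open>u \<notin> P\<close> qs(2) prime_set_mult[OF P] by blast
  qed
  show "J = ?M \<or> J = carrier L" if J: "ideal J L" "?M \<subseteq> J" "J \<subseteq> carrier L" for J
  proof (cases "J = ?M")
    case False
    then obtain x where "x \<in> J" "x \<notin> ?M" using J(2) by blast
    then obtain q s where "quo q s \<in> J" "q \<notin> P" "s \<notin> P" using J(3) unfolding L_carrier by blast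
    then show ?thesis using L_ideal_unit[OF J(1)] by blast
  qed simp
qed

lemma contraction:
  assumes "primeideal J L"
  shows "prime_set {q. quo q 1 \<in> J}" "f \<in> {q. quo q 1 \<in> J}" "{q. quo q 1 \<in> J} \<subseteq> P"
proof -
  interpret primeideal J L by fact
  have 1: "1 \<notin> P" by (rule prime_set_1[OF P])
  have zJ: "\<zero>\<^bsub>L\<^esub> \<in> J" by (rule additive_subgroup.zero_closed[OF is_additive_subgroup])
  then have z: "quo 0 1 \<in> J" unfolding L_zero .
  have add: "quo (a + b) 1 \<in> J" if "quo a 1 \<in> J" "quo b 1 \<in> J" for a b
    using additive_subgroup.a_closed[OF is_additive_subgroup that] 1 by simp
  have mult: "quo (a * b) 1 \<in> J" if "quo b 1 \<in> J" for a b
    using I_l_closed[OF that, of "quo a 1"] 1 by simp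
  show "prime_set {q. quo q 1 \<in> J}"
    unfolding prime_set_def ideal_set_def
  proof (intro conjI ballI allI impI; unfold mem_Collect_eq)
    show "quo 1 1 \<notin> J" using one_imp_carrier I_notcarr unfolding L_one by auto
    show "quo a 1 \<in> J \<or> quo b 1 \<in> J" if "quo (a * b) 1 \<in> J" for a b
      using that I_prime[of "quo a 1" "quo b 1"] 1 by simp
  qed (use z add mult in auto)
  show "f \<in> {q. quo q 1 \<in> J}"
    using quo_zero[of f 1] 1 zJ by simp
  show "{q. quo q 1 \<in> J} \<subseteq> P"
    using L_ideal_unit[OF is_ideal _ _ 1] I_notcarr by auto
qed

lemma contraction_strict:
  assumes "primeideal J L" "primeideal K L" "J \<subset> K"
  shows "{q. quo q 1 \<in> J} \<subset> {q. quo q 1 \<in> K}"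
proof -
  interpret J: primeideal J L by fact
  interpret K: primeideal K L by fact
  have 1: "1 \<notin> P" by (rule prime_set_1[OF P])
  obtain x where x: "x \<in> K" "x \<notin> J" using assms(3) by blast
  then obtain q s where qs: "x = quo q s" "s \<notin> P" using K.a_subset unfolding L_carrier by blast
  have "quo q s \<otimes>\<^bsub>L\<^esub> quo s 1 = quo q 1"
    using qs 1 by (subst L_mult, simp, simp, subst quo_eq_iff) (auto intro!: exI[of _ 1])
  then have "quo q 1 \<in> K" using K.I_r_closed[OF x(1), of "quo s 1"] qs 1 by simp
  moreover have "quo q 1 \<notin> J"
  proof
    assume q: "quo q 1 \<in> J"
    have "quo q 1 \<otimes>\<^bsub>L\<^esub> quo 1 s = quo q s" using qs 1 by simp
    then show False using J.I_r_closed[OF q, of "quo 1 s"] qs x(2) by simp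
  qed
  ultimately show ?thesis using assms(3) by blast
qed

text \<open>The Jacobian criterion. Let \<open>c\<close> be the number of variables that are dependent modulo
  \<open>P\<close>. Chains of primes in the local ring pull back to chains between
  \<open>(f)\<close> and \<open>P\<close>, so its dimension is at most \<open>c - 1\<close>. Since
  the gradient of \<open>f\<close> vanishes modulo \<open>P\<close>, generators of the maximal ideal
  still generate all gradients of elements of \<open>P\<close> modulo \<open>P\<close>, so at least
  \<open>c\<close> of them are needed.\<close>

lemma not_regular:
  assumes f0: "f \<noteq> 0" and df: "\<And>i. i < 3 \<Longrightarrow> pd i f \<in> P"
  shows "\<not> regular_local_ring L"
proof
  assume reg: "regular_local_ring L"
  then have cring: "cring L" unfolding regular_local_ring_def by blast
  interpret L: cring L by fact
  have 1: "1 \<notin> P" by (rule prime_set_1[OF P])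
  obtain m G where m: "\<And>n. maximalideal n L \<longleftrightarrow> n = m" and G: "G \<subseteq> carrier L" "finite G"
      "enat (card G) = krull_dim L" "Idl\<^bsub>L\<^esub> G = m"
    using reg unfolding regular_local_ring_def by metis
  have M: "m = {quo q s | q s. q \<in> P \<and> s \<notin> P}" using m maximalideal_L[OF cring] by simp
  obtain B where B: "B \<subseteq> {..<3}" "in_vars B \<inter> P \<subseteq> {0}"
    "\<And>j. j \<in> {..<3} - B \<Longrightarrow> \<not> in_vars (insert j B) \<inter> P \<subseteq> {0}"
    using maximal_independent_variables[OF P] by blast
  have Gm: "G \<subseteq> m" using L.genideal_self[OF G(1)] unfolding G(4) .
  then have "\<forall>g\<in>G. \<exists>q s. g = quo q s \<and> q \<in> P \<and> s \<notin> P" unfolding M by blast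
  then obtain q s where qs: "\<And>g. g \<in> G \<Longrightarrow> g = quo (q g) (s g)" "\<And>g. g \<in> G \<Longrightarrow> q g \<in> P" "\<And>g. g \<in> G \<Longrightarrow> s g \<notin> P"
    by metis
  define gen where "gen t c p \<longleftrightarrow> (\<forall>i<3. t * pd i p - (\<Sum>u\<in>G. c u * pd i (q u)) \<in> P)" for t c p
  define E where "E = {p \<in> P. \<exists>t c. t \<notin> P \<and> gen t c p}"
  have E: "ideal_set E"
    unfolding ideal_set_def
  proof (intro conjI ballI allI)
    show "0 \<in> E" unfolding E_def gen_def using 1 ideal_set_0[OF I]
      by (auto intro!: exI[of _ 1] exI[of _ "\<lambda>_. 0"])
    show "a + b \<in> E" if ab: "a \<in> E" "b \<in> E" for a b
    proof -
      obtain t c where t: "t \<notin> P" "gen t c a" using ab(1) unfolding E_def by blast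
      obtain t' c' where t': "t' \<notin> P" "gen t' c' b" using ab(2) unfolding E_def by blast
      have "gen (t * t') (\<lambda>u. t' * c u + t * c' u) (a + b)"
        unfolding gen_def
      proof (intro allI impI)
        fix i :: nat assume "i < 3"
        then have "t' * (t * pd i a - (\<Sum>u\<in>G. c u * pd i (q u))) + t * (t' * pd i b - (\<Sum>u\<in>G. c' u * pd i (q u))) \<in> P"
          using t t' unfolding gen_def by (intro ideal_set_add[OF I] ideal_set_mult[OF I]) simp_all
        moreover have "(\<Sum>u\<in>G. (t' * c u + t * c' u) * pd i (q u))
            = t' * (\<Sum>u\<in>G. c u * pd i (q u)) + t * (\<Sum>u\<in>G. c' u * pd i (q u))"
          by (simp only: distrib_right sum.distrib sum_distrib_left mult.assoc)
        moreover have "(t * t') * pd i (a + b) - (t' * v + t * w) = t' * (t * pd i a - v) + t * (t' * pd i b - w)" for v w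
          unfolding pd_simps by Groebner_Basis.algebra
        ultimately show "(t * t') * pd i (a + b) - (\<Sum>u\<in>G. (t' * c u + t * c' u) * pd i (q u)) \<in> P"
          by simp
      qed
      moreover have "t * t' \<notin> P" using t t' prime_set_mult[OF P] by blast
      ultimately show ?thesis using ab ideal_set_add[OF I] unfolding E_def by blast
    qed
    show "b * a \<in> E" if a: "a \<in> E" for a b
    proof -
      obtain t c where t: "t \<notin> P" "gen t c a" and aP: "a \<in> P" using a unfolding E_def by blast
      have "gen t (\<lambda>u. b * c u) (b * a)"
        unfolding gen_def
      proof (intro allI impI)
        fix i :: nat assume "i < 3"
        then have "b * (t * pd i a - (\<Sum>u\<in>G. c u * pd i (q u))) + (t * pd i b) * a \<in> P"
          using t aP unfolding gen_def by (intro ideal_set_add[OF I] ideal_set_mult[OF I]) simp_all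
        moreover have "(\<Sum>u\<in>G. (b * c u) * pd i (q u)) = b * (\<Sum>u\<in>G. c u * pd i (q u))"
          by (simp only: sum_distrib_left mult.assoc)
        moreover have "t * pd i (b * a) - b * v = b * (t * pd i a - v) + (t * pd i b) * a" for v
          unfolding pd_mult by Groebner_Basis.algebra
        ultimately show "t * pd i (b * a) - (\<Sum>u\<in>G. (b * c u) * pd i (q u)) \<in> P"
          by simp
      qed
      then show ?thesis using t aP ideal_set_mult[OF I] unfolding E_def by blast
    qed
  qed
  have "q u \<in> E" if u: "u \<in> G" for u
  proof -
    have "(\<Sum>v\<in>G. (if v = u then 1 else 0) * pd i (q v)) = pd i (q u)" for i
      using u G(2) by (simp add: if_distrib[of "\<lambda>z. z * _"] cong: if_cong)
    then have "gen 1 (\<lambda>v. if v = u then 1 else 0) (q u)"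
      unfolding gen_def using ideal_set_0[OF I] by simp
    then show ?thesis using qs(2)[OF u] 1 unfolding E_def by blast
  qed
  then have "G \<subseteq> {quo q s | q s. q \<in> E \<and> s \<notin> P}" using qs(1,3) by blast
  then have mE: "m \<subseteq> {quo q s | q s. q \<in> E \<and> s \<notin> P}"
    unfolding G(4)[symmetric] by (rule L.genideal_minimal[OF L_ideal[OF cring E]])
  have gen_all: "\<exists>t c. t \<notin> P \<and> (\<forall>i<3. t * pd i p - (\<Sum>u\<in>G. c u * pd i (q u)) \<in> P)" if p: "p \<in> P" for p
  proof -
    have "quo p 1 \<in> m" unfolding M using p 1 by blast
    then obtain r v where r: "r \<in> E" "v \<notin> P" "quo p 1 = quo r v" using mE by blast
    then obtain u where u: "u \<notin> P" "f dvd u * (p * v) - u * (r * 1)"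
      using quo_eq_iff[of 1 v p r] 1 by blast
    then obtain h where h: "u * (p * v) - u * (r * 1) = f * h" by (auto elim!: dvdE)
    have rP: "r \<in> P" using r(1) unfolding E_def by blast
    have d: "u * v * pd i p - u * pd i r \<in> P" if i: "i < 3" for i
    proof -
      have "pd i (u * (p * v) - u * (r * 1)) = pd i (f * h)" unfolding h ..
      then have "u * v * pd i p - u * pd i r = (pd i f * h + f * pd i h)
          - (pd i u * v * p + u * pd i v * p - pd i u * r)"
        unfolding pd_mult pd_simps by Groebner_Basis.algebra
      also have "\<dots> \<in> P"
        using df[OF i] fP p rP
        by (intro ideal_set_diff[OF I] ideal_set_add[OF I]) (auto intro: ideal_set_mult[OF I] ideal_set_mult2[OF I])
      finally show ?thesis .
    qed
    obtain t c where t: "t \<notin> P" "gen t c r" using r(1) unfolding E_def by blast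
    have "(t * u * v) * pd i p - (\<Sum>w\<in>G. (u * c w) * pd i (q w)) \<in> P" if i: "i < 3" for i
    proof -
      have "t * (u * v * pd i p - u * pd i r) + u * (t * pd i r - (\<Sum>w\<in>G. c w * pd i (q w))) \<in> P"
        using d[OF i] t i unfolding gen_def by (intro ideal_set_add[OF I] ideal_set_mult[OF I]) simp_all
      moreover have "(\<Sum>w\<in>G. (u * c w) * pd i (q w)) = u * (\<Sum>w\<in>G. c w * pd i (q w))"
        by (simp only: sum_distrib_left mult.assoc)
      moreover have "(t * u * v) * pd i p - u * z = t * (u * v * pd i p - u * pd i r) + u * (t * pd i r - z)" for z
        by Groebner_Basis.algebra
      ultimately show ?thesis by simp
    qed
    moreover have "t * u * v \<notin> P" using t u r prime_set_mult[OF P] by blast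
    ultimately show ?thesis by (intro exI[of _ "t * u * v"] exI[of _ "\<lambda>w. u * c w"]) simp
  qed
  have lower: "card ({..<3} - B) \<le> card G"
    by (rule jacobian_generator_bound[OF P G(2) B(2) B(3) gen_all])
  have chain: "card B + n + 1 \<le> 3"
    if C: "\<forall>i\<le>n. primeideal (C i) L" "\<forall>i<n. C i \<subset> C (Suc i)" for n C
  proof (rule prime_chain_bound[OF B(1), where C = "\<lambda>i. {q. quo q 1 \<in> C i}"])
    show "in_vars B \<inter> {q. quo q 1 \<in> C n} \<subseteq> {0}"
      using contraction(3)[of "C n"] C(1) B(2) by blast
    show "prime_set {q. quo q 1 \<in> C i}" if "i \<le> n" for i using contraction(1) C(1) that by blast
    show "{q. quo q 1 \<in> C i} \<subset> {q. quo q 1 \<in> C (Suc i)}" if "i < n" for i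
      using contraction_strict[of "C i" "C (Suc i)"] C that by simp
    show "f \<in> {q. quo q 1 \<in> C 0}" using contraction(2) C(1) by blast
  qed (rule f0)
  have "krull_dim L \<le> enat (2 - card B)"
    unfolding krull_dim_def
  proof (rule Sup_least)
    fix e assume "e \<in> {enat n | n. \<exists>C :: nat \<Rightarrow> ('k poly3 set \<times> 'k poly3 set) set set.
      (\<forall>i\<le>n. primeideal (C i) L) \<and> (\<forall>i<n. C i \<subset> C (Suc i))}"
    then obtain n C where "e = enat n" "\<forall>i\<le>n. primeideal (C i) L" "\<forall>i<n. C i \<subset> C (Suc i)" by blast
    then show "e \<le> enat (2 - card B)" using chain[of n C] by simp
  qed
  then have "card G \<le> 2 - card B" unfolding G(3)[symmetric] by simp
  moreover have "card ({..<3} - B) = 3 - card B"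
    using B(1) by (subst card_Diff_subset) (auto intro: finite_subset)
  moreover have "card B < 3"
  proof -
    have "B \<noteq> {..<3}"
    proof
      assume "B = {..<3}"
      then have "f \<in> in_vars B" unfolding in_vars_def by simp
      then show False using B(2) fP f0 by blast
    qed
    then have "B \<subset> {..<3}" using B(1) by blast
    then show ?thesis using psubset_card_mono[of "{..<3}" B] by simp
  qed
  ultimately show False using lower by linarith
qed

end

text \<open>If no power of \<open>v\<close> lies in the Jacobian ideal, a prime containing that ideal avoids
  \<open>v\<close>. By Euler it contains \<open>f\<close>, so it is a prime of \<open>R\<close>
  different from the irrelevant ideal at which \<open>R\<close> is not regular.\<close>

lemma isolated_singularity_power_in_jacobian_ideal:
  fixes f :: "'k::field_char_0 poly3"
  assumes iso: "isolated_singularity f" and f0: "f \<noteq> 0" and cc: "const_coeff f = 0"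
    and euler: "xx * dx f + yy * dy f + zz * dz f = cst c * f" "c \<noteq> 0"
    and v: "const_coeff v = 0"
  obtains N a b c where "v ^ N = a * dx f + b * dy f + c * dz f"
proof -
  define J where "J = {a * dx f + b * dy f + c * dz f | a b c. True}"
  have J: "ideal_set J"
    unfolding ideal_set_def
  proof (intro conjI ballI allI)
    have "0 = 0 * dx f + 0 * dy f + 0 * dz f" by simp
    then show "0 \<in> J" unfolding J_def by blast
    show "p + q \<in> J" if pq: "p \<in> J" "q \<in> J" for p q
    proof -
      obtain a b c a' b' c' where "p = a * dx f + b * dy f + c * dz f" "q = a' * dx f + b' * dy f + c' * dz f"
        using pq unfolding J_def by blast
      then have "p + q = (a + a') * dx f + (b + b') * dy f + (c + c') * dz f"
        by (simp add: distrib_right)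
      then show ?thesis unfolding J_def by blast
    qed
    show "r * p \<in> J" if p: "p \<in> J" for p r
    proof -
      obtain a b c where "p = a * dx f + b * dy f + c * dz f" using p unfolding J_def by blast
      then have "r * p = (r * a) * dx f + (r * b) * dy f + (r * c) * dz f"
        by (simp add: distrib_left mult.assoc)
      then show ?thesis unfolding J_def by blast
    qed
  qed
  have "\<exists>N. v ^ N \<in> J"
  proof (rule ccontr)
    assume "\<not> ?thesis"
    then obtain P where P: "prime_set P" "J \<subseteq> P" and vP: "v \<notin> P"
      using exists_prime_avoiding_powers[OF J] by blast
    have d: "dx f = 1 * dx f + 0 * dy f + 0 * dz f" "dy f = 0 * dx f + 1 * dy f + 0 * dz f"
      "dz f = 0 * dx f + 0 * dy f + 1 * dz f" by simp_all
    have dP: "dx f \<in> P" "dy f \<in> P" "dz f \<in> P" using d P(2) unfolding J_def by blast+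
    have "cst (1 / c) * (xx * dx f + yy * dy f + zz * dz f) \<in> P"
      using dP by (intro ideal_set_mult[OF prime_set_ideal[OF P(1)]] ideal_set_add[OF prime_set_ideal[OF P(1)]])
    moreover have "cst (1 / c) * (cst c * f) = f"
      using euler(2) by (simp add: mult.assoc[symmetric] cst_mult[symmetric])
    ultimately have "f \<in> P" unfolding euler by simp
    then interpret hyp_prime f P using P(1) by unfold_locales
    have "cls ` P \<noteq> irrelevant_ideal f"
    proof
      assume "cls ` P = irrelevant_ideal f"
      then have "cls v \<in> cls ` P" using v unfolding irrelevant_ideal_eq[OF cc] by auto
      then show False using vP cls_in_image by blast
    qed
    then have "regular_local_ring L"
      using iso primeideal_image unfolding isolated_singularity_def L_def S_def by blast
    moreover have "pd i f \<in> P" for i using dP by (simp add: pd_def)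
    ultimately show False using not_regular[OF f0] by blast
  qed
  then show thesis using that unfolding J_def by blast
qed

section \<open>Differential operators of order two\<close>

text \<open>The operator on \<open>Q\<close> with coordinates \<open>a\<close> in the chosen basis.\<close>

definition dop :: "'k::field_char_0 poly3 vec \<Rightarrow> 'k poly3 \<Rightarrow> 'k poly3" where
  "dop a g = (\<Sum>i<10. a $ i * (D2_basis ! i) g)"

lemma dop_expand: "dop a g = a $ 0 * dx g + a $ 1 * dy g + a $ 2 * dz g
    + a $ 3 * (cst (1/2) * dx (dx g)) + a $ 4 * dx (dy g) + a $ 5 * dx (dz g)
    + a $ 6 * (cst (1/2) * dy (dy g)) + a $ 7 * dy (dz g)
    + a $ 8 * (cst (1/2) * dz (dz g)) + a $ 9 * g"
  unfolding dop_def D2_basis_def by (simp add: eval_nat_numeral)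

text \<open>These identities say that the coefficients of an operator of order two can be recovered from its
  values at the monomials of degree at most two.\<close>

lemma dop_interpolation:
  fixes p q r x y k :: "'a::idom"
  shows "p - x * k + k * x = p"
    and "r - x * q - y * p + x * y * k + y * (p - x * k) + x * (q - y * k) + k * (x * y) = r"
    and "r - x * p - x * p + x * x * k + 2 * x * (p - x * k) + k * (x * x) = r"
proof -
  have "p - x * k + k * x - p = 0" by Groebner_Basis.algebra
  then show "p - x * k + k * x = p" by (simp only: right_minus_eq)
  have "r - x * q - y * p + x * y * k + y * (p - x * k) + x * (q - y * k) + k * (x * y) - r = 0"
    by Groebner_Basis.algebra
  then show "r - x * q - y * p + x * y * k + y * (p - x * k) + x * (q - y * k) + k * (x * y) = r"
    by (simp only: right_minus_eq)
  have "r - x * p - x * p + x * x * k + 2 * x * (p - x * k) + k * (x * x) - r = 0"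
    by Groebner_Basis.algebra
  then show "r - x * p - x * p + x * x * k + 2 * x * (p - x * k) + k * (x * x) = r"
    by (simp only: right_minus_eq)
qed

context
  fixes f :: "'k::field_char_0 poly3"
begin

abbreviation "cls \<equiv> hyp_class f"
abbreviation "R \<equiv> hyp_ring f"

definition lin :: "'k poly3 set \<Rightarrow> ('k poly3 \<Rightarrow> 'k poly3) \<Rightarrow> bool" where
  "lin A E \<longleftrightarrow> (\<forall>p q. f dvd E (p + q) - (E p + E q)) \<and> (\<forall>a\<in>A. \<forall>p. f dvd E (a * p) - a * E p)"

text \<open>\<open>lin A\<close> and \<open>ord_le\<close> mirror linearity and the order of a differential operator for maps on \<open>Q\<close>, with equality
  replaced by congruence modulo \<open>f\<close>.\<close>

fun ord_le :: "nat \<Rightarrow> ('k poly3 \<Rightarrow> 'k poly3) \<Rightarrow> bool" where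
  "ord_le 0 E = lin UNIV E"
| "ord_le (Suc i) E = (lin (range cst) E \<and> (\<forall>m. ord_le i (\<lambda>q. E (m * q) - m * E q)))"

lemma lin_endos_iff:
  assumes "\<And>q. \<delta> (cls q) = cls (E q)" "\<delta> \<in> extensional (carrier R)"
  shows "\<delta> \<in> lin_endos R (cls ` A) \<longleftrightarrow> lin A E"
proof -
  have "\<delta> \<in> carrier R \<rightarrow>\<^sub>E carrier R"
    using assms by (auto simp: PiE_def carrier_hyp_ring)
  then show ?thesis
    unfolding lin_endos_def lin_def by (simp add: carrier_hyp_ring assms(1) hyp_class_eq_iff)
qed

lemma lift_exists:
  assumes "\<delta> \<in> lin_endos R K"
  shows "\<exists>E. \<forall>q. \<delta> (cls q) = cls (E q)" "\<delta> \<in> extensional (carrier R)"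
proof -
  have "\<delta> \<in> carrier R \<rightarrow>\<^sub>E carrier R" using assms unfolding lin_endos_def by blast
  then have "\<delta> (cls q) \<in> carrier R" and ext: "\<delta> \<in> extensional (carrier R)" for q
    unfolding PiE_def using hyp_class_carrier by blast+
  then have "\<exists>p. \<delta> (cls q) = cls p" for q unfolding carrier_hyp_ring by blast
  then have "\<forall>q. \<exists>p. \<delta> (cls q) = cls p" by (rule allI)
  then show "\<exists>E. \<forall>q. \<delta> (cls q) = cls (E q)" by (rule choice)
  show "\<delta> \<in> extensional (carrier R)" by (rule ext)
qed

lemma diff_ops_0_lift:
  assumes "\<mu> \<in> diff_ops R K 0"
  obtains m where "\<And>q. \<mu> (cls q) = cls (m * q)"
proof -
  have \<mu>: "\<mu> \<in> lin_endos R (cls ` UNIV)" using assms by (simp add: carrier_hyp_ring)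
  from lift_exists[OF this] obtain E where E: "\<And>q. \<mu> (cls q) = cls (E q)" "\<mu> \<in> extensional (carrier R)"
    by blast
  then have "lin UNIV E" using \<mu> lin_endos_iff by blast
  then have "f dvd E (q * 1) - q * E 1" for q unfolding lin_def by blast
  then have "\<mu> (cls q) = cls (E 1 * q)" for q
    by (simp add: E(1) hyp_class_eq_iff mult.commute)
  then show thesis using that by blast
qed

lemma mult_in_diff_ops_0: "(\<lambda>r\<in>carrier R. cls m \<otimes>\<^bsub>R\<^esub> r) \<in> diff_ops R K 0"
proof -
  have "(\<lambda>r\<in>carrier R. cls m \<otimes>\<^bsub>R\<^esub> r) \<in> lin_endos R (cls ` UNIV)"
    by (subst lin_endos_iff[of _ "\<lambda>q. m * q"]) (auto simp: lin_def distrib_left mult.left_commute)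
  then show ?thesis by (simp add: carrier_hyp_ring)
qed

text \<open>Membership in the inductively defined module of differential operators on \<open>R\<close> can be
  tested on any lift to \<open>Q\<close>, modulo \<open>f\<close>.\<close>

lemma diff_ops_iff:
  assumes "\<And>q. \<delta> (cls q) = cls (E q)" "\<delta> \<in> extensional (carrier R)"
  shows "\<delta> \<in> diff_ops R (cls ` range cst) i \<longleftrightarrow> ord_le i E"
  using assms
proof (induction i arbitrary: \<delta> E)
  case 0
  then show ?case using lin_endos_iff[of \<delta> E UNIV] by (simp add: carrier_hyp_ring)
next
  case (Suc i)
  have comm: "(\<lambda>r\<in>carrier R. \<delta> (\<mu> r) \<ominus>\<^bsub>R\<^esub> \<mu> (\<delta> r)) \<in> diff_ops R (cls ` range cst) i
      \<longleftrightarrow> ord_le i (\<lambda>q. E (m * q) - m * E q)" if "\<And>q. \<mu> (cls q) = cls (m * q)" for \<mu> m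
    by (rule Suc.IH) (simp_all only: restrict_extensional, simp add: that Suc.prems(1))
  have "(\<forall>\<mu>\<in>diff_ops R (cls ` range cst) 0. (\<lambda>r\<in>carrier R. \<delta> (\<mu> r) \<ominus>\<^bsub>R\<^esub> \<mu> (\<delta> r)) \<in> diff_ops R (cls ` range cst) i)
      \<longleftrightarrow> (\<forall>m. ord_le i (\<lambda>q. E (m * q) - m * E q))" (is "?l = ?r")
  proof
    assume l: ?l
    show ?r
    proof
      fix m
      have "\<And>q. (\<lambda>r\<in>carrier R. cls m \<otimes>\<^bsub>R\<^esub> r) (cls q) = cls (m * q)" by simp
      from comm[OF this] show "ord_le i (\<lambda>q. E (m * q) - m * E q)"
        using l mult_in_diff_ops_0 by blast
    qed
  next
    assume r: ?r
    show ?l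
    proof
      fix \<mu> assume "\<mu> \<in> diff_ops R (cls ` range cst) 0"
      then obtain m where "\<And>q. \<mu> (cls q) = cls (m * q)" using diff_ops_0_lift by blast
      then show "(\<lambda>r\<in>carrier R. \<delta> (\<mu> r) \<ominus>\<^bsub>R\<^esub> \<mu> (\<delta> r)) \<in> diff_ops R (cls ` range cst) i"
        using comm r by blast
    qed
  qed
  then show ?case using lin_endos_iff[OF Suc.prems] by simp
qed

lemma lin_diff:
  assumes "lin A E" "lin A F"
  shows "lin A (\<lambda>q. E q - F q)"
  unfolding lin_def
proof (intro conjI allI ballI)
  fix p q
  have "f dvd (E (p + q) - (E p + E q)) - (F (p + q) - (F p + F q))"
    by (rule dvd_diff) (use assms in \<open>auto simp: lin_def\<close>)
  moreover have "(E (p + q) - (E p + E q)) - (F (p + q) - (F p + F q)) = E (p + q) - F (p + q) - (E p - F p + (E q - F q))"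
    by Groebner_Basis.algebra
  ultimately show "f dvd E (p + q) - F (p + q) - (E p - F p + (E q - F q))" by simp
next
  fix a p assume "a \<in> A"
  then have "f dvd (E (a * p) - a * E p) - (F (a * p) - a * F p)"
    by (intro dvd_diff[of f "_ - _" "_ - _"]) (use assms in \<open>auto simp: lin_def\<close>)
  moreover have "(E (a * p) - a * E p) - (F (a * p) - a * F p) = E (a * p) - F (a * p) - a * (E p - F p)"
    by Groebner_Basis.algebra
  ultimately show "f dvd E (a * p) - F (a * p) - a * (E p - F p)" by simp
qed

lemma ord_le_diff: "ord_le i E \<Longrightarrow> ord_le i F \<Longrightarrow> ord_le i (\<lambda>q. E q - F q)"
proof (induction i arbitrary: E F)
  case 0
  then show ?case by (simp add: lin_diff)
next
  case (Suc i)
  have "ord_le i (\<lambda>q. (E (m * q) - m * E q) - (F (m * q) - m * F q))" for m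
    using Suc by simp
  moreover have "(\<lambda>q. (E (m * q) - m * E q) - (F (m * q) - m * F q)) = (\<lambda>q. E (m * q) - F (m * q) - m * (E q - F q))" for m
    by (rule ext) Groebner_Basis.algebra
  ultimately show ?case using Suc.prems lin_diff by simp
qed

lemma lin_zero:
  assumes "lin UNIV E" "f dvd E 1"
  shows "f dvd E q"
proof -
  have "f dvd E (q * 1) - q * E 1" using assms(1) unfolding lin_def by blast
  then have "f dvd (E q - q * E 1) + q * E 1" using assms(2) by (intro dvd_add dvd_mult) simp_all
  then show ?thesis by simp
qed

lemma lin_from_variables:
  assumes E: "lin (range cst) E" and "\<And>q. f dvd E (xx * q) - xx * E q" "\<And>q. f dvd E (yy * q) - yy * E q"
    "\<And>q. f dvd E (zz * q) - zz * E q"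
  shows "lin UNIV E"
proof -
  have mult: "f dvd E ((a * p) * q) - (a * p) * E q"
    if "\<And>q. f dvd E (a * q) - a * E q" "f dvd E (p * q) - p * E q" for a p q
  proof -
    have "f dvd (E (a * (p * q)) - a * E (p * q)) + a * (E (p * q) - p * E q)"
      by (rule dvd_add[OF that(1) dvd_mult[OF that(2)]])
    then show ?thesis by (simp add: right_diff_distrib mult.assoc)
  qed
  have "f dvd E (p * q) - p * E q" for p q
  proof (induction p rule: poly3_induct)
    case (cst k)
    then show ?case using E unfolding lin_def by blast
  next
    case (add p r)
    have "f dvd E (p * q + r * q) - (E (p * q) + E (r * q))" using E unfolding lin_def by blast
    then have "f dvd (E (p * q + r * q) - (E (p * q) + E (r * q))) + ((E (p * q) - p * E q) + (E (r * q) - r * E q))"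
      by (rule dvd_add[OF _ dvd_add[OF add]])
    moreover have "(E (p * q + r * q) - (E (p * q) + E (r * q))) + ((E (p * q) - p * E q) + (E (r * q) - r * E q))
        = E ((p + r) * q) - (p + r) * E q"
      unfolding distrib_right by Groebner_Basis.algebra
    ultimately show ?case by simp
  qed (rule mult; use assms in blast)+
  then show ?thesis using E unfolding lin_def by blast
qed

text \<open>An operator of order at most one is determined by its values at \<open>1, x, y, z\<close>: its
  commutators with the variables have order zero and are determined by their value at
  \<open>1\<close>.\<close>

lemma ord_le_1_zero:
  assumes E: "ord_le 1 E" and "f dvd E 1" "f dvd E xx" "f dvd E yy" "f dvd E zz"
  shows "f dvd E q"
proof -
  have z: "f dvd E (m * q) - m * E q" if "f dvd E m" for m q
  proof (rule lin_zero[where E = "\<lambda>q. E (m * q) - m * E q"])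
    show "lin UNIV (\<lambda>q. E (m * q) - m * E q)" using E by simp
    show "f dvd E (m * 1) - m * E 1" using that assms(2) by simp
  qed
  have "lin (range cst) E" using E by simp
  then have "lin UNIV E" by (rule lin_from_variables) (rule z, fact)+
  then show ?thesis using lin_zero assms(2) by blast
qed

text \<open>The commutators with the variables have order at most one, so the previous lemma applies to them.\<close>

lemma ord_le_2_zero:
  assumes E: "ord_le 2 E" and 1: "f dvd E 1" and 2: "f dvd E xx" "f dvd E yy" "f dvd E zz"
    and 3: "f dvd E (xx * xx)" "f dvd E (xx * yy)" "f dvd E (xx * zz)" "f dvd E (yy * yy)"
      "f dvd E (yy * zz)" "f dvd E (zz * zz)"
  shows "f dvd E q"
proof -
  have z: "f dvd E (m * q) - m * E q"
    if "f dvd E m" "f dvd E (m * xx)" "f dvd E (m * yy)" "f dvd E (m * zz)" for m q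
  proof (rule ord_le_1_zero[where E = "\<lambda>q. E (m * q) - m * E q"])
    show "ord_le 1 (\<lambda>q. E (m * q) - m * E q)" using E by (simp add: numeral_2_eq_2)
  qed (use that 1 2 in auto)
  have "lin (range cst) E" using E by (simp add: numeral_2_eq_2)
  then have "lin UNIV E"
    by (rule lin_from_variables) (rule z; use 2 3 in \<open>simp only: mult.commute[of yy xx] mult.commute[of zz xx] mult.commute[of zz yy]\<close>)+
  then show ?thesis using lin_zero 1 by blast
qed

lemma dop_linear:
  fixes a :: "'k poly3 vec"
  shows "dop a (p + q) = dop a p + dop a q" "dop a (cst k * p) = cst k * dop a p"
  unfolding dop_expand partial_add partial_cst_mult by Groebner_Basis.algebra+

lemma dop_commutator:
  fixes a :: "'k poly3 vec"
  shows
  "dop a (m * (n * q)) - n * dop a (m * q) - m * (dop a (n * q) - n * dop a q) =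
    q * (a $ 3 * (2 * cst (1/2) * dx m * dx n) + a $ 4 * (dx m * dy n + dy m * dx n)
      + a $ 5 * (dx m * dz n + dz m * dx n) + a $ 6 * (2 * cst (1/2) * dy m * dy n)
      + a $ 7 * (dy m * dz n + dz m * dy n) + a $ 8 * (2 * cst (1/2) * dz m * dz n))"
  unfolding dop_expand partial_mult partial_add by Groebner_Basis.algebra

lemma ord_le_dop: "ord_le 2 (dop (a :: 'k poly3 vec))"
proof -
  have l: "lin (range cst) (dop a)"
    unfolding lin_def by (auto simp: dop_linear)
  have l1: "lin (range cst) (\<lambda>q. dop a (m * q) - m * dop a q)" for m
    unfolding lin_def
  proof (intro conjI allI ballI)
    fix p q
    have "dop a (m * (p + q)) - m * dop a (p + q) - (dop a (m * p) - m * dop a p + (dop a (m * q) - m * dop a q)) = 0"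
      unfolding distrib_left dop_linear by Groebner_Basis.algebra
    then show "f dvd dop a (m * (p + q)) - m * dop a (p + q) - (dop a (m * p) - m * dop a p + (dop a (m * q) - m * dop a q))"
      by (simp only: dvd_0_right)
  next
    fix k p assume "k \<in> range (cst :: 'k \<Rightarrow> _)"
    then obtain c where k: "k = cst c" by blast
    have mc: "m * (cst c * p) = cst c * (m * p)" by (rule mult.left_commute)
    have "dop a (m * (k * p)) - m * dop a (k * p) - k * (dop a (m * p) - m * dop a p) = 0"
      unfolding k mc dop_linear by Groebner_Basis.algebra
    then show "f dvd dop a (m * (k * p)) - m * dop a (k * p) - k * (dop a (m * p) - m * dop a p)"
      by (simp only: dvd_0_right)
  qed
  have l2: "lin UNIV (\<lambda>q. (dop a (m * (n * q)) - m * dop a (n * q)) - n * (dop a (m * q) - m * dop a q))" for m n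
  proof -
    have e: "(dop a (m * (n * q)) - m * dop a (n * q)) - n * (dop a (m * q) - m * dop a q)
      = dop a (m * (n * q)) - n * dop a (m * q) - m * (dop a (n * q) - n * dop a q)" for q
      by Groebner_Basis.algebra
    show ?thesis unfolding e dop_commutator lin_def by (simp add: distrib_right mult.assoc)
  qed
  show ?thesis using l l1 l2 by (simp add: numeral_2_eq_2)
qed

lemma half_cst: "cst (1/2) * (2 * p) = (p :: 'k poly3)"
proof -
  have "cst (1/2) * (2 * p) = cst (1/2 * 2) * p" unfolding cst_mult cst_numeral by (simp only: mult.assoc)
  then show ?thesis by simp
qed

lemma dop_monomials:
  fixes a :: "'k poly3 vec"
  shows
  "dop a 1 = a $ 9" "dop a xx = a $ 0 + a $ 9 * xx" "dop a yy = a $ 1 + a $ 9 * yy"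
  "dop a zz = a $ 2 + a $ 9 * zz"
  "dop a (xx * xx) = a $ 3 + 2 * xx * a $ 0 + a $ 9 * (xx * xx)"
  "dop a (xx * yy) = a $ 4 + yy * a $ 0 + xx * a $ 1 + a $ 9 * (xx * yy)"
  "dop a (xx * zz) = a $ 5 + zz * a $ 0 + xx * a $ 2 + a $ 9 * (xx * zz)"
  "dop a (yy * yy) = a $ 6 + 2 * yy * a $ 1 + a $ 9 * (yy * yy)"
  "dop a (yy * zz) = a $ 7 + zz * a $ 1 + yy * a $ 2 + a $ 9 * (yy * zz)"
  "dop a (zz * zz) = a $ 8 + 2 * zz * a $ 2 + a $ 9 * (zz * zz)"
proof -
  have h: "cst (1/2) * 2 = (1 :: 'k poly3)" using half_cst[of 1] by simp
  show "dop a 1 = a $ 9" "dop a xx = a $ 0 + a $ 9 * xx" "dop a yy = a $ 1 + a $ 9 * yy"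
    "dop a zz = a $ 2 + a $ 9 * zz"
    unfolding dop_expand by simp_all
  show "dop a (xx * xx) = a $ 3 + 2 * xx * a $ 0 + a $ 9 * (xx * xx)"
    "dop a (xx * yy) = a $ 4 + yy * a $ 0 + xx * a $ 1 + a $ 9 * (xx * yy)"
    "dop a (xx * zz) = a $ 5 + zz * a $ 0 + xx * a $ 2 + a $ 9 * (xx * zz)"
    "dop a (yy * yy) = a $ 6 + 2 * yy * a $ 1 + a $ 9 * (yy * yy)"
    "dop a (yy * zz) = a $ 7 + zz * a $ 1 + yy * a $ 2 + a $ 9 * (yy * zz)"
    "dop a (zz * zz) = a $ 8 + 2 * zz * a $ 2 + a $ 9 * (zz * zz)"
    unfolding dop_expand partial_mult partial_var partial_add partial_1 partial_0
    by (simp_all add: h)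
qed

lemma dop_zero_iff:
  fixes a :: "'k poly3 vec"
  assumes "dim_vec a = 10" "\<And>g. f dvd dop a g" "i < 10"
  shows "f dvd a $ i"
proof -
  note d = assms(2)[of 1] assms(2)[of xx] assms(2)[of yy] assms(2)[of zz] assms(2)[of "xx * xx"]
    assms(2)[of "xx * yy"] assms(2)[of "xx * zz"] assms(2)[of "yy * yy"] assms(2)[of "yy * zz"] assms(2)[of "zz * zz"]
  have 9: "f dvd a $ 9" using d(1) unfolding dop_monomials .
  have 0: "f dvd a $ 0" "f dvd a $ 1" "f dvd a $ 2"
    using d(2-4) 9 unfolding dop_monomials by (simp_all add: dvd_add_left_iff)
  have 3: "f dvd a $ 3" "f dvd a $ 4" "f dvd a $ 5" "f dvd a $ 6" "f dvd a $ 7" "f dvd a $ 8"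
    using d(5-10) 9 0 unfolding dop_monomials by (simp_all add: dvd_add_left_iff)
  have "\<forall>i<10. f dvd a $ i" using 0 3 9 by (simp add: eval_nat_numeral All_less_Suc)
  then show ?thesis using assms(3) by blast
qed

lemma dop_diff:
  fixes a b :: "'k poly3 vec"
  shows "dim_vec a = 10 \<Longrightarrow> dim_vec b = 10 \<Longrightarrow> dop (a - b) g = dop a g - dop b g"
  unfolding dop_def by (simp add: left_diff_distrib sum_subtractf)

lemma D2_represents_iff:
  "D2_represents f \<delta> w \<longleftrightarrow> (\<exists>a. dim_vec a = 10 \<and> w = map_vec cls a \<and> (\<forall>g. \<delta> (cls g) = cls (dop a g)))"
  unfolding D2_represents_def dop_def ..

lemma D2_represents_unique:
  assumes "D2_represents f \<delta> w" "D2_represents f \<delta> w'"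
  shows "w = w'"
proof -
  obtain a b where a: "dim_vec a = 10" "w = map_vec cls a" "\<And>g. \<delta> (cls g) = cls (dop a g)"
    and b: "dim_vec b = 10" "w' = map_vec cls b" "\<And>g. \<delta> (cls g) = cls (dop b g)"
    using assms unfolding D2_represents_iff by blast
  have "f dvd dop (a - b) g" for g
    using a(3)[of g] b(3)[of g] by (simp add: dop_diff a b hyp_class_eq_iff)
  then have "f dvd (a - b) $ i" if "i < 10" for i using dop_zero_iff[of "a - b"] that b by simp
  then show ?thesis unfolding a(2) b(2) using a(1) b(1)
    by (intro eq_vecI) (auto simp: hyp_class_eq_iff)
qed

lemma D2_coords_eq: "D2_represents f \<delta> w \<Longrightarrow> D2_coords f \<delta> = w"
  unfolding D2_coords_def using D2_represents_unique by blast

text \<open>Choose the coefficients so that the combination of basis operators has the prescribed values at the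
  monomials of degree at most two; the difference has order at most two and vanishes there.\<close>

lemma D2_representable:
  assumes "\<delta> \<in> D2 f"
  obtains a :: "'k poly3 vec" where "dim_vec a = 10" "\<And>g. \<delta> (cls g) = cls (dop a g)"
proof -
  have \<delta>: "\<delta> \<in> diff_ops R (cls ` range cst) 2" using assms unfolding D2_def .
  then have "\<delta> \<in> lin_endos R (cls ` range cst)" by (simp add: numeral_2_eq_2)
  from lift_exists[OF this] obtain E where E: "\<And>q. \<delta> (cls q) = cls (E q)" "\<delta> \<in> extensional (carrier R)"
    by blast
  then have "ord_le 2 E" using \<delta> diff_ops_iff[of \<delta> E 2] by simp
  define c where "c = E 1"
  define v where "v m = E m - m * c" for m
  define s where "s m n = E (m * n) - m * E n - n * E m + m * n * c" for m n
  define a where "a = vec_of_list [v xx, v yy, v zz, s xx xx, s xx yy, s xx zz, s yy yy, s yy zz, s zz zz, c]"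
  have dim: "dim_vec a = 10" unfolding a_def by simp
  have a: "a $ 0 = v xx" "a $ 1 = v yy" "a $ 2 = v zz" "a $ 3 = s xx xx" "a $ 4 = s xx yy" "a $ 5 = s xx zz"
    "a $ 6 = s yy yy" "a $ 7 = s yy zz" "a $ 8 = s zz zz" "a $ 9 = c"
    unfolding a_def by (simp_all add: eval_nat_numeral)
  have o: "ord_le 2 (\<lambda>q. E q - dop a q)" by (rule ord_le_diff[OF \<open>ord_le 2 E\<close> ord_le_dop])
  have m: "dop a 1 = E 1" "dop a xx = E xx" "dop a yy = E yy" "dop a zz = E zz"
    "dop a (xx * xx) = E (xx * xx)" "dop a (xx * yy) = E (xx * yy)" "dop a (xx * zz) = E (xx * zz)"
    "dop a (yy * yy) = E (yy * yy)" "dop a (yy * zz) = E (yy * zz)" "dop a (zz * zz) = E (zz * zz)"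
    unfolding dop_monomials a v_def s_def c_def by (rule refl dop_interpolation)+
  have "f dvd E q - dop a q" for q
    by (rule ord_le_2_zero[where E = "\<lambda>q. E q - dop a q", OF o]) (simp_all only: m diff_self dvd_0_right)
  then have "\<delta> (cls g) = cls (dop a g)" for g by (simp add: E hyp_class_eq_iff)
  then show thesis using that dim by blast
qed

lemma D2_submodule_eq:
  "D2_submodule f = {map_vec cls a | a. dim_vec a = 10 \<and> (\<forall>g. f dvd dop a (f * g))}"
proof (intro Set.equalityI subsetI)
  fix w assume "w \<in> D2_submodule f"
  then obtain \<delta> where \<delta>: "\<delta> \<in> D2 f" "w = D2_coords f \<delta>" unfolding D2_submodule_def by blast
  obtain a where a: "dim_vec a = 10" "\<And>g. \<delta> (cls g) = cls (dop a g)"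
    using D2_representable[OF \<delta>(1)] by blast
  then have "w = map_vec cls a" unfolding \<delta>(2) by (intro D2_coords_eq) (auto simp: D2_represents_iff)
  moreover have "f dvd dop a (f * g)" for g
  proof -
    have "cls (f * g) = cls 0" by (simp add: hyp_class_eq_iff)
    then have "cls (dop a (f * g)) = cls (dop a 0)" by (metis a(2))
    moreover have "dop a 0 = 0" unfolding dop_expand by simp
    ultimately show ?thesis by (simp add: hyp_class_eq_iff)
  qed
  ultimately show "w \<in> {map_vec cls a | a. dim_vec a = 10 \<and> (\<forall>g. f dvd dop a (f * g))}" using a(1) by blast
next
  fix w assume "w \<in> {map_vec cls a | a. dim_vec a = 10 \<and> (\<forall>g. f dvd dop a (f * g))}"
  then obtain a where a: "w = map_vec cls a" "dim_vec a = 10" "\<And>g. f dvd dop a (f * g)" by blast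
  define \<delta> where "\<delta> = (\<lambda>r\<in>carrier R. cls (dop a (SOME q. cls q = r)))"
  have \<delta>: "\<delta> (cls g) = cls (dop a g)" for g
  proof -
    define q where "q = (SOME q. cls q = cls g)"
    have "cls q = cls g" unfolding q_def by (rule someI[of _ g]) simp
    then obtain h where "q - g = f * h" by (auto simp: hyp_class_eq_iff elim!: dvdE)
    then have "q = g + f * h" by (simp add: diff_eq_eq ac_simps)
    then have "cls (dop a q) = cls (dop a g)" using a(3)[of h] by (simp add: dop_linear hyp_class_eq_iff)
    then show ?thesis unfolding \<delta>_def q_def by simp
  qed
  have "\<delta> \<in> D2 f"
    unfolding D2_def by (subst diff_ops_iff[where E = "dop a", OF \<delta>]) (auto simp: \<delta>_def ord_le_dop)
  moreover have "D2_coords f \<delta> = w" using \<delta> a by (intro D2_coords_eq) (auto simp: D2_represents_iff)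
  ultimately show "w \<in> D2_submodule f" unfolding D2_submodule_def by blast
qed

lemma dop_mult:
  "dop a (f * g) = g * dop a f + dx g * (a $ 3 * dx f + a $ 4 * dy f + a $ 5 * dz f)
    + dy g * (a $ 4 * dx f + a $ 6 * dy f + a $ 7 * dz f) + dz g * (a $ 5 * dx f + a $ 7 * dy f + a $ 8 * dz f)
    + f * (dop a g - a $ 9 * g)"
proof -
  have xx: "cst (1/2) * dx (dx (f * g)) = g * (cst (1/2) * dx (dx f)) + dx f * dx g + f * (cst (1/2) * dx (dx g))"
    using half_cst[of "dx f * dx g"] unfolding partial_mult partial_add by Groebner_Basis.algebra
  have yy: "cst (1/2) * dy (dy (f * g)) = g * (cst (1/2) * dy (dy f)) + dy f * dy g + f * (cst (1/2) * dy (dy g))"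
    using half_cst[of "dy f * dy g"] unfolding partial_mult partial_add by Groebner_Basis.algebra
  have zz: "cst (1/2) * dz (dz (f * g)) = g * (cst (1/2) * dz (dz f)) + dz f * dz g + f * (cst (1/2) * dz (dz g))"
    using half_cst[of "dz f * dz g"] unfolding partial_mult partial_add by Groebner_Basis.algebra
  show ?thesis
    unfolding dop_expand[of a "f * g"] xx yy zz unfolding dop_expand partial_mult partial_add
    by Groebner_Basis.algebra
qed

text \<open>By the Leibniz formula the value at \<open>f g\<close> is, modulo \<open>f\<close>, a combination of
  \<open>g\<close> and its first derivatives, which can be prescribed independently.\<close>

lemma dop_preserves_iff:
  "(\<forall>g. f dvd dop a (f * g)) \<longleftrightarrow> f dvd dop a f \<and> f dvd a $ 3 * dx f + a $ 4 * dy f + a $ 5 * dz f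
    \<and> f dvd a $ 4 * dx f + a $ 6 * dy f + a $ 7 * dz f \<and> f dvd a $ 5 * dx f + a $ 7 * dy f + a $ 8 * dz f"
    (is "?l \<longleftrightarrow> ?r")
proof
  assume l: ?l
  have "f dvd dop a f" using l[rule_format, of 1] by simp
  then show ?r
    using l[rule_format, of xx] l[rule_format, of yy] l[rule_format, of zz]
    unfolding dop_mult by (simp add: dvd_add_left_iff dvd_add_right_iff)
next
  assume ?r
  then show ?l unfolding dop_mult by (auto intro!: dvd_add)
qed

end

section \<open>Free modules over the hypersurface ring\<close>

lemma mult_mat_smult_vec:
  fixes A :: "'a::comm_ring_1 mat"
  assumes "A \<in> carrier_mat r n" "v \<in> carrier_vec n"
  shows "A *\<^sub>v (k \<cdot>\<^sub>v v) = k \<cdot>\<^sub>v (A *\<^sub>v v)"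
proof -
  have d: "dim_row A = r" "dim_col A = n" "dim_vec v = n" using assms by auto
  show ?thesis
    by (rule eq_vecI) (simp_all add: d scalar_prod_def sum_distrib_left mult.left_commute[of _ k])
qed

context
  fixes f :: "'k::field_char_0 poly3"
begin

lemma map_vec_cls_eq_iff:
  assumes "v \<in> carrier_vec n" "w \<in> carrier_vec n"
  shows "map_vec (hyp_class f) v = map_vec (hyp_class f) w \<longleftrightarrow> (\<forall>i<n. f dvd v $ i - w $ i)"
proof -
  have d: "dim_vec v = n" "dim_vec w = n" using assms by auto
  show ?thesis
  proof
    assume e: "map_vec (hyp_class f) v = map_vec (hyp_class f) w"
    show "\<forall>i<n. f dvd v $ i - w $ i"
    proof (intro allI impI)
      fix i assume "i < n"
      then have "hyp_class f (v $ i) = hyp_class f (w $ i)" using arg_cong[OF e, of "\<lambda>u :: 'k poly3 set vec. u $ i"] d by simp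
      then show "f dvd v $ i - w $ i" by (simp only: hyp_class_eq_iff)
    qed
  next
    assume "\<forall>i<n. f dvd v $ i - w $ i"
    then show "map_vec (hyp_class f) v = map_vec (hyp_class f) w"
      using d by (intro eq_vecI) (simp_all add: hyp_class_eq_iff)
  qed
qed

lemma free_mod_eq: "free_mod (hyp_ring f) n = map_vec (hyp_class f) ` carrier_vec n"
proof (intro Set.equalityI subsetI)
  fix v assume v: "v \<in> free_mod (hyp_ring f) n"
  have "\<forall>i. \<exists>q. i < n \<longrightarrow> v $ i = hyp_class f q"
    using v unfolding free_mod_def carrier_hyp_ring by blast
  then obtain q where q: "\<And>i. i < n \<Longrightarrow> v $ i = hyp_class f (q i)" by metis
  have "v = map_vec (hyp_class f) (vec n q)" using v q unfolding free_mod_def by (intro eq_vecI) auto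
  then show "v \<in> map_vec (hyp_class f) ` carrier_vec n" by (intro image_eqI) auto
next
  fix v assume "v \<in> map_vec (hyp_class f) ` carrier_vec n"
  then show "v \<in> free_mod (hyp_ring f) n" unfolding free_mod_def by auto
qed

lemma mat_app_class:
  assumes A: "A \<in> carrier_mat r n" and v: "v \<in> carrier_vec n"
  shows "mat_app (hyp_ring f) (map_mat (hyp_class f) A) (map_vec (hyp_class f) v) = map_vec (hyp_class f) (A *\<^sub>v v)"
proof (rule eq_vecI)
  have d: "dim_row A = r" "dim_col A = n" "dim_vec v = n" using A v by auto
  show "dim_vec (mat_app (hyp_ring f) (map_mat (hyp_class f) A) (map_vec (hyp_class f) v)) = dim_vec (map_vec (hyp_class f) (A *\<^sub>v v))"
    by (simp add: mat_app_def)
  fix i assume "i < dim_vec (map_vec (hyp_class f) (A *\<^sub>v v))"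
  then have i: "i < r" using d by simp
  interpret cring "hyp_ring f" by (rule hyp_ring_cring)
  have "mat_app (hyp_ring f) (map_mat (hyp_class f) A) (map_vec (hyp_class f) v) $ i
      = (\<Oplus>\<^bsub>hyp_ring f\<^esub>j\<in>{..<n}. map_mat (hyp_class f) A $$ (i, j) \<otimes>\<^bsub>hyp_ring f\<^esub> map_vec (hyp_class f) v $ j)"
    using i d by (simp add: mat_app_def)
  also have "\<dots> = (\<Oplus>\<^bsub>hyp_ring f\<^esub>j\<in>{..<n}. hyp_class f (A $$ (i, j) * v $ j))"
    using i d by (intro finsum_cong') auto
  also have "\<dots> = hyp_class f (\<Sum>j<n. A $$ (i, j) * v $ j)"
    by (rule hyp_class_finsum) simp
  also have "(\<Sum>j<n. A $$ (i, j) * v $ j) = (A *\<^sub>v v) $ i"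
    using i d by (simp add: scalar_prod_def lessThan_atLeast0)
  finally show "mat_app (hyp_ring f) (map_mat (hyp_class f) A) (map_vec (hyp_class f) v) $ i = map_vec (hyp_class f) (A *\<^sub>v v) $ i"
    using i d by simp
qed

lemma zero_vec_class: "vec r (\<lambda>_. \<zero>\<^bsub>hyp_ring f\<^esub>) = map_vec (hyp_class f) (0\<^sub>v r)"
  by (intro eq_vecI) (simp_all add: hyp_class_zero)

text \<open>Exactness modulo \<open>f\<close> can be checked on polynomial representatives.\<close>

lemma kernel_eq_image:
  assumes A: "A \<in> carrier_mat r n" and B: "B \<in> carrier_mat n k"
    and 1: "\<And>u. u \<in> carrier_vec k \<Longrightarrow> map_vec (hyp_class f) (A *\<^sub>v (B *\<^sub>v u)) = map_vec (hyp_class f) (0\<^sub>v r)"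
    and 2: "\<And>v. v \<in> carrier_vec n \<Longrightarrow> map_vec (hyp_class f) (A *\<^sub>v v) = map_vec (hyp_class f) (0\<^sub>v r) \<Longrightarrow>
      \<exists>u\<in>carrier_vec k. map_vec (hyp_class f) v = map_vec (hyp_class f) (B *\<^sub>v u)"
  shows "{v \<in> free_mod (hyp_ring f) n. mat_app (hyp_ring f) (map_mat (hyp_class f) A) v = vec r (\<lambda>_. \<zero>\<^bsub>hyp_ring f\<^esub>)}
    = mat_app (hyp_ring f) (map_mat (hyp_class f) B) ` free_mod (hyp_ring f) k"
proof (intro Set.equalityI subsetI)
  fix v assume "v \<in> {v \<in> free_mod (hyp_ring f) n. mat_app (hyp_ring f) (map_mat (hyp_class f) A) v = vec r (\<lambda>_. \<zero>\<^bsub>hyp_ring f\<^esub>)}"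
  then obtain q where q: "q \<in> carrier_vec n" "v = map_vec (hyp_class f) q" "map_vec (hyp_class f) (A *\<^sub>v q) = map_vec (hyp_class f) (0\<^sub>v r)"
    by (auto simp: free_mod_eq zero_vec_class mat_app_class[OF A])
  then obtain u where u: "u \<in> carrier_vec k" "v = map_vec (hyp_class f) (B *\<^sub>v u)" using 2 by blast
  then have "v = mat_app (hyp_ring f) (map_mat (hyp_class f) B) (map_vec (hyp_class f) u)" by (simp add: mat_app_class[OF B])
  then show "v \<in> mat_app (hyp_ring f) (map_mat (hyp_class f) B) ` free_mod (hyp_ring f) k" using u(1) unfolding free_mod_eq by blast
next
  fix v assume "v \<in> mat_app (hyp_ring f) (map_mat (hyp_class f) B) ` free_mod (hyp_ring f) k"
  then obtain u where u: "u \<in> carrier_vec k" "v = map_vec (hyp_class f) (B *\<^sub>v u)"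
    by (auto simp: free_mod_eq mat_app_class[OF B])
  moreover have Bu: "B *\<^sub>v u \<in> carrier_vec n" using B u(1) by auto
  ultimately have "mat_app (hyp_ring f) (map_mat (hyp_class f) A) v = map_vec (hyp_class f) (A *\<^sub>v (B *\<^sub>v u))"
    by (simp add: mat_app_class[OF A])
  then show "v \<in> {v \<in> free_mod (hyp_ring f) n. mat_app (hyp_ring f) (map_mat (hyp_class f) A) v = vec r (\<lambda>_. \<zero>\<^bsub>hyp_ring f\<^esub>)}"
    using 1[OF u(1)] Bu u(2) by (auto simp: free_mod_eq zero_vec_class)
qed

lemma image_eq: 
  assumes "A \<in> carrier_mat r n"
  shows "mat_app (hyp_ring f) (map_mat (hyp_class f) A) ` free_mod (hyp_ring f) n = {map_vec (hyp_class f) (A *\<^sub>v v) | v. v \<in> carrier_vec n}"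
  by (auto simp: free_mod_eq mat_app_class[OF assms] image_iff)

text \<open>If \<open>A v = f w\<close>, then \<open>c f v = B A v = f B w\<close>, and \<open>f\<close> can be
  cancelled.\<close>

lemma matrix_factorization_kernel:
  assumes A: "A \<in> carrier_mat n n" and B: "B \<in> carrier_mat n n" and f0: "f \<noteq> 0" and c: "c * c' = 1"
    and BA: "\<And>v. v \<in> carrier_vec n \<Longrightarrow> B *\<^sub>v (A *\<^sub>v v) = (c * f) \<cdot>\<^sub>v v"
    and v: "v \<in> carrier_vec n" and z: "map_vec (hyp_class f) (A *\<^sub>v v) = map_vec (hyp_class f) (0\<^sub>v n)"
  shows "\<exists>u\<in>carrier_vec n. v = B *\<^sub>v u"
proof -
  have Av: "A *\<^sub>v v \<in> carrier_vec n" using A v by auto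
  have "\<forall>i<n. f dvd (A *\<^sub>v v) $ i"
    using z map_vec_cls_eq_iff[OF Av zero_carrier_vec] by simp
  then have "\<forall>i. \<exists>w. i < n \<longrightarrow> (A *\<^sub>v v) $ i = f * w" by (auto elim!: dvdE)
  then obtain w where w: "\<And>i. i < n \<Longrightarrow> (A *\<^sub>v v) $ i = f * w i" by metis
  have e: "A *\<^sub>v v = f \<cdot>\<^sub>v vec n w" using w Av A by (intro eq_vecI) auto
  have "(c * f) \<cdot>\<^sub>v v = B *\<^sub>v (f \<cdot>\<^sub>v vec n w)" using BA[OF v] unfolding e by simp
  also have "\<dots> = f \<cdot>\<^sub>v (B *\<^sub>v vec n w)" by (rule mult_mat_smult_vec[OF B]) simp
  finally have cf: "(c * f) \<cdot>\<^sub>v v = f \<cdot>\<^sub>v (B *\<^sub>v vec n w)" .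
  have "v = c' \<cdot>\<^sub>v (B *\<^sub>v vec n w)"
  proof (rule eq_vecI)
    show "dim_vec v = dim_vec (c' \<cdot>\<^sub>v (B *\<^sub>v vec n w))" using v B by simp
    fix i assume "i < dim_vec (c' \<cdot>\<^sub>v (B *\<^sub>v vec n w))"
    then have i: "i < n" using B by simp
    have d: "dim_vec v = n" "dim_row B = n" using v B by auto
    have "c * f * v $ i = f * (B *\<^sub>v vec n w) $ i"
      using arg_cong[OF cf, of "\<lambda>u :: 'k poly3 vec. u $ i"] i d by simp
    then have "f * (c * v $ i) = f * (B *\<^sub>v vec n w) $ i" by (simp only: ac_simps)
    then have cv: "c * v $ i = (B *\<^sub>v vec n w) $ i" using f0 by (metis mult_left_cancel)
    have "c' * (B *\<^sub>v vec n w) $ i = (c * c') * v $ i" unfolding cv[symmetric] by (simp only: ac_simps)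
    then show "v $ i = (c' \<cdot>\<^sub>v (B *\<^sub>v vec n w)) $ i" using i d c by simp
  qed
  also have "\<dots> = B *\<^sub>v (c' \<cdot>\<^sub>v vec n w)" by (rule mult_mat_smult_vec[OF B, symmetric]) simp
  finally show ?thesis by (intro bexI[of _ "c' \<cdot>\<^sub>v vec n w"]) auto
qed

lemma elements_mat_class:
  assumes "const_coeff f = 0" "\<And>p. p \<in> elements_mat A \<Longrightarrow> const_coeff p = 0"
  shows "elements_mat (map_mat (hyp_class f) A) \<subseteq> irrelevant_ideal f"
proof
  fix x assume "x \<in> elements_mat (map_mat (hyp_class f) A)"
  then obtain i j where "i < dim_row A" "j < dim_col A" "x = hyp_class f (A $$ (i, j))"
    unfolding elements_mat_def by auto
  moreover from this have "A $$ (i, j) \<in> elements_mat A" unfolding elements_mat_def by force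
  ultimately show "x \<in> irrelevant_ideal f" unfolding irrelevant_ideal_eq[OF assms(1)] using assms(2) by blast
qed

lemma elements_mat_carrier: "elements_mat (map_mat (hyp_class f) A) \<subseteq> carrier (hyp_ring f)"
  unfolding elements_mat_def by auto

text \<open>If a proper subset of the columns generated the same module, an omitted column would be a
  combination of the others. This is a relation with a coefficient \<open>1\<close>, which does not
  vanish at the origin.\<close>

lemma minimal_generators:
  assumes E: "E \<in> carrier_mat r n" and f: "const_coeff f = 0"
    and ker: "\<And>v i. v \<in> carrier_vec n \<Longrightarrow> map_vec (hyp_class f) (E *\<^sub>v v) = map_vec (hyp_class f) (0\<^sub>v r) \<Longrightarrow> i < n \<Longrightarrow>
      const_coeff (v $ i) = 0"
  shows "distinct (cols (map_mat (hyp_class f) E))"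
    and "minimal_generating_set (hyp_ring f) r {map_vec (hyp_class f) (E *\<^sub>v v) | v. v \<in> carrier_vec n} (set (cols (map_mat (hyp_class f) E)))"
proof -
  interpret cring "hyp_ring f" by (rule hyp_ring_cring)
  have d: "dim_row E = r" "dim_col E = n" using E by auto
  define C where "C j = map_vec (hyp_class f) (col E j)" for j
  have cols: "cols (map_mat (hyp_class f) E) = map C [0..<n]"
    unfolding cols_def C_def using d by (intro map_cong) auto
  have C_ent: "C j $ i = hyp_class f (E $$ (i, j))" if "i < r" "j < n" for i j
    unfolding C_def using that d by simp
  have Ev: "E *\<^sub>v v \<in> carrier_vec r" if "v \<in> carrier_vec n" for v using E that by auto
  have unit: "E *\<^sub>v unit_vec n j = col E j" if "j < n" for j
    using that d by (intro eq_vecI) auto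
  have rel: "const_coeff ((v - w) $ i) = 0"
    if vw: "v \<in> carrier_vec n" "w \<in> carrier_vec n" "map_vec (hyp_class f) (E *\<^sub>v v) = map_vec (hyp_class f) (E *\<^sub>v w)" "i < n" for v w :: "'k poly3 vec" and i
  proof -
    have "E *\<^sub>v (v - w) = E *\<^sub>v v - E *\<^sub>v w" by (rule mult_minus_distrib_mat_vec[OF E vw(1,2)])
    moreover have "\<forall>i<r. f dvd (E *\<^sub>v v) $ i - (E *\<^sub>v w) $ i"
      using vw(3) map_vec_cls_eq_iff[OF Ev[OF vw(1)] Ev[OF vw(2)]] by blast
    moreover have "(E *\<^sub>v v - E *\<^sub>v w) $ i = (E *\<^sub>v v) $ i - (E *\<^sub>v w) $ i" if "i < r" for i
      using that d by (intro index_minus_vec(1)) simp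
    ultimately have "\<forall>i<r. f dvd (E *\<^sub>v (v - w)) $ i - 0\<^sub>v r $ i" by simp
    moreover have "E *\<^sub>v (v - w) \<in> carrier_vec r" using Ev vw(1,2) by simp
    ultimately have "map_vec (hyp_class f) (E *\<^sub>v (v - w)) = map_vec (hyp_class f) (0\<^sub>v r)"
      using map_vec_cls_eq_iff[of "E *\<^sub>v (v - w)" r "0\<^sub>v r"] by simp
    then show ?thesis using ker[of "v - w" i] vw by auto
  qed
  have indep: "v $ j \<noteq> 0" if v: "v \<in> carrier_vec n" "map_vec (hyp_class f) (E *\<^sub>v v) = C j" "j < n" for v :: "'k poly3 vec" and j
  proof
    assume z: "v $ j = 0"
    have "const_coeff ((unit_vec n j - v) $ j) = 0"
      by (rule rel) (use v unit in \<open>auto simp: C_def\<close>)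
    then show False using z v by simp
  qed
  have inj: "inj_on C {..<n}"
  proof (rule inj_onI)
    fix i j assume ij: "i \<in> {..<n}" "j \<in> {..<n}" "C i = C j"
    then have "(unit_vec n i :: 'k poly3 vec) $ j \<noteq> 0"
      using unit[of i] by (intro indep) (auto simp: C_def)
    then show "i = j" using ij by (auto split: if_splits)
  qed
  show "distinct (cols (map_mat (hyp_class f) E))"
    unfolding cols distinct_map using inj by (simp add: lessThan_atLeast0)
  have span: "vec_span (hyp_ring f) r (C ` J) = {map_vec (hyp_class f) (E *\<^sub>v v) | v. v \<in> carrier_vec n \<and> (\<forall>j<n. j \<notin> J \<longrightarrow> v $ j = 0)}"
    if J: "J \<subseteq> {..<n}" for J
  proof -
    have finJ: "finite J" using J finite_subset by blast
    have sum: "vec r (\<lambda>i. \<Oplus>\<^bsub>hyp_ring f\<^esub>s\<in>C ` J. c s \<otimes>\<^bsub>hyp_ring f\<^esub> s $ i) = map_vec (hyp_class f) (E *\<^sub>v v)"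
      if c: "\<And>j. j \<in> J \<Longrightarrow> c (C j) = hyp_class f (v $ j)" and v: "v \<in> carrier_vec n" "\<And>j. j < n \<Longrightarrow> j \<notin> J \<Longrightarrow> v $ j = 0" for c and v :: "'k poly3 vec"
    proof (rule eq_vecI)
      fix i assume "i < dim_vec (map_vec (hyp_class f) (E *\<^sub>v v))"
      then have i: "i < r" using d by simp
      have "(\<Oplus>\<^bsub>hyp_ring f\<^esub>s\<in>C ` J. c s \<otimes>\<^bsub>hyp_ring f\<^esub> s $ i) = (\<Oplus>\<^bsub>hyp_ring f\<^esub>j\<in>J. c (C j) \<otimes>\<^bsub>hyp_ring f\<^esub> C j $ i)"
        using inj_on_subset[OF inj J] C_ent i J c by (intro finsum_reindex) (auto simp: subset_iff)
      also have "\<dots> = (\<Oplus>\<^bsub>hyp_ring f\<^esub>j\<in>J. hyp_class f (v $ j * E $$ (i, j)))"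
        using C_ent i J c by (intro finsum_cong') (auto simp: subset_iff)
      also have "\<dots> = hyp_class f (\<Sum>j\<in>J. v $ j * E $$ (i, j))" by (rule hyp_class_finsum[OF finJ])
      also have "(\<Sum>j\<in>J. v $ j * E $$ (i, j)) = (\<Sum>j<n. v $ j * E $$ (i, j))"
        using v J by (intro sum.mono_neutral_left) auto
      also have "\<dots> = (E *\<^sub>v v) $ i"
        using i d v by (simp add: scalar_prod_def lessThan_atLeast0 mult.commute)
      finally show "vec r (\<lambda>i. \<Oplus>\<^bsub>hyp_ring f\<^esub>s\<in>C ` J. c s \<otimes>\<^bsub>hyp_ring f\<^esub> s $ i) $ i = map_vec (hyp_class f) (E *\<^sub>v v) $ i"
        using i d by simp
    qed (use d in simp)
    show ?thesis
    proof (intro Set.equalityI subsetI)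
      fix x assume "x \<in> vec_span (hyp_ring f) r (C ` J)"
      then obtain c where c: "c \<in> C ` J \<rightarrow> carrier (hyp_ring f)" "x = vec r (\<lambda>i. \<Oplus>\<^bsub>hyp_ring f\<^esub>s\<in>C ` J. c s \<otimes>\<^bsub>hyp_ring f\<^esub> s $ i)"
        unfolding vec_span_def by blast
      have "\<forall>j. \<exists>q. j \<in> J \<longrightarrow> c (C j) = hyp_class f q" using c(1) unfolding carrier_hyp_ring by blast
      then obtain q where q: "\<And>j. j \<in> J \<Longrightarrow> c (C j) = hyp_class f (q j)" by metis
      define v where "v = vec n (\<lambda>j. if j \<in> J then q j else 0)"
      have "x = map_vec (hyp_class f) (E *\<^sub>v v)"
        unfolding c(2) by (rule sum) (use q J in \<open>auto simp: v_def\<close>)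
      then show "x \<in> {map_vec (hyp_class f) (E *\<^sub>v v) | v. v \<in> carrier_vec n \<and> (\<forall>j<n. j \<notin> J \<longrightarrow> v $ j = 0)}"
        by (intro CollectI exI[of _ v]) (simp add: v_def)
    next
      fix x assume "x \<in> {map_vec (hyp_class f) (E *\<^sub>v v) | v. v \<in> carrier_vec n \<and> (\<forall>j<n. j \<notin> J \<longrightarrow> v $ j = 0)}"
      then obtain v :: "'k poly3 vec" where v: "x = map_vec (hyp_class f) (E *\<^sub>v v)" "v \<in> carrier_vec n" "\<And>j. j < n \<Longrightarrow> j \<notin> J \<Longrightarrow> v $ j = 0" by blast
      define c where "c s = hyp_class f (v $ the_inv_into {..<n} C s)" for s
      have "c (C j) = hyp_class f (v $ j)" if "j \<in> J" for j
        unfolding c_def using the_inv_into_f_f[OF inj, of j] that J by auto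
      then have "x = vec r (\<lambda>i. \<Oplus>\<^bsub>hyp_ring f\<^esub>s\<in>C ` J. c s \<otimes>\<^bsub>hyp_ring f\<^esub> s $ i)"
        unfolding v(1) by (rule sum[symmetric]) (use v in auto)
      then show "x \<in> vec_span (hyp_ring f) r (C ` J)" unfolding vec_span_def by (auto simp: c_def)
    qed
  qed
  have set: "set (cols (map_mat (hyp_class f) E)) = C ` {..<n}" unfolding cols by (simp add: lessThan_atLeast0)
  show "minimal_generating_set (hyp_ring f) r {map_vec (hyp_class f) (E *\<^sub>v v) | v. v \<in> carrier_vec n} (set (cols (map_mat (hyp_class f) E)))"
    unfolding minimal_generating_set_def set
  proof (intro conjI allI impI)
    show "finite (C ` {..<n})" by simp
    show "C ` {..<n} \<subseteq> free_mod (hyp_ring f) r" unfolding free_mod_eq C_def using d by auto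
    show "vec_span (hyp_ring f) r (C ` {..<n}) = {map_vec (hyp_class f) (E *\<^sub>v v) | v. v \<in> carrier_vec n}"
      by (subst span) auto
    show "vec_span (hyp_ring f) r T \<noteq> {map_vec (hyp_class f) (E *\<^sub>v v) | v. v \<in> carrier_vec n}" if T: "T \<subset> C ` {..<n}" for T
    proof
      assume eq: "vec_span (hyp_ring f) r T = {map_vec (hyp_class f) (E *\<^sub>v v) | v. v \<in> carrier_vec n}"
      define J where "J = {j \<in> {..<n}. C j \<in> T}"
      have TJ: "T = C ` J" using T unfolding J_def by blast
      obtain j where j: "j < n" "C j \<notin> T" using T by blast
      have "C j = map_vec (hyp_class f) (E *\<^sub>v unit_vec n j)" unfolding C_def unit[OF j(1)] ..
      then have "C j \<in> vec_span (hyp_ring f) r T" unfolding eq by (intro CollectI exI[of _ "unit_vec n j"]) simp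
      then obtain v :: "'k poly3 vec" where "C j = map_vec (hyp_class f) (E *\<^sub>v v)" "v \<in> carrier_vec n" "v $ j = 0"
        unfolding TJ using span[of J] j by (auto simp: J_def)
      then show False using indep[of v j] j(1) by auto
    qed
  qed
qed

end

section \<open>Matrices given by lists of rows\<close>

text \<open>Block matrices are evaluated by pushing all operations down to explicit lists of rows.\<close>

lemma append_cols_rows_list:
  assumes "length rs = length ss" "\<forall>r\<in>set rs. length r = m" "\<forall>r\<in>set ss. length r = n"
  shows "mat_of_rows_list m rs @\<^sub>c mat_of_rows_list n ss = mat_of_rows_list (m + n) (map2 (@) rs ss)"
  using assms unfolding append_cols_def mat_of_rows_list_def
  by (intro eq_matI) (auto simp: nth_append)

lemma append_rows_rows_list:
  "mat_of_rows_list n rs @\<^sub>r mat_of_rows_list n ss = mat_of_rows_list n (rs @ ss)"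
  unfolding append_rows_def mat_of_rows_list_def
  by (intro eq_matI) (auto simp: nth_append)

lemma zero_mat_rows_list: "0\<^sub>m r c = mat_of_rows_list c (replicate r (replicate c 0))"
  unfolding mat_of_rows_list_def by (intro eq_matI) auto

lemma smult_rows_list:
  assumes "\<forall>r\<in>set rs. length r = n"
  shows "c \<cdot>\<^sub>m mat_of_rows_list n rs = mat_of_rows_list n (map (map ((*) c)) rs)"
  using assms unfolding mat_of_rows_list_def by (intro eq_matI) auto

lemma uminus_rows_list:
  assumes "\<forall>r\<in>set rs. length r = n"
  shows "- mat_of_rows_list n rs = mat_of_rows_list n (map (map uminus) rs)"
  using assms unfolding mat_of_rows_list_def by (intro eq_matI) auto

lemma mat_1_1_rows_list: "mat 1 1 (\<lambda>_. c) = mat_of_rows_list 1 [[c]]"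
  and one_mat_1_rows_list: "1\<^sub>m 1 = mat_of_rows_list 1 [[1]]"
  unfolding mat_of_rows_list_def by (intro eq_matI; auto)+

lemma mult_vec_rows_list:
  assumes "\<forall>r\<in>set rs. length r = length v" "n = length v"
  shows "mat_of_rows_list n rs *\<^sub>v vec_of_list v = vec_of_list (map (\<lambda>r. \<Sum>(a, b)\<leftarrow>zip r v. a * b) rs)"
proof (rule eq_vecI)
  fix i assume "i < dim_vec (vec_of_list (map (\<lambda>r. \<Sum>(a, b)\<leftarrow>zip r v. a * b) rs))"
  then have i: "i < length rs" by simp
  then have len: "length (rs ! i) = length v" using assms(1) by simp
  have "(mat_of_rows_list n rs *\<^sub>v vec_of_list v) $ i = (\<Sum>j<length v. rs ! i ! j * v ! j)"
    using i assms(2) by (simp add: mat_of_rows_list_def scalar_prod_def vec_of_list_index lessThan_atLeast0)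
  also have "\<dots> = (\<Sum>(a, b)\<leftarrow>zip (rs ! i) v. a * b)"
    using len by (simp add: sum_list_sum_nth lessThan_atLeast0 case_prod_unfold)
  finally show "(mat_of_rows_list n rs *\<^sub>v vec_of_list v) $ i
      = vec_of_list (map (\<lambda>r. \<Sum>(a, b)\<leftarrow>zip r v. a * b) rs) $ i"
    using i by (simp add: vec_of_list_index)
qed (simp add: mat_of_rows_list_def)

lemma elements_rows_list:
  assumes "\<forall>r\<in>set rs. length r = n"
  shows "elements_mat (mat_of_rows_list n rs) \<subseteq> \<Union> (set (map set rs))"
proof
  fix x assume "x \<in> elements_mat (mat_of_rows_list n rs)"
  then obtain i j where ij: "i < length rs" "j < n" "x = rs ! i ! j"
    unfolding elements_mat_def mat_of_rows_list_def by auto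
  then have "x \<in> set (rs ! i)" using assms by simp
  then show "x \<in> \<Union> (set (map set rs))" using ij(1) nth_mem by fastforce
qed

lemma replicate_unfold: "replicate (numeral k) x = x # replicate (pred_numeral k) x" "replicate 1 x = [x]"
  by (simp_all add: numeral_eq_Suc)

lemmas rows_list_simps = append_cols_rows_list append_rows_rows_list zero_mat_rows_list smult_rows_list
  uminus_rows_list mat_1_1_rows_list one_mat_1_rows_list replicate_unfold

lemma det_2:
  assumes "A \<in> carrier_mat 2 2"
  shows "det A = A $$ (0, 0) * A $$ (1, 1) - A $$ (0, 1) * (A $$ (1, 0) :: 'a::comm_ring_1)"
proof -
  have dim: "dim_row A = 2" "dim_col A = 2" using carrier_matD[OF assms] by auto
  have del: "mat_delete A 0 j \<in> carrier_mat 1 1" for j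
    by (rule carrier_matI) (simp_all add: mat_delete_def dim)
  have d: "det (mat_delete A 0 0) = A $$ (1, 1)" "det (mat_delete A 0 1) = A $$ (1, 0)"
    unfolding det_single[OF del] by (simp_all add: mat_delete_def dim)
  have "det A = (\<Sum>j<2. A $$ (0, j) * cofactor A 0 j)"
    by (rule laplace_expansion_row[OF assms]) simp
  also have "(\<Sum>j<2. A $$ (0, j) * cofactor A 0 j) = A $$ (0, 0) * cofactor A 0 0 + A $$ (0, 1) * cofactor A 0 1"
    using sum.lessThan_Suc[of "\<lambda>j. A $$ (0, j) * cofactor A 0 j"] by (simp only: numeral_2_eq_2 sum.lessThan_Suc lessThan_0 sum.empty One_nat_def add_0_left)
  also have "cofactor A 0 0 = A $$ (1, 1)" unfolding cofactor_def d by simp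
  also have "cofactor A 0 1 = - A $$ (1, 0)" unfolding cofactor_def d by simp
  finally show ?thesis by (simp only: mult_minus_right add_uminus_conv_diff)
qed

lemma det_3:
  fixes a :: "'a::comm_ring_1"
  shows "det (mat_of_rows_list 3 [[a, b, c], [p, q, r], [u, v, w]])
    = a * (q * w - r * v) + b * (r * u - p * w) + c * (p * v - q * u)"
proof -
  define M where "M = mat_of_rows_list 3 [[a, b, c], [p, q, r], [u, v, w]]"
  have M: "M \<in> carrier_mat 3 3" by (rule carrier_matI) (simp_all add: M_def mat_of_rows_list_def)
  have dim: "dim_row M = 3" "dim_col M = 3" using carrier_matD[OF M] by auto
  have ent: "M $$ (0, 0) = a" "M $$ (0, 1) = b" "M $$ (0, 2) = c" "M $$ (1, 0) = p" "M $$ (1, 1) = q"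
    "M $$ (1, 2) = r" "M $$ (2, 0) = u" "M $$ (2, 1) = v" "M $$ (2, 2) = w"
    by (simp_all add: M_def mat_of_rows_list_def)
  have del: "mat_delete M 0 j \<in> carrier_mat 2 2" for j
    by (rule carrier_matI) (simp_all add: mat_delete_def dim)
  have del_ent: "mat_delete M 0 j $$ (k, l) = M $$ (Suc k, if l < j then l else Suc l)" if "k < 2" "l < 2" for j k l
    using that by (simp add: mat_delete_def dim)
  have sum3: "(\<Sum>j<3. h j) = h 0 + h 1 + h 2" for h :: "nat \<Rightarrow> 'a"
    by (simp add: eval_nat_numeral)
  have "det M = (\<Sum>j<3. M $$ (0, j) * cofactor M 0 j)"
    by (rule laplace_expansion_row[OF M]) simp
  also have "\<dots> = a * cofactor M 0 0 + b * cofactor M 0 1 + c * cofactor M 0 2"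
    unfolding sum3 ent by (rule refl)
  also have "cofactor M 0 0 = q * w - r * v"
    unfolding cofactor_def det_2[OF del] using ent by (simp add: del_ent numeral_2_eq_2)
  also have "cofactor M 0 1 = r * u - p * w"
    unfolding cofactor_def det_2[OF del] using ent by (simp add: del_ent numeral_2_eq_2)
  also have "cofactor M 0 2 = p * v - q * u"
    unfolding cofactor_def det_2[OF del] using ent by (simp add: del_ent numeral_2_eq_2)
  finally show ?thesis unfolding M_def .
qed

section \<open>The matrices of the resolution\<close>

lemma vec_of_list_elems:
  assumes "v \<in> carrier_vec n"
  shows "v = vec_of_list (map (vec_index v) [0..<n])"
  using assms by (intro eq_vecI) (auto simp: vec_of_list_index)

lemma cols_list_rows_list:
  assumes "\<forall>c\<in>set cs. length c = nr"
  shows "mat_of_cols_list nr cs = mat_of_rows_list (length cs) (map (\<lambda>i. map (\<lambda>c. c ! i) cs) [0..<nr])"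
  unfolding mat_of_cols_list_def mat_of_rows_list_def by (intro eq_matI) auto

lemma transpose_row: "transpose_mat (mat_of_rows_list 3 [[a, b, c]]) = mat_of_rows_list 1 [[a], [b], [c]]"
  unfolding mat_of_rows_list_def transpose_mat_def by (intro eq_matI) (auto simp: less_Suc_eq numeral_3_eq_3)

lemma column_times_row: "mat_of_rows_list 1 [[a], [b], [c]] * mat_of_rows_list 3 [[p, q, r]]
    = mat_of_rows_list 3 [[a * p, a * q, a * r], [b * p, b * q, b * r], [c * p, c * q, c * (r :: 'a::comm_ring_1)]]"
proof (rule eq_matI)
  fix i j
  assume "i < dim_row (mat_of_rows_list 3 [[a * p, a * q, a * r], [b * p, b * q, b * r], [c * p, c * q, c * r]])"
    "j < dim_col (mat_of_rows_list 3 [[a * p, a * q, a * r], [b * p, b * q, b * r], [c * p, c * q, c * r]])"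
  then have "i = 0 \<or> i = 1 \<or> i = 2" "j = 0 \<or> j = 1 \<or> j = 2"
    by (auto simp: mat_of_rows_list_def)
  then show "(mat_of_rows_list 1 [[a], [b], [c]] * mat_of_rows_list 3 [[p, q, r]]) $$ (i, j)
      = mat_of_rows_list 3 [[a * p, a * q, a * r], [b * p, b * q, b * r], [c * p, c * q, c * r]] $$ (i, j)"
    by (elim disjE) (simp_all add: mat_of_rows_list_def scalar_prod_def)
qed (simp_all add: mat_of_rows_list_def)

locale smooth_cone =
  fixes f :: "'k::field_char_0 poly3" and d :: nat
  assumes d3: "d \<ge> 3" and f0: "f \<noteq> 0" and hom: "homogeneous3 d f" and iso: "isolated_singularity f"
begin

text \<open>The integers and their inverses that occur in the matrices, as elements of \<open>Q\<close>.\<close>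

definition "dd = (cst (of_nat d) :: 'k poly3)"
definition "di = (cst (1 / of_nat d) :: 'k poly3)"
definition "nn = (cst (of_nat d - 1) :: 'k poly3)"
definition "ee = (cst (1 / (of_nat d - 1)) :: 'k poly3)"
definition "hh = (cst (1 / 2) :: 'k poly3)"

lemma d1: "(of_nat d :: 'k) - 1 \<noteq> 0"
  using d3 of_nat_eq_iff[of d 1, where 'a = 'k] by simp

lemma d_pred: "of_nat (d - 1) = (of_nat d - 1 :: 'k)"
  using d3 by (simp add: of_nat_diff)

lemma scalars:
  "cst (of_nat d - 1) = nn" "cst (1 / (of_nat d - 1)) = ee" "cst (1 / (of_nat d - 1)^2) = ee^2"
  "cst (2 / (of_nat d - 1)^2) = 2 * ee^2" "cst (1 / (of_nat d - 1)^3) = ee^3"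
  "cst (- (of_nat d - 1) / 2) = - nn * hh" "cst (1 / 2) = hh"
proof -
  show "cst (of_nat d - 1) = nn" "cst (1 / (of_nat d - 1)) = ee" "cst (1 / 2) = hh"
    unfolding nn_def ee_def hh_def by (rule refl)+
  show "cst (1 / (of_nat d - 1)^2) = ee^2" "cst (1 / (of_nat d - 1)^3) = ee^3"
    unfolding ee_def cst_power[symmetric] by (simp_all add: power_one_over)
  have "cst (2 / (of_nat d - 1)^2) = cst (2 * (1 / (of_nat d - 1))^2 :: 'k)"
    by (simp add: power_one_over)
  then show "cst (2 / (of_nat d - 1)^2) = 2 * ee^2"
    unfolding ee_def cst_mult cst_power cst_numeral .
  have "cst (- (of_nat d - 1) / 2) = cst (- (of_nat d - 1) * (1 / 2) :: 'k)" by simp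
  then show "cst (- (of_nat d - 1) / 2) = - nn * hh"
    unfolding nn_def hh_def cst_mult cst_hom(5) by simp
qed

lemma const_coeff_f: "const_coeff f = 0"
  using const_coeff_homogeneous[OF hom] d3 by simp

lemma euler: "xx * dx f + yy * dy f + zz * dz f = dd * f"
  unfolding dd_def by (rule euler_relation[OF hom])

lemma euler_partial:
  "dx (dx f) * xx + dx (dy f) * yy + dx (dz f) * zz = nn * dx f"
  "dx (dy f) * xx + dy (dy f) * yy + dy (dz f) * zz = nn * dy f"
  "dx (dz f) * xx + dy (dz f) * yy + dz (dz f) * zz = nn * dz f"
  using homogeneous3_partial[OF hom, THEN euler_relation]
  unfolding d_pred nn_def partial_commute mult.commute[of xx] mult.commute[of yy] mult.commute[of zz] by simp_all

lemma var_power_in_jacobian: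
  assumes "const_coeff v = 0"
  shows "\<exists>N. \<forall>M\<ge>N. \<exists>a b c. v ^ M = a * dx f + b * dy f + c * dz f"
proof -
  have "of_nat d \<noteq> (0 :: 'k)" using d3 by simp
  then obtain N a b c where v: "v ^ N = a * dx f + b * dy f + c * dz f"
    using isolated_singularity_power_in_jacobian_ideal[OF iso f0 const_coeff_f euler_relation[OF hom] _ assms]
    by blast
  have "\<exists>a b c. v ^ M = a * dx f + b * dy f + c * dz f" if "N \<le> M" for M
  proof (intro exI)
    have "v ^ M = v ^ (M - N) * v ^ N" using that by (simp add: power_add[symmetric])
    also have "\<dots> = (v ^ (M - N) * a) * dx f + (v ^ (M - N) * b) * dy f + (v ^ (M - N) * c) * dz f"
      unfolding v by (simp only: distrib_left mult.assoc)
    finally show "v ^ M = (v ^ (M - N) * a) * dx f + (v ^ (M - N) * b) * dy f + (v ^ (M - N) * c) * dz f" .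
  qed
  then show ?thesis by blast
qed

text \<open>A common exponent \<open>N\<close> puts \<open>x\<^sup>N, y\<^sup>N, z\<^sup>N\<close> into the
  Jacobian ideal, so exactness is transferred from these powers to the gradient.\<close>

lemma koszul_partials: "koszul1 (dx f) (dy f) (dz f)" "koszul2 (dx f) (dy f) (dz f)"
proof -
  obtain N1 where N1: "\<And>M. N1 \<le> M \<Longrightarrow> \<exists>a b c. xx ^ M = a * dx f + b * dy f + c * dz f"
    using var_power_in_jacobian[of xx] by auto
  obtain N2 where N2: "\<And>M. N2 \<le> M \<Longrightarrow> \<exists>a b c. yy ^ M = a * dx f + b * dy f + c * dz f"
    using var_power_in_jacobian[of yy] by auto
  obtain N3 where N3: "\<And>M. N3 \<le> M \<Longrightarrow> \<exists>a b c. zz ^ M = a * dx f + b * dy f + c * dz f"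
    using var_power_in_jacobian[of zz] by auto
  define N where "N = N1 + N2 + N3"
  obtain a1 a2 a3 where a: "xx ^ N = a1 * dx f + a2 * dy f + a3 * dz f" using N1[of N] unfolding N_def by auto
  obtain b1 b2 b3 where b: "yy ^ N = b1 * dx f + b2 * dy f + b3 * dz f" using N2[of N] unfolding N_def by auto
  obtain c1 c2 c3 where c: "zz ^ N = c1 * dx f + c2 * dy f + c3 * dz f" using N3[of N] unfolding N_def by auto
  have "dd * f \<noteq> 0" using f0 d3 cst_eq_iff[of "of_nat d" "0 :: 'k"] unfolding dd_def by simp
  then have nz: "dx f \<noteq> 0 \<or> dy f \<noteq> 0 \<or> dz f \<noteq> 0" using euler by auto
  show "koszul1 (dx f) (dy f) (dz f)"
    by (rule koszul1_transfer[OF koszul1_variables koszul2_variables var_power_nonzero(1) nz a b c])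
  show "koszul2 (dx f) (dy f) (dz f)"
    by (rule koszul2_transfer[OF koszul2_variables var_power_nonzero(1) nz a b c])
qed

sublocale hessian_ring xx yy zz f "dx f" "dy f" "dz f" "dx (dx f)" "dx (dy f)" "dx (dz f)"
  "dy (dy f)" "dy (dz f)" "dz (dz f)" dd di nn ee hh
proof
  show "dd * di = 1" unfolding dd_def di_def cst_mult[symmetric] using d3 by simp
  show "nn * ee = 1" unfolding nn_def ee_def cst_mult[symmetric] using d1 by simp
  show "2 * hh = 1" unfolding hh_def cst_numeral[symmetric] cst_mult[symmetric] by simp
  show "koszul1 xx yy (zz :: 'k poly3)" "koszul2 xx yy (zz :: 'k poly3)"
    using koszul1_variables[of 1] koszul2_variables[of 1] by simp_all
  show "xx \<noteq> (0 :: 'k poly3)" by (simp add: xx_def)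
qed (fact f0 euler euler_partial koszul_partials)+

lemma adjugate_entries: "Hxx f = axx" "Hyy f = ayy" "Hzz f = azz" "Hxy f = axy" "Hxz f = axz" "Hyz f = ayz"
  unfolding adjugate_defs Hxx_def Hyy_def Hzz_def Hxy_def Hxz_def Hyz_def by (rule refl)+

lemma alpha3_eq: "alpha3 d f = ee^3 * hdet"
proof -
  have "det (hess f) = hdet"
    unfolding hess_def partial_commute det_3 hdet_def adjugate_defs by Groebner_Basis.algebra
  then show ?thesis unfolding alpha3_def scalars by simp
qed

lemmas matrix_defs = par1_def par2_def par3_def Df1_def Df2_def Df3_def hess_def qmat_def alpha1_def alpha2_def
  M0_1_def M1_1_def M2_1_def M1_2_def M2_2_def theta1_def theta2_def theta3_def M0_2_def M0_2_left_def M0_2_right_def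

text \<open>The four matrices of the resolution as explicit tables; from here on the matrices enter only through
  their action on vectors.\<close>

lemma odd_rows: "odd_dif_poly d f = mat_of_rows_list 11
     [[dx f, dy f, dz f, 0, 0, 0, 0, 0, 0, 0, - (nn * ee^3 * hdet)],
      [0, zz, - yy, dx f, 0, 0, 0, nn * ee * dx (dx f), nn * ee * dx (dy f), nn * ee * dx (dz f), 0],
      [- zz, 0, xx, dy f, 0, 0, 0, nn * ee * dx (dy f), nn * ee * dy (dy f), nn * ee * dy (dz f), 0],
      [yy, - xx, 0, dz f, 0, 0, 0, nn * ee * dx (dz f), nn * ee * dy (dz f), nn * ee * dz (dz f), 0],
      [0, 0, 0, 0, dx f, dy f, dz f, 0, 0, 0, - (2 * ee^3 * hdet)],
      [0, 0, 0, 0, 0, zz, - yy, 2 * ee * dx (dx f), 2 * ee * dx (dy f), 2 * ee * dx (dz f), 0],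
      [0, 0, 0, 0, - zz, 0, xx, 2 * ee * dx (dy f), 2 * ee * dy (dy f), 2 * ee * dy (dz f), 0],
      [0, 0, 0, 0, yy, - xx, 0, 2 * ee * dx (dz f), 2 * ee * dy (dz f), 2 * ee * dz (dz f), 0],
      [0, 0, 0, 0, 0, 0, 0, 0, zz, - yy, dx f],
      [0, 0, 0, 0, 0, 0, 0, - zz, 0, xx, dy f],
      [0, 0, 0, 0, 0, 0, 0, yy, - xx, 0, dz f]]"
proof -
  show ?thesis
    unfolding odd_dif_poly_def matrix_defs Let_def adjugate_entries alpha3_eq scalars partial_commute transpose_row column_times_row
    apply (simp add: rows_list_simps cols_list_rows_list upt_rec del: One_nat_def mult_minus_left)
    apply (rule arg_cong[of _ _ "mat_of_rows_list 11"])
    apply (simp only: list.inject simp_thms)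
    apply (intro conjI; Groebner_Basis.algebra)
    done
qed

lemma odd_carrier: "odd_dif_poly d f \<in> carrier_mat 11 11"
  unfolding odd_rows by (rule carrier_matI) (simp_all add: mat_of_rows_list_def)

lemma even_rows: "even_dif_poly d f = mat_of_rows_list 11
     [[xx, 0, - dz f, dy f, 0, 0, 0, 0, nn * ee^2 * axx, nn * ee^2 * axy, nn * ee^2 * axz],
      [yy, dz f, 0, - dx f, 0, 0, 0, 0, nn * ee^2 * axy, nn * ee^2 * ayy, nn * ee^2 * ayz],
      [zz, - dy f, dx f, 0, 0, 0, 0, 0, nn * ee^2 * axz, nn * ee^2 * ayz, nn * ee^2 * azz],
      [0, xx, yy, zz, 0, - (nn * hh * xx), - (nn * hh * yy), - (nn * hh * zz), 0, 0, 0],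
      [0, 0, 0, 0, xx, 0, - dz f, dy f, 2 * ee^2 * axx, 2 * ee^2 * axy, 2 * ee^2 * axz],
      [0, 0, 0, 0, yy, dz f, 0, - dx f, 2 * ee^2 * axy, 2 * ee^2 * ayy, 2 * ee^2 * ayz],
      [0, 0, 0, 0, zz, - dy f, dx f, 0, 2 * ee^2 * axz, 2 * ee^2 * ayz, 2 * ee^2 * azz],
      [0, 0, 0, 0, 0, hh * (xx * xx), hh * (xx * yy), hh * (xx * zz), 0, - dz f, dy f],
      [0, 0, 0, 0, 0, hh * (yy * xx), hh * (yy * yy), hh * (yy * zz), dz f, 0, - dx f],
      [0, 0, 0, 0, 0, hh * (zz * xx), hh * (zz * yy), hh * (zz * zz), - dy f, dx f, 0],
      [0, 0, 0, 0, 0, 0, 0, 0, xx, yy, zz]]"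
proof -
  have half: "- nn * hh * (- 2 * (ee^2 * t)) = nn * ee^2 * t" for t
    by (rule lin1[OF hf, where c = "nn * ee^2 * t"]) Groebner_Basis.algebra
  show ?thesis
    unfolding even_dif_poly_def matrix_defs Let_def adjugate_entries alpha3_eq scalars partial_commute transpose_row column_times_row
    apply (simp add: rows_list_simps cols_list_rows_list upt_rec del: One_nat_def mult_minus_left)
    apply (rule arg_cong[of _ _ "mat_of_rows_list 11"])
    apply (simp only: list.inject simp_thms half)
    apply (intro conjI; Groebner_Basis.algebra)
    done
qed

lemma even_carrier: "even_dif_poly d f \<in> carrier_mat 11 11"
  unfolding even_rows by (rule carrier_matI) (simp_all add: mat_of_rows_list_def)

lemma first_rows: "first_dif_poly d f = mat_of_rows_list 11
     [[dx f, dy f, dz f, 0, 0, 0, 0, 0, 0, 0, - (nn * ee^3 * hdet)],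
      [0, zz, - yy, dx f, 0, 0, 0, nn * ee * dx (dx f), nn * ee * dx (dy f), nn * ee * dx (dz f), 0],
      [- zz, 0, xx, dy f, 0, 0, 0, nn * ee * dx (dy f), nn * ee * dy (dy f), nn * ee * dy (dz f), 0],
      [yy, - xx, 0, dz f, 0, 0, 0, nn * ee * dx (dz f), nn * ee * dy (dz f), nn * ee * dz (dz f), 0],
      [0, 0, 0, 0, dx f, dy f, dz f, 0, 0, 0, - (2 * ee^3 * hdet)],
      [0, 0, 0, 0, 0, zz, - yy, 2 * ee * dx (dx f), 2 * ee * dx (dy f), 2 * ee * dx (dz f), 0],
      [0, 0, 0, 0, - zz, 0, xx, 2 * ee * dx (dy f), 2 * ee * dy (dy f), 2 * ee * dy (dz f), 0],
      [0, 0, 0, 0, yy, - xx, 0, 2 * ee * dx (dz f), 2 * ee * dy (dz f), 2 * ee * dz (dz f), 0],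
      [0, 0, 0, 0, 0, 0, 0, 0, zz, - yy, dx f],
      [0, 0, 0, 0, 0, 0, 0, - zz, 0, xx, dy f],
      [0, 0, 0, 0, 0, 0, 0, yy, - xx, 0, dz f],
      [0, 0, 0, 0, 0, 0, 0, 0, 0, 0, 0]]"
proof -
  show ?thesis
    unfolding first_dif_poly_def matrix_defs Let_def adjugate_entries alpha3_eq scalars partial_commute transpose_row column_times_row
    apply (simp add: rows_list_simps cols_list_rows_list upt_rec del: One_nat_def mult_minus_left)
    apply (rule arg_cong[of _ _ "mat_of_rows_list 11"])
    apply (simp only: list.inject simp_thms)
    apply (intro conjI; Groebner_Basis.algebra)
    done
qed

lemma first_carrier: "first_dif_poly d f \<in> carrier_mat 12 11"
  unfolding first_rows by (rule carrier_matI) (simp_all add: mat_of_rows_list_def)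

lemma eps_rows: "eps_poly d f = mat_of_rows_list 12
     [[xx, 0, - dz f, dy f, 0, 0, 0, 0, nn * ee^2 * axx, nn * ee^2 * axy, nn * ee^2 * axz, 0],
      [yy, dz f, 0, - dx f, 0, 0, 0, 0, nn * ee^2 * axy, nn * ee^2 * ayy, nn * ee^2 * ayz, 0],
      [zz, - dy f, dx f, 0, 0, 0, 0, 0, nn * ee^2 * axz, nn * ee^2 * ayz, nn * ee^2 * azz, 0],
      [0, 0, 0, 0, 2 * xx^2, 0, - (2 * (xx * dz f)), 2 * (xx * dy f), 2 * ee^2 * (xx * axx), 2 * ee^2 * (2 * xx * axy - yy * axx), 2 * ee^2 * (2 * xx * axz - zz * axx), 0],
      [0, 0, 0, 0, 2 * (xx * yy), xx * dz f, - (yy * dz f), yy * dy f - xx * dx f, 2 * ee^2 * (yy * axx), 2 * ee^2 * (xx * ayy), 2 * ee^2 * (xx * ayz + yy * axz - zz * axy), 0],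
      [0, 0, 0, 0, 2 * (xx * zz), - (xx * dy f), xx * dx f - zz * dz f, zz * dy f, 2 * ee^2 * (zz * axx), 2 * ee^2 * (zz * axy + xx * ayz - yy * axz), 2 * ee^2 * (xx * azz), 0],
      [0, 0, 0, 0, 2 * yy^2, 2 * (yy * dz f), 0, - (2 * (yy * dx f)), 2 * ee^2 * (2 * yy * axy - xx * ayy), 2 * ee^2 * (yy * ayy), 2 * ee^2 * (2 * yy * ayz - zz * ayy), 0],
      [0, 0, 0, 0, 2 * (yy * zz), zz * dz f - yy * dy f, yy * dx f, - (zz * dx f), 2 * ee^2 * (yy * axz + zz * axy - xx * ayz), 2 * ee^2 * (zz * ayy), 2 * ee^2 * (yy * azz), 0],
      [0, 0, 0, 0, 2 * zz^2, - (2 * (zz * dy f)), 2 * (zz * dx f), 0, 2 * ee^2 * (2 * zz * axz - xx * azz), 2 * ee^2 * (2 * zz * ayz - yy * azz), 2 * ee^2 * (zz * azz), 0],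
      [0, 0, 0, 0, 0, 0, 0, 0, 0, 0, 0, 1]]"
proof -
  show ?thesis
    unfolding eps_poly_def matrix_defs Let_def adjugate_entries alpha3_eq scalars partial_commute transpose_row column_times_row
    apply (simp add: rows_list_simps cols_list_rows_list upt_rec del: One_nat_def mult_minus_left)
    apply (rule arg_cong[of _ _ "mat_of_rows_list 12"])
    apply (simp only: list.inject simp_thms)
    apply (intro conjI; Groebner_Basis.algebra)
    done
qed

lemma eps_carrier: "eps_poly d f \<in> carrier_mat 10 12"
  unfolding eps_rows by (rule carrier_matI) (simp_all add: mat_of_rows_list_def)

lemma odd_apply: "odd_dif_poly d f *\<^sub>v vec_of_list [u1, u2, u3, t, a1, a2, a3, b1, b2, b3, s]
    = vec_of_list [(odd1 u1 u2 u3 s), (odd2 u2 u3 t b1 b2 b3), (odd3 u1 u3 t b1 b2 b3), (odd4 u1 u2 t b1 b2 b3), (odd5 a1 a2 a3 s), (odd6 a2 a3 b1 b2 b3), (odd7 a1 a3 b1 b2 b3), (odd8 a1 a2 b1 b2 b3), (odd9 b2 b3 s), (odd10 b1 b3 s), (odd11 b1 b2 s)]"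
  unfolding odd_rows
  apply (subst mult_vec_rows_list)
    apply (simp_all only: list.set ball_simps insert_iff list.size empty_iff)
    apply (simp_all del: vec_of_list_Cons)
  apply (rule arg_cong[of _ _ vec_of_list])
  apply (simp only: list.inject simp_thms)
  apply (intro conjI; Groebner_Basis.algebra)
  done

lemma even_apply: "even_dif_poly d f *\<^sub>v vec_of_list [h, p1, p2, p3, r, q1, q2, q3, w1, w2, w3]
    = vec_of_list [(even1 h p2 p3 w1 w2 w3), (even2 h p1 p3 w1 w2 w3), (even3 h p1 p2 w1 w2 w3), (even4 p1 p2 p3 q1 q2 q3), (even5 r q2 q3 w1 w2 w3), (even6 r q1 q3 w1 w2 w3), (even7 r q1 q2 w1 w2 w3), (even8 q1 q2 q3 w2 w3), (even9 q1 q2 q3 w1 w3), (even10 q1 q2 q3 w1 w2), (xdot w1 w2 w3)]"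
  unfolding even_rows
  apply (subst mult_vec_rows_list)
    apply (simp_all only: list.set ball_simps insert_iff list.size empty_iff)
    apply (simp_all del: vec_of_list_Cons)
  apply (rule arg_cong[of _ _ vec_of_list])
  apply (simp only: list.inject simp_thms)
  apply (intro conjI; Groebner_Basis.algebra)
  done

lemma first_apply: "first_dif_poly d f *\<^sub>v vec_of_list [u1, u2, u3, t, a1, a2, a3, b1, b2, b3, s]
    = vec_of_list [(odd1 u1 u2 u3 s), (odd2 u2 u3 t b1 b2 b3), (odd3 u1 u3 t b1 b2 b3), (odd4 u1 u2 t b1 b2 b3), (odd5 a1 a2 a3 s), (odd6 a2 a3 b1 b2 b3), (odd7 a1 a3 b1 b2 b3), (odd8 a1 a2 b1 b2 b3), (odd9 b2 b3 s), (odd10 b1 b3 s), (odd11 b1 b2 s), 0]"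
  unfolding first_rows
  apply (subst mult_vec_rows_list)
    apply (simp_all only: list.set ball_simps insert_iff list.size empty_iff)
    apply (simp_all del: vec_of_list_Cons)
  apply (rule arg_cong[of _ _ vec_of_list])
  apply (simp only: list.inject simp_thms)
  apply (intro conjI; Groebner_Basis.algebra)
  done

lemma eps_apply: "eps_poly d f *\<^sub>v vec_of_list [h, p1, p2, p3, r, q1, q2, q3, w1, w2, w3, c]
    = vec_of_list [h * xx + (dy f * p3 - dz f * p2) + nn * ee^2 * (adj1 w1 w2 w3), h * yy + (dz f * p1 - dx f * p3) + nn * ee^2 * (adj2 w1 w2 w3), h * zz + (dx f * p2 - dy f * p1) + nn * ee^2 * (adj3 w1 w2 w3), nxx r q1 q2 q3 w1 w2 w3, nxy r q1 q2 q3 w1 w2 w3, nxz r q1 q2 q3 w1 w2 w3, nyy r q1 q2 q3 w1 w2 w3, nyz r q1 q2 q3 w1 w2 w3, nzz r q1 q2 q3 w1 w2 w3, c]"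
  unfolding eps_rows
  apply (subst mult_vec_rows_list)
    apply (simp_all only: list.set ball_simps insert_iff list.size empty_iff)
    apply (simp_all del: vec_of_list_Cons)
  apply (rule arg_cong[of _ _ vec_of_list])
  apply (simp only: list.inject simp_thms)
  apply (unfold symbol_defs)
  apply (intro conjI; Groebner_Basis.algebra)
  done

lemma const_coeff_partials:
  "const_coeff (dx f) = 0" "const_coeff (dy f) = 0" "const_coeff (dz f) = 0"
  "const_coeff (dx (dx f)) = 0" "const_coeff (dx (dy f)) = 0" "const_coeff (dx (dz f)) = 0"
  "const_coeff (dy (dy f)) = 0" "const_coeff (dy (dz f)) = 0" "const_coeff (dz (dz f)) = 0"
proof -
  note h1 = homogeneous3_partial[OF hom]
  have "d - 1 \<noteq> 0" "d - 1 - 1 \<noteq> 0" using d3 by auto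
  then show "const_coeff (dx f) = 0" "const_coeff (dy f) = 0" "const_coeff (dz f) = 0"
    "const_coeff (dx (dx f)) = 0" "const_coeff (dx (dy f)) = 0" "const_coeff (dx (dz f)) = 0"
    "const_coeff (dy (dy f)) = 0" "const_coeff (dy (dz f)) = 0" "const_coeff (dz (dz f)) = 0"
    using h1[THEN const_coeff_homogeneous] h1(1)[THEN homogeneous3_partial(1), THEN const_coeff_homogeneous]
      h1(2)[THEN homogeneous3_partial(1), THEN const_coeff_homogeneous] h1(3)[THEN homogeneous3_partial(1), THEN const_coeff_homogeneous]
      h1(2)[THEN homogeneous3_partial(2), THEN const_coeff_homogeneous] h1(3)[THEN homogeneous3_partial(2), THEN const_coeff_homogeneous]
      h1(3)[THEN homogeneous3_partial(3), THEN const_coeff_homogeneous]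
    by blast+
qed

lemma const_coeff_odd:
  assumes "p \<in> elements_mat (odd_dif_poly d f)"
  shows "const_coeff p = 0"
  using subsetD[OF elements_rows_list assms[unfolded odd_rows]]
  by (auto simp: adjugate_defs hdet_def const_coeff_partials)

lemma const_coeff_even:
  assumes "p \<in> elements_mat (even_dif_poly d f)"
  shows "const_coeff p = 0"
  using subsetD[OF elements_rows_list assms[unfolded even_rows]]
  by (auto simp: adjugate_defs hdet_def const_coeff_partials)

lemma const_coeff_first:
  assumes "p \<in> elements_mat (first_dif_poly d f)"
  shows "const_coeff p = 0"
  using subsetD[OF elements_rows_list assms[unfolded first_rows]]
  by (auto simp: adjugate_defs hdet_def const_coeff_partials)

end

lemma smult_vec_of_list: "c \<cdot>\<^sub>v vec_of_list xs = vec_of_list (map ((*) c) xs)"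
  by (intro eq_vecI) (auto simp: vec_of_list_index)

lemma vec_10_cases:
  assumes "v \<in> carrier_vec 10"
  obtains a0 a1 a2 a3 a4 a5 a6 a7 a8 a9 where "v = vec_of_list [a0, a1, a2, a3, a4, a5, a6, a7, a8, a9]"
  by (rule that, rule trans[OF vec_of_list_elems[OF assms]]) (simp add: upt_rec del: vec_of_list_Cons)

lemma vec_11_cases:
  assumes "v \<in> carrier_vec 11"
  obtains a0 a1 a2 a3 a4 a5 a6 a7 a8 a9 a10 where "v = vec_of_list [a0, a1, a2, a3, a4, a5, a6, a7, a8, a9, a10]"
  by (rule that, rule trans[OF vec_of_list_elems[OF assms]]) (simp add: upt_rec del: vec_of_list_Cons)

lemma vec_12_cases:
  assumes "v \<in> carrier_vec 12"
  obtains a0 a1 a2 a3 a4 a5 a6 a7 a8 a9 a10 a11 where "v = vec_of_list [a0, a1, a2, a3, a4, a5, a6, a7, a8, a9, a10, a11]"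
  by (rule that, rule trans[OF vec_of_list_elems[OF assms]]) (simp add: upt_rec del: vec_of_list_Cons)

lemma class_list_eq_iff:
  assumes "length xs = n" "length ys = n"
  shows "map_vec (hyp_class f) (vec_of_list xs) = map_vec (hyp_class f) (vec_of_list ys)
    \<longleftrightarrow> list_all2 (\<lambda>a b. f dvd a - b) xs ys"
proof -
  have "vec_of_list xs \<in> carrier_vec n" "vec_of_list ys \<in> carrier_vec n"
    using assms by (auto intro!: carrier_vecI)
  from map_vec_cls_eq_iff[OF this] show ?thesis
    using assms by (simp add: list_all2_conv_all_nth vec_of_list_index)
qed

lemma class_list_eq_0_iff:
  assumes "length xs = n"
  shows "map_vec (hyp_class f) (vec_of_list xs) = map_vec (hyp_class f) (0\<^sub>v n) \<longleftrightarrow> (\<forall>a\<in>set xs. f dvd a)"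
proof -
  have "vec_of_list xs \<in> carrier_vec n" using assms by (auto intro!: carrier_vecI)
  from map_vec_cls_eq_iff[OF this zero_carrier_vec] show ?thesis
    using assms by (force simp: vec_of_list_index in_set_conv_nth)
qed

section \<open>Exactness\<close>

context smooth_cone
begin

lemma odd_even_apply:
  assumes "v \<in> carrier_vec 11"
  shows "odd_dif_poly d f *\<^sub>v (even_dif_poly d f *\<^sub>v v) = (dd * f) \<cdot>\<^sub>v v"
proof (rule vec_11_cases[OF assms])
  fix a0 a1 a2 a3 a4 a5 a6 a7 a8 a9 a10
  assume v: "v = vec_of_list [a0, a1, a2, a3, a4, a5, a6, a7, a8, a9, a10]"
  show ?thesis
    unfolding v even_apply odd_apply odd_even smult_vec_of_list list.map by (rule refl)
qed

lemma even_odd_apply: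
  assumes "v \<in> carrier_vec 11"
  shows "even_dif_poly d f *\<^sub>v (odd_dif_poly d f *\<^sub>v v) = (dd * f) \<cdot>\<^sub>v v"
proof (rule vec_11_cases[OF assms])
  fix a0 a1 a2 a3 a4 a5 a6 a7 a8 a9 a10
  assume v: "v = vec_of_list [a0, a1, a2, a3, a4, a5, a6, a7, a8, a9, a10]"
  show ?thesis
    unfolding v even_apply odd_apply even_odd smult_vec_of_list list.map by (rule refl)
qed

lemma multiple_f_class_zero:
  assumes "v \<in> carrier_vec n"
  shows "map_vec (hyp_class f) ((c * f) \<cdot>\<^sub>v v) = map_vec (hyp_class f) (0\<^sub>v n)"
proof -
  have "(c * f) \<cdot>\<^sub>v v \<in> carrier_vec n" using assms by simp
  from map_vec_cls_eq_iff[OF this zero_carrier_vec] show ?thesis using assms by auto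
qed

lemma dd_di: "dd * di = 1"
  by (rule di)

lemma kernel_odd:
  "{v \<in> free_mod (hyp_ring f) 11. mat_app (hyp_ring f) (map_mat (hyp_class f) (odd_dif_poly d f)) v
      = vec 11 (\<lambda>_. \<zero>\<^bsub>hyp_ring f\<^esub>)}
    = mat_app (hyp_ring f) (map_mat (hyp_class f) (even_dif_poly d f)) ` free_mod (hyp_ring f) 11"
proof (rule kernel_eq_image[OF odd_carrier even_carrier])
  fix v :: "'k poly3 vec" assume v: "v \<in> carrier_vec 11"
  then show "map_vec (hyp_class f) (odd_dif_poly d f *\<^sub>v (even_dif_poly d f *\<^sub>v v)) = map_vec (hyp_class f) (0\<^sub>v 11)"
    by (simp only: odd_even_apply multiple_f_class_zero)
  assume "map_vec (hyp_class f) (odd_dif_poly d f *\<^sub>v v) = map_vec (hyp_class f) (0\<^sub>v 11)"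
  from matrix_factorization_kernel[OF odd_carrier even_carrier f0 dd_di even_odd_apply v this]
  show "\<exists>u\<in>carrier_vec 11. map_vec (hyp_class f) v = map_vec (hyp_class f) (even_dif_poly d f *\<^sub>v u)" by blast
qed

lemma kernel_even:
  "{v \<in> free_mod (hyp_ring f) 11. mat_app (hyp_ring f) (map_mat (hyp_class f) (even_dif_poly d f)) v
      = vec 11 (\<lambda>_. \<zero>\<^bsub>hyp_ring f\<^esub>)}
    = mat_app (hyp_ring f) (map_mat (hyp_class f) (odd_dif_poly d f)) ` free_mod (hyp_ring f) 11"
proof (rule kernel_eq_image[OF even_carrier odd_carrier])
  fix v :: "'k poly3 vec" assume v: "v \<in> carrier_vec 11"
  then show "map_vec (hyp_class f) (even_dif_poly d f *\<^sub>v (odd_dif_poly d f *\<^sub>v v)) = map_vec (hyp_class f) (0\<^sub>v 11)"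
    by (simp only: even_odd_apply multiple_f_class_zero)
  assume "map_vec (hyp_class f) (even_dif_poly d f *\<^sub>v v) = map_vec (hyp_class f) (0\<^sub>v 11)"
  from matrix_factorization_kernel[OF even_carrier odd_carrier f0 dd_di odd_even_apply v this]
  show "\<exists>u\<in>carrier_vec 11. map_vec (hyp_class f) v = map_vec (hyp_class f) (odd_dif_poly d f *\<^sub>v u)" by blast
qed

text \<open>The first differential is the odd matrix with a zero row appended, so both have the same kernel.\<close>

lemma first_class_zero_iff:
  assumes "v \<in> carrier_vec 11"
  shows "map_vec (hyp_class f) (first_dif_poly d f *\<^sub>v v) = map_vec (hyp_class f) (0\<^sub>v 12)
    \<longleftrightarrow> map_vec (hyp_class f) (odd_dif_poly d f *\<^sub>v v) = map_vec (hyp_class f) (0\<^sub>v 11)"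
proof (rule vec_11_cases[OF assms])
  fix a0 a1 a2 a3 a4 a5 a6 a7 a8 a9 a10
  assume v: "v = vec_of_list [a0, a1, a2, a3, a4, a5, a6, a7, a8, a9, a10]"
  have l: "length [b0, b1, b2, b3, b4, b5, b6, b7, b8, b9, b10 :: 'k poly3] = 11"
    "length [b0, b1, b2, b3, b4, b5, b6, b7, b8, b9, b10, b11 :: 'k poly3] = 12"
    for b0 b1 b2 b3 b4 b5 b6 b7 b8 b9 b10 b11 by simp_all
  show ?thesis
    unfolding v first_apply odd_apply class_list_eq_0_iff[OF l(1)] class_list_eq_0_iff[OF l(2)]
    by (simp only: list.set ball_simps dvd_0_right simp_thms)
qed

lemma kernel_first:
  "{v \<in> free_mod (hyp_ring f) 11. mat_app (hyp_ring f) (map_mat (hyp_class f) (first_dif_poly d f)) v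
      = vec 12 (\<lambda>_. \<zero>\<^bsub>hyp_ring f\<^esub>)}
    = mat_app (hyp_ring f) (map_mat (hyp_class f) (even_dif_poly d f)) ` free_mod (hyp_ring f) 11"
proof (rule kernel_eq_image[OF first_carrier even_carrier])
  fix v :: "'k poly3 vec" assume v: "v \<in> carrier_vec 11"
  then have "even_dif_poly d f *\<^sub>v v \<in> carrier_vec 11" using even_carrier by auto
  then show "map_vec (hyp_class f) (first_dif_poly d f *\<^sub>v (even_dif_poly d f *\<^sub>v v)) = map_vec (hyp_class f) (0\<^sub>v 12)"
    using v by (simp only: first_class_zero_iff odd_even_apply multiple_f_class_zero)
  assume "map_vec (hyp_class f) (first_dif_poly d f *\<^sub>v v) = map_vec (hyp_class f) (0\<^sub>v 12)"
  then have "map_vec (hyp_class f) (odd_dif_poly d f *\<^sub>v v) = map_vec (hyp_class f) (0\<^sub>v 11)"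
    by (simp only: first_class_zero_iff[OF v])
  from matrix_factorization_kernel[OF odd_carrier even_carrier f0 dd_di even_odd_apply v this]
  show "\<exists>u\<in>carrier_vec 11. map_vec (hyp_class f) v = map_vec (hyp_class f) (even_dif_poly d f *\<^sub>v u)" by blast
qed

lemma length_12: "length [b0, b1, b2, b3, b4, b5, b6, b7, b8, b9, b10, b11] = 12"
  and length_10: "length [b0, b1, b2, b3, b4, b5, b6, b7, b8, b9] = 10"
  by simp_all

lemma eps_first_class_zero:
  assumes "v \<in> carrier_vec 11"
  shows "map_vec (hyp_class f) (eps_poly d f *\<^sub>v (first_dif_poly d f *\<^sub>v v)) = map_vec (hyp_class f) (0\<^sub>v 10)"
proof (rule vec_11_cases[OF assms])
  fix a0 a1 a2 a3 a4 a5 a6 a7 a8 a9 a10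
  assume v: "v = vec_of_list [a0, a1, a2, a3, a4, a5, a6, a7, a8, a9, a10]"
  show ?thesis
    unfolding v first_apply eps_apply even_odd class_list_eq_0_iff[OF length_10]
    by (simp only: list.set ball_simps dvd_0_right simp_thms symbol_of_odd dvd_mult2 dvd_triv_right)
qed

text \<open>The second order part of the relation determines \<open>a, b, s\<close> by
  \<open>symbol_relations\<close>. Applying the identity \<open>even_odd\<close> with \<open>u =
  0\<close> and \<open>t = 0\<close> to these values removes the correction term \<open>A w\<close>
  from the first order part, to which \<open>gradient_kernel_relations\<close> applies.\<close>

lemma eps_relation:
  fixes v :: "'k poly3 vec"
  assumes v: "v \<in> carrier_vec 12" and z: "map_vec (hyp_class f) (eps_poly d f *\<^sub>v v) = map_vec (hyp_class f) (0\<^sub>v 10)"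
  shows "\<exists>u\<in>carrier_vec 11. map_vec (hyp_class f) v = map_vec (hyp_class f) (first_dif_poly d f *\<^sub>v u)"
proof (rule vec_12_cases[OF v])
  fix h p1 p2 p3 r q1 q2 q3 w1 w2 w3 c
  assume v: "v = vec_of_list [h, p1, p2, p3, r, q1, q2, q3, w1, w2, w3, c]"
  have "f dvd h * xx + (dy f * p3 - dz f * p2) + nn * ee^2 * (adj1 w1 w2 w3) \<and>
    f dvd h * yy + (dz f * p1 - dx f * p3) + nn * ee^2 * (adj2 w1 w2 w3) \<and>
    f dvd h * zz + (dx f * p2 - dy f * p1) + nn * ee^2 * (adj3 w1 w2 w3) \<and>
    f dvd nxx r q1 q2 q3 w1 w2 w3 \<and> f dvd nxy r q1 q2 q3 w1 w2 w3 \<and> f dvd nxz r q1 q2 q3 w1 w2 w3 \<and>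
    f dvd nyy r q1 q2 q3 w1 w2 w3 \<and> f dvd nyz r q1 q2 q3 w1 w2 w3 \<and> f dvd nzz r q1 q2 q3 w1 w2 w3 \<and> f dvd c"
    using z unfolding v eps_apply class_list_eq_0_iff[OF length_10] by (simp only: list.set ball_simps simp_thms)
  then have V: "f dvd h * xx + (dy f * p3 - dz f * p2) + nn * ee^2 * (adj1 w1 w2 w3)"
    "f dvd h * yy + (dz f * p1 - dx f * p3) + nn * ee^2 * (adj2 w1 w2 w3)"
    "f dvd h * zz + (dx f * p2 - dy f * p1) + nn * ee^2 * (adj3 w1 w2 w3)"
    and N: "f dvd nxx r q1 q2 q3 w1 w2 w3" "f dvd nxy r q1 q2 q3 w1 w2 w3" "f dvd nxz r q1 q2 q3 w1 w2 w3"
    "f dvd nyy r q1 q2 q3 w1 w2 w3" "f dvd nyz r q1 q2 q3 w1 w2 w3" "f dvd nzz r q1 q2 q3 w1 w2 w3"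
    and c: "f dvd c" by simp_all
  obtain a1 a2 a3 b1 b2 b3 s where r: "f dvd r - (a1 * dx f + a2 * dy f + a3 * dz f - 2 * ee^3 * hdet * s)"
    and q: "q1 = - (yy * a3 - zz * a2) + 2 * ee * (hess1 b1 b2 b3)"
      "q2 = - (zz * a1 - xx * a3) + 2 * ee * (hess2 b1 b2 b3)"
      "q3 = - (xx * a2 - yy * a1) + 2 * ee * (hess3 b1 b2 b3)"
    and w: "w1 = - (yy * b3 - zz * b2) + s * dx f" "w2 = - (zz * b1 - xx * b3) + s * dy f"
      "w3 = - (xx * b2 - yy * b1) + s * dz f"
    by (rule symbol_relations[OF N])
  define k where "k = h + nn * (ee^3 * hdet) * s"
  define l1 where "l1 = p1 - nn * ee * (hess1 b1 b2 b3)"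
  define l2 where "l2 = p2 - nn * ee * (hess2 b1 b2 b3)"
  define l3 where "l3 = p3 - nn * ee * (hess3 b1 b2 b3)"
  note E1 = even_odd(1)[where ?u1.0 = 0 and ?u2.0 = 0 and ?u3.0 = 0 and t = 0 and s = s and ?b1.0 = b1 and ?b2.0 = b2 and ?b3.0 = b3]
  note E2 = even_odd(2)[where ?u1.0 = 0 and ?u2.0 = 0 and ?u3.0 = 0 and t = 0 and s = s and ?b1.0 = b1 and ?b2.0 = b2 and ?b3.0 = b3]
  note E3 = even_odd(3)[where ?u1.0 = 0 and ?u2.0 = 0 and ?u3.0 = 0 and t = 0 and s = s and ?b1.0 = b1 and ?b2.0 = b2 and ?b3.0 = b3]
  have "h * xx + (dy f * p3 - dz f * p2) + nn * ee^2 * (adj1 w1 w2 w3) = k * xx + (dy f * l3 - dz f * l2)"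
    unfolding w k_def l2_def l3_def by (rule lin1[OF E1, where c = 1]) Groebner_Basis.algebra
  moreover have "h * yy + (dz f * p1 - dx f * p3) + nn * ee^2 * (adj2 w1 w2 w3) = k * yy + (dz f * l1 - dx f * l3)"
    unfolding w k_def l1_def l3_def by (rule lin1[OF E2, where c = 1]) Groebner_Basis.algebra
  moreover have "h * zz + (dx f * p2 - dy f * p1) + nn * ee^2 * (adj3 w1 w2 w3) = k * zz + (dx f * l2 - dy f * l1)"
    unfolding w k_def l1_def l2_def by (rule lin1[OF E3, where c = 1]) Groebner_Basis.algebra
  ultimately have K: "f dvd k * xx + (dy f * l3 - dz f * l2)" "f dvd k * yy + (dz f * l1 - dx f * l3)"
    "f dvd k * zz + (dx f * l2 - dy f * l1)" using V by (simp_all only:)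
  obtain u1 u2 u3 t where u: "k = u1 * dx f + u2 * dy f + u3 * dz f"
    "l1 = - (yy * u3 - zz * u2) + t * dx f" "l2 = - (zz * u1 - xx * u3) + t * dy f"
    "l3 = - (xx * u2 - yy * u1) + t * dz f"
    by (rule gradient_kernel_relations[OF K])
  have h: "h = (dotg u1 u2 u3) - nn * (ee^3 * hdet) * s"
    using u(1) unfolding k_def by (simp only: eq_diff_eq)
  have p: "p1 = - (yy * u3 - zz * u2) + t * dx f + nn * ee * (hess1 b1 b2 b3)"
    "p2 = - (zz * u1 - xx * u3) + t * dy f + nn * ee * (hess2 b1 b2 b3)"
    "p3 = - (xx * u2 - yy * u1) + t * dz f + nn * ee * (hess3 b1 b2 b3)"
    using u(2-4) unfolding l1_def l2_def l3_def by (simp_all only: diff_eq_eq)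
  show ?thesis
  proof (intro bexI)
    show "map_vec (hyp_class f) v = map_vec (hyp_class f)
        (first_dif_poly d f *\<^sub>v vec_of_list [u1, u2, u3, t, a1, a2, a3, b1, b2, b3, s])"
      unfolding v first_apply h p q w class_list_eq_iff[OF length_12 length_12]
      using r c by (simp only: list_all2_Cons list_all2_Nil diff_self dvd_0_right diff_zero simp_thms)
    show "vec_of_list [u1, u2, u3, t, a1, a2, a3, b1, b2, b3, s] \<in> carrier_vec 11"
      by (rule carrier_vecI) simp
  qed
qed

lemma kernel_eps:
  "{v \<in> free_mod (hyp_ring f) 12. mat_app (hyp_ring f) (map_mat (hyp_class f) (eps_poly d f)) v
      = vec 10 (\<lambda>_. \<zero>\<^bsub>hyp_ring f\<^esub>)}
    = mat_app (hyp_ring f) (map_mat (hyp_class f) (first_dif_poly d f)) ` free_mod (hyp_ring f) 11"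
  by (rule kernel_eq_image[OF eps_carrier first_carrier eps_first_class_zero eps_relation])

text \<open>Relations among the generators are combinations of columns with entries in the irrelevant ideal.\<close>

lemma eps_kernel_const_coeff:
  fixes v :: "'k poly3 vec"
  assumes v: "v \<in> carrier_vec 12" and z: "map_vec (hyp_class f) (eps_poly d f *\<^sub>v v) = map_vec (hyp_class f) (0\<^sub>v 10)"
    and i: "i < 12"
  shows "const_coeff (v $ i) = 0"
proof -
  obtain u :: "'k poly3 vec" where u: "u \<in> carrier_vec 11" "map_vec (hyp_class f) v = map_vec (hyp_class f) (first_dif_poly d f *\<^sub>v u)"
    using eps_relation[OF v z] by blast
  have F: "first_dif_poly d f *\<^sub>v u \<in> carrier_vec 12" using first_carrier u(1) by auto
  have "f dvd v $ i - (first_dif_poly d f *\<^sub>v u) $ i"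
    using u(2) i map_vec_cls_eq_iff[OF v F] by blast
  then obtain c where c: "v $ i = (first_dif_poly d f *\<^sub>v u) $ i + f * c"
    by (metis dvdE diff_eq_eq add.commute)
  have "const_coeff ((first_dif_poly d f *\<^sub>v u) $ i) = 0"
  proof (rule vec_11_cases[OF u(1)])
    fix a0 a1 a2 a3 a4 a5 a6 a7 a8 a9 a10
    assume v: "u = vec_of_list [a0, a1, a2, a3, a4, a5, a6, a7, a8, a9, a10]"
    have "i \<in> {0,1,2,3,4,5,6,7,8,9,10,11}"
      using i by (simp only: insert_iff empty_iff) presburger
    then show ?thesis
      unfolding v first_apply
      by (elim insertE emptyE) (simp_all add: vec_of_list_index const_coeff_partials hdet_def del: vec_of_list_Cons)
  qed
  then show ?thesis unfolding c using const_coeff_f by simp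
qed

text \<open>Given an operator that preserves \<open>(f)\<close>, first fix the parameters of its symbol; after
  subtracting the correction term \<open>A w\<close> the vector field is orthogonal to
  \<open>g\<close> modulo \<open>f\<close>, which provides the other parameters.\<close>

lemma image_eps: "D2_submodule f = {map_vec (hyp_class f) (eps_poly d f *\<^sub>v v) | v. v \<in> carrier_vec 12}"
proof (intro Set.equalityI subsetI)
  fix x assume "x \<in> D2_submodule f"
  then obtain a where a: "x = map_vec (hyp_class f) a" "a \<in> carrier_vec 10" "\<forall>g. f dvd dop a (f * g)"
    unfolding D2_submodule_eq by (auto intro: carrier_vecI)
  show "x \<in> {map_vec (hyp_class f) (eps_poly d f *\<^sub>v v) | v. v \<in> carrier_vec 12}"
  proof (rule vec_10_cases[OF a(2)])
    fix v1 v2 v3 s11 s12 s13 s22 s23 s33 c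
    assume l: "a = vec_of_list [v1, v2, v3, s11, s12, s13, s22, s23, s33, c]"
    have ind: "a $ 0 = v1" "a $ 1 = v2" "a $ 2 = v3" "a $ 3 = s11" "a $ 4 = s12" "a $ 5 = s13"
      "a $ 6 = s22" "a $ 7 = s23" "a $ 8 = s33" "a $ 9 = c"
      unfolding l by (simp_all add: vec_of_list_index del: vec_of_list_Cons)
    have D: "f dvd dop a f" and S: "f dvd s11 * dx f + s12 * dy f + s13 * dz f"
      "f dvd s12 * dx f + s22 * dy f + s23 * dz f" "f dvd s13 * dx f + s23 * dy f + s33 * dz f"
      using a(3) unfolding dop_preserves_iff ind by simp_all
    obtain r p1 p2 p3 w1 w2 w3 where N: "f dvd s11 - nxx r p1 p2 p3 w1 w2 w3" "f dvd s12 - nxy r p1 p2 p3 w1 w2 w3"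
      "f dvd s13 - nxz r p1 p2 p3 w1 w2 w3" "f dvd s22 - nyy r p1 p2 p3 w1 w2 w3"
      "f dvd s23 - nyz r p1 p2 p3 w1 w2 w3" "f dvd s33 - nzz r p1 p2 p3 w1 w2 w3"
      by (rule symbol_kernel_mod_f[OF S])
    obtain k0 where D: "dop a f = f * k0" using D by (elim dvdE)
    obtain k1 where k1: "s11 - nxx r p1 p2 p3 w1 w2 w3 = f * k1" using N(1) by (elim dvdE)
    obtain k2 where k2: "s12 - nxy r p1 p2 p3 w1 w2 w3 = f * k2" using N(2) by (elim dvdE)
    obtain k3 where k3: "s13 - nxz r p1 p2 p3 w1 w2 w3 = f * k3" using N(3) by (elim dvdE)
    obtain k4 where k4: "s22 - nyy r p1 p2 p3 w1 w2 w3 = f * k4" using N(4) by (elim dvdE)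
    obtain k5 where k5: "s23 - nyz r p1 p2 p3 w1 w2 w3 = f * k5" using N(5) by (elim dvdE)
    obtain k6 where k6: "s33 - nzz r p1 p2 p3 w1 w2 w3 = f * k6" using N(6) by (elim dvdE)
    note s = k1[unfolded diff_eq_eq] k2[unfolded diff_eq_eq] k3[unfolded diff_eq_eq]
      k4[unfolded diff_eq_eq] k5[unfolded diff_eq_eq] k6[unfolded diff_eq_eq]
    have T: "(v1 - nn * ee^2 * (adj1 w1 w2 w3)) * dx f
        + (v2 - nn * ee^2 * (adj2 w1 w2 w3)) * dy f
        + (v3 - nn * ee^2 * (adj3 w1 w2 w3)) * dz f
      = f * (k0 - r * dd * nn - c - hh * dx (dx f) * k1 - dx (dy f) * k2 - dx (dz f) * k3
          - hh * dy (dy f) * k4 - dy (dz f) * k5 - hh * dz (dz f) * k6)"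
      by (rule lin2[OF D[unfolded dop_expand ind scalars s] symbol_trace[where r = r and ?p1.0 = p1 and ?p2.0 = p2 and ?p3.0 = p3
            and ?w1.0 = w1 and ?w2.0 = w2 and ?w3.0 = w3], where c = 1 and c' = "- 1"])
        Groebner_Basis.algebra
    obtain h q1 q2 q3 where v: "v1 - nn * ee^2 * (adj1 w1 w2 w3) = h * xx + (dy f * q3 - dz f * q2)"
      "v2 - nn * ee^2 * (adj2 w1 w2 w3) = h * yy + (dz f * q1 - dx f * q3)"
      "v3 - nn * ee^2 * (adj3 w1 w2 w3) = h * zz + (dx f * q2 - dy f * q1)"
      by (rule gradient_kernel_mod_f[OF dvdI[OF T]])
    have "x = map_vec (hyp_class f) (eps_poly d f *\<^sub>v vec_of_list [h, q1, q2, q3, r, p1, p2, p3, w1, w2, w3, c])"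
      unfolding a(1) l eps_apply class_list_eq_iff[OF length_10 length_10] v[unfolded diff_eq_eq]
      using N by (simp only: list_all2_Cons list_all2_Nil diff_self dvd_0_right simp_thms)
    then show ?thesis by (intro CollectI exI conjI) (assumption, auto intro: carrier_vecI)
  qed
next
  fix x assume "x \<in> {map_vec (hyp_class f) (eps_poly d f *\<^sub>v v) | v. v \<in> carrier_vec 12}"
  then obtain v where v: "x = map_vec (hyp_class f) (eps_poly d f *\<^sub>v v)" "v \<in> carrier_vec 12" by blast
  show "x \<in> D2_submodule f"
  proof (rule vec_12_cases[OF v(2)])
    fix h q1 q2 q3 r p1 p2 p3 w1 w2 w3 c
    assume l: "v = vec_of_list [h, q1, q2, q3, r, p1, p2, p3, w1, w2, w3, c]"
    define a where "a = eps_poly d f *\<^sub>v v"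
    have ind: "a $ 0 = h * xx + (dy f * q3 - dz f * q2) + nn * ee^2 * (adj1 w1 w2 w3)"
      "a $ 1 = h * yy + (dz f * q1 - dx f * q3) + nn * ee^2 * (adj2 w1 w2 w3)"
      "a $ 2 = h * zz + (dx f * q2 - dy f * q1) + nn * ee^2 * (adj3 w1 w2 w3)"
      "a $ 3 = nxx r p1 p2 p3 w1 w2 w3" "a $ 4 = nxy r p1 p2 p3 w1 w2 w3" "a $ 5 = nxz r p1 p2 p3 w1 w2 w3"
      "a $ 6 = nyy r p1 p2 p3 w1 w2 w3" "a $ 7 = nyz r p1 p2 p3 w1 w2 w3" "a $ 8 = nzz r p1 p2 p3 w1 w2 w3"
      "a $ 9 = c"
      unfolding a_def l eps_apply by (simp_all add: vec_of_list_index del: vec_of_list_Cons)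
    have T: "dop a f = f * (h * dd + r * dd * nn + c)"
      unfolding dop_expand ind scalars
      by (rule lin2[OF euler symbol_trace[where r = r and ?p1.0 = p1 and ?p2.0 = p2 and ?p3.0 = p3
            and ?w1.0 = w1 and ?w2.0 = w2 and ?w3.0 = w3], where c = h and c' = 1])
        Groebner_Basis.algebra
    have "\<forall>g. f dvd dop a (f * g)"
      unfolding dop_preserves_iff T ind symbol_times_gradient by (simp only: dvd_triv_left dvd_triv_right dvd_mult2 simp_thms)
    moreover have "dim_vec a = 10" unfolding a_def l eps_apply by simp
    ultimately show ?thesis unfolding D2_submodule_eq v(1) a_def by blast
  qed
qed

end

theorem theorem4p4p3:
  fixes f :: "'k::field_char_0 poly poly poly" and d :: nat
  assumes "d \<ge> 3"
    and "f \<noteq> 0"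
    and "homogeneous3 d f"
    and "isolated_singularity f"
  shows "aug_min_free_resolution (hyp_ring f) (irrelevant_ideal f) (3 + 6 + 1)
           (D2_submodule f) res_rank (res_dif d f) (eps d f) \<and>
         distinct (cols (eps d f)) \<and>
         minimal_generating_set (hyp_ring f) (3 + 6 + 1) (D2_submodule f) (set (cols (eps d f)))"
proof -
  interpret smooth_cone f d by unfold_locales (use assms in auto)
  have ten: "3 + 6 + 1 = (10 :: nat)" by simp
  have rank: "res_rank n = (if n = 0 then 12 else 11)" for n by (simp add: res_rank_def)
  note kernels = kernel_first kernel_even kernel_odd
  have "aug_min_free_resolution (hyp_ring f) (irrelevant_ideal f) 10
      (D2_submodule f) res_rank (res_dif d f) (eps d f)"
    unfolding aug_min_free_resolution_def
  proof (intro conjI allI)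
    fix n
    show "eps d f \<in> carrier_mat 10 (res_rank 0)"
      using eps_carrier by (simp add: eps_def rank)
    show "elements_mat (eps d f) \<subseteq> carrier (hyp_ring f)"
      unfolding eps_def by (rule elements_mat_carrier)
    show "res_dif d f n \<in> carrier_mat (res_rank n) (res_rank (Suc n))"
      using first_carrier odd_carrier even_carrier by (simp add: res_dif_def rank)
    show "elements_mat (res_dif d f n) \<subseteq> carrier (hyp_ring f)"
      unfolding res_dif_def by (rule elements_mat_carrier)
    show "mat_app (hyp_ring f) (eps d f) ` free_mod (hyp_ring f) (res_rank 0) = D2_submodule f"
      using image_eq[OF eps_carrier] by (simp add: eps_def rank image_eps)
    show "{v \<in> free_mod (hyp_ring f) (res_rank 0). mat_app (hyp_ring f) (eps d f) v = vec 10 (\<lambda>_. \<zero>\<^bsub>hyp_ring f\<^esub>)}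
       = mat_app (hyp_ring f) (res_dif d f 0) ` free_mod (hyp_ring f) (res_rank 1)"
      using kernel_eps by (simp add: eps_def res_dif_def rank)
    show "{v \<in> free_mod (hyp_ring f) (res_rank (Suc n)). mat_app (hyp_ring f) (res_dif d f n) v = vec (res_rank n) (\<lambda>_. \<zero>\<^bsub>hyp_ring f\<^esub>)}
       = mat_app (hyp_ring f) (res_dif d f (Suc n)) ` free_mod (hyp_ring f) (res_rank (Suc (Suc n)))"
      using kernels by (simp add: res_dif_def rank)
    show "elements_mat (res_dif d f n) \<subseteq> irrelevant_ideal f"
      unfolding res_dif_def using const_coeff_f const_coeff_first const_coeff_odd const_coeff_even
      by (intro elements_mat_class) (auto split: if_splits)
  qed
  moreover note minimal_generators[OF eps_carrier const_coeff_f eps_kernel_const_coeff, folded image_eps eps_def]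
  ultimately show ?thesis unfolding ten by simp
qed

end
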